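(* Let $f=f(x,t)$, with free boundary $p=p(t)$, be a solution of the modified price formation problem $$f_t - f_{xx} = \lambda(t)\big(\delta(x-p(t)+a)-\delta(x-p(t)-a)\big),\quad x\in(-L,L),\ t>0,$$ $$\lambda(t) = -f_x(p(t),t),\qquad f(p(t),t)=0,$$ $$f(x,0)=f_I(x),\qquad p(0)=p_0,$$ with the modified boundary conditions $$f_x(-L,t)=\begin{cases}0, & p(t)>-L+a,\\ f_x(-L+a,t), & p(t)\le -L+a,\end{cases}\qquad f_x(L,t)=\begin{cases}0, & p(t)<L-a,\\ f_x(L-a,t), & p(t)\ge L-a.\end{cases}$$ Then the function $$F(x,t)=\begin{cases}\ \ \sum_{n=0}^{\infty} f^+(x+na,t), & x<p(t),\\ -\sum_{n=0}^{\infty} f^-(x-na,t), & x>p(t),\end{cases}$$ is a solution of the following boundary value problem for the heat equation: $$F_t=F_{xx}\ \text{ for all } x\in(-L,L),\ t>0,$$ $$F_x(-L,t)=F_x(-L+a,t),\quad F_x(L,t)=F_x(L-a,t),\quad t>0,$$ $$F(x,0)=F_I(x)\ \text{ for all } x\in(-L,L),$$ where $F_I(x)=\sum_{n=0}^{\infty} f_I^+(x+na)$ for $x<p_0$ and $F_I(x)=-\sum_{n=0}^{\infty} f_I^-(x-na)$ for $x>p_0$. Conversely, if $F$ is a solution of this heat boundary value problem (with this $F_I$), then $$f(x,t)=F(x,t)-F^+(x+a,t)+F^-(x-a,t)$$ is a solution of the modified price formation problem above, with free boundary $p(t)$ the zero level set of $F(\cdot,t)$.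
   Context: Fix $0<a<L$. The datum satisfies $f_I\in L^2(-L,L)$, $p_0\in(-L+a,L-a)$, $f_I(p_0)=0$, $f_I(x)>0$ for $x<p_0$ and $f_I(x)<0$ for $x>p_0$ (with $x\in(-L,L)$). Here $\delta$ is the Dirac delta and the unknowns of the price formation problem are the function $f$ and the free boundary $p$. For a function $g$ defined for $x\in(-L,L)$, $g^+:=\max(g,0)$ and $g^-:=\max(-g,0)$, both extended by $0$ outside $(-L,L)$ (so the sums above have only finitely many nonzero terms). *)

theory Defs
  imports "HOL-Analysis.Analysis"
begin

text \<open>
  Functions of space and time are curried, \<open>u x t\<close>, and are regarded as functions on
  \<open>-L < x < L\<close>, \<open>t \<ge> 0\<close>; values elsewhere are irrelevant.
\<close>

definition Dx :: "(real \<Rightarrow> real \<Rightarrow> real) \<Rightarrow> real \<Rightarrow> real \<Rightarrow> real" where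
  "Dx u x t = deriv (\<lambda>y. u y t) x"

definition Dt :: "(real \<Rightarrow> real \<Rightarrow> real) \<Rightarrow> real \<Rightarrow> real \<Rightarrow> real" where
  "Dt u x t = deriv (\<lambda>s. u x s) t"

definition cylinder :: "real \<Rightarrow> (real \<times> real) set" where
  "cylinder L = {-L<..<L} \<times> {0<..}"

definition C21_on :: "(real \<times> real) set \<Rightarrow> (real \<Rightarrow> real \<Rightarrow> real) \<Rightarrow> bool" where
  "C21_on U u \<longleftrightarrow>
     (\<forall>(x, t) \<in> U. (\<lambda>y. u y t) field_differentiable (at x) \<and>
                    (\<lambda>y. Dx u y t) field_differentiable (at x) \<and>
                    (\<lambda>s. u x s) field_differentiable (at t)) \<and>
     continuous_on U (\<lambda>(x, t). u x t) \<and>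
     continuous_on U (\<lambda>(x, t). Dx u x t) \<and>
     continuous_on U (\<lambda>(x, t). Dx (Dx u) x t) \<and>
     continuous_on U (\<lambda>(x, t). Dt u x t)"

text \<open>
  Regularity up to the lateral boundary: \<open>u\<^sub>x\<close> stays bounded on \<open>s \<le> t \<le> T\<close> for all
  \<open>0 < s \<le> T\<close>. The set \<open>U\<close> is the part of the cylinder where \<open>u\<^sub>x\<close> is required to exist.
\<close>

definition bounded_slope :: "(real \<times> real) set \<Rightarrow> (real \<Rightarrow> real \<Rightarrow> real) \<Rightarrow> bool" where
  "bounded_slope U u \<longleftrightarrow>
     (\<forall>s T. 0 < s \<longrightarrow> bounded ((\<lambda>(x, t). Dx u x t) ` (U \<inter> UNIV \<times> {s..T})))"

text \<open>
  Boundary values \<open>u\<^sub>x(\<plusminus>L, t) = c\<close>, understood as one-sided limits from inside the interval.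
\<close>

definition left_slope :: "real \<Rightarrow> (real \<Rightarrow> real \<Rightarrow> real) \<Rightarrow> real \<Rightarrow> real \<Rightarrow> bool" where
  "left_slope L u t c \<longleftrightarrow> ((\<lambda>x. Dx u x t) \<longlongrightarrow> c) (at_right (-L))"

definition right_slope :: "real \<Rightarrow> (real \<Rightarrow> real \<Rightarrow> real) \<Rightarrow> real \<Rightarrow> real \<Rightarrow> bool" where
  "right_slope L u t c \<longleftrightarrow> ((\<lambda>x. Dx u x t) \<longlongrightarrow> c) (at_left L)"

text \<open>
  Besides the literal condition \<open>u(x, 0) = u\<^sub>0(x)\<close>, the datum is attained in
  \<open>L\<^sup>2(-L, L)\<close>; without this, \<open>u(\<cdot>, 0)\<close> would be unrelated to \<open>u(\<cdot>, t)\<close>, \<open>t > 0\<close>.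
\<close>

definition attains_datum :: "real \<Rightarrow> (real \<Rightarrow> real \<Rightarrow> real) \<Rightarrow> (real \<Rightarrow> real) \<Rightarrow> bool" where
  "attains_datum L u u0 \<longleftrightarrow>
     (\<forall>x \<in> {-L<..<L}. u x 0 = u0 x) \<and>
     ((\<lambda>t. \<integral>\<^sup>+ x \<in> {-L<..<L}. ennreal ((u x t - u0 x)\<^sup>2) \<partial>lebesgue) \<longlongrightarrow> 0) (at_right 0)"

definition L2_on :: "real \<Rightarrow> (real \<Rightarrow> real) \<Rightarrow> bool" where
  "L2_on L g \<longleftrightarrow> set_borel_measurable lebesgue {-L<..<L} g \<and>
                 set_integrable lebesgue {-L<..<L} (\<lambda>x. (g x)\<^sup>2)"

text \<open>\<open>C\<^sub>c\<^sup>\<infinity>(U)\<close>; \<open>D i j\<close> is the partial derivative of order \<open>i\<close> in \<open>x\<close> and \<open>j\<close> in \<open>t\<close>.\<close>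

definition test_function :: "(real \<times> real) set \<Rightarrow> (real \<Rightarrow> real \<Rightarrow> real) \<Rightarrow> bool" where
  "test_function U \<phi> \<longleftrightarrow>
     (\<exists>D :: nat \<Rightarrow> nat \<Rightarrow> real \<Rightarrow> real \<Rightarrow> real. D 0 0 = \<phi> \<and>
        (\<forall>i j. continuous_on UNIV (\<lambda>(x, t). D i j x t) \<and>
           (\<forall>x t. ((\<lambda>y. D i j y t) has_field_derivative D (Suc i) j x t) (at x) \<and>
                  ((\<lambda>s. D i j x s) has_field_derivative D i (Suc j) x t) (at t)))) \<and>
     (\<exists>K. compact K \<and> K \<subseteq> U \<and> (\<forall>x t. (x, t) \<notin> K \<longrightarrow> \<phi> x t = 0))"

text \<open>
  \<open>u\<^sub>t - u\<^sub>x\<^sub>x = \<lambda>(t) (\<delta>(x - q\<^sub>1(t)) - \<delta>(x - q\<^sub>2(t)))\<close> in the sense of distributions on the cylinder.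
  Test functions vanish outside the cylinder, so a Dirac mass does not contribute
  while it is located outside \<open>(-L, L)\<close>.
\<close>

definition heat_with_dirac_sources ::
  "real \<Rightarrow> (real \<Rightarrow> real \<Rightarrow> real) \<Rightarrow> (real \<Rightarrow> real) \<Rightarrow> (real \<Rightarrow> real) \<Rightarrow> (real \<Rightarrow> real) \<Rightarrow> bool" where
  "heat_with_dirac_sources L u lam q1 q2 \<longleftrightarrow>
     (\<forall>\<phi>. test_function (cylinder L) \<phi> \<longrightarrow>
        (LINT z:cylinder L|lborel.
           u (fst z) (snd z) * (- Dt \<phi> (fst z) (snd z) - Dx (Dx \<phi>) (fst z) (snd z))) =
        (LINT t:{0<..}|lborel. lam t * (\<phi> (q1 t) t - \<phi> (q2 t) t)))"

definition off_sources :: "real \<Rightarrow> real \<Rightarrow> (real \<Rightarrow> real) \<Rightarrow> (real \<times> real) set" where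
  "off_sources L a p = {(x, t) \<in> cylinder L. x \<noteq> p t - a \<and> x \<noteq> p t + a}"

text \<open>
  Solutions \<open>(f, p)\<close> of the modified price formation problem with datum \<open>(fI, p0)\<close>. The function
  \<open>f\<close> has kinks at the sources \<open>p \<plusminus> a\<close>, so classical regularity is asked only off them.
  The points \<open>p(t)\<close>, and \<open>-L + a\<close> if \<open>p(t) \<le> -L + a\<close> (\<open>L - a\<close> if \<open>p(t) \<ge> L - a\<close>), are off the
  sources, so the values of \<open>f\<^sub>x\<close> occurring below are classical derivatives.
\<close>

definition price_solution ::
  "real \<Rightarrow> real \<Rightarrow> (real \<Rightarrow> real) \<Rightarrow> real \<Rightarrow> (real \<Rightarrow> real \<Rightarrow> real) \<Rightarrow> (real \<Rightarrow> real) \<Rightarrow> bool" where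
  "price_solution L a fI p0 f p \<longleftrightarrow>
     continuous_on {0..} p \<and> (\<forall>t \<ge> 0. p t \<in> {-L<..<L}) \<and> p 0 = p0 \<and>
     continuous_on (cylinder L) (\<lambda>(x, t). f x t) \<and>
     C21_on (off_sources L a p) f \<and> bounded_slope (off_sources L a p) f \<and>
     heat_with_dirac_sources L f (\<lambda>t. - Dx f (p t) t) (\<lambda>t. p t - a) (\<lambda>t. p t + a) \<and>
     (\<forall>t > 0. f (p t) t = 0) \<and>
     (\<forall>t > 0. left_slope L f t (if p t > -L + a then 0 else Dx f (-L + a) t)) \<and>
     (\<forall>t > 0. right_slope L f t (if p t < L - a then 0 else Dx f (L - a) t)) \<and>
     attains_datum L f fI"

definition heat_solution ::
  "real \<Rightarrow> real \<Rightarrow> (real \<Rightarrow> real) \<Rightarrow> (real \<Rightarrow> real \<Rightarrow> real) \<Rightarrow> bool" where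
  "heat_solution L a FI F \<longleftrightarrow>
     C21_on (cylinder L) F \<and> bounded_slope (cylinder L) F \<and>
     (\<forall>(x, t) \<in> cylinder L. Dt F x t = Dx (Dx F) x t) \<and>
     (\<forall>t > 0. left_slope L F t (Dx F (-L + a) t)) \<and>
     (\<forall>t > 0. right_slope L F t (Dx F (L - a) t)) \<and>
     attains_datum L F FI"

text \<open>Positive and negative parts, extended by \<open>0\<close> outside \<open>(-L, L)\<close>.\<close>

definition pos_ext :: "real \<Rightarrow> (real \<Rightarrow> real) \<Rightarrow> real \<Rightarrow> real" where
  "pos_ext L g x = (if x \<in> {-L<..<L} then max (g x) 0 else 0)"

definition neg_ext :: "real \<Rightarrow> (real \<Rightarrow> real) \<Rightarrow> real \<Rightarrow> real" where
  "neg_ext L g x = (if x \<in> {-L<..<L} then max (- g x) 0 else 0)"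

text \<open>
  The transformation \<open>f \<mapsto> F\<close> at a fixed time, \<open>q\<close> being the position of the free boundary. The
  two-case formula leaves the point \<open>x = q\<close> open; the value there is \<open>0\<close>, which is what both
  sums give if \<open>g\<close> is positive to the left of \<open>q\<close>, negative to the right, and \<open>g q = 0\<close>.
\<close>

definition to_heat :: "real \<Rightarrow> real \<Rightarrow> real \<Rightarrow> (real \<Rightarrow> real) \<Rightarrow> real \<Rightarrow> real" where
  "to_heat L a q g x =
     (if x < q then (\<Sum>n. pos_ext L g (x + real n * a))
      else if x > q then - (\<Sum>n. neg_ext L g (x - real n * a))
      else 0)"

definition from_heat :: "real \<Rightarrow> real \<Rightarrow> (real \<Rightarrow> real) \<Rightarrow> real \<Rightarrow> real" where
  "from_heat L a G x = G x - pos_ext L G (x + a) + neg_ext L G (x - a)"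

end

(*
  Both transformations are local shifts and cuts, so away from the free boundary they preserve the
  heat equation. At the free boundary, Green's formula shows that cutting f off at its zero p produces
  the Dirac mass f_x(p) delta_p, which is exactly what the shifted sources of f compensate; since p is
  only known to be continuous, this is done weakly, and Weyl's lemma returns classical solutions.

  What remains is the sign structure: for t > 0, F(., t) has to change sign exactly once in (-L, L) and
  to satisfy F(x + a) <= F(x). The nonlocal boundary conditions let F extend to a solution U on the whole
  line of at most exponential growth, hence given by the heat kernel; the extension of F_I changes sign
  exactly once and decreases under shifts by a. Multiplying the kernel representation by a suitable
  exponential makes it strictly monotone in x, so U(., t) changes sign exactly once. The zero lies in
  (-L, L) because the mass of U over (-L, -L + a) and over (L - a, L) is conserved.
*)

theory Submission imports Defs begin

section \<open>Caloric functions\<close>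

text \<open>The definition of a price solution says nothing about the sign of \<open>f\<close> away
  from \<open>p\<close>, while the formula for F contains positive and negative parts; using it
  directly would be circular. The forward direction therefore works with untruncated sums
  (\<open>unsigned_to_heat\<close>), shows that they solve the heat problem whatever the sign of
  \<open>f\<close>, and only then reads off the sign of \<open>f\<close> from that of the heat
  solution. The equation for \<open>f\<close> is given in distributions only, and cut functions have
  kinks along a merely continuous curve. So there is one weak criterion, tested on squares with one
  explicit bump function. It also glues the extension across the ends of the interval: there the
  nonlocal boundary conditions say exactly that the one-sided slopes match. The rates
  \<open>ln 3 / a\<close> and \<open>ln 14 / a\<close> come from the extension formula, which
  expresses a value by three values closer to the interval. Per length \<open>a\<close>, suprema
  grow at most by the factor 3 and L1 norms at most by 7; a weight decaying by the factor 14 leaves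
  a convergent geometric series.\<close>

definition caloric_on :: "(real \<times> real) set \<Rightarrow> (real \<Rightarrow> real \<Rightarrow> real) \<Rightarrow> bool" where
  "caloric_on U u \<longleftrightarrow> (\<exists>v w. continuous_on U (\<lambda>(x, t). u x t) \<and>
     continuous_on U (\<lambda>(x, t). v x t) \<and> continuous_on U (\<lambda>(x, t). w x t) \<and>
     (\<forall>(x, t) \<in> U. ((\<lambda>y. u y t) has_field_derivative v x t) (at x) \<and>
                    ((\<lambda>y. v y t) has_field_derivative w x t) (at x) \<and>
                    ((\<lambda>s. u x s) has_field_derivative w x t) (at t)))"

lemma eventually_slice:
  assumes "open U" "(x, t) \<in> U"
  shows "\<forall>\<^sub>F y in nhds x. (y, t) \<in> U" "\<forall>\<^sub>F s in nhds t. (x, s) \<in> U"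
proof -
  have "open ((\<lambda>y. (y, t)) -` U)" "open ((\<lambda>s. (x, s)) -` U)"
    by (rule open_vimage[OF assms(1)], intro continuous_intros)+
  then show "\<forall>\<^sub>F y in nhds x. (y, t) \<in> U" "\<forall>\<^sub>F s in nhds t. (x, s) \<in> U"
    using assms(2) unfolding eventually_nhds
    by (auto intro: exI[of _ "(\<lambda>y. (y, t)) -` U"] exI[of _ "(\<lambda>s. (x, s)) -` U"])
qed

text \<open>\<open>caloric_on\<close> quantifies over derivative functions, with one
  \<open>w\<close> for both \<open>u_xx\<close> and \<open>u_t\<close>, so that it can be
  established without computing any \<open>deriv\<close>. On an open set the witnesses are forced:
  \<open>Dx u\<close> agrees with \<open>v\<close> on a whole slice neighbourhood, hence its
  derivative agrees with \<open>w\<close>.\<close>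

lemma caloric_onD:
  assumes "open U" "caloric_on U u"
  shows "continuous_on U (\<lambda>(x, t). u x t)" "continuous_on U (\<lambda>(x, t). Dx u x t)"
    "continuous_on U (\<lambda>(x, t). Dx (Dx u) x t)"
    "\<And>x t. (x, t) \<in> U \<Longrightarrow> ((\<lambda>y. u y t) has_field_derivative Dx u x t) (at x)"
    "\<And>x t. (x, t) \<in> U \<Longrightarrow> ((\<lambda>y. Dx u y t) has_field_derivative Dx (Dx u) x t) (at x)"
    "\<And>x t. (x, t) \<in> U \<Longrightarrow> ((\<lambda>s. u x s) has_field_derivative Dx (Dx u) x t) (at t)"
proof -
  obtain v w where vw: "continuous_on U (\<lambda>(x, t). u x t)"
     "continuous_on U (\<lambda>(x, t). v x t)" "continuous_on U (\<lambda>(x, t). w x t)" and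
     d: "\<And>x t. (x, t) \<in> U \<Longrightarrow> ((\<lambda>y. u y t) has_field_derivative v x t) (at x)"
        "\<And>x t. (x, t) \<in> U \<Longrightarrow> ((\<lambda>y. v y t) has_field_derivative w x t) (at x)"
        "\<And>x t. (x, t) \<in> U \<Longrightarrow> ((\<lambda>s. u x s) has_field_derivative w x t) (at t)"
    using assms(2) unfolding caloric_on_def by blast
  have v: "Dx u x t = v x t" if "(x, t) \<in> U" for x t
    unfolding Dx_def using d(1)[OF that] by (rule DERIV_imp_deriv)
  have dv: "((\<lambda>y. Dx u y t) has_field_derivative w x t) (at x)" if "(x, t) \<in> U" for x t
  proof -
    have "\<forall>\<^sub>F y in nhds x. Dx u y t = v y t"
      using eventually_slice(1)[OF assms(1) that] by eventually_elim (rule v)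
    then show ?thesis using d(2)[OF that] by (subst DERIV_cong_ev[OF refl _ refl])
  qed
  have w: "Dx (Dx u) x t = w x t" if "(x, t) \<in> U" for x t
    unfolding Dx_def[of "Dx u"] using dv[OF that] by (rule DERIV_imp_deriv)
  show "continuous_on U (\<lambda>(x, t). u x t)" by fact
  show "continuous_on U (\<lambda>(x, t). Dx u x t)"
    using vw(2) by (rule continuous_on_eq) (auto simp: v)
  show "continuous_on U (\<lambda>(x, t). Dx (Dx u) x t)"
    using vw(3) by (rule continuous_on_eq) (auto simp: w)
  show "((\<lambda>y. u y t) has_field_derivative Dx u x t) (at x)"
    "((\<lambda>y. Dx u y t) has_field_derivative Dx (Dx u) x t) (at x)"
    "((\<lambda>s. u x s) has_field_derivative Dx (Dx u) x t) (at t)" if "(x, t) \<in> U" for x t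
    using that d(1,3) dv by (simp_all add: v w)
qed

lemma caloric_on_iff:
  assumes "open U"
  shows "caloric_on U u \<longleftrightarrow> C21_on U u \<and> (\<forall>(x, t) \<in> U. Dt u x t = Dx (Dx u) x t)"
proof
  assume c: "caloric_on U u"
  note D = caloric_onD[OF assms c]
  have Dt: "Dt u x t = Dx (Dx u) x t" if "(x, t) \<in> U" for x t
    unfolding Dt_def using D(6)[OF that] by (rule DERIV_imp_deriv)
  have "continuous_on U (\<lambda>(x, t). Dt u x t)"
    using D(3) by (rule continuous_on_eq) (auto simp: Dt)
  then show "C21_on U u \<and> (\<forall>(x, t) \<in> U. Dt u x t = Dx (Dx u) x t)"
    unfolding C21_on_def field_differentiable_def using D Dt by blast
next
  assume *: "C21_on U u \<and> (\<forall>(x, t) \<in> U. Dt u x t = Dx (Dx u) x t)"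
  show "caloric_on U u"
    unfolding caloric_on_def
  proof (intro exI conjI ballI)
    show "continuous_on U (\<lambda>(x, t). u x t)" "continuous_on U (\<lambda>(x, t). Dx u x t)"
      "continuous_on U (\<lambda>(x, t). Dx (Dx u) x t)"
      using * unfolding C21_on_def by blast+
    fix z assume z: "z \<in> U"
    obtain x t where xt: "z = (x, t)" by (cases z)
    have "(\<lambda>y. u y t) field_differentiable at x" "(\<lambda>y. Dx u y t) field_differentiable at x"
      "(\<lambda>s. u x s) field_differentiable at t" "Dt u x t = Dx (Dx u) x t"
      using * z unfolding C21_on_def xt by auto
    then show "case z of (x, t) \<Rightarrow>
       ((\<lambda>y. u y t) has_real_derivative Dx u x t) (at x) \<and>
       ((\<lambda>y. Dx u y t) has_real_derivative Dx (Dx u) x t) (at x) \<and>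
       (u x has_real_derivative Dx (Dx u) x t) (at t)"
      unfolding xt prod.case by (metis DERIV_deriv_iff_field_differentiable Dx_def Dt_def)
  qed
qed

lemma caloric_on_subset: "caloric_on U u \<Longrightarrow> V \<subseteq> U \<Longrightarrow> caloric_on V u"
  unfolding caloric_on_def by (meson continuous_on_subset subsetD)

lemma caloric_on_cong:
  assumes U: "open U" and c: "caloric_on U u" and eq: "\<And>x t. (x, t) \<in> U \<Longrightarrow> u' x t = u x t"
  shows "caloric_on U u'"
proof -
  note D = caloric_onD[OF U c]
  show ?thesis unfolding caloric_on_def
  proof (intro exI conjI ballI)
    show "continuous_on U (\<lambda>(x, t). u' x t)"
      using D(1) by (rule continuous_on_eq) (auto simp: eq)
    show "continuous_on U (\<lambda>(x, t). Dx u x t)" "continuous_on U (\<lambda>(x, t). Dx (Dx u) x t)"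
      by fact+
    fix z assume z: "z \<in> U"
    obtain x t where xt: "z = (x, t)" by (cases z)
    note xU = z[unfolded xt]
    have "\<forall>\<^sub>F y in nhds x. u' y t = u y t" "\<forall>\<^sub>F s in nhds t. u' x s = u x s"
      using eventually_slice[OF U xU] by (auto elim: eventually_mono simp: eq)
    then show "case z of (x, t) \<Rightarrow>
       ((\<lambda>y. u' y t) has_real_derivative Dx u x t) (at x) \<and>
       ((\<lambda>y. Dx u y t) has_real_derivative Dx (Dx u) x t) (at x) \<and>
       (u' x has_real_derivative Dx (Dx u) x t) (at t)"
      unfolding xt prod.case using D(4-6)[OF xU] by (simp add: DERIV_cong_ev[OF refl _ refl])
  qed
qed

text \<open>Gluing needs no choice of patches: on each patch the witnesses are the globally defined
  \<open>Dx u\<close> and \<open>Dx (Dx u)\<close>, and every clause of the definition can be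
  checked point by point.\<close>

lemma caloric_on_local:
  assumes "\<And>x t. (x, t) \<in> U \<Longrightarrow> \<exists>V. open V \<and> (x, t) \<in> V \<and> caloric_on V u"
  shows "caloric_on U u"
proof -
  have *: "isCont (\<lambda>(x, t). u x t) z" "isCont (\<lambda>(x, t). Dx u x t) z" "isCont (\<lambda>(x, t). Dx (Dx u) x t) z"
    "case z of (x, t) \<Rightarrow>
       ((\<lambda>y. u y t) has_real_derivative Dx u x t) (at x) \<and>
       ((\<lambda>y. Dx u y t) has_real_derivative Dx (Dx u) x t) (at x) \<and>
       (u x has_real_derivative Dx (Dx u) x t) (at t)" if z: "z \<in> U" for z
  proof -
    obtain V where V: "open V" "z \<in> V" "caloric_on V u"
      using assms[of "fst z" "snd z"] z by auto
    note D = caloric_onD[OF V(1,3)]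
    show "isCont (\<lambda>(x, t). u x t) z" "isCont (\<lambda>(x, t). Dx u x t) z" "isCont (\<lambda>(x, t). Dx (Dx u) x t) z"
      using D(1-3) V(1,2) by (meson continuous_on_eq_continuous_at)+
    show "case z of (x, t) \<Rightarrow>
       ((\<lambda>y. u y t) has_real_derivative Dx u x t) (at x) \<and>
       ((\<lambda>y. Dx u y t) has_real_derivative Dx (Dx u) x t) (at x) \<and>
       (u x has_real_derivative Dx (Dx u) x t) (at t)"
      using D(4-6) V(2) by (cases z) auto
  qed
  show ?thesis unfolding caloric_on_def
    by (rule exI[of _ "Dx u"], rule exI[of _ "Dx (Dx u)"])
       (use * in \<open>auto intro!: continuous_at_imp_continuous_on\<close>)
qed

lemma caloric_on_add:
  assumes "caloric_on U u" "caloric_on U u'"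
  shows "caloric_on U (\<lambda>x t. u x t + u' x t)"
proof -
  obtain v w v' w' where *: "continuous_on U (\<lambda>(x, t). u x t)"
     "continuous_on U (\<lambda>(x, t). v x t)" "continuous_on U (\<lambda>(x, t). w x t)"
     "continuous_on U (\<lambda>(x, t). u' x t)"
     "continuous_on U (\<lambda>(x, t). v' x t)" "continuous_on U (\<lambda>(x, t). w' x t)" and
     d: "\<And>x t. (x, t) \<in> U \<Longrightarrow> ((\<lambda>y. u y t) has_field_derivative v x t) (at x)"
        "\<And>x t. (x, t) \<in> U \<Longrightarrow> ((\<lambda>y. v y t) has_field_derivative w x t) (at x)"
        "\<And>x t. (x, t) \<in> U \<Longrightarrow> ((\<lambda>s. u x s) has_field_derivative w x t) (at t)"
        "\<And>x t. (x, t) \<in> U \<Longrightarrow> ((\<lambda>y. u' y t) has_field_derivative v' x t) (at x)"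
        "\<And>x t. (x, t) \<in> U \<Longrightarrow> ((\<lambda>y. v' y t) has_field_derivative w' x t) (at x)"
        "\<And>x t. (x, t) \<in> U \<Longrightarrow> ((\<lambda>s. u' x s) has_field_derivative w' x t) (at t)"
    using assms unfolding caloric_on_def by (elim exE conjE) blast
  have "continuous_on U (\<lambda>(x, t). u x t + u' x t)" "continuous_on U (\<lambda>(x, t). v x t + v' x t)"
    "continuous_on U (\<lambda>(x, t). w x t + w' x t)"
    using continuous_on_add[OF *(1,4)] continuous_on_add[OF *(2,5)] continuous_on_add[OF *(3,6)]
    by (simp_all add: case_prod_unfold)
  then show ?thesis unfolding caloric_on_def
    by - (rule exI[of _ "\<lambda>x t. v x t + v' x t"], rule exI[of _ "\<lambda>x t. w x t + w' x t"],
       use d in \<open>auto intro!: DERIV_add\<close>)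
qed

text \<open>Covers translations (\<open>m = 1\<close>) and reflections (\<open>m = -1\<close>),
  multiplied by a constant: the extension formula combines precisely these. The second space
  derivative picks up \<open>m\<^sup>2 = 1\<close>, so the equation is preserved.\<close>

lemma caloric_on_affine:
  assumes c: "caloric_on U u" and m: "m\<^sup>2 = 1"
  shows "caloric_on {(x, t). (m * x + b, t) \<in> U} (\<lambda>x t. k * u (m * x + b) t)"
proof -
  let ?V = "{(x, t). (m * x + b, t) \<in> U}"
  obtain v w where *: "continuous_on U (\<lambda>(x, t). u x t)"
     "continuous_on U (\<lambda>(x, t). v x t)" "continuous_on U (\<lambda>(x, t). w x t)" and
     d: "\<And>x t. (x, t) \<in> U \<Longrightarrow> ((\<lambda>y. u y t) has_field_derivative v x t) (at x)"
        "\<And>x t. (x, t) \<in> U \<Longrightarrow> ((\<lambda>y. v y t) has_field_derivative w x t) (at x)"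
        "\<And>x t. (x, t) \<in> U \<Longrightarrow> ((\<lambda>s. u x s) has_field_derivative w x t) (at t)"
    using c unfolding caloric_on_def by blast
  have cc: "continuous_on ?V (\<lambda>(x, t). c * g (m * x + b) t)"
    if "continuous_on U (\<lambda>(x, t). g x t)" for g :: "real \<Rightarrow> real \<Rightarrow> real" and c
  proof -
    have "continuous_on ?V (\<lambda>z. (\<lambda>(x, t). g x t) (m * fst z + b, snd z))"
      by (rule continuous_on_compose2[OF that]) (auto intro!: continuous_intros)
    then show ?thesis by (auto simp: case_prod_unfold intro!: continuous_intros)
  qed
  have lin: "((\<lambda>y. m * y + b) has_field_derivative m) (at x)" for x
    by (auto intro!: derivative_eq_intros)
  show ?thesis unfolding caloric_on_def
  proof (rule exI[of _ "\<lambda>x t. (k * m) * v (m * x + b) t"], rule exI[of _ "\<lambda>x t. k * w (m * x + b) t"],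
      intro conjI ballI)
    show "continuous_on ?V (\<lambda>(x, t). k * u (m * x + b) t)"
      "continuous_on ?V (\<lambda>(x, t). (k * m) * v (m * x + b) t)"
      "continuous_on ?V (\<lambda>(x, t). k * w (m * x + b) t)"
      using *(1-3) by (blast intro: cc)+
    fix z assume "z \<in> ?V"
    then obtain x t where xt: "z = (x, t)" "(m * x + b, t) \<in> U" by auto
    have 1: "((\<lambda>y. u (m * y + b) t) has_field_derivative v (m * x + b) t * m) (at x)"
      by (rule DERIV_chain2[OF d(1)[OF xt(2)] lin])
    have 2: "((\<lambda>y. v (m * y + b) t) has_field_derivative w (m * x + b) t * m) (at x)"
      by (rule DERIV_chain2[OF d(2)[OF xt(2)] lin])
    have "k * m * (w (m * x + b) t * m) = k * w (m * x + b) t * m\<^sup>2"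
      by (simp add: power2_eq_square)
    also have "\<dots> = k * w (m * x + b) t" using m by simp
    finally have eq: "k * m * (w (m * x + b) t * m) = k * w (m * x + b) t" .
    show "case z of (x, t) \<Rightarrow>
       ((\<lambda>y. k * u (m * y + b) t) has_real_derivative k * m * v (m * x + b) t) (at x) \<and>
       ((\<lambda>y. k * m * v (m * y + b) t) has_real_derivative k * w (m * x + b) t) (at x) \<and>
       ((\<lambda>s. k * u (m * x + b) s) has_real_derivative k * w (m * x + b) t) (at t)"
      unfolding xt prod.case using DERIV_cmult[OF 1, of k] DERIV_cmult[OF 2, of "k * m", unfolded eq]
        DERIV_cmult[OF d(3)[OF xt(2)], of k] by (simp add: mult_ac)
  qed
qed

section \<open>The parabolic maximum principle\<close>

lemma second_deriv_nonpos_at_max: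
  fixes f f' :: "real \<Rightarrow> real"
  assumes "e > 0" and max: "\<And>y. \<bar>y - x\<bar> < e \<Longrightarrow> f y \<le> f x"
    and d: "\<And>y. \<bar>y - x\<bar> < e \<Longrightarrow> (f has_field_derivative f' y) (at y)"
    and d2: "(f' has_field_derivative l) (at x)"
  shows "f' x = 0" "l \<le> 0"
proof -
  show 0: "f' x = 0"
    using DERIV_local_max[OF d[of x] \<open>e > 0\<close>] max \<open>e > 0\<close> by (auto simp: abs_minus_commute)
  show "l \<le> 0"
  proof (rule ccontr)
    assume "\<not> l \<le> 0"
    then obtain h where h: "h > 0" "\<And>k. 0 < k \<Longrightarrow> k < h \<Longrightarrow> f' x < f' (x + k)"
      using DERIV_pos_inc_right[OF d2] by auto
    define k where "k = min h e / 2"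
    have k: "0 < k" "k < h" "k < e" using h \<open>e > 0\<close> by (auto simp: k_def)
    have "\<exists>z. x < z \<and> z < x + k \<and> f (x + k) - f x = (x + k - x) * f' z"
      using k by (intro MVT2) (auto intro!: d)
    then obtain z where z: "x < z" "z < x + k" "f (x + k) - f x = k * f' z" by auto
    have "f' z > 0" using h(2)[of "z - x"] z k 0 by auto
    then have "f (x + k) > f x" using z k by (smt (verit) mult_pos_pos)
    with max[of "x + k"] k show False by auto
  qed
qed

text \<open>Subtracting \<open>\<eta> * (t - t1)\<close> makes the differential inequality strict: a
  maximum of \<open>g\<close> away from the lateral sides and the bottom would give
  \<open>w_xx \<le> 0\<close> and \<open>w_t \<ge> \<eta> > 0\<close>. The derivatives are abstract
  functions because the principle is applied to the nonlinear expression \<open>W\<close> of the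
  gradient estimate.\<close>

lemma parabolic_max_principle:
  fixes w wx wxx wt :: "real \<Rightarrow> real \<Rightarrow> real"
  assumes ord: "x1 < x2" "t1 < t2"
    and cont: "continuous_on (cbox (x1, t1) (x2, t2)) (\<lambda>(x, t). w x t)"
    and dx: "\<And>x t. x1 < x \<Longrightarrow> x < x2 \<Longrightarrow> t1 < t \<Longrightarrow> t \<le> t2 \<Longrightarrow> ((\<lambda>y. w y t) has_field_derivative wx x t) (at x)"
    and dxx: "\<And>x t. x1 < x \<Longrightarrow> x < x2 \<Longrightarrow> t1 < t \<Longrightarrow> t \<le> t2 \<Longrightarrow> ((\<lambda>y. wx y t) has_field_derivative wxx x t) (at x)"
    and dt: "\<And>x t. x1 < x \<Longrightarrow> x < x2 \<Longrightarrow> t1 < t \<Longrightarrow> t \<le> t2 \<Longrightarrow> ((\<lambda>s. w x s) has_field_derivative wt x t) (at t)"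
    and sub: "\<And>x t. x1 < x \<Longrightarrow> x < x2 \<Longrightarrow> t1 < t \<Longrightarrow> t \<le> t2 \<Longrightarrow> wt x t \<le> wxx x t"
    and bdry: "\<And>x t. x1 \<le> x \<Longrightarrow> x \<le> x2 \<Longrightarrow> t1 \<le> t \<Longrightarrow> t \<le> t2 \<Longrightarrow> x = x1 \<or> x = x2 \<or> t = t1 \<Longrightarrow> w x t \<le> B"
    and xt: "x1 \<le> x" "x \<le> x2" "t1 \<le> t" "t \<le> t2"
  shows "w x t \<le> B"
proof (rule field_le_epsilon)
  fix e :: real assume e: "e > 0"
  \<comment> \<open>The perturbation costs at most \<open>e\<close> over the whole time
    interval.\<close>
  define \<eta> where "\<eta> = e / (t2 - t1)"
  have \<eta>: "\<eta> > 0" using e ord by (simp add: \<eta>_def)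
  let ?Q = "cbox (x1, t1) (x2, t2)"
  define g where "g = (\<lambda>z. w (fst z) (snd z) - \<eta> * (snd z - t1))"
  have "continuous_on ?Q g"
    unfolding g_def using cont by (auto simp: case_prod_unfold intro!: continuous_intros)
  moreover have "compact ?Q" "?Q \<noteq> {}" using ord by (auto simp: box_ne_empty Basis_prod_def)
  ultimately obtain z where z: "z \<in> ?Q" "\<And>z'. z' \<in> ?Q \<Longrightarrow> g z' \<le> g z"
    using continuous_attains_sup by metis
  obtain y s where ys: "z = (y, s)" by (cases z)
  have yin: "x1 \<le> y" "y \<le> x2" "t1 \<le> s" "s \<le> t2" using z(1) ys by (auto simp: cbox_Pair_eq)
  have gz: "g z \<le> B"
  proof (cases "y = x1 \<or> y = x2 \<or> s = t1")
    case True
    then have "w y s \<le> B" using bdry yin by auto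
    moreover have "\<eta> * (s - t1) \<ge> 0" using \<eta> yin by simp
    ultimately show ?thesis by (simp add: g_def ys)
  next
    case False
    then have int: "x1 < y" "y < x2" "t1 < s" "s \<le> t2" using yin by auto
    define e' where "e' = min (y - x1) (x2 - y)"
    have "e' > 0" using int by (simp add: e'_def)
    have mx: "w y' s \<le> w y s" if "\<bar>y' - y\<bar> < e'" for y'
      using z(2)[of "(y', s)"] that int by (auto simp: g_def ys cbox_Pair_eq e'_def abs_less_iff)
    have "wxx y s \<le> 0"
      by (rule second_deriv_nonpos_at_max(2)[where f = "\<lambda>y. w y s" and f' = "\<lambda>y. wx y s" and e = e' and x = y])
         (use int \<open>e' > 0\<close> mx in \<open>auto intro!: dx dxx simp: e'_def abs_less_iff\<close>)
    \<comment> \<open>Only earlier times are compared, so the argument also covers a maximum on the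
      top side \<open>s = t2\<close>.\<close>
    moreover have "wt y s \<ge> \<eta>"
    proof (rule ccontr)
      assume "\<not> wt y s \<ge> \<eta>"
      moreover have "((\<lambda>s. w y s - \<eta> * (s - t1)) has_field_derivative wt y s - \<eta>) (at s)"
        using int by (auto intro!: derivative_eq_intros dt)
      ultimately obtain h where h: "h > 0"
        "\<And>k. 0 < k \<Longrightarrow> k < h \<Longrightarrow> w y s - \<eta> * (s - t1) < w y (s - k) - \<eta> * (s - k - t1)"
        using DERIV_neg_dec_left[of "\<lambda>s. w y s - \<eta> * (s - t1)" "wt y s - \<eta>" s] by auto
      define k where "k = min h (s - t1) / 2"
      have k: "0 < k" "k < h" "k < s - t1" using h int by (auto simp: k_def)
      show False using h(2)[OF k(1,2)] z(2)[of "(y, s - k)"] k int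
        by (auto simp: g_def ys cbox_Pair_eq)
    qed
    ultimately show ?thesis using sub[OF int] \<eta> by linarith
  qed
  have "g (x, t) \<le> g z" using xt by (intro z(2)) (auto simp: cbox_Pair_eq)
  moreover have "\<eta> * (t - t1) \<le> \<eta> * (t2 - t1)" using \<eta> xt by simp
  moreover have "\<eta> * (t2 - t1) = e" using ord by (simp add: \<eta>_def)
  ultimately show "w x t \<le> B + e" using gz by (simp add: g_def)
qed

section \<open>Interior gradient estimate and limits of caloric functions\<close>

text \<open>Bernstein's method: \<open>W = h\<^sup>2 v\<^sup>2 + A u\<^sup>2\<close> is a
  subsolution, because the good terms \<open>2 h\<^sup>2 w\<^sup>2\<close> and
  \<open>2 A v\<^sup>2\<close> absorb all the others. The cutoff \<open>h\<close> vanishes on the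
  lateral sides and at the bottom, where only \<open>A u\<^sup>2 \<le> A M\<^sup>2\<close> is
  left.\<close>

lemma gradient_estimate:
  fixes u v w z :: "real \<Rightarrow> real \<Rightarrow> real"
  defines "Q \<equiv> \<lambda>x0 t0 r. cbox (x0 - r, t0 - r) (x0 + r, t0)"
  assumes r: "0 < r" "r \<le> 1"
    and cu: "continuous_on (Q x0 t0 r) (\<lambda>(x, t). u x t)"
    and cv: "continuous_on (Q x0 t0 r) (\<lambda>(x, t). v x t)"
    and d: "\<And>x t. (x, t) \<in> Q x0 t0 r \<Longrightarrow> ((\<lambda>y. u y t) has_field_derivative v x t) (at x)"
      "\<And>x t. (x, t) \<in> Q x0 t0 r \<Longrightarrow> ((\<lambda>y. v y t) has_field_derivative w x t) (at x)"
      "\<And>x t. (x, t) \<in> Q x0 t0 r \<Longrightarrow> ((\<lambda>y. w y t) has_field_derivative z x t) (at x)"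
      "\<And>x t. (x, t) \<in> Q x0 t0 r \<Longrightarrow> ((\<lambda>s. u x s) has_field_derivative w x t) (at t)"
      "\<And>x t. (x, t) \<in> Q x0 t0 r \<Longrightarrow> ((\<lambda>s. v x s) has_field_derivative z x t) (at t)"
    and M: "\<And>x t. (x, t) \<in> Q x0 t0 r \<Longrightarrow> \<bar>u x t\<bar> \<le> M"
  shows "\<bar>v x0 t0\<bar> \<le> 4 * M / r"
proof -
  \<comment> \<open>With \<open>r \<le> 1\<close>, the coefficient of \<open>v\<^sup>2\<close> that
    has to be absorbed is at most \<open>(2 + 6 * 4 + 4) r^4 = 30 r^4 = 2 A\<close>. Since
    \<open>15 \<le> 16\<close>, the final constant is 4.\<close>
  define A where "A = 15 * r ^ 4"
  define h where "h = (\<lambda>x t. (r\<^sup>2 - (x - x0)\<^sup>2) * (t - t0 + r))"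
  define hx where "hx = (\<lambda>x t. - 2 * (x - x0) * (t - t0 + r))"
  define hxx where "hxx = (\<lambda>(x::real) t. - 2 * (t - t0 + r))"
  define ht where "ht = (\<lambda>x (t::real). r\<^sup>2 - (x - x0)\<^sup>2)"
  have dchi: "((\<lambda>x. h x t) has_field_derivative hx x t) (at x)"
    "((\<lambda>x. hx x t) has_field_derivative hxx x t) (at x)"
    "((\<lambda>t. h x t) has_field_derivative ht x t) (at t)" for x t
    unfolding h_def hx_def hxx_def ht_def by (auto intro!: derivative_eq_intros)
  define W where "W = (\<lambda>x t. (h x t)\<^sup>2 * (v x t)\<^sup>2 + A * (u x t)\<^sup>2)"
  define Wx where "Wx = (\<lambda>x t. 2 * h x t * hx x t * (v x t)\<^sup>2 + (h x t)\<^sup>2 * (2 * v x t * w x t) + A * (2 * u x t * v x t))"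
  define Wxx where "Wxx = (\<lambda>x t. (2 * (hx x t)\<^sup>2 + 2 * h x t * hxx x t) * (v x t)\<^sup>2 + 8 * h x t * hx x t * v x t * w x t
      + (h x t)\<^sup>2 * (2 * (w x t)\<^sup>2 + 2 * v x t * z x t) + A * (2 * (v x t)\<^sup>2 + 2 * u x t * w x t))"
  define Wt where "Wt = (\<lambda>x t. 2 * h x t * ht x t * (v x t)\<^sup>2 + (h x t)\<^sup>2 * (2 * v x t * z x t) + A * (2 * u x t * w x t))"
  have M0: "0 \<le> M" using M[of x0 t0] r by (force simp: Q_def cbox_Pair_eq)
  have "W x0 t0 \<le> A * M\<^sup>2"
  proof (rule parabolic_max_principle[where ?x1.0 = "x0 - r" and ?x2.0 = "x0 + r" and ?t1.0 = "t0 - r" and ?t2.0 = t0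
        and w = W and wx = Wx and wxx = Wxx and wt = Wt and x = x0 and t = t0])
    show "continuous_on (cbox (x0 - r, t0 - r) (x0 + r, t0)) (\<lambda>(x, t). W x t)"
      using cu cv unfolding Q_def W_def h_def case_prod_unfold by (intro continuous_intros)
    fix x t assume xt: "x0 - r < x" "x < x0 + r" "t0 - r < t" "t \<le> t0"
    then have Q: "(x, t) \<in> Q x0 t0 r" by (simp add: Q_def cbox_Pair_eq)
    note dd = d[OF Q]
    show "((\<lambda>y. W y t) has_real_derivative Wx x t) (at x)"
      unfolding W_def Wx_def
      by (rule derivative_eq_intros dchi dd refl)+ (simp add: algebra_simps power2_eq_square)
    show "((\<lambda>y. Wx y t) has_real_derivative Wxx x t) (at x)"
      unfolding Wxx_def Wx_def
      by (rule derivative_eq_intros dchi dd refl)+ (simp add: algebra_simps power2_eq_square)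
    show "((\<lambda>s. W x s) has_real_derivative Wt x t) (at t)"
      unfolding W_def Wt_def
      by (rule derivative_eq_intros dchi dd refl)+ (simp add: algebra_simps power2_eq_square)
    show "Wt x t \<le> Wxx x t"
    proof -
      have xr: "(x - x0)\<^sup>2 \<le> r\<^sup>2" using xt by (intro power2_le_iff_abs_le[THEN iffD2]) auto
      have tr: "0 \<le> t - t0 + r" "t - t0 + r \<le> r" using xt by auto
      have ct: "0 \<le> ht x t" "ht x t \<le> r\<^sup>2" using xr by (auto simp: ht_def)
      have c_eq: "h x t = ht x t * (t - t0 + r)" by (simp add: h_def ht_def)
      have c: "0 \<le> h x t" "h x t \<le> r\<^sup>2 * r"
        unfolding c_eq using ct tr r by (auto intro!: mult_mono mult_nonneg_nonneg)
      have "(hx x t)\<^sup>2 = 4 * ((x - x0)\<^sup>2 * (t - t0 + r)\<^sup>2)" by (simp add: hx_def power2_eq_square algebra_simps)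
      also have "\<dots> \<le> 4 * (r\<^sup>2 * r\<^sup>2)" using mult_mono[OF xr power_mono[OF tr(2,1), of 2]] by simp
      finally have cx: "(hx x t)\<^sup>2 \<le> 4 * r ^ 4" by (simp add: power_add[symmetric])
      have "h x t * (t - t0 + r) \<le> (r\<^sup>2 * r) * r" using c tr r by (intro mult_mono) auto
      moreover have "2 * h x t * hxx x t = - 4 * (h x t * (t - t0 + r))" by (simp add: hxx_def algebra_simps)
      moreover have "r\<^sup>2 * r * r = r ^ 4" by (simp add: power_numeral_reduce)
      ultimately have cxx: "2 * h x t * hxx x t \<ge> - 4 * r ^ 4" by linarith
      have "h x t * ht x t \<le> (r\<^sup>2 * r) * r\<^sup>2" using c ct r by (intro mult_mono) auto
      also have "\<dots> = r ^ 4 * r" by (simp add: power_numeral_reduce)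
      also have "\<dots> \<le> r ^ 4" using r by (simp add: mult_left_le)
      finally have ctt: "2 * h x t * ht x t \<le> 2 * r ^ 4" by simp
      have "2 * h x t * ht x t + 6 * (hx x t)\<^sup>2 - 2 * h x t * hxx x t \<le> 2 * A"
        using cx cxx ctt unfolding A_def by linarith
      then have "(2 * h x t * ht x t + 6 * (hx x t)\<^sup>2 - 2 * h x t * hxx x t) * (v x t)\<^sup>2 \<le> 2 * A * (v x t)\<^sup>2"
        by (intro mult_right_mono) auto
      \<comment> \<open>Completing the square in \<open>h w\<close> removes the mixed term
        \<open>8 h h_x v w\<close> at the price of \<open>8 h_x\<^sup>2 v\<^sup>2\<close>; two of
        these eight are present in \<open>Wxx\<close> already, hence the coefficient 6.\<close>
      moreover have "0 \<le> 2 * (h x t * w x t + 2 * hx x t * v x t)\<^sup>2" by simp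
      ultimately show ?thesis
        unfolding Wt_def Wxx_def by (simp add: algebra_simps power2_eq_square)
    qed
  next
    fix x t assume xt: "x0 - r \<le> x" "x \<le> x0 + r" "t0 - r \<le> t" "t \<le> t0"
      "x = x0 - r \<or> x = x0 + r \<or> t = t0 - r"
    then have "h x t = 0" by (auto simp: h_def)
    moreover have "(u x t)\<^sup>2 \<le> M\<^sup>2"
      using M[of x t] xt M0 by (intro power2_le_iff_abs_le[THEN iffD2]) (auto simp: Q_def cbox_Pair_eq)
    moreover have "A \<ge> 0" using r by (simp add: A_def)
    ultimately show "W x t \<le> A * M\<^sup>2" by (simp add: W_def mult_left_mono)
  qed (use r in auto)
  moreover have "A * (u x0 t0)\<^sup>2 \<ge> 0" using r by (simp add: A_def)
  moreover have "h x0 t0 = r ^ 3" by (simp add: h_def power_numeral_reduce)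
  ultimately have "(r ^ 3)\<^sup>2 * (v x0 t0)\<^sup>2 \<le> A * M\<^sup>2"
    unfolding W_def by (simp only:)
  then have "(r ^ 3)\<^sup>2 * (v x0 t0)\<^sup>2 \<le> 15 * r ^ 4 * M\<^sup>2" by (simp only: A_def)
  then have "r ^ 4 * (r\<^sup>2 * (v x0 t0)\<^sup>2) \<le> r ^ 4 * (15 * M\<^sup>2)"
    by (simp add: power_numeral_reduce algebra_simps)
  then have "r\<^sup>2 * (v x0 t0)\<^sup>2 \<le> 15 * M\<^sup>2"
    by (rule mult_left_le_imp_le) (use r in simp)
  then have "(r * v x0 t0)\<^sup>2 \<le> (4 * M)\<^sup>2"
    using zero_le_power2[of M] unfolding power_mult_distrib by (simp, linarith)
  then have "\<bar>r * v x0 t0\<bar> \<le> \<bar>4 * M\<bar>"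
    by (rule abs_le_square_iff[THEN iffD2])
  then have "\<bar>r * v x0 t0\<bar> \<le> 4 * M" using M0 by simp
  then show ?thesis using r by (simp add: abs_mult field_simps)
qed

lemma DERIV_uniform_limit:
  fixes f f' :: "nat \<Rightarrow> real \<Rightarrow> real"
  assumes d: "\<And>n y. y \<in> {a..b} \<Longrightarrow> (f n has_field_derivative f' n y) (at y)"
    and lim: "uniform_limit {a..b} f' g' sequentially"
    and f: "\<And>y. y \<in> {a..b} \<Longrightarrow> (\<lambda>n. f n y) \<longlonglongrightarrow> g y"
    and x: "a < x" "x < b"
  shows "(g has_field_derivative g' x) (at x)"
proof -
  have "\<exists>h. \<forall>y\<in>{a..b}. (\<lambda>n. f n y) \<longlonglongrightarrow> h y \<and> (h has_derivative (\<lambda>k. g' y * k)) (at y within {a..b})"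
  proof (rule has_derivative_sequence[where f' = "\<lambda>n y k. f' n y * k" and ?x0.0 = x])
    show "(f n has_derivative (\<lambda>k. f' n y * k)) (at y within {a..b})" if "y \<in> {a..b}" for n y
      using d[OF that] has_field_derivative_at_within has_field_derivative_def by blast
    show "\<forall>\<^sub>F n in sequentially. \<forall>y\<in>{a..b}. \<forall>h. norm (f' n y * h - g' y * h) \<le> e * norm h"
      if "e > 0" for e
      using lim[unfolded uniform_limit_iff, rule_format, OF that]
    proof eventually_elim
      case (elim n)
      show ?case
      proof (intro ballI allI)
        fix y h assume "y \<in> {a..b}"
        with elim have "\<bar>f' n y - g' y\<bar> \<le> e" by (auto simp: dist_real_def less_imp_le)
        then have "\<bar>f' n y - g' y\<bar> * \<bar>h\<bar> \<le> e * \<bar>h\<bar>" by (rule mult_right_mono) simp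
        then show "norm (f' n y * h - g' y * h) \<le> e * norm h"
          by (simp add: abs_mult[symmetric] left_diff_distrib)
      qed
    qed
    show "(\<lambda>n. f n x) \<longlonglongrightarrow> g x" using f x by simp
  qed (use x in auto)
  then obtain h where h: "\<And>y. y \<in> {a..b} \<Longrightarrow> (\<lambda>n. f n y) \<longlonglongrightarrow> h y"
    "\<And>y. y \<in> {a..b} \<Longrightarrow> (h has_derivative (\<lambda>k. g' y * k)) (at y within {a..b})" by blast
  have eq: "h y = g y" if "y \<in> {a..b}" for y
    using LIMSEQ_unique h(1)[OF that] f[OF that] by blast
  have "at x within {a..b} = at x" using x by (intro at_within_interior) auto
  then have "(h has_field_derivative g' x) (at x)"
    using h(2)[of x] x by (simp add: has_field_derivative_def)
  then show ?thesis
    by (rule has_field_derivative_transform_within_open[where S = "{a<..<b}"]) (use x eq in auto)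
qed

abbreviation sqbox :: "real \<Rightarrow> real \<Rightarrow> real \<Rightarrow> (real \<times> real) set" where
  "sqbox x t r \<equiv> cbox (x - r, t - r) (x + r, t + r)"

lemma mem_sqbox: "(y, s) \<in> sqbox x t r \<longleftrightarrow> \<bar>y - x\<bar> \<le> r \<and> \<bar>s - t\<bar> \<le> r"
  by (auto simp: cbox_Pair_eq)

text \<open>The index \<open>k\<close> counts space derivatives; the assumption on time derivatives
  encodes the heat equation for all of them. Hence every difference \<open>d n k - d m k\<close> is
  itself caloric, and the gradient estimate turns uniform convergence at order \<open>k\<close> into
  uniform convergence at order \<open>k + 1\<close> on a smaller square. Two such steps
  suffice.\<close>

lemma caloric_limit:
  fixes d :: "nat \<Rightarrow> nat \<Rightarrow> real \<Rightarrow> real \<Rightarrow> real"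
  assumes R: "R > 0"
    and c: "\<And>n k. continuous_on (sqbox x0 t0 R) (\<lambda>(x, t). d n k x t)"
    and dx: "\<And>n k x t. (x, t) \<in> sqbox x0 t0 R \<Longrightarrow> ((\<lambda>y. d n k y t) has_field_derivative d n (Suc k) x t) (at x)"
    and dt: "\<And>n k x t. (x, t) \<in> sqbox x0 t0 R \<Longrightarrow> ((\<lambda>s. d n k x s) has_field_derivative d n (Suc (Suc k)) x t) (at t)"
    and lim: "uniform_limit (sqbox x0 t0 R) (\<lambda>n (x, t). d n 0 x t) (\<lambda>(x, t). u x t) sequentially"
  shows "caloric_on (box (x0 - R/2, t0 - R/2) (x0 + R/2, t0 + R/2)) u"
proof -
  define r where "r = min 1 (R / 4)"
  have r: "0 < r" "r \<le> 1" "r \<le> R / 4" using R by (auto simp: r_def)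
  \<comment> \<open>One application: the radius shrinks by \<open>R / 4\<close> and the bound grows
    by the factor \<open>4 / r\<close>.\<close>
  have step: "\<bar>d n (Suc k) x t - d m (Suc k) x t\<bar> \<le> 4 * M / r"
    if "\<And>y s. (y, s) \<in> sqbox x0 t0 R' \<Longrightarrow> \<bar>d n k y s - d m k y s\<bar> \<le> M"
      and R': "R' \<le> R" and xt: "(x, t) \<in> sqbox x0 t0 (R' - R/4)" for n m k x t M R'
  proof (rule gradient_estimate[where r = r and u = "\<lambda>x t. d n k x t - d m k x t"
        and v = "\<lambda>x t. d n (Suc k) x t - d m (Suc k) x t"
        and w = "\<lambda>x t. d n (Suc (Suc k)) x t - d m (Suc (Suc k)) x t"
        and z = "\<lambda>x t. d n (Suc (Suc (Suc k))) x t - d m (Suc (Suc (Suc k))) x t"])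
    let ?Q = "cbox (x - r, t - r) (x + r, t)"
    have sub: "?Q \<subseteq> sqbox x0 t0 R'" "sqbox x0 t0 R' \<subseteq> sqbox x0 t0 R"
      using xt r R' by (auto simp: cbox_Pair_eq)
    have cc: "continuous_on ?Q (\<lambda>(x, t). d n k x t - d m k x t)" for k
      using continuous_on_subset[OF c[of n k]] continuous_on_subset[OF c[of m k]] sub
      by (auto simp: case_prod_unfold intro!: continuous_on_diff)
    show "continuous_on ?Q (\<lambda>(x, t). d n k x t - d m k x t)"
      "continuous_on ?Q (\<lambda>(x, t). d n (Suc k) x t - d m (Suc k) x t)" by (rule cc)+
    fix y s assume ys: "(y, s) \<in> ?Q"
    then have "(y, s) \<in> sqbox x0 t0 R" using sub by blast
    note dd = dx[OF this] dt[OF this]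
    show "((\<lambda>y. d n k y s - d m k y s) has_real_derivative d n (Suc k) y s - d m (Suc k) y s) (at y)"
      "((\<lambda>y. d n (Suc k) y s - d m (Suc k) y s) has_real_derivative d n (Suc (Suc k)) y s - d m (Suc (Suc k)) y s) (at y)"
      "((\<lambda>y. d n (Suc (Suc k)) y s - d m (Suc (Suc k)) y s) has_real_derivative d n (Suc (Suc (Suc k))) y s - d m (Suc (Suc (Suc k))) y s) (at y)"
      "((\<lambda>s. d n k y s - d m k y s) has_real_derivative d n (Suc (Suc k)) y s - d m (Suc (Suc k)) y s) (at s)"
      "((\<lambda>s. d n (Suc k) y s - d m (Suc k) y s) has_real_derivative d n (Suc (Suc (Suc k))) y s - d m (Suc (Suc (Suc k))) y s) (at s)"
      by (intro DERIV_diff dd)+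
    show "\<bar>d n k y s - d m k y s\<bar> \<le> M" using that(1) ys sub by blast
  qed (use r in auto)
  let ?H = "sqbox x0 t0 (R/2)"
  have HR: "?H \<subseteq> sqbox x0 t0 R" using R by (auto simp: cbox_Pair_eq)
  have cauchy0: "\<exists>N. \<forall>n\<ge>N. \<forall>m\<ge>N. \<forall>y s. (y, s) \<in> sqbox x0 t0 R \<longrightarrow> \<bar>d n 0 y s - d m 0 y s\<bar> \<le> e"
    if "e > 0" for e
  proof -
    have "\<forall>\<^sub>F n in sequentially. \<forall>z\<in>sqbox x0 t0 R. dist ((\<lambda>(x, t). d n 0 x t) z) ((\<lambda>(x, t). u x t) z) < e/2"
      using lim[unfolded uniform_limit_iff, rule_format, of "e/2"] that by simp
    then obtain N where N: "\<And>n z. n \<ge> N \<Longrightarrow> z \<in> sqbox x0 t0 R \<Longrightarrow> dist ((\<lambda>(x, t). d n 0 x t) z) ((\<lambda>(x, t). u x t) z) < e/2"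
      unfolding eventually_sequentially by blast
    have "\<bar>d n 0 y s - d m 0 y s\<bar> \<le> e" if "n \<ge> N" "m \<ge> N" "(y, s) \<in> sqbox x0 t0 R" for n m y s
      using N[OF that(1,3)] N[OF that(2,3)] unfolding prod.case dist_real_def by linarith
    then show ?thesis by blast
  qed
  have "\<exists>l. uniform_limit ?H (\<lambda>n (x, t). d n k x t) l sequentially" if k: "k \<le> 2" for k
  proof -
    have "uniformly_Cauchy_on ?H (\<lambda>n (x, t). d n k x t)"
      unfolding uniformly_Cauchy_on_def
    proof (intro allI impI)
      fix e :: real assume e: "e > 0"
      \<comment> \<open>Two applications of the estimate multiply the bound by
        \<open>16 / r\<^sup>2\<close>, which leaves \<open>e / 2\<close>.\<close>
      define e' where "e' = e * r\<^sup>2 / 32"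
      have e': "e' > 0" using e r by (simp add: e'_def)
      obtain N where N: "\<And>n m y s. n \<ge> N \<Longrightarrow> m \<ge> N \<Longrightarrow> (y, s) \<in> sqbox x0 t0 R \<Longrightarrow> \<bar>d n 0 y s - d m 0 y s\<bar> \<le> e'"
        using cauchy0[OF e'] by blast
      have N1: "\<bar>d n 1 y s - d m 1 y s\<bar> \<le> 4 * e' / r" if "n \<ge> N" "m \<ge> N" "(y, s) \<in> sqbox x0 t0 (3 * R / 4)" for n m y s
        using step[of R n 0 m e' y s] N[OF that(1,2)] that(3) by (simp add: field_simps)
      have N2: "\<bar>d n 2 y s - d m 2 y s\<bar> \<le> 4 * (4 * e' / r) / r" if "n \<ge> N" "m \<ge> N" "(y, s) \<in> sqbox x0 t0 (R / 2)" for n m y s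
        using step[of "3 * R / 4" n 1 m "4 * e' / r" y s] N1[OF that(1,2)] that(3) R by (simp add: field_simps numeral_2_eq_2)
      have r2: "r\<^sup>2 \<le> 1" "r\<^sup>2 \<le> r" using r by (auto simp: power2_eq_square mult_le_one mult_left_le)
      have "e' < e" "4 * e' / r < e" "4 * (4 * e' / r) / r < e"
        using r e r2 unfolding e'_def by (auto simp: field_simps power2_eq_square)
      moreover have "k = 0 \<or> k = 1 \<or> k = 2" using k by linarith
      ultimately have "\<bar>d n k y s - d m k y s\<bar> < e" if "n \<ge> N" "m \<ge> N" "(y, s) \<in> ?H" for n m y s
        using N[of n m y s] N1[of n m y s] N2[of n m y s] that R HR by (auto simp: mem_sqbox)
      then show "\<exists>M. \<forall>z\<in>?H. \<forall>m\<ge>M. \<forall>n\<ge>M. dist ((\<lambda>(x, t). d m k x t) z) ((\<lambda>(x, t). d n k x t) z) < e"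
        by (intro exI[of _ N]) (auto simp: dist_real_def)
    qed
    then have "uniformly_convergent_on ?H (\<lambda>n (x, t). d n k x t)"
      by (rule Cauchy_uniformly_convergent)
    then show ?thesis unfolding uniformly_convergent_on_def .
  qed
  then obtain l1 l2 where l1: "uniform_limit ?H (\<lambda>n (x, t). d n 1 x t) l1 sequentially"
    and l2: "uniform_limit ?H (\<lambda>n (x, t). d n 2 x t) l2 sequentially"
    by (metis one_le_numeral order_refl)
  define v where "v = (\<lambda>x t. l1 (x, t))"
  define w where "w = (\<lambda>x t. l2 (x, t))"
  have l0: "uniform_limit ?H (\<lambda>n (x, t). d n 0 x t) (\<lambda>(x, t). u x t) sequentially"
    using lim HR by (rule uniform_limit_on_subset)
  have v: "uniform_limit ?H (\<lambda>n (x, t). d n 1 x t) (\<lambda>(x, t). v x t) sequentially"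
    using l1 by (simp add: v_def)
  have w: "uniform_limit ?H (\<lambda>n (x, t). d n 2 x t) (\<lambda>(x, t). w x t) sequentially"
    using l2 by (simp add: w_def)
  have cH: "continuous_on ?H (\<lambda>(x, t). d n k x t)" for n k
    by (rule continuous_on_subset[OF c HR])
  let ?B = "box (x0 - R/2, t0 - R/2) (x0 + R/2, t0 + R/2)"
  have BH: "?B \<subseteq> ?H" by (rule box_subset_cbox)
  have slx: "uniform_limit {x0 - R/2..x0 + R/2} (\<lambda>n y. f n y t) (\<lambda>y. g y t) sequentially"
    if "uniform_limit ?H (\<lambda>n (x, t). f n x t) (\<lambda>(x, t). g x t) sequentially" "\<bar>t - t0\<bar> \<le> R/2"
    for f :: "nat \<Rightarrow> real \<Rightarrow> real \<Rightarrow> real" and g t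
    unfolding uniform_limit_iff
  proof (intro allI impI)
    fix e :: real assume "e > 0"
    show "\<forall>\<^sub>F n in sequentially. \<forall>y\<in>{x0 - R/2..x0 + R/2}. dist (f n y t) (g y t) < e"
      using that(1)[unfolded uniform_limit_iff, rule_format, OF \<open>e > 0\<close>]
    proof eventually_elim
      case (elim n)
      show ?case
      proof
        fix y assume "y \<in> {x0 - R/2..x0 + R/2}"
        then have "(y, t) \<in> ?H" using that(2) unfolding mem_sqbox atLeastAtMost_iff by linarith
        from bspec[OF elim this] show "dist (f n y t) (g y t) < e" by simp
      qed
    qed
  qed
  have slt: "uniform_limit {t0 - R/2..t0 + R/2} (\<lambda>n s. f n x s) (\<lambda>s. g x s) sequentially"
    if "uniform_limit ?H (\<lambda>n (x, t). f n x t) (\<lambda>(x, t). g x t) sequentially" "\<bar>x - x0\<bar> \<le> R/2"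
    for f :: "nat \<Rightarrow> real \<Rightarrow> real \<Rightarrow> real" and g x
    unfolding uniform_limit_iff
  proof (intro allI impI)
    fix e :: real assume "e > 0"
    show "\<forall>\<^sub>F n in sequentially. \<forall>s\<in>{t0 - R/2..t0 + R/2}. dist (f n x s) (g x s) < e"
      using that(1)[unfolded uniform_limit_iff, rule_format, OF \<open>e > 0\<close>]
    proof eventually_elim
      case (elim n)
      show ?case
      proof
        fix s assume "s \<in> {t0 - R/2..t0 + R/2}"
        then have "(x, s) \<in> ?H" using that(2) unfolding mem_sqbox atLeastAtMost_iff by linarith
        from bspec[OF elim this] show "dist (f n x s) (g x s) < e" by simp
      qed
    qed
  qed
  show ?thesis
    unfolding caloric_on_def
  proof (rule exI[of _ v], rule exI[of _ w], intro conjI ballI)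
    show "continuous_on ?B (\<lambda>(x, t). u x t)" "continuous_on ?B (\<lambda>(x, t). v x t)"
      "continuous_on ?B (\<lambda>(x, t). w x t)"
      using uniform_limit_theorem[OF _ l0] uniform_limit_theorem[OF _ v] uniform_limit_theorem[OF _ w] cH
      by (auto intro!: continuous_on_subset[OF _ BH] always_eventually)
    fix z assume "z \<in> ?B"
    then obtain x t where z: "z = (x, t)" and xt: "\<bar>x - x0\<bar> < R/2" "\<bar>t - t0\<bar> < R/2"
    proof (cases z)
      case (Pair a b)
      with \<open>z \<in> ?B\<close> have "x0 - R/2 < a" "a < x0 + R/2" "t0 - R/2 < b" "b < t0 + R/2"
        by (auto simp: mem_box Basis_prod_def)
      then have "\<bar>a - x0\<bar> < R/2" "\<bar>b - t0\<bar> < R/2" by linarith+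
      with Pair show ?thesis by (rule that)
    qed
    have inR: "(y, s) \<in> sqbox x0 t0 R" if "\<bar>y - x0\<bar> \<le> R/2" "\<bar>s - t0\<bar> \<le> R/2" for y s
      using that R unfolding mem_sqbox by linarith
    have bnd: "x0 - R/2 < x" "x < x0 + R/2" "t0 - R/2 < t" "t < t0 + R/2"
      using xt by linarith+
    have in1: "(y, t) \<in> sqbox x0 t0 R" if "y \<in> {x0 - R/2..x0 + R/2}" for y
      using that xt by (intro inR) (simp_all only: atLeastAtMost_iff, linarith+)
    have in2: "(x, s) \<in> sqbox x0 t0 R" if "s \<in> {t0 - R/2..t0 + R/2}" for s
      using that xt by (intro inR) (simp_all only: atLeastAtMost_iff, linarith+)
    have "((\<lambda>y. u y t) has_real_derivative v x t) (at x)"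
    proof (rule DERIV_uniform_limit[where f = "\<lambda>n y. d n 0 y t" and f' = "\<lambda>n y. d n 1 y t"])
      show "uniform_limit {x0 - R/2..x0 + R/2} (\<lambda>n y. d n 1 y t) (\<lambda>y. v y t) sequentially"
        using slx[OF v] xt by simp
      show "(\<lambda>n. d n 0 y t) \<longlonglongrightarrow> u y t" if "y \<in> {x0 - R/2..x0 + R/2}" for y
        using tendsto_uniform_limitI[OF slx[OF l0] that] xt by simp
    qed (use dx[OF in1, where k = 0] bnd in auto)
    moreover have "((\<lambda>y. v y t) has_real_derivative w x t) (at x)"
    proof (rule DERIV_uniform_limit[where f = "\<lambda>n y. d n 1 y t" and f' = "\<lambda>n y. d n 2 y t"])
      show "uniform_limit {x0 - R/2..x0 + R/2} (\<lambda>n y. d n 2 y t) (\<lambda>y. w y t) sequentially"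
        using slx[OF w] xt by simp
      show "(\<lambda>n. d n 1 y t) \<longlonglongrightarrow> v y t" if "y \<in> {x0 - R/2..x0 + R/2}" for y
        using tendsto_uniform_limitI[OF slx[OF v] that] xt by simp
    qed (use dx[OF in1, where k = 1] bnd in \<open>auto simp: numeral_2_eq_2\<close>)
    moreover have "((\<lambda>s. u x s) has_real_derivative w x t) (at t)"
    proof (rule DERIV_uniform_limit[where f = "\<lambda>n s. d n 0 x s" and f' = "\<lambda>n s. d n 2 x s"])
      show "uniform_limit {t0 - R/2..t0 + R/2} (\<lambda>n s. d n 2 x s) (\<lambda>s. w x s) sequentially"
        using slt[OF w] xt by simp
      show "(\<lambda>n. d n 0 x s) \<longlonglongrightarrow> u x s" if "s \<in> {t0 - R/2..t0 + R/2}" for s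
        using tendsto_uniform_limitI[OF slt[OF l0] that] xt by simp
    qed (use dt[OF in2, where k = 0] bnd in \<open>auto simp: numeral_2_eq_2\<close>)
    ultimately show "case z of (x, t) \<Rightarrow>
       ((\<lambda>y. u y t) has_real_derivative v x t) (at x) \<and>
       ((\<lambda>y. v y t) has_real_derivative w x t) (at x) \<and>
       (u x has_real_derivative w x t) (at t)"
      unfolding z by simp
  qed
qed

section \<open>Weyl's lemma\<close>

text \<open>Numerators of the derivatives of \<open>exp (- 1 / (1 - x\<^sup>2))\<close>: the
  derivative of order \<open>n\<close> is this polynomial over
  \<open>(1 - x\<^sup>2) ^ (2 * n)\<close> times the exponential. The recursion is the quotient
  rule, with \<open>[:1, 0, -1:]\<close> standing for \<open>1 - x\<^sup>2\<close>. An explicit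
  formula makes all derivatives available at once.\<close>

primrec bump_poly :: "nat \<Rightarrow> real poly" where
  "bump_poly 0 = 1"
| "bump_poly (Suc n) = pderiv (bump_poly n) * [:1, 0, -1:]\<^sup>2
     + (smult (4 * real n) ([:0, 1:] * [:1, 0, -1:]) - [:0, 2:]) * bump_poly n"

definition bump :: "nat \<Rightarrow> real \<Rightarrow> real" where
  "bump n x = (if \<bar>x\<bar> < 1 then poly (bump_poly n) x / (1 - x\<^sup>2) ^ (2 * n) * exp (- 1 / (1 - x\<^sup>2)) else 0)"

lemma power_div_fact_le_exp:
  fixes y :: real assumes "0 \<le> y" shows "y ^ k / fact k \<le> exp y"
proof -
  have s: "(\<lambda>n. y ^ n / fact n) sums exp y"
    using exp_converges[of y] by (simp add: divide_inverse mult.commute scaleR_conv_of_real)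
  have "(\<Sum>n\<in>{k}. y ^ n / fact n) \<le> (\<Sum>n. y ^ n / fact n)"
    by (rule sum_le_suminf) (use s assms in \<open>auto simp: sums_iff\<close>)
  then show ?thesis using s by (simp add: sums_iff)
qed

text \<open>The exponential beats every pole: with \<open>q = 1 - x\<^sup>2\<close>, a single term
  of the exponential series gives \<open>exp (- 1 / q) \<le> (2 n + 2)! q ^ (2 n + 2)\<close>, of
  which \<open>q ^ (2 n)\<close> is lost to the denominator. What remains vanishes to second order
  at the ends of the support, which is all that differentiability there requires.\<close>

lemma bump_bound:
  obtains C where "C \<ge> 0" "\<And>x. \<bar>x\<bar> \<le> 1 \<Longrightarrow> \<bar>bump n x\<bar> \<le> C * (1 - x\<^sup>2)\<^sup>2"
proof -
  have "compact ((\<lambda>x. \<bar>poly (bump_poly n) x\<bar>) ` {-1..1})"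
    by (intro compact_continuous_image continuous_intros) auto
  then have "bdd_above ((\<lambda>x. \<bar>poly (bump_poly n) x\<bar>) ` {-1..1})"
    by (intro bounded_imp_bdd_above compact_imp_bounded)
  then obtain P where P: "\<And>x. x \<in> {-1..1} \<Longrightarrow> \<bar>poly (bump_poly n) x\<bar> \<le> P"
    unfolding bdd_above_def by blast
  have P0: "0 \<le> P" using P[of 0] by auto
  define C where "C = P * fact (2 * n + 2)"
  show ?thesis
  proof (rule that[of C])
    show "C \<ge> 0" using P0 by (simp add: C_def)
    fix x :: real assume x: "\<bar>x\<bar> \<le> 1"
    show "\<bar>bump n x\<bar> \<le> C * (1 - x\<^sup>2)\<^sup>2"
    proof (cases "\<bar>x\<bar> < 1")
      case False
      then show ?thesis using \<open>C \<ge> 0\<close> by (simp add: bump_def)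
    next
      case True
      define q where "q = 1 - x\<^sup>2"
      have q: "q > 0" using True abs_square_less_1[of x] by (simp add: q_def)
      have "exp (- 1 / q) \<le> fact (2 * n + 2) * q ^ (2 * n + 2)"
      proof -
        define K Q E where "K = (fact (2 * n + 2) :: real)" and "Q = q ^ (2 * n + 2)" and "E = exp (1 / q)"
        have pos: "K > 0" "Q > 0" "E > 0" using q by (auto simp: K_def Q_def E_def)
        have "(1 / q) ^ (2 * n + 2) / K \<le> E"
          unfolding K_def E_def using q by (intro power_div_fact_le_exp) simp
        then have "1 / Q / K \<le> E" by (simp add: Q_def power_one_over)
        then have "1 / E \<le> K * Q" using pos by (simp add: field_simps)
        moreover have "exp (- 1 / q) = 1 / E" by (simp add: E_def exp_minus field_simps)
        ultimately show ?thesis by (simp add: K_def Q_def)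
      qed
      then have "exp (- 1 / q) / q ^ (2 * n) \<le> fact (2 * n + 2) * q\<^sup>2"
        using q by (simp add: field_simps power_add power2_eq_square)
      moreover have "\<bar>poly (bump_poly n) x\<bar> \<le> P" using P[of x] True unfolding atLeastAtMost_iff by linarith
      ultimately have "\<bar>poly (bump_poly n) x\<bar> * (exp (- 1 / q) / q ^ (2 * n)) \<le> P * (fact (2 * n + 2) * q\<^sup>2)"
        using P0 q by (intro mult_mono) auto
      moreover have "\<bar>bump n x\<bar> = \<bar>poly (bump_poly n) x\<bar> * (exp (- 1 / q) / q ^ (2 * n))"
        using True q unfolding bump_def q_def[symmetric] by (simp add: abs_mult)
      ultimately show ?thesis unfolding C_def q_def by (simp add: mult_ac)
    qed
  qed
qed

lemma DERIV_bump: "(bump n has_field_derivative bump (Suc n) x) (at x)"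
proof -
  consider "\<bar>x\<bar> < 1" | "\<bar>x\<bar> > 1" | "\<bar>x\<bar> = 1" by linarith
  then show ?thesis
  proof cases
    case 1
    define q where "q = 1 - x\<^sup>2"
    have q: "q > 0" using 1 abs_square_less_1[of x] by (simp add: q_def)
    let ?P = "poly (bump_poly n) x" and ?P' = "poly (pderiv (bump_poly n)) x"
    have "((\<lambda>x. poly (bump_poly n) x / (1 - x\<^sup>2) ^ (2 * n) * exp (- 1 / (1 - x\<^sup>2))) has_field_derivative
       (?P' * q ^ (2*n) + ?P * (real (2 * n) * q ^ (2 * n - 1) * (2 * x))) / (q ^ (2 * n) * q ^ (2 * n)) * exp (- 1 / q)
       + ?P / q ^ (2 * n) * (exp (- 1 / q) * (- 2 * x / q\<^sup>2))) (at x)"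
    proof -
      have A: "(poly (bump_poly n) has_field_derivative ?P') (at x)" by (rule poly_DERIV)
      have B0: "((\<lambda>x. 1 - x\<^sup>2) has_field_derivative - (2 * x)) (at x)"
        by (auto intro!: derivative_eq_intros)
      have B: "((\<lambda>x. (1 - x\<^sup>2) ^ (2 * n)) has_field_derivative real (2 * n) * (- (2 * x) * q ^ (2 * n - 1))) (at x)"
        using DERIV_power[OF B0, of "2 * n"] by (simp add: q_def)
      have "((\<lambda>x. - 1 / (1 - x\<^sup>2)) has_field_derivative (- 2 * x) / q\<^sup>2) (at x)"
        using q by (auto intro!: derivative_eq_intros B0 simp: q_def power2_eq_square)
      then have C: "((\<lambda>x. exp (- 1 / (1 - x\<^sup>2))) has_field_derivative exp (- 1 / q) * (- 2 * x / q\<^sup>2)) (at x)"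
        using DERIV_chain2[OF DERIV_exp] by (fastforce simp: q_def)
      have q0: "(1 - x\<^sup>2) ^ (2 * n) \<noteq> 0" using q by (simp add: q_def)
      show ?thesis
        by (rule DERIV_cong[OF DERIV_mult[OF DERIV_divide[OF A B q0] C]])
           (unfold q_def[symmetric], simp add: algebra_simps)
    qed
    moreover have "(?P' * q ^ (2*n) + ?P * (real (2 * n) * q ^ (2 * n - 1) * (2 * x))) / (q ^ (2 * n) * q ^ (2 * n)) * exp (- 1 / q)
       + ?P / q ^ (2 * n) * (exp (- 1 / q) * (- 2 * x / q\<^sup>2))
      = (?P' * q\<^sup>2 + (4 * real n * (x * q) - 2 * x) * ?P) / q ^ (2 * n + 2) * exp (- 1 / q)"
    proof (cases n)
      case 0
      then show ?thesis using q by (simp add: field_simps power2_eq_square)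
    next
      case (Suc k)
      have "q ^ (2 * n - 1) * q = q ^ (2 * n)" using Suc by (simp add: power_Suc2[symmetric])
      then have *: "q ^ (2 * n - 1) = q ^ (2 * n) / q" using q by (simp add: field_simps)
      show ?thesis unfolding * using q by (simp add: field_simps power2_eq_square power_add)
    qed
    moreover have "(?P' * q\<^sup>2 + (4 * real n * (x * q) - 2 * x) * ?P) / q ^ (2 * n + 2) * exp (- 1 / q) = bump (Suc n) x"
    proof -
      have "poly [:1, 0, -1:] x = q" by (simp add: q_def power2_eq_square)
      then have "poly (bump_poly (Suc n)) x = ?P' * q\<^sup>2 + (4 * real n * (x * q) - 2 * x) * ?P"
        unfolding bump_poly.simps poly_add poly_mult poly_power poly_diff poly_smult by simp
      then show ?thesis using 1 unfolding bump_def q_def[symmetric] by simp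
    qed
    ultimately have "((\<lambda>x. poly (bump_poly n) x / (1 - x\<^sup>2) ^ (2 * n) * exp (- 1 / (1 - x\<^sup>2))) has_field_derivative bump (Suc n) x) (at x)"
      by simp
    then show ?thesis
      by (rule has_field_derivative_transform_within_open[where S = "{-1<..<1}"])
         (use 1 in \<open>auto simp: bump_def abs_less_iff\<close>)
  next
    case 2
    have "((\<lambda>x. 0) has_field_derivative bump (Suc n) x) (at x)" using 2 by (simp add: bump_def)
    then show ?thesis
      by (rule has_field_derivative_transform_within_open[where S = "- {-1..1}"])
         (use 2 in \<open>auto simp: bump_def\<close>)
  next
    \<comment> \<open>At the edge of the support the difference quotient is \<open>O(h)\<close>: the
      bound is quadratic in \<open>1 - (x + h)\<^sup>2\<close>, which is at most
      \<open>2 * \<bar>h\<bar>\<close> in absolute value as long as \<open>x + h\<close> is inside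
      the support.\<close>
    case 3
    obtain C where C: "C \<ge> 0" "\<And>x. \<bar>x\<bar> \<le> 1 \<Longrightarrow> \<bar>bump n x\<bar> \<le> C * (1 - x\<^sup>2)\<^sup>2"
      using bump_bound by blast
    have b: "\<bar>bump n (x + h)\<bar> \<le> 4 * C * h\<^sup>2" for h
    proof (cases "\<bar>x + h\<bar> < 1")
      case True
      have "\<bar>1 - (x + h)\<^sup>2\<bar> = \<bar>h\<bar> * \<bar>2 * x + h\<bar>"
      proof -
        have "x * x = 1" using 3 by (metis abs_mult_self_eq mult_1)
        then have "1 - (x + h)\<^sup>2 = - (h * (2 * x + h))" by (simp add: power2_eq_square algebra_simps)
        then show ?thesis by (simp add: abs_mult)
      qed
      moreover have "\<bar>2 * x + h\<bar> \<le> 2" using True 3 by linarith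
      ultimately have "\<bar>1 - (x + h)\<^sup>2\<bar> \<le> 2 * \<bar>h\<bar>"
        by (metis abs_ge_zero mult.commute mult_right_mono)
      then have "(1 - (x + h)\<^sup>2)\<^sup>2 \<le> (2 * \<bar>h\<bar>)\<^sup>2"
        by (metis abs_ge_zero power2_abs power_mono)
      then have "C * (1 - (x + h)\<^sup>2)\<^sup>2 \<le> C * (4 * h\<^sup>2)"
        using C(1) by (intro mult_left_mono) (auto simp: power_mult_distrib)
      then show ?thesis using C(2)[of "x + h"] True by simp
    qed (use C in \<open>simp add: bump_def\<close>)
    have 0: "bump n x = 0" "bump (Suc n) x = 0" using 3 by (auto simp: bump_def)
    have "(\<lambda>h. bump n (x + h) / h) \<midarrow>0\<rightarrow> 0"
    proof (rule Lim_null_comparison)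
      show "\<forall>\<^sub>F h in at 0. norm (bump n (x + h) / h) \<le> 4 * C * \<bar>h\<bar>"
      proof (rule eventually_at_topological[THEN iffD2], intro exI[of _ UNIV] conjI ballI impI)
        fix h :: real assume "h \<noteq> 0"
        then show "norm (bump n (x + h) / h) \<le> 4 * C * \<bar>h\<bar>"
          using b[of h] by (simp add: field_simps power2_eq_square)
      qed auto
      show "((\<lambda>h. 4 * C * \<bar>h\<bar>) \<longlongrightarrow> 0) (at 0)"
        by (auto intro!: tendsto_eq_intros)
    qed
    then show ?thesis using 0 by (simp add: DERIV_def)
  qed
qed

lemma continuous_bump [continuous_intros]: "continuous_on S f \<Longrightarrow> continuous_on S (\<lambda>x. bump n (f x))"
  by (rule continuous_on_compose2[where g = "bump n" and t = UNIV])
     (auto intro!: continuous_at_imp_continuous_on DERIV_isCont DERIV_bump)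

lemma bump_eq_0: "\<bar>x\<bar> \<ge> 1 \<Longrightarrow> bump n x = 0"
  by (simp add: bump_def)

lemma bump_0_nonneg: "0 \<le> bump 0 x" and bump_0_0: "bump 0 0 > 0" and bump_0_even: "bump 0 (- x) = bump 0 x"
  by (simp_all add: bump_def)

text \<open>The derivative of order \<open>i\<close> in \<open>x\<close> and \<open>j\<close> in \<open>t\<close> of \<open>bump 0 ((x - y) / r) * bump 0 ((t - s) / r)\<close>.\<close>

definition mol :: "nat \<Rightarrow> nat \<Rightarrow> real \<Rightarrow> real \<Rightarrow> real \<Rightarrow> real \<Rightarrow> real \<Rightarrow> real" where
  "mol i j r x t y s = bump i ((x - y) / r) * bump j ((t - s) / r) / r ^ (i + j)"

lemma DERIV_mol:
  assumes "r \<noteq> 0"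
  shows "((\<lambda>x. mol i j r x t y s) has_field_derivative mol (Suc i) j r x t y s) (at x)"
    "((\<lambda>t. mol i j r x t y s) has_field_derivative mol i (Suc j) r x t y s) (at t)"
    "((\<lambda>y. mol i j r x t y s) has_field_derivative - mol (Suc i) j r x t y s) (at y)"
    "((\<lambda>s. mol i j r x t y s) has_field_derivative - mol i (Suc j) r x t y s) (at s)"
proof -
  have b: "((\<lambda>x. bump n (f x)) has_field_derivative bump (Suc n) (f x) * f') (at x)"
    if "(f has_field_derivative f') (at x)" for n f f' x
    by (rule DERIV_chain2[OF DERIV_bump that])
  show "((\<lambda>x. mol i j r x t y s) has_field_derivative mol (Suc i) j r x t y s) (at x)"
    "((\<lambda>t. mol i j r x t y s) has_field_derivative mol i (Suc j) r x t y s) (at t)"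
    "((\<lambda>y. mol i j r x t y s) has_field_derivative - mol (Suc i) j r x t y s) (at y)"
    "((\<lambda>s. mol i j r x t y s) has_field_derivative - mol i (Suc j) r x t y s) (at s)"
    unfolding mol_def
    by (rule derivative_eq_intros b refl assms | use assms in \<open>simp add: field_simps; fail\<close>)+
qed

lemma continuous_mol [continuous_intros]:
  assumes "continuous_on S f" "continuous_on S g" "continuous_on S h" "continuous_on S k"
  shows "continuous_on S (\<lambda>z. mol i j r (f z) (g z) (h z) (k z))"
  unfolding mol_def divide_inverse by (intro continuous_intros assms)

lemma mol_eq_0:
  assumes "r > 0" "(y, s) \<notin> sqbox x t r \<or> \<bar>y - x\<bar> = r \<or> \<bar>s - t\<bar> = r"
  shows "mol i j r x t y s = 0"
proof -
  have "\<bar>(x - y) / r\<bar> \<ge> 1 \<or> \<bar>(t - s) / r\<bar> \<ge> 1"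
    using assms unfolding mem_sqbox by (auto simp: abs_minus_commute)
  then show ?thesis unfolding mol_def using bump_eq_0 by auto
qed

text \<open>Testing against rescaled translates of one bump is enough for Weyl's lemma. In the
  integration variables \<open>(y, s)\<close> the bump \<open>\<phi>\<close> has
  \<open>\<phi>_s = - mol 0 1\<close> and \<open>\<phi>_yy = mol 2 0\<close>, so the integrand is
  \<open>u (- \<phi>_s - \<phi>_yy)\<close>, the same expression as in
  \<open>heat_with_dirac_sources\<close>.\<close>

definition weakly_caloric_on :: "(real \<times> real) set \<Rightarrow> (real \<Rightarrow> real \<Rightarrow> real) \<Rightarrow> bool" where
  "weakly_caloric_on U u \<longleftrightarrow> (\<forall>x t r. 0 < r \<longrightarrow> sqbox x t r \<subseteq> U \<longrightarrow>
     integral (sqbox x t r) (\<lambda>(y, s). u y s * (mol 0 1 r x t y s - mol 2 0 r x t y s)) = 0)"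

text \<open>The domain of integration is a fixed set \<open>Q\<close> and not the support of the
  kernel, so that differentiating in \<open>(x, t)\<close> never touches the domain.\<close>

definition mollify :: "(real \<times> real) set \<Rightarrow> (real \<Rightarrow> real \<Rightarrow> real) \<Rightarrow> nat \<Rightarrow> nat \<Rightarrow> real \<Rightarrow> real \<Rightarrow> real \<Rightarrow> real" where
  "mollify Q u i j r x t = integral Q (\<lambda>z. u (fst z) (snd z) * mol i j r x t (fst z) (snd z))"

context
  fixes a b :: "real \<times> real" and u :: "real \<Rightarrow> real \<Rightarrow> real"
  assumes u: "continuous_on (cbox a b) (\<lambda>(x, t). u x t)"
begin

lemma u_cont: "continuous_on (cbox a b) (\<lambda>z. u (fst z) (snd z))"
  using u by (simp add: case_prod_unfold)

lemma integrand_cont: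
  assumes "continuous_on (V \<times> cbox a b) f" "continuous_on (V \<times> cbox a b) g"
  shows "continuous_on (V \<times> cbox a b) (\<lambda>w. u (fst (snd w)) (snd (snd w)) * mol i j r (f w) (g w) (fst (snd w)) (snd (snd w)))"
proof -
  have "continuous_on (V \<times> cbox a b) (\<lambda>w. u (fst (snd w)) (snd (snd w)))"
    by (rule continuous_on_compose2[OF u_cont]) (auto intro!: continuous_intros)
  then show ?thesis by (intro continuous_intros assms)
qed

lemma mol_integrable:
  "(\<lambda>z. u (fst z) (snd z) * mol i j r x t (fst z) (snd z)) integrable_on cbox a b"
  by (intro integrable_continuous continuous_intros u_cont)

lemma DERIV_mollify:
  assumes "r \<noteq> 0"
  shows "((\<lambda>x. mollify (cbox a b) u i j r x t) has_field_derivative mollify (cbox a b) u (Suc i) j r x t) (at x)"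
    "((\<lambda>t. mollify (cbox a b) u i j r x t) has_field_derivative mollify (cbox a b) u i (Suc j) r x t) (at t)"
proof -
  show "((\<lambda>x. mollify (cbox a b) u i j r x t) has_field_derivative mollify (cbox a b) u (Suc i) j r x t) (at x)"
    unfolding mollify_def
  proof (rule leibniz_rule_field_derivative[where U = UNIV and fx = "\<lambda>x z. u (fst z) (snd z) * mol (Suc i) j r x t (fst z) (snd z)"])
    show "continuous_on (UNIV \<times> cbox a b) (\<lambda>(x, z). u (fst z) (snd z) * mol (Suc i) j r x t (fst z) (snd z))"
      using integrand_cont[of UNIV fst "\<lambda>_. t" "Suc i" j r] by (simp add: case_prod_unfold continuous_intros)
  qed (auto intro!: DERIV_cmult DERIV_mol assms mol_integrable)
  show "((\<lambda>t. mollify (cbox a b) u i j r x t) has_field_derivative mollify (cbox a b) u i (Suc j) r x t) (at t)"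
    unfolding mollify_def
  proof (rule leibniz_rule_field_derivative[where U = UNIV and fx = "\<lambda>t z. u (fst z) (snd z) * mol i (Suc j) r x t (fst z) (snd z)"])
    show "continuous_on (UNIV \<times> cbox a b) (\<lambda>(t, z). u (fst z) (snd z) * mol i (Suc j) r x t (fst z) (snd z))"
      using integrand_cont[of UNIV "\<lambda>_. x" fst i "Suc j" r] by (simp add: case_prod_unfold continuous_intros)
  qed (auto intro!: DERIV_cmult DERIV_mol assms mol_integrable)
qed

lemma continuous_mollify: "continuous_on UNIV (\<lambda>(x, t). mollify (cbox a b) u i j r x t)"
proof -
  have "continuous_on (UNIV \<times> cbox a b) (\<lambda>(w, z). u (fst z) (snd z) * mol i j r (fst w) (snd w) (fst z) (snd z))"
    using integrand_cont[of UNIV "\<lambda>w. fst (fst w)" "\<lambda>w. snd (fst w)" i j r]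
    by (simp add: case_prod_unfold continuous_intros)
  from integral_continuous_on_param[OF this] show ?thesis
    by (simp add: mollify_def case_prod_unfold)
qed

lemma integral_mol_superset:
  assumes "r > 0" "sqbox x t r \<subseteq> cbox a b"
  shows "integral (cbox a b) (\<lambda>z. u (fst z) (snd z) * mol i j r x t (fst z) (snd z)) =
    integral (sqbox x t r) (\<lambda>z. u (fst z) (snd z) * mol i j r x t (fst z) (snd z))"
proof -
  have "((\<lambda>z. u (fst z) (snd z) * mol i j r x t (fst z) (snd z)) has_integral
      integral (sqbox x t r) (\<lambda>z. u (fst z) (snd z) * mol i j r x t (fst z) (snd z))) (sqbox x t r)"
    using integrable_on_subcbox[OF mol_integrable assms(2)] by (rule integrable_integral)
  then have "((\<lambda>z. u (fst z) (snd z) * mol i j r x t (fst z) (snd z)) has_integral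
      integral (sqbox x t r) (\<lambda>z. u (fst z) (snd z) * mol i j r x t (fst z) (snd z))) (cbox a b)"
  proof (rule has_integral_on_superset)
    fix z assume "z \<notin> sqbox x t r"
    then show "u (fst z) (snd z) * mol i j r x t (fst z) (snd z) = 0"
      using mol_eq_0[OF assms(1), of "fst z" "snd z" x t] by simp
  qed (use assms in auto)
  then show ?thesis by (rule integral_unique)
qed

end


lemma open_contains_sqbox:
  assumes "open U" "(x, t) \<in> U"
  obtains R where "R > 0" "sqbox x t R \<subseteq> U"
proof -
  obtain e where e: "e > 0" "ball (x, t) e \<subseteq> U" using assms open_contains_ball by blast
  have "sqbox x t (e / 3) \<subseteq> ball (x, t) e"
  proof
    fix z assume "z \<in> sqbox x t (e / 3)"
    moreover obtain y s where z: "z = (y, s)" by (cases z)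
    ultimately have "\<bar>y - x\<bar> \<le> e / 3" "\<bar>s - t\<bar> \<le> e / 3" unfolding z mem_sqbox by auto
    moreover have "dist (x, t) z \<le> \<bar>x - y\<bar> + \<bar>t - s\<bar>"
      unfolding z dist_Pair_Pair dist_real_def using sqrt_sum_squares_le_sum_abs by (metis power2_abs)
    ultimately show "z \<in> ball (x, t) e" using e(1) unfolding mem_ball by linarith
  qed
  with e show ?thesis by (intro that[of "e / 3"]) auto
qed

lemma integral_mol_pos:
  assumes "r > 0"
  shows "integral (sqbox x t r) (\<lambda>z. mol 0 0 r x t (fst z) (snd z)) > 0"
proof -
  let ?f = "\<lambda>z. mol 0 0 r x t (fst z) (snd z)"
  have c: "continuous_on (sqbox x t r) ?f" by (intro continuous_intros)
  have nn: "?f z \<ge> 0" for z by (simp add: mol_def bump_0_nonneg)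
  have "integral (sqbox x t r) ?f \<noteq> 0"
  proof
    assume "integral (sqbox x t r) ?f = 0"
    then have "(?f has_integral 0) (sqbox x t r)"
      using integrable_continuous[OF c] by (simp add: has_integral_integrable_integral)
    from has_integral_0_cbox_imp_0[OF c nn this, of "(x, t)"] assms have "?f (x, t) = 0"
      by (auto simp: box_ne_empty Basis_prod_def)
    then show False using bump_0_0 by (simp add: mol_def)
  qed
  moreover have "integral (sqbox x t r) ?f \<ge> 0"
    using nn by (intro Henstock_Kurzweil_Integration.integral_nonneg integrable_continuous c)
  ultimately show ?thesis by linarith
qed

lemma integral_mol_translate:
  "integral (sqbox x t r) (\<lambda>z. mol 0 0 r x t (fst z) (snd z)) = integral (sqbox 0 0 r) (\<lambda>z. mol 0 0 r 0 0 (fst z) (snd z))"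
proof -
  have "integral (cbox ((x - r, t - r) - (x, t)) ((x + r, t + r) - (x, t))) (\<lambda>z. mol 0 0 r x t (fst (z + (x, t))) (snd (z + (x, t))))
      = integral (sqbox x t r) (\<lambda>z. mol 0 0 r x t (fst z) (snd z))"
    by (rule integral_shift_cbox)
  moreover have "mol 0 0 r x t (fst (z + (x, t))) (snd (z + (x, t))) = mol 0 0 r 0 0 (fst z) (snd z)" for z
    by (simp add: mol_def)
  ultimately show ?thesis by simp
qed

text \<open>The weak equation on the square around \<open>(x, t)\<close> says that the time
  derivative of the mollified function equals its second space derivative at \<open>(x, t)\<close>.
  So the mollifications are smooth caloric functions; they converge uniformly to \<open>u\<close>,
  and \<open>caloric_limit\<close> applies.\<close>

theorem weakly_caloric_imp_caloric:
  assumes U: "open U" and u: "continuous_on U (\<lambda>(x, t). u x t)" and weak: "weakly_caloric_on U u"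
  shows "caloric_on U u"
proof (rule caloric_on_local)
  fix x0 t0 assume "(x0, t0) \<in> U"
  then obtain R' where R': "R' > 0" "sqbox x0 t0 R' \<subseteq> U" using open_contains_sqbox[OF U] by blast
  define R where "R = R' / 2"
  have R: "R > 0" and QU: "sqbox x0 t0 (2 * R) \<subseteq> U" using R' by (auto simp: R_def)
  let ?Q = "sqbox x0 t0 (2 * R)"
  have uQ: "continuous_on ?Q (\<lambda>(x, t). u x t)" using u QU by (rule continuous_on_subset)
  define r where "r = (\<lambda>n::nat. R / (2 * (real n + 1)))"
  have r: "r n > 0" "r n \<le> R / 2" for n using R by (auto simp: r_def field_simps)
  have "r = (\<lambda>n. R / 2 * inverse (real (Suc n)))" by (auto simp: r_def fun_eq_iff field_simps)
  then have r0: "r \<longlonglongrightarrow> 0"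
    using tendsto_mult_right_zero[OF LIMSEQ_inverse_real_of_nat, of "R / 2"] by simp
  define c where "c = (\<lambda>n. integral (sqbox 0 0 (r n)) (\<lambda>z. mol 0 0 (r n) 0 0 (fst z) (snd z)))"
  have c: "c n > 0" for n unfolding c_def by (rule integral_mol_pos[OF r(1)])
  have sub: "sqbox x t (r n) \<subseteq> ?Q" if "\<bar>x - x0\<bar> \<le> 3 * R / 2" "\<bar>t - t0\<bar> \<le> 3 * R / 2" for x t n
  proof
    fix z assume z: "z \<in> sqbox x t (r n)"
    show "z \<in> ?Q" using z that r[of n] unfolding mem_sqbox[of "fst z" "snd z", unfolded prod.collapse]
      by linarith
  qed
  let ?m = "mollify ?Q u"
  let ?O = "{x0 - 3 * R / 2<..<x0 + 3 * R / 2}" and ?T = "{t0 - 3 * R / 2<..<t0 + 3 * R / 2}"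
  \<comment> \<open>The case \<open>k = 0\<close> is the weak equation; higher \<open>k\<close>
    follow by differentiating the identity in \<open>x\<close>, which is possible because it holds
    on the open interval \<open>?O\<close>.\<close>
  have heat: "?m k 1 (r n) x t = ?m (k + 2) 0 (r n) x t" if "x \<in> ?O" "t \<in> ?T" for k n x t
    using that
  proof (induction k arbitrary: x t)
    case 0
    let ?g = "\<lambda>i j z. u (fst z) (snd z) * mol i j (r n) x t (fst z) (snd z)"
    have s: "sqbox x t (r n) \<subseteq> ?Q" using 0 unfolding greaterThanLessThan_iff by (intro sub) linarith+
    have "integral (sqbox x t (r n)) (\<lambda>z. ?g 0 1 z - ?g 2 0 z) = 0"
      using weak[unfolded weakly_caloric_on_def, rule_format, OF r(1) order_trans[OF s QU]]
      by (simp add: case_prod_unfold right_diff_distrib)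
    moreover have "?g i j integrable_on sqbox x t (r n)" for i j
      using mol_integrable[OF continuous_on_subset[OF uQ s]] .
    ultimately have "integral (sqbox x t (r n)) (?g 0 1) = integral (sqbox x t (r n)) (?g 2 0)"
      by (simp add: Henstock_Kurzweil_Integration.integral_diff)
    then show ?case
      unfolding mollify_def integral_mol_superset[OF uQ r(1) s] by (simp add: numeral_2_eq_2)
  next
    case (Suc k)
    have "((\<lambda>x. ?m k 1 (r n) x t) has_field_derivative ?m (Suc k) 1 (r n) x t) (at x)"
      by (rule DERIV_mollify(1)[OF uQ]) (use r(1)[of n] in simp)
    moreover have "((\<lambda>x. ?m (k + 2) 0 (r n) x t) has_field_derivative ?m (Suc (k + 2)) 0 (r n) x t) (at x)"
      by (rule DERIV_mollify(1)[OF uQ]) (use r(1)[of n] in simp)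
    then have "((\<lambda>x. ?m k 1 (r n) x t) has_field_derivative ?m (Suc (k + 2)) 0 (r n) x t) (at x)"
      by (rule has_field_derivative_transform_within_open[where S = ?O]) (use Suc in auto)
    ultimately show ?case using DERIV_unique by (metis add_Suc)
  qed
  have inO: "x \<in> ?O" "t \<in> ?T" if "(x, t) \<in> sqbox x0 t0 R" for x t
    using that R unfolding mem_sqbox greaterThanLessThan_iff by linarith+
  \<comment> \<open>\<open>c n\<close> is the mass of the kernel, the same for all centres by
    translation.\<close>
  define d where "d = (\<lambda>n k x t. ?m k 0 (r n) x t / c n)"
  have "caloric_on (box (x0 - R/2, t0 - R/2) (x0 + R/2, t0 + R/2)) u"
  proof (rule caloric_limit[where d = d, OF R])
    fix n k
    show "continuous_on (sqbox x0 t0 R) (\<lambda>(x, t). d n k x t)"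
      using continuous_on_subset[OF continuous_mollify[OF uQ, of k 0 "r n"], of "sqbox x0 t0 R"] c[of n]
      by (auto simp: d_def case_prod_unfold intro!: continuous_intros)
    fix x t assume xt: "(x, t) \<in> sqbox x0 t0 R"
    have rn: "r n \<noteq> 0" using r(1)[of n] by simp
    show "((\<lambda>y. d n k y t) has_real_derivative d n (Suc k) x t) (at x)"
      unfolding d_def by (intro DERIV_cdivide DERIV_mollify[OF uQ rn])
    have "((\<lambda>s. d n k x s) has_real_derivative ?m k 1 (r n) x t / c n) (at t)"
      unfolding d_def using DERIV_mollify(2)[OF uQ rn, of k 0] by (intro DERIV_cdivide) simp
    then show "((\<lambda>s. d n k x s) has_real_derivative d n (Suc (Suc k)) x t) (at t)"
      using heat[OF inO[OF xt]] by (simp add: d_def)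
  next
    show "uniform_limit (sqbox x0 t0 R) (\<lambda>n (x, t). d n 0 x t) (\<lambda>(x, t). u x t) sequentially"
      unfolding uniform_limit_iff
    proof (intro allI impI)
      fix e :: real assume e: "e > 0"
      have "uniformly_continuous_on ?Q (\<lambda>(x, t). u x t)"
        by (rule compact_uniformly_continuous[OF uQ compact_cbox])
      then obtain \<delta> where \<delta>: "\<delta> > 0" "\<And>z z'. z \<in> ?Q \<Longrightarrow> z' \<in> ?Q \<Longrightarrow> dist z' z < \<delta> \<Longrightarrow>
          dist ((\<lambda>(x, t). u x t) z') ((\<lambda>(x, t). u x t) z) < e / 2"
        unfolding uniformly_continuous_on_def using e by (metis half_gt_zero)
      have "\<forall>\<^sub>F n in sequentially. r n < \<delta> / 2" using r0 \<delta>(1) by (intro order_tendstoD) auto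
      then show "\<forall>\<^sub>F n in sequentially. \<forall>z\<in>sqbox x0 t0 R. dist ((\<lambda>(x, t). d n 0 x t) z) ((\<lambda>(x, t). u x t) z) < e"
      proof eventually_elim
        case (elim n)
        show ?case
        proof
          fix z assume z: "z \<in> sqbox x0 t0 R"
          obtain x t where xt: "z = (x, t)" by (cases z)
          have s: "sqbox x t (r n) \<subseteq> ?Q"
            using z R unfolding xt mem_sqbox by (intro sub) linarith+
          have zQ: "(x, t) \<in> ?Q" using z R unfolding xt mem_sqbox by linarith
          let ?M = "\<lambda>w. mol 0 0 (r n) x t (fst w) (snd w)"
          let ?u = "\<lambda>w. u (fst w) (snd w)"
          have cu: "continuous_on (sqbox x t (r n)) ?u"
            using continuous_on_subset[OF uQ s] by (simp add: case_prod_unfold)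
          have cM: "continuous_on (sqbox x t (r n)) ?M" by (intro continuous_intros)
          have IM: "integral (sqbox x t (r n)) ?M = c n" unfolding c_def by (rule integral_mol_translate)
          have "d n 0 x t * c n = integral (sqbox x t (r n)) (\<lambda>w. ?u w * ?M w)"
            using c[of n] by (simp add: d_def mollify_def integral_mol_superset[OF uQ r(1) s])
          moreover have "integral (sqbox x t (r n)) (\<lambda>w. u x t * ?M w) = u x t * c n"
            by (simp only: Henstock_Kurzweil_Integration.integral_mult_right IM)
          ultimately have "(d n 0 x t - u x t) * c n = integral (sqbox x t (r n)) (\<lambda>w. ?u w * ?M w - u x t * ?M w)"
            by (subst Henstock_Kurzweil_Integration.integral_diff) (auto intro!: integrable_continuous continuous_intros cu simp: left_diff_distrib)
          moreover have "norm (integral (sqbox x t (r n)) (\<lambda>w. ?u w * ?M w - u x t * ?M w))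
              \<le> integral (sqbox x t (r n)) (\<lambda>w. e / 2 * ?M w)"
          proof (rule Henstock_Kurzweil_Integration.integral_norm_bound_integral)
            fix w assume w: "w \<in> sqbox x t (r n)"
            have "dist w (x, t) \<le> \<bar>fst w - x\<bar> + \<bar>snd w - t\<bar>"
              unfolding dist_prod_def dist_real_def fst_conv snd_conv
              using sqrt_sum_squares_le_sum_abs by (metis power2_abs)
            moreover have "\<bar>fst w - x\<bar> \<le> r n" "\<bar>snd w - t\<bar> \<le> r n"
              using w mem_sqbox[of "fst w" "snd w"] by auto
            ultimately have "dist w (x, t) < \<delta>" using elim by linarith
            from \<delta>(2)[OF zQ subsetD[OF s w] this] have "\<bar>?u w - u x t\<bar> \<le> e / 2"
              by (simp add: dist_real_def case_prod_unfold)
            moreover have "?M w \<ge> 0" by (simp add: mol_def bump_0_nonneg)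
            ultimately have "\<bar>?u w - u x t\<bar> * ?M w \<le> e / 2 * ?M w" by (rule mult_right_mono)
            then show "norm (?u w * ?M w - u x t * ?M w) \<le> e / 2 * ?M w"
              using \<open>?M w \<ge> 0\<close> by (simp add: abs_mult left_diff_distrib[symmetric])
          qed (auto intro!: integrable_continuous continuous_intros cu)
          moreover have "integral (sqbox x t (r n)) (\<lambda>w. e / 2 * ?M w) = e / 2 * c n"
            by (simp only: Henstock_Kurzweil_Integration.integral_mult_right IM)
          ultimately have "\<bar>d n 0 x t - u x t\<bar> * c n \<le> e / 2 * c n"
            using c[of n] by (metis abs_mult abs_of_pos real_norm_def)
          then have "\<bar>d n 0 x t - u x t\<bar> \<le> e / 2" using c[of n] by simp
          then show "dist ((\<lambda>(x, t). d n 0 x t) z) ((\<lambda>(x, t). u x t) z) < e"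
            using e by (simp add: xt dist_real_def)
        qed
      qed
    qed
  qed
  moreover have "(x0, t0) \<in> box (x0 - R/2, t0 - R/2) (x0 + R/2, t0 + R/2)"
    using R by (auto simp: mem_box Basis_prod_def)
  ultimately show "\<exists>V. open V \<and> (x0, t0) \<in> V \<and> caloric_on V u"
    by (intro exI[of _ "box (x0 - R/2, t0 - R/2) (x0 + R/2, t0 + R/2)"]) (auto intro: open_box)
qed

text \<open>Makes the mollifier admissible in the distributional equation. Derivatives are taken in
  the second pair of arguments here, whence the sign \<open>(- 1) ^ (i + j)\<close> in the witness
  \<open>D\<close>.\<close>

lemma test_function_mol:
  assumes r: "r > 0" and sub: "sqbox x t r \<subseteq> U"
  shows "test_function U (\<lambda>y s. mol 0 0 r x t y s)"
    and "Dt (\<lambda>y s. mol 0 0 r x t y s) y s = - mol 0 1 r x t y s"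
    and "Dx (Dx (\<lambda>y s. mol 0 0 r x t y s)) y s = mol 2 0 r x t y s"
proof -
  have rn: "r \<noteq> 0" using r by simp
  define D where "D = (\<lambda>i j y s. (- 1) ^ (i + j) * mol i j r x t y s)"
  have "((\<lambda>y. D i j y s) has_field_derivative D (Suc i) j y s) (at y)"
    "((\<lambda>s. D i j y s) has_field_derivative D i (Suc j) y s) (at s)" for i j y s
    unfolding D_def using DERIV_cmult[OF DERIV_mol(3)[OF rn], of "(-1) ^ (i + j)"]
      DERIV_cmult[OF DERIV_mol(4)[OF rn], of "(-1) ^ (i + j)"] by auto
  moreover have "continuous_on UNIV (\<lambda>(y, s). D i j y s)" for i j
    unfolding D_def case_prod_unfold by (intro continuous_intros)
  moreover have "D 0 0 = (\<lambda>y s. mol 0 0 r x t y s)" by (simp add: D_def)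
  ultimately have "\<exists>D. D 0 0 = (\<lambda>y s. mol 0 0 r x t y s) \<and>
        (\<forall>i j. continuous_on UNIV (\<lambda>(x, t). D i j x t) \<and>
           (\<forall>x t. ((\<lambda>y. D i j y t) has_field_derivative D (Suc i) j x t) (at x) \<and>
                  ((\<lambda>s. D i j x s) has_field_derivative D i (Suc j) x t) (at t)))"
    by (intro exI[of _ D]) auto
  moreover have "\<exists>K. compact K \<and> K \<subseteq> U \<and> (\<forall>y s. (y, s) \<notin> K \<longrightarrow> mol 0 0 r x t y s = 0)"
    using sub mol_eq_0[OF r] by (intro exI[of _ "sqbox x t r"]) auto
  ultimately show "test_function U (\<lambda>y s. mol 0 0 r x t y s)"
    unfolding test_function_def by blast
  show "Dt (\<lambda>y s. mol 0 0 r x t y s) y s = - mol 0 1 r x t y s"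
    unfolding Dt_def using DERIV_mol(4)[OF rn, of 0 0] by (auto intro!: DERIV_imp_deriv)
  have 1: "Dx (\<lambda>y s. mol 0 0 r x t y s) = (\<lambda>y s. - mol 1 0 r x t y s)"
    unfolding Dx_def using DERIV_mol(3)[OF rn, of 0 0] by (auto intro!: DERIV_imp_deriv ext)
  show "Dx (Dx (\<lambda>y s. mol 0 0 r x t y s)) y s = mol 2 0 r x t y s"
    unfolding 1 unfolding Dx_def using DERIV_minus[OF DERIV_mol(3)[OF rn, of 1 0]]
    by (auto intro!: DERIV_imp_deriv simp: numeral_2_eq_2)
qed

section \<open>Green's formula at the free boundary\<close>

lemma fst_snd_mem_sqbox: "z \<in> sqbox x t r \<longleftrightarrow> \<bar>fst z - x\<bar> \<le> r \<and> \<bar>snd z - t\<bar> \<le> r"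
  using mem_sqbox[of "fst z" "snd z"] by simp

lemma continuous_on_compact_bound:
  fixes f :: "'a::topological_space \<Rightarrow> real"
  assumes "compact K" "continuous_on K f"
  obtains M where "\<And>z. z \<in> K \<Longrightarrow> \<bar>f z\<bar> \<le> M"
  using compact_imp_bounded[OF compact_continuous_image[OF assms(2,1)]] unfolding bounded_iff by auto

text \<open>The integrand is \<open>B - A\<close>, where \<open>A\<close> is the time derivative of
  \<open>u \<phi>\<close> and \<open>B\<close> the space derivative of
  \<open>v \<phi> - u \<phi>_x\<close>. The first integrates to zero because \<open>\<phi>\<close>
  vanishes at \<open>t1\<close> and \<open>t2\<close>; the lateral terms are kept, since they are
  what has to match when two rectangles are glued.\<close>

lemma rectangle_green:
  fixes u v w \<phi> \<phi>x \<phi>xx \<phi>t :: "real \<Rightarrow> real \<Rightarrow> real"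
  defines "\<psi> \<equiv> \<lambda>x t. u x t * (- \<phi>t x t - \<phi>xx x t)"
  assumes ord: "x1 \<le> x2" "t1 \<le> t2"
    and cu: "continuous_on (cbox (x1, t1) (x2, t2)) (\<lambda>(x, t). u x t)"
    and cv: "continuous_on (cbox (x1, t1) (x2, t2)) (\<lambda>(x, t). v x t)"
    and cw: "continuous_on (cbox (x1, t1) (x2, t2)) (\<lambda>(x, t). w x t)"
    and du: "\<And>x t. (x, t) \<in> cbox (x1, t1) (x2, t2) \<Longrightarrow> ((\<lambda>y. u y t) has_field_derivative v x t) (at x)"
      "\<And>x t. (x, t) \<in> cbox (x1, t1) (x2, t2) \<Longrightarrow> ((\<lambda>y. v y t) has_field_derivative w x t) (at x)"
      "\<And>x t. (x, t) \<in> cbox (x1, t1) (x2, t2) \<Longrightarrow> ((\<lambda>s. u x s) has_field_derivative w x t) (at t)"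
    and c\<phi>: "continuous_on UNIV (\<lambda>(x, t). \<phi> x t)" "continuous_on UNIV (\<lambda>(x, t). \<phi>x x t)"
      "continuous_on UNIV (\<lambda>(x, t). \<phi>xx x t)" "continuous_on UNIV (\<lambda>(x, t). \<phi>t x t)"
    and d\<phi>: "\<And>x t. ((\<lambda>y. \<phi> y t) has_field_derivative \<phi>x x t) (at x)"
      "\<And>x t. ((\<lambda>y. \<phi>x y t) has_field_derivative \<phi>xx x t) (at x)"
      "\<And>x t. ((\<lambda>s. \<phi> x s) has_field_derivative \<phi>t x t) (at t)"
    and van: "\<And>x. \<phi> x t1 = 0" "\<And>x. \<phi> x t2 = 0"
  shows "integral (cbox x1 x2) (\<lambda>x. integral (cbox t1 t2) (\<psi> x)) =
    integral (cbox t1 t2) (\<lambda>t. v x2 t * \<phi> x2 t - u x2 t * \<phi>x x2 t) -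
    integral (cbox t1 t2) (\<lambda>t. v x1 t * \<phi> x1 t - u x1 t * \<phi>x x1 t)"
proof -
  let ?Q = "cbox (x1, t1) (x2, t2)"
  have mem: "(x, t) \<in> ?Q \<longleftrightarrow> x \<in> {x1..x2} \<and> t \<in> {t1..t2}" for x t by (auto simp: cbox_Pair_eq)
  note fs = case_prod_unfold
  have C: "continuous_on ?Q (\<lambda>z. u (fst z) (snd z))" "continuous_on ?Q (\<lambda>z. v (fst z) (snd z))"
    "continuous_on ?Q (\<lambda>z. w (fst z) (snd z))"
    "continuous_on ?Q (\<lambda>z. \<phi> (fst z) (snd z))" "continuous_on ?Q (\<lambda>z. \<phi>x (fst z) (snd z))"
    "continuous_on ?Q (\<lambda>z. \<phi>xx (fst z) (snd z))" "continuous_on ?Q (\<lambda>z. \<phi>t (fst z) (snd z))"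
    using cu cv cw c\<phi>[THEN continuous_on_subset, OF subset_UNIV] by (simp_all add: fs)
  define A where "A = (\<lambda>x t. w x t * \<phi> x t + u x t * \<phi>t x t)"
  define B where "B = (\<lambda>x t. w x t * \<phi> x t - u x t * \<phi>xx x t)"
  have cA: "continuous_on ?Q (\<lambda>(x, t). A x t)" and cB: "continuous_on ?Q (\<lambda>(x, t). B x t)"
    unfolding A_def B_def fs by (intro continuous_intros C)+
  have eq: "\<psi> x t = B x t - A x t" for x t by (simp add: \<psi>_def A_def B_def algebra_simps)
  have iA: "integral (cbox t1 t2) (A x) = 0" if "x \<in> {x1..x2}" for x
  proof -
    have "(A x has_integral u x t2 * \<phi> x t2 - u x t1 * \<phi> x t1) {t1..t2}"
    proof (rule fundamental_theorem_of_calculus)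
      fix t assume "t \<in> {t1..t2}"
      then have "(x, t) \<in> ?Q" using that mem by simp
      from du(3)[OF this] have "((\<lambda>s. u x s * \<phi> x s) has_field_derivative A x t) (at t)"
        unfolding A_def by (auto intro!: derivative_eq_intros d\<phi>(3))
      then show "((\<lambda>s. u x s * \<phi> x s) has_vector_derivative A x t) (at t within {t1..t2})"
        by (simp add: has_real_derivative_iff_has_vector_derivative has_vector_derivative_at_within)
    qed (use ord in auto)
    then show ?thesis by (simp add: van integral_unique)
  qed
  have iB: "integral (cbox x1 x2) (\<lambda>x. B x t) = (v x2 t * \<phi> x2 t - u x2 t * \<phi>x x2 t) - (v x1 t * \<phi> x1 t - u x1 t * \<phi>x x1 t)"
    if "t \<in> {t1..t2}" for t
  proof -
    have "((\<lambda>x. B x t) has_integral (v x2 t * \<phi> x2 t - u x2 t * \<phi>x x2 t) - (v x1 t * \<phi> x1 t - u x1 t * \<phi>x x1 t)) {x1..x2}"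
    proof (rule fundamental_theorem_of_calculus)
      fix x assume "x \<in> {x1..x2}"
      then have xt: "(x, t) \<in> ?Q" using that mem by simp
      have "((\<lambda>x. v x t * \<phi> x t - u x t * \<phi>x x t) has_field_derivative B x t) (at x)"
        unfolding B_def
        by (rule DERIV_cong[OF DERIV_diff[OF DERIV_mult[OF du(2)[OF xt] d\<phi>(1)] DERIV_mult[OF du(1)[OF xt] d\<phi>(2)]]])
           (simp add: algebra_simps)
      then show "((\<lambda>x. v x t * \<phi> x t - u x t * \<phi>x x t) has_vector_derivative B x t) (at x within {x1..x2})"
        by (simp add: has_real_derivative_iff_has_vector_derivative has_vector_derivative_at_within)
    qed (use ord in auto)
    then show ?thesis by (simp add: integral_unique)
  qed
  have slice: "continuous_on (cbox t1 t2) (\<lambda>t. f x t)" if "continuous_on ?Q (\<lambda>(x, t). f x t)" "x \<in> {x1..x2}"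
    for f :: "real \<Rightarrow> real \<Rightarrow> real" and x
  proof -
    have "continuous_on (cbox t1 t2) (\<lambda>t. (\<lambda>(x, t). f x t) (x, t))"
      by (rule continuous_on_compose2[OF that(1)]) (use that(2) mem in \<open>auto intro!: continuous_intros\<close>)
    then show ?thesis by simp
  qed
  have "integral (cbox x1 x2) (\<lambda>x. integral (cbox t1 t2) (\<psi> x)) = integral (cbox x1 x2) (\<lambda>x. integral (cbox t1 t2) (B x))"
  proof (rule Henstock_Kurzweil_Integration.integral_cong)
    fix x assume "x \<in> cbox x1 x2"
    then have x: "x \<in> {x1..x2}" by simp
    have "\<psi> x = (\<lambda>t. B x t - A x t)" using eq by auto
    then show "integral (cbox t1 t2) (\<psi> x) = integral (cbox t1 t2) (B x)"
      using iA[OF x] slice[OF cA x] slice[OF cB x]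
      by (simp add: Henstock_Kurzweil_Integration.integral_diff integrable_continuous_real)
  qed
  also have "\<dots> = integral (cbox t1 t2) (\<lambda>t. integral (cbox x1 x2) (\<lambda>x. B x t))"
    by (rule integral_swap_continuous[OF cB])
  also have "\<dots> = integral (cbox t1 t2) (\<lambda>t. (v x2 t * \<phi> x2 t - u x2 t * \<phi>x x2 t) - (v x1 t * \<phi> x1 t - u x1 t * \<phi>x x1 t))"
    by (rule Henstock_Kurzweil_Integration.integral_cong) (use iB in auto)
  also have "\<dots> = integral (cbox t1 t2) (\<lambda>t. v x2 t * \<phi> x2 t - u x2 t * \<phi>x x2 t) -
    integral (cbox t1 t2) (\<lambda>t. v x1 t * \<phi> x1 t - u x1 t * \<phi>x x1 t)"
  proof (rule Henstock_Kurzweil_Integration.integral_diff; rule integrable_continuous)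
    have "continuous_on ?Q (\<lambda>(x, t). v x t * \<phi> x t - u x t * \<phi>x x t)"
      unfolding fs by (intro continuous_intros C)
    from slice[OF this] show "continuous_on (cbox t1 t2) (\<lambda>t. v x2 t * \<phi> x2 t - u x2 t * \<phi>x x2 t)"
      "continuous_on (cbox t1 t2) (\<lambda>t. v x1 t * \<phi> x1 t - u x1 t * \<phi>x x1 t)" using ord by auto
  qed
  finally show ?thesis .
qed

text \<open>A vertical line is removable when \<open>u\<close> is continuous across it and
  \<open>u_x\<close> has the same limit from both sides. Green's formula on either side leaves the
  lateral integral \<open>B\<close>; its limit at \<open>\<xi>\<close> is the same from the left and
  from the right, so the two contributions cancel in the weak formulation. Nothing is assumed on how
  the limit of \<open>u_x\<close> depends on \<open>t\<close>; local boundedness permits dominated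
  convergence.\<close>

lemma caloric_on_glue_line:
  assumes U: "open U" and u: "continuous_on U (\<lambda>(x, t). u x t)"
    and cal: "caloric_on (U \<inter> {z. fst z \<noteq> \<xi>}) u"
    and bd: "\<And>K. compact K \<Longrightarrow> K \<subseteq> U \<Longrightarrow> bounded ((\<lambda>(x, t). Dx u x t) ` (K \<inter> {z. fst z \<noteq> \<xi>}))"
    and lim: "\<And>t. (\<xi>, t) \<in> U \<Longrightarrow> \<exists>c. ((\<lambda>x. Dx u x t) \<longlongrightarrow> c) (at \<xi>)"
  shows "caloric_on U u"
proof (rule weakly_caloric_imp_caloric[OF U u])
  show "weakly_caloric_on U u" unfolding weakly_caloric_on_def
  proof (intro allI impI)
    fix x t r :: real assume r: "0 < r" and sub: "sqbox x t r \<subseteq> U"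
    let ?Q = "sqbox x t r"
    let ?v = "Dx u" and ?w = "Dx (Dx u)"
    let ?\<phi> = "\<lambda>i j y s. mol i j r x t y s"
    have "U \<inter> {z. fst z \<noteq> \<xi>} = U \<inter> (fst -` (- {\<xi>}))" by auto
    then have oU: "open (U \<inter> {z. fst z \<noteq> \<xi>})"
      using U by (auto intro!: open_Int open_vimage continuous_intros)
    note D = caloric_onD[OF oU cal]
    define h where "h = (\<lambda>y. integral (cbox (t - r) (t + r)) (\<lambda>s. u y s * (?\<phi> 0 1 y s - ?\<phi> 2 0 y s)))"
    define B where "B = (\<lambda>y. integral (cbox (t - r) (t + r)) (\<lambda>s. ?v y s * ?\<phi> 0 0 y s - u y s * - ?\<phi> 1 0 y s))"
    have uQ: "continuous_on ?Q (\<lambda>z. u (fst z) (snd z))"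
      using continuous_on_subset[OF u sub] by (simp add: case_prod_unfold)
    have rn: "r \<noteq> 0" using r by simp
    have cont: "continuous_on ?Q (\<lambda>(y, s). u y s * (?\<phi> 0 1 y s - ?\<phi> 2 0 y s))"
      unfolding case_prod_unfold by (intro continuous_intros uQ)
    have tot: "integral ?Q (\<lambda>(y, s). u y s * (?\<phi> 0 1 y s - ?\<phi> 2 0 y s)) = integral {x - r..x + r} h"
      unfolding integral_prod_continuous[OF cont] h_def by simp
    have hint: "h integrable_on {x - r..x + r}"
    proof -
      have "continuous_on ({x - r..x + r} \<times> cbox (t - r) (t + r)) (\<lambda>(y, s). u y s * (?\<phi> 0 1 y s - ?\<phi> 2 0 y s))"
        using cont by (simp add: cbox_Pair_eq)
      from integral_continuous_on_param[OF this] show ?thesis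
        unfolding h_def by (intro integrable_continuous_real) simp
    qed
    have rect: "integral {y1..y2} h = B y2 - B y1"
      if y: "x - r \<le> y1" "y1 \<le> y2" "y2 \<le> x + r" "\<xi> \<notin> {y1..y2}" for y1 y2
    proof -
      let ?R = "cbox (y1, t - r) (y2, t + r)"
      have RU: "?R \<subseteq> U \<inter> {z. fst z \<noteq> \<xi>}" using sub y by (force simp: cbox_Pair_eq)
      have "integral (cbox y1 y2) (\<lambda>y. integral (cbox (t - r) (t + r)) (\<lambda>s. u y s * (- (- ?\<phi> 0 1 y s) - ?\<phi> 2 0 y s)))
        = B y2 - B y1"
        unfolding B_def
      proof (rule rectangle_green[where v = ?v and w = ?w and \<phi>t = "\<lambda>y s. - ?\<phi> 0 1 y s" and \<phi>xx = "?\<phi> 2 0" and \<phi>x = "\<lambda>y s. - ?\<phi> 1 0 y s"])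
        show "continuous_on ?R (\<lambda>(x, y). u x y)" "continuous_on ?R (\<lambda>(x, y). Dx u x y)" "continuous_on ?R (\<lambda>(x, y). Dx (Dx u) x y)"
          using D(1-3) RU by (meson continuous_on_subset)+
        show "((\<lambda>y. mol 0 0 r x t y s) has_real_derivative - mol 1 0 r x t y s) (at y)"
          "((\<lambda>y. - mol 1 0 r x t y s) has_real_derivative mol 2 0 r x t y s) (at y)"
          "((\<lambda>s. mol 0 0 r x t y s) has_real_derivative - mol 0 1 r x t y s) (at s)" for y s
          using DERIV_mol(3)[OF rn, of 0 0] DERIV_minus[OF DERIV_mol(3)[OF rn, of 1 0]] DERIV_mol(4)[OF rn, of 0 0]
          by (auto simp: numeral_2_eq_2)
        show "continuous_on UNIV (\<lambda>(y, s). mol 0 0 r x t y s)" "continuous_on UNIV (\<lambda>(y, s). - mol 1 0 r x t y s)"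
          "continuous_on UNIV (\<lambda>(y, s). mol 2 0 r x t y s)" "continuous_on UNIV (\<lambda>(y, s). - mol 0 1 r x t y s)"
          unfolding case_prod_unfold by (intro continuous_intros)+
        show "mol 0 0 r x t y (t - r) = 0" "mol 0 0 r x t y (t + r) = 0" for y
          using r by (auto intro!: mol_eq_0)
        show "((\<lambda>y. u y s) has_real_derivative Dx u y s) (at y)"
          "((\<lambda>y. Dx u y s) has_real_derivative Dx (Dx u) y s) (at y)"
          "((\<lambda>s. u y s) has_real_derivative Dx (Dx u) y s) (at s)" if "(y, s) \<in> ?R" for y s
          using D(4-6)[OF subsetD[OF RU that]] .
      qed (use y r in auto)
      then show ?thesis unfolding h_def by simp
    qed
    have Bends: "B (x - r) = 0" "B (x + r) = 0"
      using r by (auto simp: B_def mol_eq_0)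
    have "integral {x - r..x + r} h = 0"
    proof (cases "\<xi> \<in> {x - r..x + r}")
      case False
      then show ?thesis using rect[of "x - r" "x + r"] Bends r by simp
    next
      case True
      have tU: "(\<xi>, s) \<in> U" if "s \<in> {t - r..t + r}" for s
        using True that sub by (auto simp: cbox_Pair_eq)
      then obtain c where c: "\<And>s. s \<in> {t - r..t + r} \<Longrightarrow> ((\<lambda>x. Dx u x s) \<longlongrightarrow> c s) (at \<xi>)"
        using lim by metis
      define B' where "B' = integral (cbox (t - r) (t + r)) (\<lambda>s. c s * ?\<phi> 0 0 \<xi> s - u \<xi> s * - ?\<phi> 1 0 \<xi> s)"
      have "bounded ((\<lambda>(x, t). Dx u x t) ` (?Q \<inter> {z. fst z \<noteq> \<xi>}))" using sub by (intro bd) auto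
      then obtain V where V: "\<And>y s. (y, s) \<in> ?Q \<Longrightarrow> y \<noteq> \<xi> \<Longrightarrow> \<bar>Dx u y s\<bar> \<le> V"
        unfolding bounded_iff by fastforce
      have cm: "continuous_on ?Q (\<lambda>z. ?\<phi> i j (fst z) (snd z))" for i j by (intro continuous_intros)
      have "continuous_on ?Q (\<lambda>z. u (fst z) (snd z) * - ?\<phi> 1 0 (fst z) (snd z))"
        by (intro continuous_intros uQ)
      from continuous_on_compact_bound[OF compact_cbox this] obtain M
        where M: "\<And>z. z \<in> ?Q \<Longrightarrow> \<bar>u (fst z) (snd z) * - ?\<phi> 1 0 (fst z) (snd z)\<bar> \<le> M" by blast
      obtain P where P: "\<And>z. z \<in> ?Q \<Longrightarrow> \<bar>?\<phi> 0 0 (fst z) (snd z)\<bar> \<le> P"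
        using continuous_on_compact_bound[OF compact_cbox cm] by blast
      \<comment> \<open>Dominated convergence in \<open>s\<close>: \<open>V\<close> bounds
        \<open>u_x\<close>, \<open>P\<close> bounds the mollifier and \<open>M\<close> the term with
        its derivative, all uniformly up to the line.\<close>
      have Blim: "(\<lambda>n. B (y n)) \<longlonglongrightarrow> B'"
        if y: "\<And>n. y n \<in> {x - r..x + r}" "\<And>n. y n \<noteq> \<xi>" "y \<longlonglongrightarrow> \<xi>" for y
        unfolding B_def B'_def
      proof (rule dominated_convergence(2)[where h = "\<lambda>s. V * P + M"])
        fix n
        have "continuous_on (cbox (t - r) (t + r)) (\<lambda>s. (\<lambda>(y, s). Dx u y s) (y n, s))"
          by (rule continuous_on_compose2[OF D(2)])
             (use y(1,2)[of n] sub in \<open>auto intro!: continuous_intros simp: cbox_Pair_eq\<close>)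
        moreover have "continuous_on (cbox (t - r) (t + r)) (\<lambda>s. (\<lambda>z. u (fst z) (snd z)) (y n, s))"
          by (rule continuous_on_compose2[OF uQ])
             (use y(1,2)[of n] in \<open>auto intro!: continuous_intros simp: cbox_Pair_eq\<close>)
        ultimately show "(\<lambda>s. ?v (y n) s * ?\<phi> 0 0 (y n) s - u (y n) s * - ?\<phi> 1 0 (y n) s) integrable_on cbox (t - r) (t + r)"
          by (intro integrable_continuous continuous_intros) auto
        fix s assume "s \<in> cbox (t - r) (t + r)"
        then have s: "s \<in> {t - r..t + r}" by simp
        then have Q: "(y n, s) \<in> ?Q" using y(1)[of n] by (auto simp: cbox_Pair_eq)
        have "\<bar>?v (y n) s * ?\<phi> 0 0 (y n) s\<bar> \<le> V * P"
          unfolding abs_mult using V[OF Q y(2)] P[OF Q] unfolding fst_conv snd_conv by (intro mult_mono) auto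
        then show "norm (?v (y n) s * ?\<phi> 0 0 (y n) s - u (y n) s * - ?\<phi> 1 0 (y n) s) \<le> V * P + M"
          using M[OF Q] unfolding real_norm_def fst_conv snd_conv by linarith
      next
        fix s assume "s \<in> cbox (t - r) (t + r)"
        then have s: "s \<in> {t - r..t + r}" by simp
        have 1: "(\<lambda>n. ?v (y n) s) \<longlonglongrightarrow> c s"
          using y(2,3) by (intro filterlim_compose[OF c[OF s]]) (auto simp: filterlim_at)
        have 2: "(\<lambda>n. (\<lambda>z. u (fst z) (snd z)) (y n, s)) \<longlonglongrightarrow> (\<lambda>z. u (fst z) (snd z)) (\<xi>, s)"
          by (rule continuous_on_tendsto_compose[OF uQ])
             (use s y True in \<open>auto intro!: tendsto_intros simp: cbox_Pair_eq\<close>)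
        have 3: "(\<lambda>n. ?\<phi> i j (y n) s) \<longlonglongrightarrow> ?\<phi> i j \<xi> s" for i j
          by (rule continuous_on_tendsto_compose[where f = "\<lambda>y. mol i j r x t y s" and s = UNIV])
             (use y(3) in \<open>auto intro!: continuous_intros\<close>)
        show "(\<lambda>n. ?v (y n) s * ?\<phi> 0 0 (y n) s - u (y n) s * - ?\<phi> 1 0 (y n) s)
          \<longlonglongrightarrow> c s * ?\<phi> 0 0 \<xi> s - u \<xi> s * - ?\<phi> 1 0 \<xi> s"
          using 1 2 3 by (intro tendsto_intros) auto
      qed auto
      define q where "q = (\<lambda>n::nat. inverse (real (Suc n)))"
      have q: "q \<longlonglongrightarrow> 0" "0 < q n" "q n \<le> 1" for n
        using LIMSEQ_inverse_real_of_nat by (auto simp: q_def field_simps)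
      have ql: "(\<lambda>n. \<xi> + k * q n) \<longlonglongrightarrow> \<xi>" for k
        using tendsto_add[OF tendsto_const tendsto_mult_right_zero[OF q(1)], of \<xi> k] by simp
      have L: "integral {x - r..\<xi>} h = B'" 
      proof (cases "\<xi> = x - r")
        case True
        then show ?thesis using r by (simp add: B'_def mol_eq_0)
      next
        case False
        \<comment> \<open>The points \<open>\<xi> + k * q n\<close> start at the left side of the
          square for \<open>n = 0\<close> and tend to \<open>\<xi>\<close> from the left.\<close>
        define k where "k = (x - r) - \<xi>"
        have k: "k < 0" using False True \<open>\<xi> \<in> _\<close> by (auto simp: k_def)
        have yn: "\<xi> + k * q n \<in> {x - r..x + r}" "\<xi> + k * q n < \<xi>" for n
        proof -
          have "k * q n < 0" "k * q n \<ge> k" using q(2,3)[of n] k by (auto simp: mult_neg_pos mult_le_cancel_left2)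
          then show "\<xi> + k * q n \<in> {x - r..x + r}" "\<xi> + k * q n < \<xi>"
            using \<open>\<xi> \<in> _\<close> by (auto simp: k_def)
        qed
        have ne: "\<xi> + k * q n \<noteq> \<xi>" for n using yn(2)[of n] by linarith
        have "(\<lambda>n. B (\<xi> + k * q n)) \<longlonglongrightarrow> B'"
          by (rule Blim) (use yn ne ql in auto)
        moreover have "B (\<xi> + k * q n) = integral {x - r..\<xi> + k * q n} h" for n
          using rect[of "x - r" "\<xi> + k * q n"] yn[of n] Bends by auto
        moreover have "(\<lambda>n. integral {x - r..\<xi> + k * q n} h) \<longlonglongrightarrow> integral {x - r..\<xi>} h"
          by (rule continuous_on_tendsto_compose[OF indefinite_integral_continuous_1[OF hint] ql])
             (use yn \<open>\<xi> \<in> _\<close> in auto)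
        ultimately show ?thesis using LIMSEQ_unique by simp
      qed
      have Rr: "integral {\<xi>..x + r} h = - B'" 
      proof (cases "\<xi> = x + r")
        case True
        then show ?thesis using r by (simp add: B'_def mol_eq_0)
      next
        case False
        define k where "k = (x + r) - \<xi>"
        have k: "k > 0" using False True \<open>\<xi> \<in> _\<close> by (auto simp: k_def)
        have yn: "\<xi> + k * q n \<in> {x - r..x + r}" "\<xi> + k * q n > \<xi>" for n
        proof -
          have "k * q n > 0" "k * q n \<le> k" using q(2,3)[of n] k by (auto simp: mult_le_cancel_left1 mult_left_le)
          then show "\<xi> + k * q n \<in> {x - r..x + r}" "\<xi> + k * q n > \<xi>"
            using \<open>\<xi> \<in> _\<close> by (auto simp: k_def)
        qed
        have ne: "\<xi> + k * q n \<noteq> \<xi>" for n using yn(2)[of n] by linarith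
        have "(\<lambda>n. - B (\<xi> + k * q n)) \<longlonglongrightarrow> - B'"
          by (intro tendsto_minus Blim) (use yn ne ql in auto)
        moreover have "- B (\<xi> + k * q n) = integral {\<xi> + k * q n..x + r} h" for n
          using rect[of "\<xi> + k * q n" "x + r"] yn[of n] Bends by auto
        moreover have "(\<lambda>n. integral {\<xi> + k * q n..x + r} h) \<longlonglongrightarrow> integral {\<xi>..x + r} h"
          by (rule continuous_on_tendsto_compose[OF indefinite_integral_continuous_1'[OF hint] ql])
             (use yn \<open>\<xi> \<in> _\<close> in auto)
        ultimately show ?thesis using LIMSEQ_unique by simp
      qed
      have "integral {x - r..x + r} h = integral {x - r..\<xi>} h + integral {\<xi>..x + r} h"
        using True hint by (intro Henstock_Kurzweil_Integration.integral_combine[symmetric]) auto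
      then show ?thesis using L Rr by simp
    qed
    then show "integral ?Q (\<lambda>(y, s). u y s * (mol 0 1 r x t y s - mol 2 0 r x t y s)) = 0"
      using tot by simp
  qed
qed


text \<open>By Fubini, as every slice at fixed time is at most a single point; continuity makes the
  graph closed and so measurable.\<close>

lemma null_sets_graph:
  fixes p :: "real \<Rightarrow> real"
  assumes p: "continuous_on {t1..t2} p"
  shows "{z. snd z \<in> {t1..t2} \<and> fst z = p (snd z)} \<in> null_sets lborel"
proof -
  let ?G = "{z :: real \<times> real. snd z \<in> {t1..t2} \<and> fst z = p (snd z)}"
  have "continuous_on (UNIV \<times> {t1..t2}) (\<lambda>z. fst z - p (snd z))"
    by (intro continuous_intros continuous_on_compose2[OF p]) auto
  then have "closed ((UNIV \<times> {t1..t2}) \<inter> (\<lambda>z. fst z - p (snd z)) -` {0})"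
    by (rule continuous_closed_preimage) (auto intro: closed_Times)
  moreover have "(UNIV \<times> {t1..t2}) \<inter> (\<lambda>z. fst z - p (snd z)) -` {0} = ?G" by auto
  ultimately have "closed ?G" by (simp only:)
  then have G: "?G \<in> sets (lborel \<Otimes>\<^sub>M lborel)" by (subst lborel_prod) (simp add: borel_closed)
  have "emeasure (lborel \<Otimes>\<^sub>M lborel) ?G = (\<integral>\<^sup>+ y. emeasure lborel ((\<lambda>x. (x, y)) -` ?G) \<partial>lborel)"
    by (rule lborel_pair.emeasure_pair_measure_alt2[OF G])
  also have "\<dots> = (\<integral>\<^sup>+ y. 0 \<partial>(lborel :: real measure))"
  proof (rule nn_integral_cong)
    fix y :: real
    have "emeasure lborel ((\<lambda>x. (x, y)) -` ?G) \<le> emeasure lborel {p y}"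
      by (rule emeasure_mono) auto
    then show "emeasure lborel ((\<lambda>x. (x, y)) -` ?G) = 0" by simp
  qed
  finally have "emeasure lborel ?G = 0" by (subst (asm) lborel_prod) simp
  moreover have "?G \<in> sets lborel" using \<open>closed ?G\<close> by (simp only: borel_closed sets_lborel)
  ultimately show ?thesis unfolding null_sets_def by blast
qed

lemma integral_lborel_translate:
  fixes f :: "'a::euclidean_space \<Rightarrow> real"
  assumes "f \<in> borel_measurable borel"
  shows "(\<integral>x. f (c + x) \<partial>lborel) = (\<integral>x. f x \<partial>lborel)"
proof -
  have "(\<integral>x. f x \<partial>lborel) = (\<integral>x. f x \<partial>distr lborel borel ((+) c))" by (simp add: lborel_distr_plus)
  also have "\<dots> = (\<integral>x. f (c + x) \<partial>lborel)" using assms by (intro integral_distr) auto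
  finally show ?thesis ..
qed

text \<open>
  Green's formula on the region to the left of a merely continuous curve \<open>x = p t\<close>. Since
  \<open>p\<close> need not have bounded variation, the time derivative is integrated as a limit of
  difference quotients; no boundary term appears because \<open>u\<close> vanishes on the curve.
\<close>

lemma free_boundary_green:
  fixes u v w \<phi> \<phi>x \<phi>xx \<phi>t :: "real \<Rightarrow> real \<Rightarrow> real" and p :: "real \<Rightarrow> real"
  assumes ord: "x1 < x2" "t1 < t2"
    and cu: "continuous_on (cbox (x1, t1) (x2, t2)) (\<lambda>(x, t). u x t)"
    and cv: "continuous_on (cbox (x1, t1) (x2, t2)) (\<lambda>(x, t). v x t)"
    and cw: "continuous_on (cbox (x1, t1) (x2, t2)) (\<lambda>(x, t). w x t)"
    and du: "\<And>x t. (x, t) \<in> cbox (x1, t1) (x2, t2) \<Longrightarrow> ((\<lambda>y. u y t) has_field_derivative v x t) (at x)"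
      "\<And>x t. (x, t) \<in> cbox (x1, t1) (x2, t2) \<Longrightarrow> ((\<lambda>y. v y t) has_field_derivative w x t) (at x)"
      "\<And>x t. (x, t) \<in> cbox (x1, t1) (x2, t2) \<Longrightarrow> ((\<lambda>s. u x s) has_field_derivative w x t) (at t)"
    and c\<phi>: "continuous_on UNIV (\<lambda>(x, t). \<phi> x t)" "continuous_on UNIV (\<lambda>(x, t). \<phi>x x t)"
      "continuous_on UNIV (\<lambda>(x, t). \<phi>xx x t)" "continuous_on UNIV (\<lambda>(x, t). \<phi>t x t)"
    and d\<phi>: "\<And>x t. ((\<lambda>y. \<phi> y t) has_field_derivative \<phi>x x t) (at x)"
      "\<And>x t. ((\<lambda>y. \<phi>x y t) has_field_derivative \<phi>xx x t) (at x)"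
      "\<And>x t. ((\<lambda>s. \<phi> x s) has_field_derivative \<phi>t x t) (at t)"
    and van: "\<And>x t. (x, t) \<notin> box (x1, t1) (x2, t2) \<Longrightarrow> \<phi> x t = 0 \<and> \<phi>x x t = 0"
    and p: "continuous_on {t1..t2} p"
    and up: "\<And>t. t \<in> {t1..t2} \<Longrightarrow> p t \<in> {x1..x2} \<Longrightarrow> u (p t) t = 0"
  shows "(LINT z:{z \<in> cbox (x1, t1) (x2, t2). fst z < p (snd z)}|lborel.
      u (fst z) (snd z) * (- \<phi>t (fst z) (snd z) - \<phi>xx (fst z) (snd z))) =
    (LINT t:{t1..t2}|lborel. v (p t) t * \<phi> (p t) t)"
proof -
  let ?Q = "cbox (x1, t1) (x2, t2)"
  define S where "S = {z \<in> ?Q. fst z < p (snd z)}"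
  have mem: "(x, t) \<in> ?Q \<longleftrightarrow> x \<in> {x1..x2} \<and> t \<in> {t1..t2}" for x t by (auto simp: cbox_Pair_eq)
  have memS: "(x, t) \<in> S \<longleftrightarrow> x \<in> {x1..x2} \<and> t \<in> {t1..t2} \<and> x < p t" for x t
    by (simp add: S_def mem)
  have memB: "(x, t) \<in> box (x1, t1) (x2, t2) \<longleftrightarrow> x1 < x \<and> x < x2 \<and> t1 < t \<and> t < t2" for x t
    by (auto simp: mem_box Basis_prod_def)
  note fs = case_prod_unfold
  have C: "continuous_on ?Q (\<lambda>z. u (fst z) (snd z))" "continuous_on ?Q (\<lambda>z. v (fst z) (snd z))"
    "continuous_on ?Q (\<lambda>z. w (fst z) (snd z))"
    "continuous_on ?Q (\<lambda>z. \<phi> (fst z) (snd z))" "continuous_on ?Q (\<lambda>z. \<phi>x (fst z) (snd z))"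
    "continuous_on ?Q (\<lambda>z. \<phi>xx (fst z) (snd z))" "continuous_on ?Q (\<lambda>z. \<phi>t (fst z) (snd z))"
    using cu cv cw c\<phi>[THEN continuous_on_subset, OF subset_UNIV] by (simp_all add: fs)
  define g where "g = (\<lambda>z. u (fst z) (snd z) * \<phi> (fst z) (snd z))"
  define A where "A = (\<lambda>z. w (fst z) (snd z) * \<phi> (fst z) (snd z) + u (fst z) (snd z) * \<phi>t (fst z) (snd z))"
  define B where "B = (\<lambda>z. w (fst z) (snd z) * \<phi> (fst z) (snd z) - u (fst z) (snd z) * \<phi>xx (fst z) (snd z))"
  have cg: "continuous_on ?Q g" and cA: "continuous_on ?Q A" and cB: "continuous_on ?Q B"
    unfolding g_def A_def B_def by (intro continuous_intros C)+
  have pQ: "continuous_on ?Q (\<lambda>z. p (snd z))"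
    by (rule continuous_on_compose2[OF p]) (auto intro!: continuous_intros simp: cbox_Pair_eq)
  have "closed {z \<in> ?Q. p (snd z) \<le> fst z}"
    by (intro continuous_on_closed_Collect_le pQ continuous_intros closed_cbox)
  moreover have "S = ?Q - {z \<in> ?Q. p (snd z) \<le> fst z}" by (auto simp: S_def)
  ultimately have S: "S \<in> sets borel" by (auto intro!: sets.Diff borel_closed)
  have intS: "integrable lborel (\<lambda>z. indicator S z * f z)" if "continuous_on ?Q f" for f :: "real \<times> real \<Rightarrow> real"
  proof -
    have "set_integrable lborel ?Q f"
      unfolding set_integrable_def using borel_integrable_compact[OF compact_cbox that] by simp
    then have "set_integrable lborel S f"
      by (rule set_integrable_subset) (use S in \<open>auto simp: S_def\<close>)
    then show ?thesis by (simp add: set_integrable_def)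
  qed
  obtain M where M: "\<And>z. z \<in> ?Q \<Longrightarrow> \<bar>A z\<bar> \<le> M"
    using compact_imp_bounded[OF compact_continuous_image[OF cA compact_cbox]] unfolding bounded_iff by auto
  have M0: "0 \<le> M" using M[of "(x1, t1)"] ord mem by fastforce
  have dg: "((\<lambda>s. g (x, s)) has_field_derivative A (x, t)) (at t)" if "(x, t) \<in> ?Q" for x t
    using du(3)[OF that] unfolding g_def A_def fst_conv snd_conv by (auto intro!: derivative_eq_intros d\<phi>(3))
  have lip: "\<bar>g (x, s) - g (x, t)\<bar> \<le> M * \<bar>s - t\<bar>" if "(x, t) \<in> ?Q" "(x, s) \<in> ?Q" for x s t
  proof -
    have x: "x \<in> {x1..x2}" using that mem by simp
    have "norm (g (x, s) - g (x, t)) \<le> M * norm (s - t)"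
      by (rule field_differentiable_bound[where S = "{t1..t2}" and f' = "\<lambda>t. A (x, t)"])
         (use that x dg M mem in \<open>auto intro: has_field_derivative_at_within\<close>)
    then show ?thesis by simp
  qed
  have g0: "g (x, t) = 0" if "(x, t) \<notin> box (x1, t1) (x2, t2)" for x t using van[OF that] by (simp add: g_def)
  \<comment> \<open>Cut off at the curve, \<open>u \<phi>\<close> is still Lipschitz in time
    although \<open>p\<close> is merely continuous: between a time in \<open>S\<close> and a time
    outside, the point meets either the curve or the top or bottom of the rectangle, and
    \<open>g\<close> vanishes there.\<close>
  define k where "k = (\<lambda>z. indicator S z * g z)"
  have zero_between: "\<exists>s \<in> closed_segment t t'. (x, s) \<in> ?Q \<and> g (x, s) = 0"
    if "(x, t) \<in> S" "(x, t') \<notin> S" for x t t'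
  proof -
    have x: "x \<in> {x1..x2}" "t \<in> {t1..t2}" "x < p t" using that(1) memS by auto
    show ?thesis
    proof (cases "t' \<in> {t1..t2}")
      case True
      then have "p t' \<le> x" using that(2) x memS by auto
      have sub: "closed_segment t t' \<subseteq> {t1..t2}"
        using x(2) True by (simp add: closed_segment_subset)
      have "is_interval (p ` closed_segment t t')"
        unfolding is_interval_connected_1
        by (intro connected_continuous_image continuous_on_subset[OF p sub] connected_segment)
      from mem_is_interval_1_I[OF this, of "p t'" "p t" x] have "x \<in> p ` closed_segment t t'"
        using x \<open>p t' \<le> x\<close> by auto
      then obtain s where s: "s \<in> closed_segment t t'" "p s = x" by auto
      then have "u x s = 0" using up[of s] sub x by auto
      then show ?thesis using s sub x mem by (intro bexI[of _ s]) (auto simp: g_def)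
    next
      case False
      then consider "t' < t1" | "t' > t2" by fastforce
      then show ?thesis
      proof cases
        case 1
        have "g (x, t1) = 0" by (rule g0) (simp add: memB)
        then show ?thesis using 1 x mem ord by (intro bexI[of _ t1]) (auto simp: closed_segment_eq_real_ivl)
      next
        case 2
        have "g (x, t2) = 0" by (rule g0) (simp add: memB)
        then show ?thesis using 2 x mem ord by (intro bexI[of _ t2]) (auto simp: closed_segment_eq_real_ivl)
      qed
    qed
  qed
  have klip1: "\<bar>k (x, t) - k (x, t')\<bar> \<le> M * \<bar>t - t'\<bar>" if tS: "(x, t) \<in> S" for x t t'
  proof (cases "(x, t') \<in> S")
    case True
    then show ?thesis using lip[of x t' t] tS by (auto simp: k_def S_def)
  next
    case False
    obtain s where s: "s \<in> closed_segment t t'" "(x, s) \<in> ?Q" "g (x, s) = 0"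
      using zero_between[OF tS False] by blast
    have "\<bar>k (x, t) - k (x, t')\<bar> = \<bar>g (x, t) - g (x, s)\<bar>" using tS False s by (simp add: k_def)
    also have "\<dots> \<le> M * \<bar>t - s\<bar>" using tS s by (intro lip) (auto simp: S_def)
    also have "\<dots> \<le> M * \<bar>t - t'\<bar>"
      using s(1) M0 by (intro mult_left_mono) (auto simp: closed_segment_eq_real_ivl split: if_splits)
    finally show ?thesis .
  qed
  have klip: "\<bar>k (x, t) - k (x, t')\<bar> \<le> M * \<bar>t - t'\<bar>" for x t t'
  proof (cases "(x, t) \<in> S \<or> (x, t') \<in> S")
    case True
    then show ?thesis using klip1[of x t t'] klip1[of x t' t] by (auto simp: abs_minus_commute)
  qed (use M0 in \<open>simp add: k_def\<close>)
  have kint: "integrable lborel k" unfolding k_def by (rule intS[OF cg])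
  have km: "k \<in> borel_measurable borel" using borel_measurable_integrable[OF kint] by simp
  define q where "q = (\<lambda>n::nat. inverse (real (Suc n)))"
  have q: "q \<longlonglongrightarrow> 0" "0 < q n" "q n \<le> 1" for n
    using LIMSEQ_inverse_real_of_nat by (auto simp: q_def field_simps)
  \<comment> \<open>The difference quotients of an integrable function along a coordinate have
    integral zero by translation invariance. In the limit this says that the integral of
    \<open>A\<close> over \<open>S\<close> vanishes.\<close>
  define dq where "dq = (\<lambda>n z. (k ((0, q n) + z) - k z) / q n)"
  have "integral\<^sup>L lborel (dq n) = 0" for n
  proof -
    have "integrable lborel (\<lambda>z. k ((0, q n) + z))"
    proof -
      have "integrable (distr lborel borel ((+) (0, q n))) k" using kint by (simp add: lborel_distr_plus)
      then show ?thesis by (subst (asm) integrable_distr_eq) (auto simp: km)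
    qed
    then show ?thesis
      unfolding dq_def using kint integral_lborel_translate[OF km, of "(0, q n)"] by simp
  qed
  moreover have "(\<lambda>n. integral\<^sup>L lborel (dq n)) \<longlonglongrightarrow> integral\<^sup>L lborel (\<lambda>z. indicator S z * A z)"
  proof (rule integral_dominated_convergence)
    \<comment> \<open>Enlarged downwards by 1, since the forward shift by \<open>q n \<le> 1\<close>
      can move points from below \<open>t1\<close> into \<open>S\<close>.\<close>
    let ?K = "cbox (x1, t1 - 1) (x2, t2)"
    show "(\<lambda>z. indicator S z * A z) \<in> borel_measurable lborel"
      using intS[OF cA] by (rule borel_measurable_integrable)
    show "dq n \<in> borel_measurable lborel" for n
      unfolding dq_def using km by measurable
    have "integrable lborel (\<lambda>z. indicator ?K z *\<^sub>R M)"
      by (rule borel_integrable_compact) (auto intro!: compact_cbox)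
    then show "integrable lborel (\<lambda>z. indicator ?K z * M)" by simp
    show "AE z in lborel. norm (dq n z) \<le> indicator ?K z * M" for n
    proof (rule AE_I2)
      fix z :: "real \<times> real"
      obtain x t where z: "z = (x, t)" by (cases z)
      show "norm (dq n z) \<le> indicator ?K z * M"
      proof (cases "z \<in> ?K")
        case True
        have "\<bar>k (x, q n + t) - k (x, t)\<bar> \<le> M * q n" using klip[of x "q n + t" t] q(2)[of n] by simp
        then show ?thesis using True q(2)[of n] by (simp add: dq_def z field_simps)
      next
        case False
        then have "(x, t) \<notin> S" "(x, q n + t) \<notin> S"
          using q(2,3)[of n] by (auto simp: z memS cbox_Pair_eq)
        then show ?thesis using False by (simp add: dq_def z k_def)
      qed
    qed
    let ?G = "{z. snd z \<in> {t1..t2} \<and> fst z = p (snd z)}"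
    have "AE z in lborel. z \<notin> ?G" by (rule AE_not_in[OF null_sets_graph[OF p]])
    moreover have "AE z in lborel. z \<notin> ?Q - box (x1, t1) (x2, t2)"
    proof (rule AE_not_in)
      have "?Q - box (x1, t1) (x2, t2) \<in> sets lborel" by auto
      moreover have "negligible (?Q - box (x1, t1) (x2, t2))" by (rule negligible_frontier_interval)
      ultimately show "?Q - box (x1, t1) (x2, t2) \<in> null_sets lborel"
        by (simp add: negligible_iff_null_sets null_sets_completion_iff)
    qed
    ultimately show "AE z in lborel. (\<lambda>n. dq n z) \<longlonglongrightarrow> indicator S z * A z"
    proof eventually_elim
      case (elim z)
      obtain x t where z: "z = (x, t)" by (cases z)
      have qt: "(\<lambda>n. q n + t) \<longlonglongrightarrow> t" using tendsto_add[OF q(1) tendsto_const[of t]] by simp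
      show ?case
      proof (cases "z \<in> ?Q")
        case False
        have "open (- ?Q)" by auto
        moreover have "(\<lambda>n. (x, q n + t)) \<longlonglongrightarrow> (x, t)" using qt by (intro tendsto_intros)
        ultimately have "\<forall>\<^sub>F n in sequentially. (x, q n + t) \<in> - ?Q"
          using False z topological_tendstoD by fastforce
        then have "\<forall>\<^sub>F n in sequentially. dq n z = 0"
          by eventually_elim (use False in \<open>auto simp: dq_def z k_def S_def\<close>)
        then show ?thesis using False by (simp add: S_def tendsto_eventually)
      next
        case True
        then have int: "x1 < x" "x < x2" "t1 < t" "t < t2" "x \<noteq> p t"
          using elim z memB[of x t] by auto
        have ev1: "\<forall>\<^sub>F n in sequentially. q n + t \<in> {t1..t2}"
          using order_tendstoD(1)[OF qt int(3)] order_tendstoD(2)[OF qt int(4)] by eventually_elim simp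
        have pt: "(\<lambda>n. p (q n + t)) \<longlonglongrightarrow> p t"
          by (rule continuous_on_tendsto_compose[OF p qt _ ev1]) (use int in auto)
        show ?thesis
        proof (cases "x < p t")
          case True
          have "\<forall>\<^sub>F n in sequentially. (x, q n + t) \<in> S"
            using order_tendstoD(1)[OF pt True] ev1 by eventually_elim (use int in \<open>auto simp: memS\<close>)
          then have ev: "\<forall>\<^sub>F n in sequentially. (g (x, t + q n) - g (x, t)) / q n = dq n z"
            by eventually_elim (use True int in \<open>auto simp: dq_def z k_def memS add.commute\<close>)
          have "((\<lambda>h. (g (x, t + h) - g (x, t)) / h) \<longlongrightarrow> A (x, t)) (at 0)"
            using dg[of x t] \<open>z \<in> ?Q\<close> z by (simp add: DERIV_def)
          moreover have "filterlim q (at 0) sequentially"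
          proof -
            have "q n \<noteq> 0" for n using q(2)[of n] by simp
            then show ?thesis by (simp add: filterlim_at q(1))
          qed
          ultimately have "(\<lambda>n. (g (x, t + q n) - g (x, t)) / q n) \<longlonglongrightarrow> A (x, t)"
            by (rule filterlim_compose)
          then have "(\<lambda>n. dq n z) \<longlonglongrightarrow> A (x, t)" using ev by (rule Lim_transform_eventually)
          then show ?thesis using True int by (simp add: z memS)
        next
          case False
          then have "p t < x" using int by simp
          then have "\<forall>\<^sub>F n in sequentially. p (q n + t) < x" by (rule order_tendstoD(2)[OF pt])
          then have "\<forall>\<^sub>F n in sequentially. dq n z = 0"
            by eventually_elim (use False in \<open>auto simp: dq_def z k_def memS\<close>)
          then show ?thesis using False by (simp add: z memS tendsto_eventually)
        qed
      qed
    qed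
  qed
  ultimately have IA: "integral\<^sup>L lborel (\<lambda>z. indicator S z * A z) = 0"
    using LIMSEQ_unique[OF _ tendsto_const] by simp
  have "integral\<^sup>L lborel (\<lambda>z. indicator S z * B z) = (\<integral>t. (\<integral>x. indicator S (x, t) * B (x, t) \<partial>lborel) \<partial>lborel)"
    using lborel_pair.integral_snd[of "\<lambda>x t. indicator S (x, t) * B (x, t)"] intS[OF cB]
    by (simp add: lborel_prod case_prod_unfold)
  also have "\<dots> = (LINT t:{t1..t2}|lborel. v (p t) t * \<phi> (p t) t)"
    unfolding set_lebesgue_integral_def
  proof (rule Bochner_Integration.integral_cong[OF refl])
    fix t :: real
    show "(\<integral>x. indicator S (x, t) * B (x, t) \<partial>lborel) = indicator {t1..t2} t *\<^sub>R (v (p t) t * \<phi> (p t) t)"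
    proof (cases "t \<in> {t1..t2}")
      case False
      then have "(x, t) \<notin> S" for x using memS by blast
      with False show ?thesis by simp
    next
      case t: True
      show ?thesis
      proof (cases "p t \<le> x1")
        case True
        then have "indicator S (x, t) = (0::real)" for x by (auto simp: memS indicator_def)
        moreover have "\<phi> (p t) t = 0" using True van[of "p t" t] memB by auto
        ultimately show ?thesis by simp
      next
        case False
        \<comment> \<open>Right end of the slice of \<open>S\<close>. If the curve is to the right
          of the rectangle, the boundary term vanishes through \<open>\<phi>\<close>; otherwise
          \<open>u = 0\<close> on the curve leaves only \<open>v \<phi>\<close>.\<close>
        define c where "c = min (p t) x2"
        have c: "x1 < c" "c \<le> x2" using False ord by (auto simp: c_def)
        have FTC: "(\<integral>x. indicator {x1..c} x *\<^sub>R B (x, t) \<partial>lborel)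
          = (v c t * \<phi> c t - u c t * \<phi>x c t) - (v x1 t * \<phi> x1 t - u x1 t * \<phi>x x1 t)"
        proof (rule integral_FTC_Icc)
          fix x assume x: "x1 \<le> x" "x \<le> c"
          then have xt: "(x, t) \<in> ?Q" using c t mem by auto
          have "((\<lambda>x. v x t * \<phi> x t - u x t * \<phi>x x t) has_field_derivative B (x, t)) (at x)"
            unfolding B_def
            by (rule DERIV_cong[OF DERIV_diff[OF DERIV_mult[OF du(2)[OF xt] d\<phi>(1)] DERIV_mult[OF du(1)[OF xt] d\<phi>(2)]]])
               (simp add: algebra_simps)
          then show "((\<lambda>x. v x t * \<phi> x t - u x t * \<phi>x x t) has_vector_derivative B (x, t)) (at x within {x1..c})"
            by (simp add: has_real_derivative_iff_has_vector_derivative has_vector_derivative_at_within)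
        next
          show "continuous_on {x1..c} (\<lambda>x. B (x, t))"
            by (rule continuous_on_compose2[OF cB]) (use c t mem in \<open>auto intro!: continuous_intros\<close>)
        qed (use c in auto)
        have "(\<integral>x. indicator S (x, t) * B (x, t) \<partial>lborel) = (\<integral>x. indicator {x1..c} x *\<^sub>R B (x, t) \<partial>lborel)"
        proof (rule integral_cong_AE)
          have "AE x in lborel. x \<noteq> p t" by (rule AE_lborel_singleton)
          then show "AE x in lborel. indicator S (x, t) * B (x, t) = indicator {x1..c} x *\<^sub>R B (x, t)"
            by eventually_elim (use t in \<open>auto simp: memS c_def indicator_def\<close>)
          have "(\<lambda>z. indicator S z * B z) \<in> borel_measurable (lborel \<Otimes>\<^sub>M lborel)"
            using borel_measurable_integrable[OF intS[OF cB]] by (simp add: lborel_prod)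
          then show "(\<lambda>x. indicator S (x, t) * B (x, t)) \<in> borel_measurable lborel"
            by (rule measurable_compose[rotated]) simp
          have "continuous_on {x1..c} (\<lambda>x. B (x, t))"
            by (rule continuous_on_compose2[OF cB]) (use c t mem in \<open>auto intro!: continuous_intros\<close>)
          then show "(\<lambda>x. indicator {x1..c} x *\<^sub>R B (x, t)) \<in> borel_measurable lborel"
            by (intro borel_measurable_integrable borel_integrable_compact) auto
        qed
        also have "\<dots> = v c t * \<phi> c t - u c t * \<phi>x c t"
          unfolding FTC using van[of x1 t] memB by simp
        also have "\<dots> = v (p t) t * \<phi> (p t) t"
        proof (cases "p t \<le> x2")
          case True
          then have "u (p t) t = 0" using up[OF t] False by auto
          then show ?thesis using True by (simp add: c_def)
        next
          case False
          then show ?thesis using van[of x2 t] van[of "p t" t] memB by (simp add: c_def)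
        qed
        finally show ?thesis using t by simp
      qed
    qed
  qed
  finally have IB: "integral\<^sup>L lborel (\<lambda>z. indicator S z * B z) = (LINT t:{t1..t2}|lborel. v (p t) t * \<phi> (p t) t)" .
  have "(LINT z:S|lborel. u (fst z) (snd z) * (- \<phi>t (fst z) (snd z) - \<phi>xx (fst z) (snd z)))
     = (\<integral>z. indicator S z * B z - indicator S z * A z \<partial>lborel)"
    unfolding set_lebesgue_integral_def
    by (rule Bochner_Integration.integral_cong) (auto simp: A_def B_def algebra_simps)
  also have "\<dots> = (LINT t:{t1..t2}|lborel. v (p t) t * \<phi> (p t) t)"
    using intS[OF cA] intS[OF cB] IA IB by simp
  finally show ?thesis by (simp add: S_def)
qed

section \<open>Extension to the whole line\<close>

text \<open>
  The conditions \<open>F\<^sub>x(L) = F\<^sub>x(L - a)\<close> and \<open>F\<^sub>x(-L) = F\<^sub>x(-L + a)\<close> say that the increment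
  \<open>F(x) - F(x - a)\<close> satisfies Neumann conditions at \<open>L\<close> and at \<open>-L + a\<close>. The extension below is
  the one for which the increment becomes even about both points.
\<close>

primrec ext_steps :: "real \<Rightarrow> real \<Rightarrow> nat \<Rightarrow> (real \<Rightarrow> real) \<Rightarrow> real \<Rightarrow> real" where
  "ext_steps L a 0 g x = g x"
| "ext_steps L a (Suc n) g x = (if \<bar>x\<bar> \<le> L then g x else
     ext_steps L a n g (x - sgn x * a) + ext_steps L a n g (2 * sgn x * L - x)
     - ext_steps L a n g (2 * sgn x * L - sgn x * a - x))"

text \<open>Any number of unfoldings that brings all arguments back to \<open>[-L, L]\<close> gives
  the same value; \<open>\<bar>x\<bar> / a\<close> rounded up is a convenient one.\<close>

definition extend :: "real \<Rightarrow> real \<Rightarrow> (real \<Rightarrow> real) \<Rightarrow> real \<Rightarrow> real" where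
  "extend L a g x = ext_steps L a (nat \<lceil>\<bar>x\<bar> / a\<rceil>) g x"

context
  fixes L a :: real
  assumes a: "0 < a" and aL: "a < L"
begin

text \<open>All three arguments of the recursion lie one step of length \<open>a\<close> closer to
  the interval; for the last one, the shifted reflection, this is where \<open>a < L\<close> is
  used. The well-foundedness of the recursion and every estimate on the extension rest on
  it.\<close>

lemma extension_args:
  assumes "L < \<bar>x\<bar>" "\<bar>x\<bar> \<le> L + real (Suc n) * a"
  shows "\<bar>x - sgn x * a\<bar> \<le> L + real n * a" "\<bar>2 * sgn x * L - x\<bar> \<le> L + real n * a"
    "\<bar>2 * sgn x * L - sgn x * a - x\<bar> \<le> L + real n * a"
proof -
  have n: "0 \<le> real n * a" "real (Suc n) * a = real n * a + a" using a by (simp_all add: algebra_simps)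
  consider "sgn x = 1" "x > 0" | "sgn x = - 1" "x < 0"
  proof -
    have "x > 0 \<or> x < 0" using assms(1) a aL by linarith
    then show ?thesis using that by auto
  qed
  then show "\<bar>x - sgn x * a\<bar> \<le> L + real n * a" "\<bar>2 * sgn x * L - x\<bar> \<le> L + real n * a"
    "\<bar>2 * sgn x * L - sgn x * a - x\<bar> \<le> L + real n * a"
    using assms n a aL by (cases; simp only:; linarith)+
qed

lemma ext_steps_stable:
  "\<bar>x\<bar> \<le> L + real n * a \<Longrightarrow> ext_steps L a (Suc n) g x = ext_steps L a n g x"
proof (induction n arbitrary: x)
  case (Suc n)
  show ?case
  proof (cases "\<bar>x\<bar> \<le> L")
    case False
    then have "L < \<bar>x\<bar>" by simp
    from extension_args[OF this Suc.prems] Suc.IH False show ?thesis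
      unfolding ext_steps.simps(2)[of L a "Suc n"] by (simp del: ext_steps.simps(2)) simp
  qed simp
qed simp

lemma extend_eq_steps:
  assumes "\<bar>x\<bar> \<le> L + real n * a"
  shows "extend L a g x = ext_steps L a n g x"
proof -
  have up: "ext_steps L a (m + k) g x = ext_steps L a m g x" if "\<bar>x\<bar> \<le> L + real m * a" for m k
  proof (induction k)
    case (Suc k)
    have "real m * a \<le> real (m + k) * a" using a by (intro mult_right_mono) auto
    then have "\<bar>x\<bar> \<le> L + real (m + k) * a" using that by linarith
    then show ?case using Suc ext_steps_stable[of x "m + k" g] by simp
  qed simp
  let ?m = "nat \<lceil>\<bar>x\<bar> / a\<rceil>"
  have "\<bar>x\<bar> / a \<le> real ?m" using a by (simp add: of_nat_ceiling)
  then have "\<bar>x\<bar> \<le> real ?m * a" using a by (simp only: pos_divide_le_eq)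
  then have "\<bar>x\<bar> \<le> L + real ?m * a" using a aL by linarith
  then show ?thesis
    using up[of ?m "n - ?m"] up[of n "?m - n"] assms unfolding extend_def
    by (cases rule: le_cases[of n ?m]) auto
qed

lemma extend_base: "\<bar>x\<bar> \<le> L \<Longrightarrow> extend L a g x = g x"
  using extend_eq_steps[of x 0] by simp

lemma bound_by_steps: "\<exists>n. \<bar>x\<bar> \<le> L + real n * a"
proof -
  obtain n where "\<bar>x\<bar> / a \<le> real n" using real_arch_simple by blast
  then have "\<bar>x\<bar> \<le> L + real n * a" using a aL by (simp add: field_simps)
  then show ?thesis ..
qed

lemma extend_rec:
  assumes "L < \<bar>x\<bar>"
  shows "extend L a g x = extend L a g (x - sgn x * a) + extend L a g (2 * sgn x * L - x)
     - extend L a g (2 * sgn x * L - sgn x * a - x)"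
proof -
  obtain n where n: "\<bar>x\<bar> \<le> L + real n * a" using bound_by_steps by blast
  then have n': "\<bar>x\<bar> \<le> L + real (Suc n) * a" using a by (simp add: algebra_simps)
  show ?thesis
    using extend_eq_steps[OF n'] extension_args[OF assms n', THEN extend_eq_steps] assms by simp
qed

lemma extend_induct [case_names base step]:
  assumes base: "\<And>x. \<bar>x\<bar> \<le> L \<Longrightarrow> P x"
    and step: "\<And>x. L < \<bar>x\<bar> \<Longrightarrow> P (x - sgn x * a) \<Longrightarrow> P (2 * sgn x * L - x) \<Longrightarrow> P (2 * sgn x * L - sgn x * a - x) \<Longrightarrow> P x"
  shows "P x"
proof -
  have "P x" if "\<bar>x\<bar> \<le> L + real n * a" for n x
    using that
  proof (induction n arbitrary: x)
    case 0
    then show ?case using base by simp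
  next
    case (Suc n)
    show ?case
    proof (cases "\<bar>x\<bar> \<le> L")
      case False
      then have "L < \<bar>x\<bar>" by simp
      then show ?thesis using step extension_args[OF _ Suc.prems] Suc.IH by blast
    qed (rule base)
  qed
  then show ?thesis using bound_by_steps by blast
qed

lemma extend_diff: "extend L a (\<lambda>y. g y - h y) x = extend L a g x - extend L a h x"
  by (induction x rule: extend_induct) (simp_all add: extend_base extend_rec)

text \<open>Each unfolding produces three values and consumes a distance \<open>a\<close>, so the
  bound triples per step: at most \<open>3 ^ (\<bar>x\<bar> / a + 1) * M\<close>, which is the
  stated exponential.\<close>

lemma extend_bound:
  assumes "\<And>y. \<bar>y\<bar> \<le> L \<Longrightarrow> \<bar>g y\<bar> \<le> M"
  shows "\<bar>extend L a g x\<bar> \<le> 3 * M * exp (ln 3 / a * \<bar>x\<bar>)"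
proof -
  have M: "0 \<le> M" using assms[of 0] a aL by auto
  have *: "\<bar>extend L a g x\<bar> \<le> 3 ^ n * M" if "\<bar>x\<bar> \<le> L + real n * a" for n x
    using that
  proof (induction n arbitrary: x)
    case 0
    then show ?case using assms by (simp add: extend_base)
  next
    case (Suc n)
    show ?case
    proof (cases "\<bar>x\<bar> \<le> L")
      case True
      have "1 * M \<le> 3 ^ Suc n * M" using M by (intro mult_right_mono one_le_power) auto
      with assms[OF True] show ?thesis unfolding extend_base[OF True] by linarith
    next
      case False
      then have x: "L < \<bar>x\<bar>" by simp
      show ?thesis
        using extension_args[OF x Suc.prems, THEN Suc.IH] unfolding extend_rec[OF x] by simp
    qed
  qed
  define n where "n = nat \<lceil>\<bar>x\<bar> / a\<rceil>"
  have n: "\<bar>x\<bar> / a \<le> real n" "real n \<le> \<bar>x\<bar> / a + 1"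
    using a by (auto simp: n_def of_nat_ceiling)
  have "\<bar>x\<bar> \<le> L + real n * a" using n(1) a aL by (simp add: field_simps)
  then have "\<bar>extend L a g x\<bar> \<le> 3 ^ n * M" by (rule *)
  also have "(3::real) ^ n = exp (ln 3 * real n)"
    by (subst mult.commute, subst exp_of_nat_mult) simp
  also have "\<dots> \<le> exp (ln 3 * (\<bar>x\<bar> / a + 1))" using n(2) by simp
  also have "\<dots> = 3 * exp (ln 3 / a * \<bar>x\<bar>)" by (simp add: algebra_simps exp_add)
  finally show ?thesis using M by (simp add: mult_right_mono mult_ac)
qed

text \<open>At each point \<open>ext_steps\<close> is eventually constant in the number of steps, so
  \<open>extend\<close> is a pointwise limit of measurable functions.\<close>

lemma borel_measurable_extend [measurable]:
  assumes [measurable]: "g \<in> borel_measurable borel"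
  shows "extend L a g \<in> borel_measurable borel"
proof (rule borel_measurable_LIMSEQ_real)
  show "ext_steps L a n g \<in> borel_measurable borel" for n
  proof (induction n)
    case 0
    then show ?case using assms by (simp cong: measurable_cong)
  next
    case (Suc n)
    note [measurable] = Suc
    show ?case unfolding ext_steps.simps(2) by measurable
  qed
  fix x :: real
  obtain n where n: "\<bar>x\<bar> \<le> L + real n * a" using bound_by_steps by blast
  have "\<forall>\<^sub>F m in sequentially. ext_steps L a m g x = extend L a g x"
  proof (rule eventually_sequentiallyI)
    fix m assume "n \<le> m"
    then have "real n * a \<le> real m * a" using a by simp
    then show "ext_steps L a m g x = extend L a g x" using n by (intro extend_eq_steps[symmetric]) linarith
  qed
  then show "(\<lambda>m. ext_steps L a m g x) \<longlonglongrightarrow> extend L a g x" by (rule tendsto_eventually)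
qed

text \<open>For \<open>y > L\<close> the recursion is an identity between the increments at
  \<open>y\<close> and at the reflected point \<open>2 L - y\<close>; for \<open>y - a < -L\<close>
  the reflection is about \<open>-L + a\<close>. Either way the same increment reappears at a point
  closer to the interval.\<close>

lemma extend_increment_le:
  assumes "\<And>y. \<bar>y\<bar> \<le> L \<Longrightarrow> \<bar>y - a\<bar> \<le> L \<Longrightarrow> g y \<le> g (y - a)"
  shows "extend L a g y \<le> extend L a g (y - a)"
proof -
  have "extend L a g y \<le> extend L a g (y - a)"
    if "\<bar>y\<bar> \<le> L + real n * a" "\<bar>y - a\<bar> \<le> L + real n * a" for n y
    using that
  proof (induction n arbitrary: y)
    case 0
    then show ?case using assms by (simp add: extend_base)
  next
    case (Suc n)
    consider "y > L" | "y - a < - L" | "\<bar>y\<bar> \<le> L" "\<bar>y - a\<bar> \<le> L" using a aL by linarith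
    then show ?case
    proof cases
      case 1
      then have s: "L < \<bar>y\<bar>" "sgn y = 1" using a aL by auto
      have "extend L a g (2 * L - y) \<le> extend L a g (2 * L - y - a)"
        using extension_args[OF s(1) Suc.prems(1)] s by (intro Suc.IH) (simp_all add: algebra_simps)
      then show ?thesis using extend_rec[OF s(1), of g] s by (simp add: algebra_simps)
    next
      case 2
      then have s: "L < \<bar>y - a\<bar>" "sgn (y - a) = - 1" using a aL by auto
      have "extend L a g (- 2 * L + a - (y - a)) \<le> extend L a g (- 2 * L + a - (y - a) - a)"
        using extension_args[OF s(1) Suc.prems(2)] s by (intro Suc.IH) (simp_all add: algebra_simps)
      then show ?thesis using extend_rec[OF s(1), of g] s by (simp add: algebra_simps)
    next
      case 3
      then show ?thesis using assms by (simp add: extend_base)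
    qed
  qed
  note * = this
  obtain n where n: "\<bar>\<bar>y\<bar> + a\<bar> \<le> L + real n * a" using bound_by_steps by blast
  show ?thesis by (rule *[of y n]) (use n a in linarith)+
qed

text \<open>For \<open>x > L\<close>, monotonicity under shifts bounds the value at \<open>x\<close>
  by the value at \<open>x - a\<close>, and \<open>x - a\<close> is still to the right of
  \<open>q\<close> because \<open>q < L - a\<close>. The left side is symmetric, with
  \<open>-L + a < q\<close>.\<close>

lemma extend_sign:
  assumes mono: "\<And>y. \<bar>y\<bar> \<le> L \<Longrightarrow> \<bar>y - a\<bar> \<le> L \<Longrightarrow> g y \<le> g (y - a)"
    and q: "- L + a < q" "q < L - a"
    and neg: "\<And>y. q < y \<Longrightarrow> y \<le> L \<Longrightarrow> g y \<le> 0" and pos: "\<And>y. - L \<le> y \<Longrightarrow> y < q \<Longrightarrow> 0 \<le> g y"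
  shows "(q < y \<longrightarrow> extend L a g y \<le> 0) \<and> (y < q \<longrightarrow> 0 \<le> extend L a g y)"
proof -
  have inc: "extend L a g y \<le> extend L a g (y - a)" for y by (rule extend_increment_le) (rule mono)
  show ?thesis
proof (induction y rule: extend_induct)
  case (base x)
  then show ?case using neg pos by (auto simp: extend_base abs_le_iff)
next
  case (step x)
  show ?case
  proof (cases "x > 0")
    case True
    then have "x > L" "sgn x = 1" using step(1) by auto
    then show ?thesis using step(2) inc[of x] q a aL by auto
  next
    case False
    then have "x < - L" "sgn x = - 1" using step(1) a aL by auto
    then show ?thesis using step(2) inc[of "x + a"] q a aL by auto
  qed
qed
qed

text \<open>Counterpart of \<open>extend_bound\<close> for data that are merely integrable. On the
  growing intervals \<open>D n\<close> the \<open>L\<^sup>1\<close> norm increases at most by the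
  factor \<open>7 = 1 + 3 + 3\<close> per step: the old interval and three terms on each side. The
  weight contributes \<open>1 / 14\<close> per step, so the series has ratio \<open>1 / 2\<close>
  and sum \<open>14 * 2 = 28\<close>.\<close>

lemma extend_L1_weighted:
  assumes g [measurable]: "g \<in> borel_measurable borel"
  shows "(\<integral>\<^sup>+x. ennreal (\<bar>extend L a g x\<bar> * exp (- (ln 14 / a) * \<bar>x\<bar>)) \<partial>lborel)
    \<le> 28 * (\<integral>\<^sup>+x\<in>{-L..L}. ennreal \<bar>g x\<bar> \<partial>lborel)"
proof -
  define D where "D = (\<lambda>n::nat. {x. \<bar>x\<bar> \<le> L + real n * a})"
  have D [measurable]: "D n \<in> sets borel" for n unfolding D_def by measurable
  define h where "h = (\<lambda>n x. ennreal \<bar>extend L a g x\<bar> * indicator (D n) x)"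
  have hm [measurable]: "h n \<in> borel_measurable borel" for n unfolding h_def by measurable
  define J where "J = (\<lambda>n. \<integral>\<^sup>+x. h n x \<partial>lborel)"
  have sh: "(\<integral>\<^sup>+x. h n (b + c * x) \<partial>lborel) = J n" if "\<bar>c\<bar> = 1" for n b c
    using nn_integral_real_affine[OF hm, of c n b] that unfolding J_def by auto
  have Jstep: "J (Suc n) \<le> 7 * J n" for n
  proof -
    have "h (Suc n) x \<le> h n x + (h n (- a + 1 * x) + h n (2 * L + (-1) * x) + h n (2 * L - a + (-1) * x))
       + (h n (a + 1 * x) + h n (- 2 * L + (-1) * x) + h n (- 2 * L + a + (-1) * x))" (is "_ \<le> ?R") for x
    proof (cases "\<bar>x\<bar> \<le> L")
      case True
      have "0 \<le> real n * a" using a by simp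
      then have "x \<in> D n" using True unfolding D_def mem_Collect_eq by linarith
      then have "h (Suc n) x \<le> h n x" by (auto simp: h_def indicator_def)
      then show ?thesis by (simp add: add_increasing2 add.assoc)
    next
      case False
      show ?thesis
      proof (cases "x \<in> D (Suc n)")
        case True
        have x: "L < \<bar>x\<bar>" using False by simp
        note args = extension_args[OF x True[unfolded D_def mem_Collect_eq]]
        have "ennreal \<bar>extend L a g x\<bar> \<le> ennreal (\<bar>extend L a g (x - sgn x * a)\<bar> + \<bar>extend L a g (2 * sgn x * L - x)\<bar>
          + \<bar>extend L a g (2 * sgn x * L - sgn x * a - x)\<bar>)"
          unfolding extend_rec[OF x] by (intro ennreal_leI) linarith
        also have "\<dots> = h n (x - sgn x * a) + h n (2 * sgn x * L - x) + h n (2 * sgn x * L - sgn x * a - x)"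
          using args by (simp add: h_def D_def)
        also have "\<dots> \<le> ?R"
        proof (cases "x > 0")
          case True
          then have eq: "x - sgn x * a = - a + 1 * x" "2 * sgn x * L - x = 2 * L + (-1) * x"
            "2 * sgn x * L - sgn x * a - x = 2 * L - a + (-1) * x" by simp_all
          show ?thesis unfolding eq by (intro add_increasing2 add_increasing order_refl) auto
        next
          case False
          then have "sgn x = -1" using x a aL by auto
          then have eq: "x - sgn x * a = a + 1 * x" "2 * sgn x * L - x = - 2 * L + (-1) * x"
            "2 * sgn x * L - sgn x * a - x = - 2 * L + a + (-1) * x" by simp_all
          show ?thesis unfolding eq by (rule add_increasing) auto
        qed
        finally show ?thesis using True by (simp add: h_def)
      qed (simp add: h_def)
    qed
    then have "J (Suc n) \<le> (\<integral>\<^sup>+x. h n x + (h n (- a + 1 * x) + h n (2 * L + (-1) * x) + h n (2 * L - a + (-1) * x))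
       + (h n (a + 1 * x) + h n (- 2 * L + (-1) * x) + h n (- 2 * L + a + (-1) * x)) \<partial>lborel)"
      unfolding J_def by (rule nn_integral_mono)
    also have "\<dots> = J n + (J n + J n + J n) + (J n + J n + J n)"
    proof -
      have "(\<lambda>x. h n (b + c * x)) \<in> borel_measurable lborel" for b c by measurable
      moreover have "h n \<in> borel_measurable lborel" by measurable
      moreover have "integral\<^sup>N lborel (h n) = J n" by (simp add: J_def)
      ultimately show ?thesis
        by (simp only: nn_integral_add borel_measurable_add sh abs_one abs_neg_one)
    qed
    also have "\<dots> = 7 * J n"
    proof -
      have "(7::ennreal) = 1 + (1 + 1 + 1) + (1 + 1 + 1)" by simp
      then show ?thesis by (simp only: distrib_right mult_1)
    qed
    finally show ?thesis .
  qed
  have Jn: "J n \<le> 7 ^ n * J 0" for n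
  proof (induction n)
    case (Suc n)
    have "J (Suc n) \<le> 7 * (7 ^ n * J 0)" using Jstep[of n] mult_left_mono[OF Suc, of 7] by (auto intro: order_trans)
    then show ?case by (simp add: mult_ac)
  qed simp
  have "(\<integral>\<^sup>+x. ennreal (\<bar>extend L a g x\<bar> * exp (- (ln 14 / a) * \<bar>x\<bar>)) \<partial>lborel)
    \<le> (\<integral>\<^sup>+x. (\<Sum>n. ennreal (14 * (1 / 14) ^ n) * h n x) \<partial>lborel)"
  proof (rule nn_integral_mono)
    fix x :: real
    define n where "n = (LEAST n. x \<in> D n)"
    have ex: "\<exists>n. x \<in> D n" using bound_by_steps[of x] by (simp add: D_def)
    have n: "x \<in> D n" unfolding n_def using ex by (rule LeastI_ex)
    \<comment> \<open>If \<open>n = m + 1\<close>, minimality puts \<open>x\<close> outside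
      \<open>D m\<close>, so only \<open>m\<close> steps of decay are certain; this off-by-one is
      the factor 14.\<close>
    have "exp (- (ln 14 / a) * \<bar>x\<bar>) \<le> 14 * (1 / 14) ^ n"
    proof (cases n)
      case 0
      have "exp (- (ln 14 / a) * \<bar>x\<bar>) \<le> 1" using a by simp
      then show ?thesis unfolding 0 power_0 by linarith
    next
      case (Suc m)
      then have "x \<notin> D m" unfolding n_def using not_less_Least by (metis lessI)
      then have "real m * a \<le> \<bar>x\<bar>" using a aL by (simp add: D_def)
      then have "- (ln 14 / a) * \<bar>x\<bar> \<le> - (ln 14 / a) * (real m * a)"
        using a by (intro mult_left_mono_neg) auto
      also have "\<dots> = real m * ln (1 / 14)" using a by (simp add: ln_div)
      finally have "exp (- (ln 14 / a) * \<bar>x\<bar>) \<le> exp (real m * ln (1 / 14))" by simp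
      also have "\<dots> = (1 / 14) ^ m" by (simp add: exp_of_nat_mult)
      finally show ?thesis using Suc by simp
    qed
    then have "ennreal (\<bar>extend L a g x\<bar> * exp (- (ln 14 / a) * \<bar>x\<bar>)) \<le> ennreal (\<bar>extend L a g x\<bar> * (14 * (1 / 14) ^ n))"
      by (intro ennreal_leI mult_left_mono) auto
    also have "\<dots> = ennreal (14 * (1 / 14) ^ n) * h n x"
      using n by (simp add: h_def ennreal_mult' mult.commute)
    also have "\<dots> = (\<Sum>m\<in>{n}. ennreal (14 * (1 / 14) ^ m) * h m x)" by simp
    also have "\<dots> \<le> (\<Sum>n. ennreal (14 * (1 / 14) ^ n) * h n x)"
      by (rule sum_le_suminf) auto
    finally show "ennreal (\<bar>extend L a g x\<bar> * exp (- (ln 14 / a) * \<bar>x\<bar>)) \<le> (\<Sum>n. ennreal (14 * (1 / 14) ^ n) * h n x)" .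
  qed
  also have "\<dots> = (\<Sum>n. ennreal (14 * (1 / 14) ^ n) * J n)"
    by (subst nn_integral_suminf) (auto simp: nn_integral_cmult J_def)
  also have "\<dots> \<le> (\<Sum>n. ennreal (14 * (1 / 2) ^ n) * J 0)"
  proof (rule suminf_le)
    fix n
    have "ennreal (14 * (1 / 14) ^ n) * J n \<le> ennreal (14 * (1 / 14) ^ n) * (7 ^ n * J 0)"
      by (intro mult_left_mono Jn) auto
    also have "\<dots> = ennreal (14 * (1 / 14) ^ n * 7 ^ n) * J 0"
      by (simp add: ennreal_mult mult.assoc ennreal_power[symmetric])
    also have "14 * (1 / 14 :: real) ^ n * 7 ^ n = 14 * (1 / 2) ^ n"
      by (simp add: power_mult_distrib[symmetric] mult.assoc)
    finally show "ennreal (14 * (1 / 14) ^ n) * J n \<le> ennreal (14 * (1 / 2) ^ n) * J 0" .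
  qed auto
  also have "\<dots> = (\<Sum>n. ennreal (14 * (1 / 2) ^ n)) * J 0" by (rule ennreal_suminf_multc)
  also have "(\<Sum>n. ennreal (14 * (1 / 2) ^ n)) = ennreal 28"
  proof (rule suminf_ennreal_eq)
    show "(\<lambda>n. 14 * (1 / 2 :: real) ^ n) sums 28"
      using sums_mult[OF geometric_sums[of "1 / 2 :: real"], of 14] by simp
  qed auto
  also have "J 0 = (\<integral>\<^sup>+x\<in>{-L..L}. ennreal \<bar>g x\<bar> \<partial>lborel)"
    unfolding J_def h_def by (rule nn_integral_cong) (auto simp: D_def extend_base indicator_def)
  finally show ?thesis by simp
qed

end


section \<open>Boundary values and smoothness of the extension\<close>

lemma slope_bound:
  assumes bs: "bounded_slope U u" and "0 < s"
  obtains M where "\<And>x t. (x, t) \<in> U \<Longrightarrow> s \<le> t \<Longrightarrow> t \<le> T \<Longrightarrow> \<bar>Dx u x t\<bar> \<le> M"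
proof -
  have "bounded ((\<lambda>(x, t). Dx u x t) ` (U \<inter> UNIV \<times> {s..T}))"
    using assms unfolding bounded_slope_def by blast
  then obtain M where M: "\<And>y. y \<in> (\<lambda>(x, t). Dx u x t) ` (U \<inter> UNIV \<times> {s..T}) \<Longrightarrow> \<bar>y\<bar> \<le> M"
    unfolding bounded_iff by auto
  show ?thesis
  proof (rule that[of M])
    fix x t assume "(x, t) \<in> U" "s \<le> t" "t \<le> T"
    then have "Dx u x t \<in> (\<lambda>(x, t). Dx u x t) ` (U \<inter> UNIV \<times> {s..T})"
      by (intro image_eqI[of _ _ "(x, t)"]) auto
    then show "\<bar>Dx u x t\<bar> \<le> M" by (rule M)
  qed
qed

lemma cylinder_slope_bound:
  assumes bs: "bounded_slope (cylinder L) u" and s: "0 < s"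
  obtains M where "\<And>x t. \<bar>x\<bar> < L \<Longrightarrow> s \<le> t \<Longrightarrow> t \<le> T \<Longrightarrow> \<bar>Dx u x t\<bar> \<le> M"
proof -
  obtain M where M: "\<And>x t. (x, t) \<in> cylinder L \<Longrightarrow> s \<le> t \<Longrightarrow> t \<le> T \<Longrightarrow> \<bar>Dx u x t\<bar> \<le> M"
    using slope_bound[OF bs s] by blast
  show ?thesis by (rule that[of M], rule M) (use s in \<open>auto simp: cylinder_def\<close>)
qed

lemma open_cylinder: "open (cylinder L)"
  unfolding cylinder_def by (intro open_Times open_greaterThanLessThan open_greaterThan)

text \<open>The values of a heat solution at \<open>x = L\<close> and \<open>x = -L\<close> are
  irrelevant, so they are replaced by limits from inside. Time comes before space to make
  \<open>closed_ext L F t\<close> an argument for \<open>extend\<close>.\<close>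

definition closed_ext :: "real \<Rightarrow> (real \<Rightarrow> real \<Rightarrow> real) \<Rightarrow> real \<Rightarrow> real \<Rightarrow> real" where
  "closed_ext L F t x = (if \<bar>x\<bar> = L then Lim (at x within {-L<..<L}) (\<lambda>y. F y t) else F x t)"

context
  fixes L a :: real and F :: "real \<Rightarrow> real \<Rightarrow> real"
  assumes a: "0 < a" and aL: "a < L"
    and cal: "caloric_on (cylinder L) F" and bs: "bounded_slope (cylinder L) F"
    and left: "\<And>t. 0 < t \<Longrightarrow> left_slope L F t (Dx F (- L + a) t)"
    and right: "\<And>t. 0 < t \<Longrightarrow> right_slope L F t (Dx F (L - a) t)"
begin

private lemma FD: "continuous_on (cylinder L) (\<lambda>(x, t). F x t)" "continuous_on (cylinder L) (\<lambda>(x, t). Dx F x t)"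
  "\<And>x t. \<bar>x\<bar> < L \<Longrightarrow> 0 < t \<Longrightarrow> ((\<lambda>y. F y t) has_field_derivative Dx F x t) (at x)"
  using caloric_onD[OF open_cylinder cal] by (auto simp: cylinder_def abs_less_iff)

private lemma Dx_slice: "\<bar>x\<bar> < L \<Longrightarrow> 0 < t \<Longrightarrow> ((\<lambda>y. Dx F y t) \<longlongrightarrow> Dx F x t) (at x)"
  using caloric_onD(5)[OF open_cylinder cal, of x t, THEN DERIV_isCont]
  by (auto simp: cylinder_def isCont_def abs_less_iff)

private lemma F_lipschitz:
  assumes M: "\<And>x. \<bar>x\<bar> < L \<Longrightarrow> \<bar>Dx F x t\<bar> \<le> M" and "0 < t" "\<bar>x\<bar> < L" "\<bar>y\<bar> < L"
  shows "\<bar>F x t - F y t\<bar> \<le> M * \<bar>x - y\<bar>"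
proof -
  have "norm (F x t - F y t) \<le> M * norm (x - y)"
  proof (rule field_differentiable_bound[where S = "{-L<..<L}" and f' = "\<lambda>x. Dx F x t"])
    fix z assume "z \<in> {-L<..<L}"
    then have z: "\<bar>z\<bar> < L" unfolding greaterThanLessThan_iff by linarith
    show "((\<lambda>x. F x t) has_field_derivative Dx F z t) (at z within {-L<..<L})"
      by (rule has_field_derivative_at_within[OF FD(3)[OF z assms(2)]])
    show "norm (Dx F z t) \<le> M" using M[OF z] by simp
  next
    show "x \<in> {-L<..<L}" "y \<in> {-L<..<L}"
      using assms(3,4) unfolding greaterThanLessThan_iff by linarith+
  qed simp
  then show ?thesis by simp
qed

private lemma closure_pt: "\<bar>x\<bar> = L \<Longrightarrow> x \<in> closure {-L<..<L}" "\<bar>x\<bar> = L \<Longrightarrow> at x within {-L<..<L} \<noteq> bot"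
proof -
  assume x: "\<bar>x\<bar> = L"
  then have *: "x \<in> closure {-L<..<L}" "x \<notin> {-L<..<L}" using a aL by (auto simp: closure_greaterThanLessThan)
  then show "x \<in> closure {-L<..<L}" by simp
  show "at x within {-L<..<L} \<noteq> bot" using * by (simp add: trivial_limit_within islimpt_in_closure)
qed

text \<open>The bounded slope makes \<open>F\<close> Lipschitz in space, hence uniformly continuous
  up to the ends.\<close>

private lemma closed_ext_limit:
  assumes "\<bar>x\<bar> = L" "0 < t"
  shows "((\<lambda>y. F y t) \<longlongrightarrow> closed_ext L F t x) (at x within {-L<..<L})"
proof -
  obtain M where M: "\<And>x. \<bar>x\<bar> < L \<Longrightarrow> \<bar>Dx F x t\<bar> \<le> M"
    using cylinder_slope_bound[OF bs assms(2), of t] by (metis order_refl)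
  have "uniformly_continuous_on {-L<..<L} (\<lambda>y. F y t)"
  proof (rule lipschitz_on_uniformly_continuous[where L = M], rule lipschitz_onI)
    show "0 \<le> M" using M[of 0] a aL by auto
  qed (use F_lipschitz[OF M assms(2)] in \<open>auto simp: dist_real_def\<close>)
  from uniformly_continuous_on_extension_at_closure[OF this closure_pt(1)[OF assms(1)]]
  obtain l where l: "((\<lambda>y. F y t) \<longlongrightarrow> l) (at x within {-L<..<L})" .
  then have "Lim (at x within {-L<..<L}) (\<lambda>y. F y t) = l"
    by (intro tendsto_Lim closure_pt assms)
  then show ?thesis using l assms by (simp add: closed_ext_def)
qed

private lemma closed_ext_lipschitz:
  assumes M: "\<And>x. \<bar>x\<bar> < L \<Longrightarrow> \<bar>Dx F x t\<bar> \<le> M" and t: "0 < t" and y: "\<bar>y\<bar> < L" and x: "\<bar>x\<bar> \<le> L"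
  shows "\<bar>closed_ext L F t x - F y t\<bar> \<le> M * \<bar>x - y\<bar>"
proof (cases "\<bar>x\<bar> = L")
  case False
  then show ?thesis using F_lipschitz[OF M t, of x y] x y by (simp add: closed_ext_def)
next
  case True
  show ?thesis
  proof (rule tendsto_le[OF closure_pt(2)[OF True]])
    show "((\<lambda>z. M * \<bar>z - y\<bar>) \<longlongrightarrow> M * \<bar>x - y\<bar>) (at x within {-L<..<L})"
      by (intro tendsto_intros)
    show "((\<lambda>z. \<bar>F z t - F y t\<bar>) \<longlongrightarrow> \<bar>closed_ext L F t x - F y t\<bar>) (at x within {-L<..<L})"
      by (intro tendsto_intros closed_ext_limit True t)
    show "\<forall>\<^sub>F z in at x within {-L<..<L}. \<bar>F z t - F y t\<bar> \<le> M * \<bar>z - y\<bar>"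
      unfolding eventually_at_filter
      by (rule always_eventually) (use F_lipschitz[OF M t _ y] in \<open>auto simp: abs_less_iff\<close>)
  qed
qed

text \<open>The slope bound is uniform in time near \<open>t0\<close>, so values near
  \<open>x0\<close> can be compared with those at a fixed interior abscissa \<open>y\<close> close
  to \<open>x0\<close>, where continuity in time is known.\<close>

private lemma continuous_closed_ext:
  "continuous_on ({-L..L} \<times> {0<..}) (\<lambda>(x, t). closed_ext L F t x)"
  unfolding continuous_on_iff
proof (intro ballI allI impI)
  fix z :: "real \<times> real" and e :: real assume z: "z \<in> {-L..L} \<times> {0<..}" and e: "e > 0"
  obtain x0 t0 where xt: "z = (x0, t0)" "\<bar>x0\<bar> \<le> L" "0 < t0" using z by (cases z) (auto simp: abs_le_iff)
  obtain M where M: "\<And>x t. \<bar>x\<bar> < L \<Longrightarrow> t0 / 2 \<le> t \<Longrightarrow> t \<le> 2 * t0 \<Longrightarrow> \<bar>Dx F x t\<bar> \<le> M"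
    using cylinder_slope_bound[OF bs, of "t0 / 2" "2 * t0"] xt(3) by (metis half_gt_zero)
  have M0: "M \<ge> 0" using M[of 0 t0] a aL xt by auto
  define h where "h = e / (8 * (M + 1))"
  have h: "h > 0" "M * h < e / 8" using e M0 by (auto simp: h_def field_simps)
  define y where "y = (if \<bar>x0\<bar> < L then x0 else x0 - sgn x0 * min h L)"
  have y: "\<bar>y\<bar> < L" "\<bar>x0 - y\<bar> \<le> h"
    using h(1) a aL xt(2) by (auto simp: y_def sgn_if abs_if split: if_splits)
  have "continuous_on {0<..} (\<lambda>t. (\<lambda>(x, t). F x t) (y, t))"
    by (rule continuous_on_compose2[OF FD(1)]) (use y in \<open>auto intro!: continuous_intros simp: cylinder_def abs_less_iff\<close>)
  then have "continuous_on {0<..} (F y)" by simp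
  then obtain d where d: "d > 0" "\<And>t. 0 < t \<Longrightarrow> dist t t0 < d \<Longrightarrow> dist (F y t) (F y t0) < e / 4"
    unfolding continuous_on_iff using xt(3) e by (metis divide_pos_pos greaterThan_iff zero_less_numeral)
  define d' where "d' = Min {d, t0 / 2, h}"
  have d': "d' > 0" "d' \<le> d" "d' \<le> t0 / 2" "d' \<le> h" using d(1) xt(3) h(1) by (auto simp: d'_def)
  show "\<exists>d>0. \<forall>z'\<in>{-L..L} \<times> {0<..}. dist z' z < d \<longrightarrow>
      dist (case z' of (x, t) \<Rightarrow> closed_ext L F t x) (case z of (x, t) \<Rightarrow> closed_ext L F t x) < e"
  proof (intro exI[of _ d'] conjI ballI impI d'(1))
    fix z' assume z': "z' \<in> {-L..L} \<times> {0<..}" "dist z' z < d'"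
    obtain x t where xt': "z' = (x, t)" "\<bar>x\<bar> \<le> L" "0 < t" using z'(1) by (cases z') (auto simp: abs_le_iff)
    have dd: "\<bar>x - x0\<bar> < d'" "\<bar>t - t0\<bar> < d'"
      using z'(2) dist_fst_le[of z' z] dist_snd_le[of z' z] by (auto simp: xt xt' dist_real_def)
    have tt: "t0 / 2 \<le> t" "t \<le> 2 * t0" using dd d' by linarith+
    have "\<bar>closed_ext L F t x - F y t\<bar> \<le> M * \<bar>x - y\<bar>"
      by (rule closed_ext_lipschitz[OF M[OF _ tt] xt'(3) y(1) xt'(2)])
    also have "\<dots> \<le> M * (2 * h)" using dd d' y M0 by (intro mult_left_mono) linarith+
    finally have 1: "\<bar>closed_ext L F t x - F y t\<bar> \<le> e / 4" using h by linarith
    have "\<bar>closed_ext L F t0 x0 - F y t0\<bar> \<le> M * \<bar>x0 - y\<bar>"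
      by (rule closed_ext_lipschitz[OF M xt(3) y(1) xt(2)]) (use xt in auto)
    also have "\<dots> \<le> M * h" using y M0 by (intro mult_left_mono) linarith+
    finally have 2: "\<bar>closed_ext L F t0 x0 - F y t0\<bar> \<le> e / 8" using h by linarith
    have "\<bar>F y t - F y t0\<bar> < e / 4" using d(2)[OF xt'(3)] dd d' by (simp add: dist_real_def)
    with 1 2 show "dist (case z' of (x, t) \<Rightarrow> closed_ext L F t x) (case z of (x, t) \<Rightarrow> closed_ext L F t x) < e"
      using e unfolding xt(1) xt'(1) prod.case dist_real_def by linarith
  qed
qed

private lemma slope_at_end:
  assumes \<sigma>: "\<sigma> = 1 \<or> \<sigma> = -1" and t: "0 < t"
  shows "((\<lambda>y. Dx F y t) \<longlongrightarrow> Dx F (\<sigma> * (L - a)) t) (at (\<sigma> * L) within {-L<..<L})"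
proof -
  have "at L within {-L<..<L} = at_left L"
    by (rule at_within_nhd[where S = "{-L<..}"]) (use a aL in auto)
  moreover have "at (-L) within {-L<..<L} = at_right (-L)"
    by (rule at_within_nhd[where S = "{..<L}"]) (use a aL in auto)
  ultimately show ?thesis
    using left[OF t] right[OF t] \<sigma> by (auto simp: left_slope_def right_slope_def)
qed

text \<open>With \<open>c\<close> the slope of \<open>F\<close> at
  \<open>\<sigma> * (L - a)\<close>, the slope from inside tends to \<open>c\<close> by the boundary
  condition, and the slope from outside to \<open>c - c + c\<close>, where the middle term is the
  reflected boundary slope. So the slopes match because of the nonlocal condition, and
  \<open>caloric_on_glue_line\<close> applies. The case \<open>\<sigma> = 1\<close> is the right
  end, \<open>\<sigma> = -1\<close> the left end; \<open>\<eta>\<close> is small enough to keep the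
  arguments of the recursion inside the interval.\<close>

private lemma caloric_extend_boundary:
  assumes \<sigma>: "\<sigma> = 1 \<or> \<sigma> = -1"
  defines "\<eta> \<equiv> min a (2 * L - 2 * a)"
  shows "caloric_on ({\<sigma> * L - \<eta> <..< \<sigma> * L + \<eta>} \<times> {0<..}) (\<lambda>x t. extend L a (closed_ext L F t) x)"
proof -
  let ?U = "\<lambda>x t. extend L a (closed_ext L F t) x"
  let ?V = "{\<sigma> * L - \<eta> <..< \<sigma> * L + \<eta>} \<times> {0::real<..}"
  have \<eta>: "\<eta> > 0" "\<eta> \<le> a" "\<eta> \<le> 2 * L - 2 * a" using a aL by (auto simp: \<eta>_def)
  have V: "open ?V" by (intro open_Times open_greaterThanLessThan open_greaterThan)
  have s1: "\<sigma> * \<sigma> = 1" using \<sigma> by auto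
  have inside: "?U x t = closed_ext L F t x" if "\<bar>x - \<sigma> * L\<bar> < \<eta>" "\<sigma> * x \<le> L" for x t
    using that \<sigma> \<eta> a aL by (intro extend_base) (auto simp: abs_if split: if_splits)
  have inside_F: "?U x t = F x t" if "\<bar>x - \<sigma> * L\<bar> < \<eta>" "\<sigma> * x < L" for x t
    using inside[of x t] that \<sigma> \<eta> a aL by (auto simp: closed_ext_def abs_if split: if_splits)
  have args: "\<bar>x - \<sigma> * a\<bar> < L" "\<bar>2 * \<sigma> * L - x\<bar> \<le> L" "\<sigma> * x > L \<Longrightarrow> \<bar>2 * \<sigma> * L - x\<bar> < L" "\<bar>2 * \<sigma> * L - \<sigma> * a - x\<bar> < L"
    if "\<bar>x - \<sigma> * L\<bar> < \<eta>" "\<sigma> * x \<ge> L" for x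
    using that \<sigma> \<eta> a aL by (auto simp: abs_if split: if_splits)
  have outside: "?U x t = F (x - \<sigma> * a) t + closed_ext L F t (2 * \<sigma> * L - x) - F (2 * \<sigma> * L - \<sigma> * a - x) t"
    if x: "\<bar>x - \<sigma> * L\<bar> < \<eta>" "\<sigma> * x \<ge> L" for x t
  proof (cases "\<sigma> * x = L")
    case True
    then have xe: "x = \<sigma> * L" using s1 by (metis mult.assoc mult.left_neutral)
    have "\<bar>\<sigma> * L\<bar> = L" using \<sigma> a aL by auto
    then have "?U x t = closed_ext L F t (\<sigma> * L)" unfolding xe by (intro extend_base) (use a aL in auto)
    then show ?thesis by (simp add: xe algebra_simps)
  next
    case False
    then have x': "\<sigma> * x > L" using x by simp
    then have "L < \<bar>x\<bar>" "sgn x = \<sigma>" using \<sigma> a aL by auto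
    then show ?thesis
      using args[OF x] args(3)[OF x x'] by (simp add: extend_rec[OF a aL] extend_base[OF a aL] closed_ext_def)
  qed
  have outside_F: "?U x t = F (x - \<sigma> * a) t + F (2 * \<sigma> * L - x) t - F (2 * \<sigma> * L - \<sigma> * a - x) t"
    if "\<bar>x - \<sigma> * L\<bar> < \<eta>" "\<sigma> * x > L" for x t
    using outside[of x t] args(3)[of x] that by (simp add: closed_ext_def)
  have Vmem: "(x, t) \<in> ?V \<longleftrightarrow> \<bar>x - \<sigma> * L\<bar> < \<eta> \<and> 0 < t" for x t by (auto simp: abs_less_iff)
  have FD': "((\<lambda>y. F y t) has_field_derivative Dx F x t) (at x)" if "\<bar>x\<bar> < L" "0 < t" for x t using FD(3) that .
  have dxin: "Dx ?U x t = Dx F x t" if "\<bar>x - \<sigma> * L\<bar> < \<eta>" "\<sigma> * x < L" "0 < t" for x t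
  proof -
    have "\<forall>\<^sub>F y in nhds x. ?U y t = F y t"
    proof -
      have "\<forall>\<^sub>F y in nhds x. \<bar>y - \<sigma> * L\<bar> < \<eta>" "\<forall>\<^sub>F y in nhds x. \<sigma> * y < L"
        using that by (auto intro!: order_tendstoD tendsto_intros filterlim_ident)
      then show ?thesis by eventually_elim (rule inside_F)
    qed
    then show ?thesis unfolding Dx_def by (rule deriv_cong_ev) simp
  qed
  have dxout: "Dx ?U x t = Dx F (x - \<sigma> * a) t - Dx F (2 * \<sigma> * L - x) t + Dx F (2 * \<sigma> * L - \<sigma> * a - x) t"
    if x: "\<bar>x - \<sigma> * L\<bar> < \<eta>" "\<sigma> * x > L" and t: "0 < t" for x t
  proof -
    have ev: "\<forall>\<^sub>F y in nhds x. ?U y t = F (y - \<sigma> * a) t + F (2 * \<sigma> * L - y) t - F (2 * \<sigma> * L - \<sigma> * a - y) t"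
    proof -
      have "\<forall>\<^sub>F y in nhds x. \<bar>y - \<sigma> * L\<bar> < \<eta>" "\<forall>\<^sub>F y in nhds x. \<sigma> * y > L"
        using x by (auto intro!: order_tendstoD tendsto_intros filterlim_ident)
      then show ?thesis by eventually_elim (rule outside_F)
    qed
    have ag: "\<bar>x - \<sigma> * a\<bar> < L" "\<bar>2 * \<sigma> * L - x\<bar> < L" "\<bar>2 * \<sigma> * L - \<sigma> * a - x\<bar> < L"
      using args[of x] x by auto
    have ch: "((\<lambda>y. F (m * y + b) t) has_field_derivative Dx F (m * x + b) t * m) (at x)" if "\<bar>m * x + b\<bar> < L" for m b
      by (rule DERIV_chain2[where f = "\<lambda>y. F y t" and g = "\<lambda>y. m * y + b"])
         (use FD'[OF that t] in \<open>auto intro!: derivative_eq_intros\<close>)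
    have "((\<lambda>y. F (1 * y + - (\<sigma> * a)) t + F (- 1 * y + 2 * \<sigma> * L) t - F (- 1 * y + (2 * \<sigma> * L - \<sigma> * a)) t) has_field_derivative
        Dx F (1 * x + - (\<sigma> * a)) t * 1 + Dx F (- 1 * x + 2 * \<sigma> * L) t * (- 1) - Dx F (- 1 * x + (2 * \<sigma> * L - \<sigma> * a)) t * (- 1)) (at x)"
      by (intro DERIV_add DERIV_diff ch) (use ag in \<open>simp_all add: algebra_simps\<close>)
    then have "((\<lambda>y. F (y - \<sigma> * a) t + F (2 * \<sigma> * L - y) t - F (2 * \<sigma> * L - \<sigma> * a - y) t) has_field_derivative
        Dx F (x - \<sigma> * a) t - Dx F (2 * \<sigma> * L - x) t + Dx F (2 * \<sigma> * L - \<sigma> * a - x) t) (at x)"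
      by (simp add: algebra_simps)
    then show ?thesis unfolding Dx_def[of ?U] deriv_cong_ev[OF ev refl] by (auto intro: DERIV_imp_deriv)
  qed
  show ?thesis
  proof (rule caloric_on_glue_line[where \<xi> = "\<sigma> * L", OF V])
    have cc: "continuous_on A (\<lambda>z. closed_ext L F (snd z) (f z))"
      if "continuous_on A f" "\<And>z. z \<in> A \<Longrightarrow> \<bar>f z\<bar> \<le> L \<and> 0 < snd z" for A :: "(real \<times> real) set" and f
    proof -
      have "continuous_on A (\<lambda>z. (\<lambda>(x, t). closed_ext L F t x) (f z, snd z))"
        by (rule continuous_on_compose2[OF continuous_closed_ext])
           (use that in \<open>auto intro!: continuous_intros simp: abs_le_iff dest!: that(2)\<close>)
      then show ?thesis by simp
    qed
    let ?g = "\<lambda>z. closed_ext L F (snd z) (fst z - \<sigma> * a) + closed_ext L F (snd z) (2 * \<sigma> * L - fst z)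
        - closed_ext L F (snd z) (2 * \<sigma> * L - \<sigma> * a - fst z)"
    have "continuous_on ?V (\<lambda>z. if \<sigma> * fst z \<le> L then closed_ext L F (snd z) (fst z) else ?g z)"
    proof (rule continuous_on_cases_le)
      show "continuous_on {z \<in> ?V. \<sigma> * fst z \<le> L} (\<lambda>z. closed_ext L F (snd z) (fst z))"
        by (intro cc continuous_intros) (use \<sigma> \<eta> a aL in \<open>auto simp: abs_le_iff\<close>)
      show "continuous_on {z \<in> ?V. L \<le> \<sigma> * fst z} ?g"
      proof (intro continuous_intros cc)
        fix z assume "z \<in> {z \<in> ?V. L \<le> \<sigma> * fst z}"
        then have z: "\<bar>fst z - \<sigma> * L\<bar> < \<eta>" "L \<le> \<sigma> * fst z" "0 < snd z"
          using Vmem[of "fst z" "snd z"] by auto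
        show "\<bar>fst z - \<sigma> * a\<bar> \<le> L \<and> 0 < snd z" "\<bar>2 * \<sigma> * L - fst z\<bar> \<le> L \<and> 0 < snd z"
          "\<bar>2 * \<sigma> * L - \<sigma> * a - fst z\<bar> \<le> L \<and> 0 < snd z"
          using args[OF z(1,2)] z(3) by auto
      qed
      show "closed_ext L F (snd z) (fst z) = ?g z" if "z \<in> ?V" "\<sigma> * fst z = L" for z
      proof -
        have xe: "fst z = \<sigma> * L" using that(2) s1 by (metis mult.assoc mult.left_neutral)
        show ?thesis by (simp add: xe algebra_simps)
      qed
    qed (intro continuous_intros)
    then show "continuous_on ?V (\<lambda>(x, t). ?U x t)"
    proof (rule continuous_on_eq)
      fix z assume "z \<in> ?V"
      then have z: "\<bar>fst z - \<sigma> * L\<bar> < \<eta>" "0 < snd z" using Vmem[of "fst z" "snd z"] by auto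
      show "(if \<sigma> * fst z \<le> L then closed_ext L F (snd z) (fst z) else ?g z) = (case z of (x, t) \<Rightarrow> ?U x t)"
      proof (cases "\<sigma> * fst z \<le> L")
        case True
        then show ?thesis using inside[OF z(1) True] by (simp add: case_prod_unfold)
      next
        case False
        then have "L \<le> \<sigma> * fst z" by simp
        from outside[OF z(1) this] args[OF z(1) this] False show ?thesis
          by (simp add: case_prod_unfold closed_ext_def)
      qed
    qed
  next
    show "caloric_on (?V \<inter> {z. fst z \<noteq> \<sigma> * L}) ?U"
    proof (rule caloric_on_local)
      fix x t assume "(x, t) \<in> ?V \<inter> {z. fst z \<noteq> \<sigma> * L}"
      then have x: "\<bar>x - \<sigma> * L\<bar> < \<eta>" "0 < t" "x \<noteq> \<sigma> * L" using Vmem by auto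
      have "\<sigma> * x \<noteq> L"
      proof
        assume "\<sigma> * x = L"
        then show False using x(3) s1 by (metis mult.assoc mult.left_neutral)
      qed
      then consider "\<sigma> * x < L" | "\<sigma> * x > L" by linarith
      then show "\<exists>V. open V \<and> (x, t) \<in> V \<and> caloric_on V ?U"
      proof cases
        case 1
        let ?W = "?V \<inter> {z. \<sigma> * fst z < L}"
        have W: "open ?W" by (intro open_Int V open_Collect_less continuous_intros)
        have "caloric_on ?W F"
          by (rule caloric_on_subset[OF cal]) (use \<sigma> \<eta> a aL in \<open>auto simp: cylinder_def\<close>)
        then have "caloric_on ?W ?U" by (rule caloric_on_cong[OF W]) (use inside_F Vmem in auto)
        then show ?thesis using 1 x Vmem W by (intro exI[of _ ?W]) auto
      next
        case 2
        let ?W = "?V \<inter> {z. \<sigma> * fst z > L}"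
        have W: "open ?W" by (intro open_Int V open_Collect_less continuous_intros)
        have Wargs: "\<bar>x - \<sigma> * a\<bar> < L \<and> \<bar>2 * \<sigma> * L - x\<bar> < L \<and> \<bar>2 * \<sigma> * L - \<sigma> * a - x\<bar> < L \<and> 0 < t"
          if "(x, t) \<in> ?W" for x t
        proof -
          from that have xt: "\<bar>x - \<sigma> * L\<bar> < \<eta>" "L < \<sigma> * x" "0 < t" using Vmem by auto
          then show ?thesis using args[OF xt(1)] by simp
        qed
        have Wsub: "?W \<subseteq> {(x, t). (m * x + b, t) \<in> cylinder L}" if "\<And>x t. (x, t) \<in> ?W \<Longrightarrow> \<bar>m * x + b\<bar> < L" for m b
        proof
          fix z assume z: "z \<in> ?W"
          then have "\<bar>m * fst z + b\<bar> < L" by (intro that[of _ "snd z"]) simp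
          then show "z \<in> {(x, t). (m * x + b, t) \<in> cylinder L}"
            using z by (auto simp: cylinder_def abs_less_iff)
        qed
        have "caloric_on {(x, t). (1 * x + - (\<sigma> * a), t) \<in> cylinder L} (\<lambda>x t. 1 * F (1 * x + - (\<sigma> * a)) t)"
          by (rule caloric_on_affine[OF cal]) simp
        then have "caloric_on ?W (\<lambda>x t. 1 * F (1 * x + - (\<sigma> * a)) t)"
          by (rule caloric_on_subset[OF _ Wsub]) (use Wargs in \<open>fastforce simp: algebra_simps\<close>)
        then have 3: "caloric_on ?W (\<lambda>x t. F (x - \<sigma> * a) t)" by (simp add: algebra_simps)
        have "caloric_on {(x, t). (- 1 * x + 2 * \<sigma> * L, t) \<in> cylinder L} (\<lambda>x t. 1 * F (- 1 * x + 2 * \<sigma> * L) t)"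
          by (rule caloric_on_affine[OF cal]) simp
        then have "caloric_on ?W (\<lambda>x t. 1 * F (- 1 * x + 2 * \<sigma> * L) t)"
          by (rule caloric_on_subset[OF _ Wsub]) (use Wargs in \<open>fastforce simp: algebra_simps\<close>)
        then have 4: "caloric_on ?W (\<lambda>x t. F (2 * \<sigma> * L - x) t)" by (simp add: algebra_simps)
        have "caloric_on {(x, t). (- 1 * x + (2 * \<sigma> * L - \<sigma> * a), t) \<in> cylinder L} (\<lambda>x t. - 1 * F (- 1 * x + (2 * \<sigma> * L - \<sigma> * a)) t)"
          by (rule caloric_on_affine[OF cal]) simp
        then have "caloric_on ?W (\<lambda>x t. - 1 * F (- 1 * x + (2 * \<sigma> * L - \<sigma> * a)) t)"
          by (rule caloric_on_subset[OF _ Wsub]) (use Wargs in \<open>fastforce simp: algebra_simps\<close>)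
        then have 5: "caloric_on ?W (\<lambda>x t. - F (2 * \<sigma> * L - \<sigma> * a - x) t)" by (simp add: algebra_simps)
        have "caloric_on ?W ?U"
          by (rule caloric_on_cong[OF W caloric_on_add[OF caloric_on_add[OF 3 4] 5]]) (use outside_F Vmem in auto)
        then show ?thesis using 2 x Vmem W by (intro exI[of _ ?W]) auto
      qed
    qed
  next
    fix K assume K: "compact K" "K \<subseteq> ?V"
    show "bounded ((\<lambda>(x, t). Dx ?U x t) ` (K \<inter> {z. fst z \<noteq> \<sigma> * L}))"
    proof (cases "K = {}")
      case False
      have cK: "compact (snd ` K)" by (intro compact_continuous_image K continuous_intros)
      obtain s where s: "s \<in> snd ` K" "\<And>t. t \<in> snd ` K \<Longrightarrow> s \<le> t" using compact_attains_inf[OF cK] False by auto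
      obtain T where T: "\<And>t. t \<in> snd ` K \<Longrightarrow> t \<le> T" using compact_attains_sup[OF cK] False by auto
      have "0 < s" using s(1) K(2) by auto
      then obtain M where M: "\<And>x t. \<bar>x\<bar> < L \<Longrightarrow> s \<le> t \<Longrightarrow> t \<le> T \<Longrightarrow> \<bar>Dx F x t\<bar> \<le> M"
        using cylinder_slope_bound[OF bs, of s T] by blast
      have "\<bar>Dx ?U x t\<bar> \<le> 3 * M" if "(x, t) \<in> K" "x \<noteq> \<sigma> * L" for x t
      proof -
        have x: "\<bar>x - \<sigma> * L\<bar> < \<eta>" "0 < t" using subsetD[OF K(2) that(1)] unfolding Vmem by auto
        have st: "s \<le> t" "t \<le> T" using s(2) T that by force+
        have M0: "0 \<le> M" using M[OF _ st, of 0] a aL by auto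
        have "\<sigma> * x \<noteq> L"
        proof
          assume "\<sigma> * x = L"
          then show False using that(2) s1 by (metis mult.assoc mult.left_neutral)
        qed
        then consider "\<sigma> * x < L" | "\<sigma> * x > L" by linarith
        then show ?thesis
        proof cases
          case 1
          then have "\<bar>x\<bar> < L" using x \<sigma> \<eta> a aL by (auto simp: abs_if split: if_splits)
          from M[OF this st] show ?thesis using dxin[OF x(1) 1 x(2)] M0 by simp
        next
          case 2
          then have "L \<le> \<sigma> * x" by simp
          note ag = args[OF x(1) this]
          show ?thesis
            using dxout[OF x(1) 2 x(2)] M[OF ag(1) st] M[OF ag(3)[OF 2] st] M[OF ag(4) st] by linarith
        qed
      qed
      then show ?thesis unfolding bounded_iff by (intro exI[of _ "3 * M"]) auto
    qed simp
  next
    fix t assume "(\<sigma> * L, t) \<in> ?V"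
    then have t: "0 < t" by simp
    let ?c = "Dx F (\<sigma> * (L - a)) t"
    have near: "\<forall>\<^sub>F x in at (\<sigma> * L) within S. \<bar>x - \<sigma> * L\<bar> < \<eta>" for S
      using \<eta>(1) unfolding eventually_at by (auto simp: dist_real_def)
    have 1: "((\<lambda>x. Dx ?U x t) \<longlongrightarrow> ?c) (at (\<sigma> * L) within {x. \<sigma> * x < L})"
    proof -
      have "at (\<sigma> * L) within {x. \<sigma> * x < L} = at (\<sigma> * L) within {-L<..<L}"
        by (rule at_within_nhd[where S = "{\<sigma> * L - \<eta> <..< \<sigma> * L + \<eta>}"]) (use \<sigma> \<eta> a aL in auto)
      then have lim: "((\<lambda>y. Dx F y t) \<longlongrightarrow> ?c) (at (\<sigma> * L) within {x. \<sigma> * x < L})"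
        using slope_at_end[OF \<sigma> t] by simp
      have "\<forall>\<^sub>F x in at (\<sigma> * L) within {x. \<sigma> * x < L}. \<sigma> * x < L" by (simp add: eventually_at_filter)
      with near have "\<forall>\<^sub>F x in at (\<sigma> * L) within {x. \<sigma> * x < L}. Dx F x t = Dx ?U x t"
        by eventually_elim (simp add: dxin t)
      with lim show ?thesis by (rule Lim_transform_eventually)
    qed
    have 2: "((\<lambda>x. Dx ?U x t) \<longlongrightarrow> ?c) (at (\<sigma> * L) within {x. \<sigma> * x > L})"
    proof (rule Lim_transform_eventually)
      have in1: "\<bar>\<sigma> * (L - a)\<bar> < L" using \<sigma> a aL by auto
      have A: "((\<lambda>x. Dx F (x - \<sigma> * a) t) \<longlongrightarrow> ?c) (at (\<sigma> * L) within {x. \<sigma> * x > L})"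
        by (rule filterlim_compose[OF Dx_slice[OF in1 t]])
           (auto intro!: tendsto_eq_intros simp: filterlim_at eventually_at_filter algebra_simps)
      have C: "((\<lambda>x. Dx F (2 * \<sigma> * L - \<sigma> * a - x) t) \<longlongrightarrow> ?c) (at (\<sigma> * L) within {x. \<sigma> * x > L})"
        by (rule filterlim_compose[OF Dx_slice[OF in1 t]])
           (auto intro!: tendsto_eq_intros simp: filterlim_at eventually_at_filter algebra_simps)
      have B: "((\<lambda>x. Dx F (2 * \<sigma> * L - x) t) \<longlongrightarrow> ?c) (at (\<sigma> * L) within {x. \<sigma> * x > L})"
      proof (rule filterlim_compose[OF slope_at_end[OF \<sigma> t]])
        have "((\<lambda>x. 2 * \<sigma> * L - x) \<longlongrightarrow> \<sigma> * L) (at (\<sigma> * L) within {x. \<sigma> * x > L})"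
          by (auto intro!: tendsto_eq_intros)
        moreover have "\<forall>\<^sub>F x in at (\<sigma> * L) within {x. \<sigma> * x > L}. 2 * \<sigma> * L - x \<in> {-L<..<L} \<and> 2 * \<sigma> * L - x \<noteq> \<sigma> * L"
        proof -
          have "\<forall>\<^sub>F x in at (\<sigma> * L) within {x. \<sigma> * x > L}. x \<noteq> \<sigma> * L \<and> \<sigma> * x > L"
            by (simp add: eventually_at_filter)
          with near show ?thesis
          proof eventually_elim
            case (elim x)
            then have "\<bar>2 * \<sigma> * L - x\<bar> < L" using args(3)[of x] by auto
            then show ?case using elim by (auto simp: abs_less_iff)
          qed
        qed
        ultimately show "filterlim (\<lambda>x. 2 * \<sigma> * L - x) (at (\<sigma> * L) within {-L<..<L}) (at (\<sigma> * L) within {x. \<sigma> * x > L})"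
          unfolding filterlim_at by simp
      qed
      show "((\<lambda>x. Dx F (x - \<sigma> * a) t - Dx F (2 * \<sigma> * L - x) t + Dx F (2 * \<sigma> * L - \<sigma> * a - x) t) \<longlongrightarrow> ?c)
          (at (\<sigma> * L) within {x. \<sigma> * x > L})"
        using tendsto_add[OF tendsto_diff[OF A B] C] by simp
      have "\<forall>\<^sub>F x in at (\<sigma> * L) within {x. \<sigma> * x > L}. \<sigma> * x > L" by (simp add: eventually_at_filter)
      with near show "\<forall>\<^sub>F x in at (\<sigma> * L) within {x. \<sigma> * x > L}.
          Dx F (x - \<sigma> * a) t - Dx F (2 * \<sigma> * L - x) t + Dx F (2 * \<sigma> * L - \<sigma> * a - x) t = Dx ?U x t"
        by eventually_elim (use dxout t in auto)
    qed
    have "at (\<sigma> * L) = at (\<sigma> * L) within ({x. \<sigma> * x < L} \<union> {x. \<sigma> * x > L})"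
    proof -
      have "{x. \<sigma> * x < L} \<union> {x. \<sigma> * x > L} = UNIV - {\<sigma> * L}" using \<sigma> by auto
      then show ?thesis by (simp add: at_within_def)
    qed
    then have "((\<lambda>x. Dx ?U x t) \<longlongrightarrow> ?c) (at (\<sigma> * L))" using Lim_within_Un 1 2 by metis
    then show "\<exists>c. ((\<lambda>x. Dx ?U x t) \<longlongrightarrow> c) (at (\<sigma> * L))" ..
  qed
qed

text \<open>Induction along the recursion: beyond the ends, the extension is locally a combination
  of translates and reflections of itself at points closer to the interval, with \<open>sgn\<close>
  locally constant. At the ends themselves the gluing lemma takes over.\<close>

lemma caloric_extend: "caloric_on (UNIV \<times> {0<..}) (\<lambda>x t. extend L a (closed_ext L F t) x)"
proof (rule caloric_on_local)
  let ?U = "\<lambda>x t. extend L a (closed_ext L F t) x"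
  have "\<forall>t>0. \<exists>V. open V \<and> (x, t) \<in> V \<and> caloric_on V ?U" for x
  proof (induction x rule: extend_induct[OF a aL])
    case (1 x)
    show ?case
    proof (cases "\<bar>x\<bar> < L")
      case True
      have "caloric_on (cylinder L) ?U"
        by (rule caloric_on_cong[OF open_cylinder cal]) (auto simp: cylinder_def extend_base[OF a aL] closed_ext_def abs_if)
      then show ?thesis using True open_cylinder by (intro allI impI exI[of _ "cylinder L"]) (auto simp: cylinder_def abs_less_iff)
    next
      case False
      then have "(sgn x = 1 \<or> sgn x = -1) \<and> x = sgn x * L"
        using 1 a aL by (auto simp: sgn_if abs_if split: if_splits)
      then obtain \<sigma> where \<sigma>: "\<sigma> = 1 \<or> \<sigma> = -1" "x = \<sigma> * L" by blast
      let ?V = "{\<sigma> * L - min a (2 * L - 2 * a)<..<\<sigma> * L + min a (2 * L - 2 * a)} \<times> {0::real<..}"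
      have "open ?V" by (intro open_Times open_greaterThanLessThan open_greaterThan)
      then show ?thesis using caloric_extend_boundary[OF \<sigma>(1)] \<sigma> a aL by (intro allI impI exI[of _ ?V]) auto
    qed
  next
    case (2 x)
    show ?case
    proof (intro allI impI)
      fix t :: real assume t: "0 < t"
      obtain V1 V2 V3 where V1: "open V1" "(x - sgn x * a, t) \<in> V1" "caloric_on V1 ?U"
        and V2: "open V2" "(2 * sgn x * L - x, t) \<in> V2" "caloric_on V2 ?U"
        and V3: "open V3" "(2 * sgn x * L - sgn x * a - x, t) \<in> V3" "caloric_on V3 ?U"
        using 2(2-4)[rule_format, OF t] by (elim exE conjE) blast
      define \<sigma> where "\<sigma> = sgn x"
      have s: "L < \<sigma> * x" "\<sigma> = 1 \<or> \<sigma> = -1" using 2(1) a aL by (auto simp: \<sigma>_def sgn_if abs_if split: if_splits)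
      define W where "W = {(y, s). (1 * y + - (\<sigma> * a), s) \<in> V1} \<inter> {(y, s). (- 1 * y + 2 * \<sigma> * L, s) \<in> V2}
        \<inter> {(y, s). (- 1 * y + (2 * \<sigma> * L - \<sigma> * a), s) \<in> V3} \<inter> {z. L < \<sigma> * fst z}"
      have op: "open {(y, s). (m * y + b, s) \<in> V}" if "open V" for V :: "(real \<times> real) set" and m b
      proof -
        have "{(y, s). (m * y + b, s) \<in> V} = (\<lambda>z. (m * fst z + b, snd z)) -` V" by auto
        then show ?thesis using that by (auto intro!: open_vimage continuous_intros)
      qed
      have W: "open W" unfolding W_def
        by (intro open_Int op V1 V2 V3 open_Collect_less continuous_intros)
      have c1: "caloric_on W (\<lambda>x t. 1 * ?U (1 * x + - (\<sigma> * a)) t)"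
        by (rule caloric_on_subset[OF caloric_on_affine[OF V1(3)]]) (auto simp: W_def)
      have c2: "caloric_on W (\<lambda>x t. 1 * ?U (- 1 * x + 2 * \<sigma> * L) t)"
        by (rule caloric_on_subset[OF caloric_on_affine[OF V2(3)]]) (auto simp: W_def)
      have c3: "caloric_on W (\<lambda>x t. - 1 * ?U (- 1 * x + (2 * \<sigma> * L - \<sigma> * a)) t)"
        by (rule caloric_on_subset[OF caloric_on_affine[OF V3(3)]]) (auto simp: W_def)
      have "caloric_on W ?U"
      proof (rule caloric_on_cong[OF W caloric_on_add[OF caloric_on_add[OF c1 c2] c3]])
        fix y s' assume "(y, s') \<in> W"
        then have "L < \<bar>y\<bar>" "sgn y = \<sigma>" using s(2) a aL by (auto simp: W_def)
        then show "?U y s' = 1 * ?U (1 * y + - (\<sigma> * a)) s' + 1 * ?U (- 1 * y + 2 * \<sigma> * L) s'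
            + - 1 * ?U (- 1 * y + (2 * \<sigma> * L - \<sigma> * a)) s'"
          by (simp add: extend_rec[OF a aL] algebra_simps)
      qed
      moreover have "(x, t) \<in> W" using V1(2) V2(2) V3(2) s(1) by (simp add: W_def \<sigma>_def[symmetric] algebra_simps)
      ultimately show "\<exists>V. open V \<and> (x, t) \<in> V \<and> caloric_on V ?U" using W by blast
    qed
  qed
  then show "\<exists>V. open V \<and> (x, t) \<in> V \<and> caloric_on V ?U" if "(x, t) \<in> UNIV \<times> {0<..}" for x t
    using that by auto
qed

lemma extend_growth:
  assumes "0 < s"
  obtains M where "\<And>x t. s \<le> t \<Longrightarrow> t \<le> T \<Longrightarrow> \<bar>extend L a (closed_ext L F t) x\<bar> \<le> M * exp (ln 3 / a * \<bar>x\<bar>)"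
proof -
  have "continuous_on ({-L..L} \<times> {s..T}) (\<lambda>(x, t). closed_ext L F t x)"
    by (rule continuous_on_subset[OF continuous_closed_ext]) (use assms in auto)
  moreover have "compact ({-L..L} \<times> {s..T})" by (intro compact_Times) auto
  ultimately obtain M where M: "\<And>z. z \<in> {-L..L} \<times> {s..T} \<Longrightarrow> \<bar>(\<lambda>(x, t). closed_ext L F t x) z\<bar> \<le> M"
    using continuous_on_compact_bound by blast
  show ?thesis
  proof (rule that[of "3 * M"])
    fix x t assume "s \<le> t" "t \<le> T"
    then have "\<bar>closed_ext L F t y\<bar> \<le> M" if "\<bar>y\<bar> \<le> L" for y
      using M[of "(y, t)"] that by (auto simp: abs_le_iff)
    then show "\<bar>extend L a (closed_ext L F t) x\<bar> \<le> 3 * M * exp (ln 3 / a * \<bar>x\<bar>)"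
      by (rule extend_bound[OF a aL])
  qed
qed

end

section \<open>Representation by the heat kernel\<close>

lemma integrable_exp_minus_abs: "integrable lborel (\<lambda>y::real. exp (- \<bar>y\<bar>))"
proof (rule integrableI_nonneg)
  have half: "(\<integral>\<^sup>+y. ennreal (exp (- y)) * indicator {0..} y \<partial>lborel) = ennreal (0 - (- exp (- 0 :: real)))"
  proof (rule nn_integral_FTC_atLeast)
    show "((\<lambda>y::real. - exp (- y)) has_real_derivative exp (- y)) (at y)" if "0 \<le> y" for y
      by (auto intro!: derivative_eq_intros)
    show "((\<lambda>y::real. - exp (- y)) \<longlongrightarrow> 0) at_top"
      using tendsto_minus[OF filterlim_compose[OF exp_at_bot filterlim_uminus_at_bot_at_top]] by simp
  qed auto
  have "(\<integral>\<^sup>+y. ennreal (exp (- \<bar>y\<bar>)) \<partial>(lborel :: real measure))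
      \<le> (\<integral>\<^sup>+y. ennreal (exp (- y)) * indicator {0..} y + ennreal (exp (- (0 + (-1) * y))) * indicator {0..} (0 + (-1) * y) \<partial>lborel)"
    by (intro nn_integral_mono) (auto simp: indicator_def)
  also have "\<dots> = (\<integral>\<^sup>+y. ennreal (exp (- y)) * indicator {0..} y \<partial>lborel)
      + (\<integral>\<^sup>+y. ennreal (exp (- (0 + (-1) * y))) * indicator {0..} (0 + (-1) * y :: real) \<partial>lborel)"
    by (intro nn_integral_add) measurable
  also have "(\<integral>\<^sup>+y. ennreal (exp (- (0 + (-1) * y))) * indicator {0..} (0 + (-1) * y :: real) \<partial>lborel)
      = (\<integral>\<^sup>+y. ennreal (exp (- y)) * indicator {0..} (y::real) \<partial>lborel)"
    using nn_integral_real_affine[of "\<lambda>y. ennreal (exp (- y)) * indicator {0..} y" "-1" 0] by simp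
  finally show "(\<integral>\<^sup>+y. ennreal (exp (- \<bar>y\<bar>)) \<partial>(lborel :: real measure)) < \<infinity>"
    unfolding half by (auto simp: less_top[symmetric] top_unique)
qed auto

text \<open>Two elementary squares: \<open>(x - y)\<^sup>2 \<ge> y\<^sup>2 / 2 - x\<^sup>2\<close>
  and \<open>(k + 1) \<bar>y\<bar> \<le> y\<^sup>2 / (8 T) + 2 T (k + 1)\<^sup>2\<close>. The
  constant does not depend on \<open>\<tau>\<close>, so the bound serves as a dominating function
  while \<open>\<tau>\<close> varies.\<close>

lemma gaussian_domination:
  fixes x y k \<tau> T :: real
  assumes "0 < \<tau>" "\<tau> \<le> T"
  shows "exp (- ((x - y)\<^sup>2 / (4 * \<tau>))) * exp (k * \<bar>y\<bar>) \<le> exp (x\<^sup>2 / (4 * T) + 2 * T * (k + 1)\<^sup>2) * exp (- \<bar>y\<bar>)"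
proof -
  have T: "0 < T" using assms by simp
  have "(x - y)\<^sup>2 / (4 * T) \<le> (x - y)\<^sup>2 / (4 * \<tau>)" using assms by (intro divide_left_mono) auto
  moreover have "(y\<^sup>2 / 2 - x\<^sup>2) / (4 * T) \<le> (x - y)\<^sup>2 / (4 * T)"
  proof (rule divide_right_mono)
    have "0 \<le> (2 * x - y)\<^sup>2" by simp
    then show "y\<^sup>2 / 2 - x\<^sup>2 \<le> (x - y)\<^sup>2" by (simp add: power2_eq_square algebra_simps)
  qed (use T in simp)
  moreover have "0 \<le> (\<bar>y\<bar> - 4 * T * (k + 1))\<^sup>2 / (8 * T)" using T by simp
  moreover have "(\<bar>y\<bar> - 4 * T * (k + 1))\<^sup>2 / (8 * T) = y\<^sup>2 / (8 * T) - (k + 1) * \<bar>y\<bar> + 2 * T * (k + 1)\<^sup>2"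
    using T by (simp add: power2_eq_square field_simps)
  moreover have "(y\<^sup>2 / 2 - x\<^sup>2) / (4 * T) = y\<^sup>2 / (8 * T) - x\<^sup>2 / (4 * T)" using T by (simp add: field_simps)
  ultimately have "- ((x - y)\<^sup>2 / (4 * \<tau>)) + k * \<bar>y\<bar> \<le> x\<^sup>2 / (4 * T) + 2 * T * (k + 1)\<^sup>2 - \<bar>y\<bar>"
    by (simp add: algebra_simps)
  then have "exp (- ((x - y)\<^sup>2 / (4 * \<tau>)) + k * \<bar>y\<bar>) \<le> exp (x\<^sup>2 / (4 * T) + 2 * T * (k + 1)\<^sup>2 - \<bar>y\<bar>)" by simp
  then show ?thesis by (simp add: exp_add exp_diff exp_minus field_simps)
qed

text \<open>The heat kernel without its factor \<open>1 / sqrt (4 * pi)\<close>; the mass of the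
  Gaussian is carried along as an integral, of which only positivity matters later.\<close>

definition gauss :: "real \<Rightarrow> real \<Rightarrow> real" where
  "gauss \<tau> z = exp (- (z\<^sup>2 / (4 * \<tau>))) / sqrt \<tau>"

lemma DERIV_gauss_space:
  assumes "0 < \<tau>"
  shows "((\<lambda>y. gauss \<tau> (x - y)) has_field_derivative (x - y) / (2 * \<tau>) * gauss \<tau> (x - y)) (at y)"
proof -
  have "((\<lambda>y. - ((x - y)\<^sup>2 / (4 * \<tau>))) has_field_derivative (x - y) / (2 * \<tau>)) (at y)"
    using assms by (auto intro!: derivative_eq_intros simp: field_simps)
  from DERIV_cdivide[OF DERIV_fun_exp[OF this], of "sqrt \<tau>"] show ?thesis
    unfolding gauss_def by (simp add: mult_ac)
qed

lemma DERIV_gauss_space2: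
  assumes "0 < \<tau>"
  shows "((\<lambda>y. (x - y) / (2 * \<tau>) * gauss \<tau> (x - y)) has_field_derivative
     ((x - y)\<^sup>2 / (4 * \<tau>\<^sup>2) - 1 / (2 * \<tau>)) * gauss \<tau> (x - y)) (at y)"
proof -
  have "((\<lambda>y. (x - y) / (2 * \<tau>)) has_field_derivative - 1 / (2 * \<tau>)) (at y)"
    using assms by (auto intro!: derivative_eq_intros)
  from DERIV_mult[OF this DERIV_gauss_space[OF assms, of x y]] show ?thesis
    by (rule DERIV_cong) (use assms in \<open>simp add: field_simps power2_eq_square\<close>)
qed

lemma DERIV_gauss_time:
  assumes "s < t"
  shows "((\<lambda>s. gauss (t - s) z) has_field_derivative - ((z\<^sup>2 / (4 * (t - s)\<^sup>2) - 1 / (2 * (t - s))) * gauss (t - s) z)) (at s)"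
proof -
  have \<tau>: "t - s > 0" "sqrt (t - s) > 0" "sqrt (t - s) * sqrt (t - s) = t - s" using assms by auto
  have "((\<lambda>s. exp (- (z\<^sup>2 / (4 * (t - s))))) has_field_derivative
      exp (- (z\<^sup>2 / (4 * (t - s)))) * (- (z\<^sup>2 / (4 * (t - s)\<^sup>2)))) (at s)"
  proof -
    have d: "((\<lambda>s. 4 * (t - s)) has_field_derivative - 4) (at s)" by (auto intro!: derivative_eq_intros)
    have "((\<lambda>s. z\<^sup>2 / (4 * (t - s))) has_field_derivative z\<^sup>2 / (4 * (t - s)\<^sup>2)) (at s)"
    proof (rule DERIV_cong[OF DERIV_divide[OF DERIV_const d]])
      show "(0 * (4 * (t - s)) - z\<^sup>2 * - 4) / (4 * (t - s) * (4 * (t - s))) = z\<^sup>2 / (4 * (t - s)\<^sup>2)"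
      proof -
        have "(0 * (4 * k) - z\<^sup>2 * - 4) / (4 * k * (4 * k)) = z\<^sup>2 / (4 * k\<^sup>2)" if "k \<noteq> 0" for k :: real
          using that by (simp add: field_simps power2_eq_square)
        from this[of "t - s"] assms show ?thesis by auto
      qed
    qed (use assms in simp)
    from DERIV_fun_exp[OF DERIV_minus[OF this]] show ?thesis .
  qed
  moreover have "((\<lambda>s. sqrt (t - s)) has_field_derivative - (1 / (2 * sqrt (t - s)))) (at s)"
    using assms by (auto intro!: derivative_eq_intros simp: field_simps)
  ultimately have "((\<lambda>s. exp (- (z\<^sup>2 / (4 * (t - s)))) / sqrt (t - s)) has_field_derivative
     (exp (- (z\<^sup>2 / (4 * (t - s)))) * (- (z\<^sup>2 / (4 * (t - s)\<^sup>2))) * sqrt (t - s)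
       - exp (- (z\<^sup>2 / (4 * (t - s)))) * - (1 / (2 * sqrt (t - s)))) / (sqrt (t - s) * sqrt (t - s))) (at s)"
    using \<tau> by (intro DERIV_divide) auto
  note d = this
  have alg: "(e * (- k) * r - e * - (1 / (2 * r))) / (r * r) = - ((k - 1 / (2 * (r * r))) * (e / r))"
    if "r > 0" for e k r :: real
    using that by (simp add: field_simps)
  show ?thesis unfolding gauss_def
    by (rule DERIV_cong[OF d], subst alg[OF \<tau>(2)], simp only: \<tau>(3))
qed

lemma continuous_on_gauss [continuous_intros]:
  "continuous_on S f \<Longrightarrow> continuous_on S g \<Longrightarrow> (\<And>z. z \<in> S \<Longrightarrow> 0 < f z) \<Longrightarrow> continuous_on S (\<lambda>z. gauss (f z) (g z))"
  unfolding gauss_def by (intro continuous_intros) (auto simp: less_imp_neq dest: less_imp_neq[symmetric])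

lemma gauss_pos: "0 < \<tau> \<Longrightarrow> 0 < gauss \<tau> z"
  by (simp add: gauss_def)

lemma borel_measurable_gauss [measurable]: "gauss \<tau> \<in> borel_measurable borel"
  unfolding gauss_def by measurable

section \<open>Solutions of exponential growth are given by their initial data\<close>

context
  fixes U :: "real \<Rightarrow> real \<Rightarrow> real" and c :: real
  assumes cal: "caloric_on (UNIV \<times> {0<..}) U" and c: "0 \<le> c"
    and growth: "\<And>s T. 0 < s \<Longrightarrow> \<exists>M. \<forall>x t. s \<le> t \<longrightarrow> t \<le> T \<longrightarrow> \<bar>U x t\<bar> \<le> M * exp (c * \<bar>x\<bar>)"
begin

private lemma oU: "open (UNIV \<times> {0<..} :: (real \<times> real) set)" by (intro open_Times) auto

private lemma UD: "continuous_on (UNIV \<times> {0<..}) (\<lambda>z. U (fst z) (snd z))"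
  "continuous_on (UNIV \<times> {0<..}) (\<lambda>z. Dx (Dx U) (fst z) (snd z))"
  "0 < t \<Longrightarrow> ((\<lambda>y. U y t) has_field_derivative Dx U x t) (at x)"
  "0 < t \<Longrightarrow> ((\<lambda>y. Dx U y t) has_field_derivative Dx (Dx U) x t) (at x)"
  "0 < t \<Longrightarrow> ((\<lambda>s. U x s) has_field_derivative Dx (Dx U) x t) (at t)"
  using caloric_onD[OF oU cal] by (auto simp: case_prod_unfold)

private lemma U_slice: "0 < t \<Longrightarrow> continuous_on S (\<lambda>x. U x t)"
  using UD(3) by (intro continuous_at_imp_continuous_on ballI DERIV_isCont) blast

private lemma U_measurable: "0 < t \<Longrightarrow> (\<lambda>x. U x t) \<in> borel_measurable borel"
  by (intro borel_measurable_continuous_onI U_slice)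

text \<open>A cutoff on \<open>[-R, R]\<close> that vanishes together with its first derivative
  \<open>cut1\<close> at the ends, which removes all boundary terms; \<open>cut1\<close> and
  \<open>cut2\<close> are of order \<open>1 / R\<close>.\<close>

private definition cut where "cut R y = (1 - y\<^sup>2 / R\<^sup>2)\<^sup>2" for R y :: real
private definition cut1 where "cut1 R y = - 4 * y / R\<^sup>2 * (1 - y\<^sup>2 / R\<^sup>2)" for R y :: real
private definition cut2 where "cut2 R y = - 4 / R\<^sup>2 + 12 * y\<^sup>2 / (R\<^sup>2 * R\<^sup>2)" for R y :: real

private lemma dcut: "R > 0 \<Longrightarrow> (cut R has_field_derivative cut1 R y) (at y)"
  "R > 0 \<Longrightarrow> (cut1 R has_field_derivative cut2 R y) (at y)"
  unfolding cut_def[abs_def] cut1_def[abs_def] cut2_def[abs_def]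
  by (auto intro!: derivative_eq_intros simp: field_simps power2_eq_square)

private lemma cut_cont [continuous_intros]:
  "continuous_on S f \<Longrightarrow> continuous_on S (\<lambda>z. cut R (f z))"
  "continuous_on S f \<Longrightarrow> continuous_on S (\<lambda>z. cut1 R (f z))"
  "continuous_on S f \<Longrightarrow> continuous_on S (\<lambda>z. cut2 R (f z))"
  unfolding cut_def cut1_def cut2_def divide_inverse by (intro continuous_intros; assumption)+

private lemma cut_bounds:
  assumes "R \<ge> 1" "\<bar>y\<bar> \<le> R"
  shows "0 \<le> cut R y" "cut R y \<le> 1" "\<bar>cut1 R y\<bar> \<le> 4 / R" "\<bar>cut2 R y\<bar> \<le> 8 / R"
proof -
  define q where "q = y\<^sup>2 / R\<^sup>2"
  have R: "R > 0" using assms by simp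
  have "y\<^sup>2 \<le> R\<^sup>2" using assms by (simp add: abs_le_square_iff[symmetric])
  then have q: "0 \<le> q" "q \<le> 1" using R by (auto simp: q_def)
  show "0 \<le> cut R y" "cut R y \<le> 1" using q by (auto simp: cut_def q_def[symmetric] power_le_one)
  have "\<bar>cut1 R y\<bar> = (4 * (\<bar>y\<bar> / R) * (1 - q)) / R"
    using R q unfolding cut1_def q_def[symmetric] by (simp add: abs_mult power2_eq_square)
  also have "\<dots> \<le> (4 * 1 * 1) / R"
    using assms R q by (intro divide_right_mono mult_mono) auto
  finally show "\<bar>cut1 R y\<bar> \<le> 4 / R" by simp
  have "cut2 R y = (- 4 + 12 * q) / R\<^sup>2" using R by (simp add: cut2_def q_def field_simps)
  then have "\<bar>cut2 R y\<bar> = \<bar>- 4 + 12 * q\<bar> / R\<^sup>2" by simp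
  also have "\<dots> \<le> 8 / R\<^sup>2" using q by (intro divide_right_mono) auto
  also have "\<dots> \<le> 8 / R" using assms R by (intro divide_left_mono) (auto simp: power2_eq_square)
  finally show "\<bar>cut2 R y\<bar> \<le> 8 / R" .
qed

private definition J where "J x t R s = integral {-R..R} (\<lambda>y. cut R y * gauss (t - s) (x - y) * U y s)"

text \<open>In \<open>(y, s)\<close> the kernel solves the backward heat equation. After two
  integrations by parts the terms without derivatives of the cutoff cancel, and only
  \<open>cut1\<close> and \<open>cut2\<close> survive.\<close>

private lemma DERIV_J:
  assumes R: "R > 0" and s: "0 < s" "s < t"
  shows "(J x t R has_field_derivative integral {-R..R} (\<lambda>y. (cut2 R y * gauss (t - s) (x - y)
      + 2 * cut1 R y * ((x - y) / (2 * (t - s)) * gauss (t - s) (x - y))) * U y s)) (at s)"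
proof -
  let ?g = "\<lambda>s y. gauss (t - s) (x - y)" and ?g1 = "\<lambda>s y. (x - y) / (2 * (t - s)) * gauss (t - s) (x - y)"
  let ?g2 = "\<lambda>s y. ((x - y)\<^sup>2 / (4 * (t - s)\<^sup>2) - 1 / (2 * (t - s))) * gauss (t - s) (x - y)"
  let ?D = "\<lambda>s y. cut R y * (- ?g2 s y * U y s + ?g s y * Dx (Dx U) y s)"
  define \<delta> where "\<delta> = min s (t - s) / 2"
  let ?S = "{s - \<delta><..<s + \<delta>}"
  have \<delta>: "\<delta> > 0" "\<delta> < s" "\<delta> < t - s" using s by (auto simp: \<delta>_def)
  have "((\<lambda>s. integral (cbox (-R) R) (\<lambda>y. cut R y * ?g s y * U y s)) has_field_derivative integral (cbox (-R) R) (?D s)) (at s within ?S)"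
  proof (rule leibniz_rule_field_derivative[where fx = ?D])
    fix r y assume r: "r \<in> ?S"
    then have r': "0 < r" "r < t" using \<delta> by auto
    have "((\<lambda>s. ?g s y * U y s) has_field_derivative - ?g2 r y * U y r + Dx (Dx U) y r * ?g r y) (at r)"
      by (rule DERIV_mult[OF DERIV_gauss_time[OF r'(2)] UD(5)[OF r'(1)]])
    from DERIV_cmult[OF this, of "cut R y"]
    have "((\<lambda>s. cut R y * ?g s y * U y s) has_field_derivative ?D r y) (at r)" by (simp add: algebra_simps)
    then show "((\<lambda>s. cut R y * ?g s y * U y s) has_field_derivative ?D r y) (at r within ?S)"
      by (rule has_field_derivative_at_within)
  next
    fix r assume "r \<in> ?S"
    then have r': "0 < r" "r < t" using \<delta> by auto
    show "(\<lambda>y. cut R y * ?g r y * U y r) integrable_on cbox (-R) R"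
      by (intro integrable_continuous continuous_intros U_slice) (use r' in auto)
  next
    have "continuous_on (?S \<times> cbox (-R) R) (\<lambda>z. U (snd z) (fst z))"
      by (rule continuous_on_compose2[OF UD(1), of _ "\<lambda>z. (snd z, fst z)", simplified]) (use \<delta> in \<open>auto intro!: continuous_intros\<close>)
    moreover have "continuous_on (?S \<times> cbox (-R) R) (\<lambda>z. Dx (Dx U) (snd z) (fst z))"
      by (rule continuous_on_compose2[OF UD(2), of _ "\<lambda>z. (snd z, fst z)", simplified]) (use \<delta> in \<open>auto intro!: continuous_intros\<close>)
    ultimately show "continuous_on (?S \<times> cbox (-R) R) (\<lambda>(s, y). ?D s y)"
      unfolding case_prod_unfold by (intro continuous_intros) (use \<delta> in auto)
  qed (use \<delta> in auto)
  moreover have "at s within ?S = at s" using \<delta> by (intro at_within_open) auto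
  moreover have "(\<lambda>s. integral (cbox (-R) R) (\<lambda>y. cut R y * ?g s y * U y s)) = J x t R" by (simp add: J_def fun_eq_iff)
  moreover have "integral (cbox (-R) R) (?D s) = integral {-R..R} (\<lambda>y. (cut2 R y * ?g s y + 2 * cut1 R y * ?g1 s y) * U y s)"
  proof -
    \<comment> \<open>The antiderivative that collects both integrations by parts; it vanishes at
      the two ends because \<open>cut\<close> and \<open>cut1\<close> do.\<close>
    let ?P = "\<lambda>y. cut R y * ?g s y * Dx U y s - (cut1 R y * ?g s y + cut R y * ?g1 s y) * U y s"
    let ?H = "\<lambda>y. (cut2 R y * ?g s y + 2 * cut1 R y * ?g1 s y) * U y s"
    have "((\<lambda>y. ?D s y - ?H y) has_integral ?P R - ?P (- R)) {-R..R}"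
    proof (rule fundamental_theorem_of_calculus)
      fix y assume "y \<in> {-R..R}"
      have ts: "0 < t - s" using s by simp
      note d = dcut[OF R, of y] DERIV_gauss_space[OF ts, of x y] DERIV_gauss_space2[OF ts, of x y] UD(3)[OF s(1), of y] UD(4)[OF s(1), of y]
      have "(?P has_field_derivative ?D s y - ?H y) (at y)"
        by (rule DERIV_cong[OF DERIV_diff[OF DERIV_mult[OF DERIV_mult[OF d(1) d(3)] d(6)]
           DERIV_mult[OF DERIV_add[OF DERIV_mult[OF d(2) d(3)] DERIV_mult[OF d(1) d(4)]] d(5)]]])
           (simp add: algebra_simps)
      then show "(?P has_vector_derivative ?D s y - ?H y) (at y within {-R..R})"
        by (simp add: has_real_derivative_iff_has_vector_derivative has_vector_derivative_at_within)
    qed (use R in simp)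
    moreover have "?P R = 0" "?P (- R) = 0" using R by (simp_all add: cut_def cut1_def)
    ultimately have "integral {-R..R} (\<lambda>y. ?D s y - ?H y) = 0" by (simp add: integral_unique)
    moreover have ts: "0 < t - s" "t - s \<noteq> 0" using s by auto
    have w: "continuous_on {-R..R} (\<lambda>y. Dx (Dx U) y s)"
      by (rule continuous_on_compose2[OF UD(2), of _ "\<lambda>y. (y, s)", simplified]) (use s in \<open>auto intro!: continuous_intros\<close>)
    have "?D s integrable_on {-R..R}" "?H integrable_on {-R..R}"
      by (intro integrable_continuous_real continuous_intros U_slice w; use ts s in simp)+
    ultimately show ?thesis by (simp add: Henstock_Kurzweil_Integration.integral_diff)
  qed
  ultimately show ?thesis by simp
qed

text \<open>Handles the kernel and its space derivative together. The factor linear in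
  \<open>\<bar>x - y\<bar>\<close> is absorbed by one more exponential
  \<open>exp \<bar>y\<bar>\<close>, so that \<open>c + 1\<close> takes the place of \<open>c\<close>
  in \<open>gaussian_domination\<close>.\<close>

private lemma kernel_bound:
  assumes "0 < s1" "s2 < t"
  obtains C where "0 \<le> C" "\<And>s y. s1 \<le> s \<Longrightarrow> s \<le> s2 \<Longrightarrow> (1 + \<bar>x - y\<bar> / (2 * (t - s))) * gauss (t - s) (x - y) * \<bar>U y s\<bar> \<le> C * exp (- \<bar>y\<bar>)"
proof -
  obtain M where M: "\<And>x s. s1 \<le> s \<Longrightarrow> s \<le> s2 \<Longrightarrow> \<bar>U x s\<bar> \<le> M * exp (c * \<bar>x\<bar>)"
    using growth[OF assms(1), of s2] by blast
  define \<tau> where "\<tau> = t - s2"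
  define A where "A = 1 + (\<bar>x\<bar> + 1) / (2 * \<tau>)"
  have \<tau>: "0 < \<tau>" using assms by (simp add: \<tau>_def)
  have A: "A \<ge> 0" using \<tau> by (simp add: A_def)
  define C where "C = A / sqrt \<tau> * \<bar>M\<bar> * exp (x\<^sup>2 / (4 * t) + 2 * t * (c + 1 + 1)\<^sup>2)"
  show ?thesis
  proof (rule that[of C])
    show "0 \<le> C" using A \<tau> by (simp add: C_def)
    fix s y assume s: "s1 \<le> s" "s \<le> s2"
    have ts: "\<tau> \<le> t - s" "0 < t - s" "t - s \<le> t" using s assms by (auto simp: \<tau>_def)
    have "\<bar>x - y\<bar> / (2 * (t - s)) \<le> (\<bar>x\<bar> + \<bar>y\<bar>) / (2 * \<tau>)" using ts \<tau> by (intro frac_le) auto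
    also have "\<dots> \<le> (\<bar>x\<bar> + 1) / (2 * \<tau>) * exp \<bar>y\<bar>"
    proof -
      have "\<bar>x\<bar> * 1 \<le> \<bar>x\<bar> * exp \<bar>y\<bar>" by (intro mult_left_mono) auto
      moreover have "\<bar>y\<bar> \<le> exp \<bar>y\<bar>" using exp_ge_add_one_self[of "\<bar>y\<bar>"] by linarith
      ultimately have "\<bar>x\<bar> + \<bar>y\<bar> \<le> (\<bar>x\<bar> + 1) * exp \<bar>y\<bar>" by (simp add: algebra_simps)
      then show ?thesis using \<tau> by (simp add: divide_right_mono)
    qed
    finally have quot: "\<bar>x - y\<bar> / (2 * (t - s)) \<le> (\<bar>x\<bar> + 1) / (2 * \<tau>) * exp \<bar>y\<bar>" .
    have "1 + \<bar>x - y\<bar> / (2 * (t - s)) \<le> A * exp \<bar>y\<bar>"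
    proof -
      have "1 \<le> exp \<bar>y\<bar>" by simp
      with quot show ?thesis unfolding A_def distrib_right by linarith
    qed
    moreover have "gauss (t - s) (x - y) \<le> exp (- ((x - y)\<^sup>2 / (4 * (t - s)))) / sqrt \<tau>"
      unfolding gauss_def using ts \<tau> by (intro divide_left_mono) auto
    moreover have "\<bar>U y s\<bar> \<le> \<bar>M\<bar> * exp (c * \<bar>y\<bar>)"
      by (rule order_trans[OF M[OF s] mult_right_mono[OF abs_ge_self]]) simp
    ultimately have "(1 + \<bar>x - y\<bar> / (2 * (t - s))) * gauss (t - s) (x - y) * \<bar>U y s\<bar>
      \<le> (A * exp \<bar>y\<bar>) * (exp (- ((x - y)\<^sup>2 / (4 * (t - s)))) / sqrt \<tau>) * (\<bar>M\<bar> * exp (c * \<bar>y\<bar>))"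
      using A \<tau> ts gauss_pos[OF ts(2)] by (intro mult_mono mult_nonneg_nonneg) (auto intro: less_imp_le)
    also have "\<dots> = A / sqrt \<tau> * \<bar>M\<bar> * (exp (- ((x - y)\<^sup>2 / (4 * (t - s)))) * exp ((c + 1) * \<bar>y\<bar>))"
      by (simp add: exp_add algebra_simps)
    also have "\<dots> \<le> A / sqrt \<tau> * \<bar>M\<bar> * (exp (x\<^sup>2 / (4 * t) + 2 * t * (c + 1 + 1)\<^sup>2) * exp (- \<bar>y\<bar>))"
      using A \<tau> ts by (intro mult_left_mono gaussian_domination) auto
    finally show "(1 + \<bar>x - y\<bar> / (2 * (t - s))) * gauss (t - s) (x - y) * \<bar>U y s\<bar> \<le> C * exp (- \<bar>y\<bar>)"
      by (simp add: C_def mult.assoc)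
  qed
qed

private definition I where "I x t s = (\<integral>y. gauss (t - s) (x - y) * U y s \<partial>lborel)"

private lemma J_limit:
  assumes s: "0 < s" "s < t"
  shows "(\<lambda>n. J x t (real (Suc n)) s) \<longlonglongrightarrow> I x t s"
proof -
  obtain C where C: "0 \<le> C" "\<And>y. (1 + \<bar>x - y\<bar> / (2 * (t - s))) * gauss (t - s) (x - y) * \<bar>U y s\<bar> \<le> C * exp (- \<bar>y\<bar>)"
    using kernel_bound[OF s(1) s(2), of x] by (metis order_refl)
  have ts: "0 < t - s" using s by simp
  have g0: "0 \<le> gauss (t - s) (x - y)" for y using gauss_pos[OF ts] less_imp_le by blast
  have bd: "\<bar>gauss (t - s) (x - y) * U y s\<bar> \<le> C * exp (- \<bar>y\<bar>)" for y
  proof -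
    have "1 * gauss (t - s) (x - y) * \<bar>U y s\<bar> \<le> (1 + \<bar>x - y\<bar> / (2 * (t - s))) * gauss (t - s) (x - y) * \<bar>U y s\<bar>"
      using ts g0 by (intro mult_right_mono) auto
    then show ?thesis using C(2)[of y] g0 by (simp add: abs_mult)
  qed
  note [measurable] = U_measurable[OF s(1)]
  have eq: "J x t (real (Suc n)) s = (\<integral>y. indicator {- real (Suc n)..real (Suc n)} y * (cut (real (Suc n)) y * gauss (t - s) (x - y) * U y s) \<partial>lborel)" for n
  proof -
    have "continuous_on {- real (Suc n)..real (Suc n)} (\<lambda>y. cut (real (Suc n)) y * gauss (t - s) (x - y) * U y s)"
      by (intro continuous_intros U_slice) (use s in auto)
    then have "set_integrable lborel {- real (Suc n)..real (Suc n)} (\<lambda>y. cut (real (Suc n)) y * gauss (t - s) (x - y) * U y s)"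
      unfolding set_integrable_def by (intro borel_integrable_compact) auto
    from set_borel_integral_eq_integral(2)[OF this] show ?thesis
      unfolding J_def set_lebesgue_integral_def by simp
  qed
  show ?thesis unfolding eq I_def
  proof (rule integral_dominated_convergence[where w = "\<lambda>y. C * exp (- \<bar>y\<bar>)"])
    show "integrable lborel (\<lambda>y. C * exp (- \<bar>y\<bar>))" using integrable_exp_minus_abs by simp
    show "(\<lambda>y. gauss (t - s) (x - y) * U y s) \<in> borel_measurable lborel" by measurable
    show "(\<lambda>y. indicator {- real (Suc n)..real (Suc n)} y * (cut (real (Suc n)) y * gauss (t - s) (x - y) * U y s)) \<in> borel_measurable lborel" for n
      unfolding cut_def by measurable
    show "AE y in lborel. norm (indicator {- real (Suc n)..real (Suc n)} y * (cut (real (Suc n)) y * gauss (t - s) (x - y) * U y s)) \<le> C * exp (- \<bar>y\<bar>)" for n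
    proof (rule AE_I2)
      fix y :: real
      show "norm (indicator {- real (Suc n)..real (Suc n)} y * (cut (real (Suc n)) y * gauss (t - s) (x - y) * U y s)) \<le> C * exp (- \<bar>y\<bar>)"
      proof (cases "\<bar>y\<bar> \<le> real (Suc n)")
        case True
        have "\<bar>cut (real (Suc n)) y\<bar> * \<bar>gauss (t - s) (x - y) * U y s\<bar> \<le> 1 * \<bar>gauss (t - s) (x - y) * U y s\<bar>"
          using cut_bounds(1,2)[OF _ True] by (intro mult_right_mono) auto
        also have "\<dots> \<le> C * exp (- \<bar>y\<bar>)" using bd by simp
        finally show ?thesis using C(1) by (simp add: abs_mult indicator_def mult.assoc)
      next
        case False
        then have "y \<notin> {- real (Suc n)..real (Suc n)}" unfolding atLeastAtMost_iff by linarith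
        then show ?thesis using C(1) by simp
      qed
    qed
    show "AE y in lborel. (\<lambda>n. indicator {- real (Suc n)..real (Suc n)} y * (cut (real (Suc n)) y * gauss (t - s) (x - y) * U y s))
        \<longlonglongrightarrow> gauss (t - s) (x - y) * U y s"
    proof (rule AE_I2)
      fix y :: real
      have "(\<lambda>n. (1 - y\<^sup>2 * (inverse (real (Suc n)))\<^sup>2)\<^sup>2) \<longlonglongrightarrow> (1 - y\<^sup>2 * 0\<^sup>2)\<^sup>2"
        by (intro tendsto_intros LIMSEQ_inverse_real_of_nat)
      then have "(\<lambda>n. cut (real (Suc n)) y) \<longlonglongrightarrow> 1" by (simp add: cut_def divide_inverse power_inverse)
      then have 1: "(\<lambda>n. cut (real (Suc n)) y * gauss (t - s) (x - y) * U y s) \<longlonglongrightarrow> 1 * gauss (t - s) (x - y) * U y s"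
        by (intro tendsto_intros)
      obtain N where N: "\<bar>y\<bar> \<le> real N" using real_arch_simple by blast
      have "\<forall>\<^sub>F n in sequentially. cut (real (Suc n)) y * gauss (t - s) (x - y) * U y s
          = indicator {- real (Suc n)..real (Suc n)} y * (cut (real (Suc n)) y * gauss (t - s) (x - y) * U y s)"
        by (rule eventually_sequentiallyI[of N]) (use N in \<open>auto simp: indicator_def abs_le_iff\<close>)
      from Lim_transform_eventually[OF 1 this]
      show "(\<lambda>n. indicator {- real (Suc n)..real (Suc n)} y * (cut (real (Suc n)) y * gauss (t - s) (x - y) * U y s))
        \<longlonglongrightarrow> gauss (t - s) (x - y) * U y s" by simp
    qed
  qed
qed

text \<open>The truncated integral \<open>J\<close> changes by at most
  \<open>8 C E \<bar>s1 - s2\<bar> / R\<close> between the two times; let \<open>R\<close> tend to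
  infinity. Here the growth bound on \<open>U\<close> excludes contributions from infinity.\<close>

private lemma I_const:
  assumes s: "0 < s1" "s1 \<le> s2" "s2 < t"
  shows "I x t s1 = I x t s2"
proof -
  obtain C where C: "0 \<le> C" "\<And>s y. s1 \<le> s \<Longrightarrow> s \<le> s2 \<Longrightarrow> (1 + \<bar>x - y\<bar> / (2 * (t - s))) * gauss (t - s) (x - y) * \<bar>U y s\<bar> \<le> C * exp (- \<bar>y\<bar>)"
    using kernel_bound[OF s(1,3), of x] by blast
  define E where "E = (\<integral>y. exp (- \<bar>y :: real\<bar>) \<partial>lborel)"
  have E: "integral {-R..R} (\<lambda>y. exp (- \<bar>y\<bar>)) \<le> E" for R :: real
  proof -
    have si: "set_integrable lborel {-R..R} (\<lambda>y. exp (- \<bar>y\<bar>))"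
    proof (rule set_integrable_subset)
      show "set_integrable lborel UNIV (\<lambda>y::real. exp (- \<bar>y\<bar>))"
        unfolding set_integrable_def using integrable_exp_minus_abs by simp
    qed auto
    have "(LINT y:{-R..R}|lborel. exp (- \<bar>y\<bar>)) \<le> E"
      unfolding E_def set_lebesgue_integral_def
      by (rule integral_mono[OF si[unfolded set_integrable_def] integrable_exp_minus_abs]) (simp add: indicator_def)
    then show ?thesis using set_borel_integral_eq_integral(2)[OF si] by simp
  qed
  have b: "\<bar>J x t (real (Suc n)) s1 - J x t (real (Suc n)) s2\<bar> \<le> (8 * C * E * \<bar>s1 - s2\<bar>) * inverse (real (Suc n))" for n
  proof -
    define R where "R = real (Suc n)"
    have R: "R \<ge> 1" "R > 0" by (auto simp: R_def)
    let ?H = "\<lambda>s y. (cut2 R y * gauss (t - s) (x - y) + 2 * cut1 R y * ((x - y) / (2 * (t - s)) * gauss (t - s) (x - y))) * U y s"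
    have "norm (J x t R s1 - J x t R s2) \<le> (8 * C * E / R) * norm (s1 - s2)"
    proof (rule field_differentiable_bound[where S = "{s1..s2}" and f' = "\<lambda>s. integral {-R..R} (?H s)"])
      fix r assume r: "r \<in> {s1..s2}"
      then have r': "0 < r" "r < t" using s by auto
      then have tr: "0 < t - r" by simp
      show "(J x t R has_field_derivative integral {-R..R} (?H r)) (at r within {s1..s2})"
        by (rule has_field_derivative_at_within[OF DERIV_J[OF R(2) r']])
      have "norm (integral {-R..R} (?H r)) \<le> integral {-R..R} (\<lambda>y. 8 * C / R * exp (- \<bar>y\<bar>))"
      proof (rule Henstock_Kurzweil_Integration.integral_norm_bound_integral)
        show "?H r integrable_on {-R..R}"
          by (intro integrable_continuous_real continuous_intros U_slice; use r' in simp)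
        show "(\<lambda>y. 8 * C / R * exp (- \<bar>y\<bar>)) integrable_on {-R..R}"
          by (intro integrable_continuous_real continuous_intros)
        fix y assume "y \<in> {-R..R}"
        then have y: "\<bar>y\<bar> \<le> R" by auto
        have g0: "0 \<le> gauss (t - r) (x - y)" using gauss_pos[OF tr] less_imp_le by blast
        have "\<bar>cut2 R y * gauss (t - r) (x - y) + 2 * cut1 R y * ((x - y) / (2 * (t - r)) * gauss (t - r) (x - y))\<bar>
          \<le> \<bar>cut2 R y\<bar> * gauss (t - r) (x - y) + \<bar>2 * cut1 R y\<bar> * (\<bar>x - y\<bar> / (2 * (t - r)) * gauss (t - r) (x - y))"
          using g0 tr by (intro order_trans[OF abs_triangle_ineq]) (simp add: abs_mult)
        also have "\<dots> \<le> 8 / R * gauss (t - r) (x - y) + 8 / R * (\<bar>x - y\<bar> / (2 * (t - r)) * gauss (t - r) (x - y))"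
          using g0 tr cut_bounds(3,4)[OF R(1) y] by (intro add_mono mult_right_mono) auto
        also have "\<dots> = 8 / R * ((1 + \<bar>x - y\<bar> / (2 * (t - r))) * gauss (t - r) (x - y))" by (simp add: algebra_simps)
        finally have "norm (?H r y) \<le> 8 / R * ((1 + \<bar>x - y\<bar> / (2 * (t - r))) * gauss (t - r) (x - y)) * \<bar>U y r\<bar>"
          unfolding real_norm_def abs_mult[of _ "U y r"] by (rule mult_right_mono) simp
        also have "\<dots> \<le> 8 / R * (C * exp (- \<bar>y\<bar>))"
          unfolding mult.assoc[of "8 / R"] using C(2)[of r y] r R by (intro mult_left_mono) (auto simp: mult.assoc)
        finally show "norm (?H r y) \<le> 8 * C / R * exp (- \<bar>y\<bar>)" by simp
      qed
      also have "\<dots> \<le> 8 * C / R * E"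
        unfolding Henstock_Kurzweil_Integration.integral_mult_right using E[of R] C(1) R by (intro mult_left_mono) auto
      finally show "norm (integral {-R..R} (?H r)) \<le> 8 * C * E / R" by simp
    qed (use s in auto)
    then show ?thesis by (simp add: R_def divide_inverse mult_ac)
  qed
  have "(\<lambda>n. \<bar>J x t (real (Suc n)) s1 - J x t (real (Suc n)) s2\<bar>) \<longlonglongrightarrow> \<bar>I x t s1 - I x t s2\<bar>"
    by (intro tendsto_intros J_limit) (use s in auto)
  moreover have "(\<lambda>n. (8 * C * E * \<bar>s1 - s2\<bar>) * inverse (real (Suc n))) \<longlonglongrightarrow> 0"
    by (rule tendsto_mult_right_zero[OF LIMSEQ_inverse_real_of_nat])
  ultimately have "\<bar>I x t s1 - I x t s2\<bar> \<le> 0"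
    by (rule LIMSEQ_le) (use b in blast)
  then show ?thesis by simp
qed

text \<open>As the time of the slice increases to \<open>t\<close>, the substitution
  \<open>y = x + sqrt (t - s) z\<close> turns the kernel into a fixed Gaussian, and \<open>U\<close>
  at the moving point tends to \<open>U x t\<close>. By \<open>I_const\<close> the limit is the
  value at every earlier time.\<close>

private lemma I_value:
  assumes s: "0 < s" "s < t"
  shows "I x t s = (\<integral>z. exp (- (z\<^sup>2 / 4)) \<partial>lborel) * U x t"
proof -
  have t: "0 < t" using s by simp
  define r where "r = (\<lambda>n. t - t / 2 * inverse (real (Suc n)))"
  have r: "t / 2 \<le> r n" "r n < t" for n
    using t by (auto simp: r_def field_simps)
  have rp: "0 < r n" for n using r(1)[of n] t by simp
  have rlim: "r \<longlonglongrightarrow> t"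
    unfolding r_def using tendsto_diff[OF tendsto_const tendsto_mult_right_zero[OF LIMSEQ_inverse_real_of_nat, of "t / 2"]] by fastforce
  obtain M where M: "\<And>x s. t / 2 \<le> s \<Longrightarrow> s \<le> t \<Longrightarrow> \<bar>U x s\<bar> \<le> M * exp (c * \<bar>x\<bar>)"
    using growth[of "t / 2" t] t by auto
  have eq: "I x t (r n) = (\<integral>z. exp (- (z\<^sup>2 / 4)) * U (x + sqrt (t - r n) * z) (r n) \<partial>lborel)" for n
  proof -
    have ts: "0 < t - r n" "sqrt (t - r n) > 0" using r(2)[of n] by auto
    have "I x t (r n) = \<bar>sqrt (t - r n)\<bar> *\<^sub>R (\<integral>z. gauss (t - r n) (x - (x + sqrt (t - r n) * z)) * U (x + sqrt (t - r n) * z) (r n) \<partial>lborel)"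
      unfolding I_def by (rule lborel_integral_real_affine) (use ts in simp)
    also have "\<dots> = (\<integral>z. sqrt (t - r n) * (gauss (t - r n) (x - (x + sqrt (t - r n) * z)) * U (x + sqrt (t - r n) * z) (r n)) \<partial>lborel)"
      using ts by simp
    also have "\<dots> = (\<integral>z. exp (- (z\<^sup>2 / 4)) * U (x + sqrt (t - r n) * z) (r n) \<partial>lborel)"
      by (rule Bochner_Integration.integral_cong) (use ts in \<open>auto simp: gauss_def power_mult_distrib field_simps\<close>)
    finally show ?thesis .
  qed
  have "(\<lambda>n. I x t (r n)) \<longlonglongrightarrow> (\<integral>z. exp (- (z\<^sup>2 / 4)) * U x t \<partial>lborel)"
    unfolding eq
  proof (rule integral_dominated_convergence[where w = "\<lambda>z. \<bar>M\<bar> * exp (c * \<bar>x\<bar>) * (exp (0\<^sup>2 / (4 * 1) + 2 * 1 * (c * sqrt t + 1)\<^sup>2) * exp (- \<bar>z\<bar>))"])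
    show "integrable lborel (\<lambda>z. \<bar>M\<bar> * exp (c * \<bar>x\<bar>) * (exp (0\<^sup>2 / (4 * 1) + 2 * 1 * (c * sqrt t + 1)\<^sup>2) * exp (- \<bar>z\<bar>)))"
      using integrable_exp_minus_abs by simp
    show "(\<lambda>z. exp (- (z\<^sup>2 / 4)) * U (x + sqrt (t - r n) * z) (r n)) \<in> borel_measurable lborel" for n
    proof -
      have "0 < r n" using r(1)[of n] t by simp
      note [measurable] = U_measurable[OF this]
      show ?thesis by measurable
    qed
    show "(\<lambda>z. exp (- (z\<^sup>2 / 4)) * U x t) \<in> borel_measurable lborel" by measurable
    show "AE z in lborel. (\<lambda>n. exp (- (z\<^sup>2 / 4)) * U (x + sqrt (t - r n) * z) (r n)) \<longlonglongrightarrow> exp (- (z\<^sup>2 / 4)) * U x t"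
    proof (intro AE_I2 tendsto_mult tendsto_const)
      fix z :: real
      have "(\<lambda>n. x + sqrt (t - r n) * z) \<longlonglongrightarrow> x + sqrt (t - t) * z" by (intro tendsto_intros rlim)
      then have "(\<lambda>n. (x + sqrt (t - r n) * z, r n)) \<longlonglongrightarrow> (x, t)" using rlim by (auto intro!: tendsto_Pair)
      from continuous_on_tendsto_compose[OF UD(1) this]
      show "(\<lambda>n. U (x + sqrt (t - r n) * z) (r n)) \<longlonglongrightarrow> U x t"
        using t rp by simp
    qed
    show "AE z in lborel. norm (exp (- (z\<^sup>2 / 4)) * U (x + sqrt (t - r n) * z) (r n))
       \<le> \<bar>M\<bar> * exp (c * \<bar>x\<bar>) * (exp (0\<^sup>2 / (4 * 1) + 2 * 1 * (c * sqrt t + 1)\<^sup>2) * exp (- \<bar>z\<bar>))" for n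
    proof (rule AE_I2)
      fix z :: real
      have "sqrt (t - r n) \<le> sqrt t" using r[of n] t by simp
      then have "\<bar>sqrt (t - r n) * z\<bar> \<le> sqrt t * \<bar>z\<bar>" using r(2)[of n] by (simp add: abs_mult mult_right_mono)
      then have "\<bar>x + sqrt (t - r n) * z\<bar> \<le> \<bar>x\<bar> + sqrt t * \<bar>z\<bar>" by linarith
      then have "c * \<bar>x + sqrt (t - r n) * z\<bar> \<le> c * (\<bar>x\<bar> + sqrt t * \<bar>z\<bar>)" using c by (rule mult_left_mono)
      then have "exp (c * \<bar>x + sqrt (t - r n) * z\<bar>) \<le> exp (c * \<bar>x\<bar>) * exp (c * sqrt t * \<bar>z\<bar>)"
        by (simp add: exp_add[symmetric] algebra_simps)
      then have "\<bar>M\<bar> * exp (c * \<bar>x + sqrt (t - r n) * z\<bar>) \<le> \<bar>M\<bar> * (exp (c * \<bar>x\<bar>) * exp (c * sqrt t * \<bar>z\<bar>))"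
        by (rule mult_left_mono) simp
      moreover have "\<bar>U (x + sqrt (t - r n) * z) (r n)\<bar> \<le> \<bar>M\<bar> * exp (c * \<bar>x + sqrt (t - r n) * z\<bar>)"
        by (rule order_trans[OF M mult_right_mono[OF abs_ge_self]]) (use r[of n] in auto)
      ultimately have "\<bar>U (x + sqrt (t - r n) * z) (r n)\<bar> \<le> \<bar>M\<bar> * (exp (c * \<bar>x\<bar>) * exp (c * sqrt t * \<bar>z\<bar>))" by linarith
      then have "norm (exp (- (z\<^sup>2 / 4)) * U (x + sqrt (t - r n) * z) (r n))
         \<le> exp (- (z\<^sup>2 / 4)) * (\<bar>M\<bar> * (exp (c * \<bar>x\<bar>) * exp (c * sqrt t * \<bar>z\<bar>)))"
        by (simp add: abs_mult mult_left_mono)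
      also have "\<dots> = \<bar>M\<bar> * exp (c * \<bar>x\<bar>) * (exp (- ((0 - z)\<^sup>2 / (4 * 1))) * exp (c * sqrt t * \<bar>z\<bar>))" by simp
      also have "\<dots> \<le> \<bar>M\<bar> * exp (c * \<bar>x\<bar>) * (exp (0\<^sup>2 / (4 * 1) + 2 * 1 * (c * sqrt t + 1)\<^sup>2) * exp (- \<bar>z\<bar>))"
        by (intro mult_left_mono gaussian_domination) auto
      finally show "norm (exp (- (z\<^sup>2 / 4)) * U (x + sqrt (t - r n) * z) (r n))
       \<le> \<bar>M\<bar> * exp (c * \<bar>x\<bar>) * (exp (0\<^sup>2 / (4 * 1) + 2 * 1 * (c * sqrt t + 1)\<^sup>2) * exp (- \<bar>z\<bar>))" .
    qed
  qed
  moreover have "\<forall>\<^sub>F n in sequentially. I x t (r n) = I x t s"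
    using order_tendstoD(1)[OF rlim s(2)] proof eventually_elim
    case (elim n)
    show ?case by (rule I_const[OF s(1) less_imp_le[OF elim] r(2), symmetric])
  qed
  ultimately have "(\<integral>z. exp (- (z\<^sup>2 / 4)) * U x t \<partial>lborel) = I x t s"
    using LIMSEQ_unique tendsto_eventually by metis
  then show ?thesis by simp
qed

text \<open>Lets the time of the slice in \<open>I\<close> tend to 0. The kernels with
  \<open>\<tau> \<le> t\<close> all lie below one multiple of
  \<open>exp (- \<kappa> * \<bar>y\<bar>)\<close>, so it suffices that \<open>U\<close> attains its
  datum in the correspondingly weighted \<open>L\<^sup>1\<close> norm.\<close>

theorem gaussian_representation:
  assumes t: "0 < t" and \<kappa>: "0 \<le> \<kappa>" and U0 [measurable]: "U0 \<in> borel_measurable borel"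
    and fin: "(\<integral>\<^sup>+y. ennreal (\<bar>U0 y\<bar> * exp (- \<kappa> * \<bar>y\<bar>)) \<partial>lborel) < \<infinity>"
    and lim: "((\<lambda>s. \<integral>\<^sup>+y. ennreal (\<bar>U y s - U0 y\<bar> * exp (- \<kappa> * \<bar>y\<bar>)) \<partial>lborel) \<longlongrightarrow> 0) (at_right 0)"
  shows "integrable lborel (\<lambda>y. exp (- ((x - y)\<^sup>2 / (4 * t))) * U0 y)"
    and "(\<integral>z. exp (- (z\<^sup>2 / 4)) \<partial>lborel) * sqrt t * U x t = (\<integral>y. exp (- ((x - y)\<^sup>2 / (4 * t))) * U0 y \<partial>lborel)"
proof -
  define C where "C = exp (x\<^sup>2 / (4 * t) + 2 * t * (\<kappa> + 1)\<^sup>2)"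
  have dom: "exp (- ((x - y)\<^sup>2 / (4 * \<tau>))) \<le> C * exp (- \<kappa> * \<bar>y\<bar>)" if "0 < \<tau>" "\<tau> \<le> t" for \<tau> y
  proof -
    have "exp (- ((x - y)\<^sup>2 / (4 * \<tau>))) * exp (\<kappa> * \<bar>y\<bar>) \<le> C * exp (- \<bar>y\<bar>)"
      unfolding C_def by (rule gaussian_domination[OF that])
    also have "\<dots> \<le> C * 1" by (intro mult_left_mono) (auto simp: C_def)
    finally show ?thesis by (simp add: exp_minus field_simps)
  qed
  have w: "integrable lborel (\<lambda>y. \<bar>U0 y\<bar> * exp (- \<kappa> * \<bar>y\<bar>))"
    by (rule integrableI_nonneg) (use fin in auto)
  have intU0: "integrable lborel (\<lambda>y. exp (- ((x - y)\<^sup>2 / (4 * \<tau>))) * U0 y)" if \<tau>: "0 < \<tau>" "\<tau> \<le> t" for \<tau>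
  proof (rule Bochner_Integration.integrable_bound)
    show "integrable lborel (\<lambda>y. C * (\<bar>U0 y\<bar> * exp (- \<kappa> * \<bar>y\<bar>)))" using w by (rule integrable_mult_right)
    show "AE y in lborel. norm (exp (- ((x - y)\<^sup>2 / (4 * \<tau>))) * U0 y) \<le> norm (C * (\<bar>U0 y\<bar> * exp (- \<kappa> * \<bar>y\<bar>)))"
    proof (rule AE_I2)
      fix y :: real
      show "norm (exp (- ((x - y)\<^sup>2 / (4 * \<tau>))) * U0 y) \<le> norm (C * (\<bar>U0 y\<bar> * exp (- \<kappa> * \<bar>y\<bar>)))"
        using mult_right_mono[OF dom[OF \<tau>, of y], of "\<bar>U0 y\<bar>"] by (simp add: abs_mult C_def mult_ac)
    qed
  qed measurable
  show int0: "integrable lborel (\<lambda>y. exp (- ((x - y)\<^sup>2 / (4 * t))) * U0 y)" using intU0 t by simp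
  define r where "r = (\<lambda>n. t / 2 * inverse (real (Suc n)))"
  have r: "0 < r n" "r n \<le> t / 2" "r n < t" for n
  proof -
    have "0 < inverse (real (Suc n))" "inverse (real (Suc n)) \<le> 1" by (auto simp: field_simps)
    then show "0 < r n" "r n \<le> t / 2" using t by (auto simp: r_def mult_left_le)
    then show "r n < t" using t by linarith
  qed
  have rlim: "r \<longlonglongrightarrow> 0" unfolding r_def by (rule tendsto_mult_right_zero[OF LIMSEQ_inverse_real_of_nat])
  have rat: "filterlim r (at_right 0) sequentially"
  proof -
    have "r n \<noteq> 0" for n using r(1)[of n] by simp
    then show ?thesis using rlim r(1) by (simp add: filterlim_at)
  qed
  let ?K = "\<lambda>s y. exp (- ((x - y)\<^sup>2 / (4 * (t - s))))"
  have val: "(\<integral>y. ?K (r n) y * U y (r n) \<partial>lborel) = (\<integral>z. exp (- (z\<^sup>2 / 4)) \<partial>lborel) * U x t * sqrt (t - r n)" for n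
  proof -
    have "I x t (r n) = (\<integral>y. ?K (r n) y * U y (r n) / sqrt (t - r n) \<partial>lborel)"
      unfolding I_def gauss_def by simp
    also have "\<dots> = (\<integral>y. ?K (r n) y * U y (r n) \<partial>lborel) / sqrt (t - r n)" by simp
    finally show ?thesis using I_value[OF r(1,3), of x n] r(3)[of n] by (simp add: field_simps)
  qed
  have L1: "(\<lambda>n. (\<integral>y. ?K (r n) y * U y (r n) \<partial>lborel)) \<longlonglongrightarrow> (\<integral>z. exp (- (z\<^sup>2 / 4)) \<partial>lborel) * U x t * sqrt (t - 0)"
    unfolding val by (intro tendsto_intros rlim)
  have L2: "(\<lambda>n. (\<integral>y. ?K (r n) y * U0 y \<partial>lborel)) \<longlonglongrightarrow> (\<integral>y. exp (- ((x - y)\<^sup>2 / (4 * t))) * U0 y \<partial>lborel)"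
  proof (rule integral_dominated_convergence[where w = "\<lambda>y. C * (\<bar>U0 y\<bar> * exp (- \<kappa> * \<bar>y\<bar>))"])
    show "integrable lborel (\<lambda>y. C * (\<bar>U0 y\<bar> * exp (- \<kappa> * \<bar>y\<bar>)))" using w by (rule integrable_mult_right)
    show "AE y in lborel. norm (?K (r n) y * U0 y) \<le> C * (\<bar>U0 y\<bar> * exp (- \<kappa> * \<bar>y\<bar>))" for n
    proof (rule AE_I2)
      fix y :: real
      have "?K (r n) y \<le> C * exp (- \<kappa> * \<bar>y\<bar>)" using r[of n] by (intro dom) auto
      from mult_right_mono[OF this, of "\<bar>U0 y\<bar>"]
      show "norm (?K (r n) y * U0 y) \<le> C * (\<bar>U0 y\<bar> * exp (- \<kappa> * \<bar>y\<bar>))" by (simp add: abs_mult mult_ac)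
    qed
    show "AE y in lborel. (\<lambda>n. ?K (r n) y * U0 y) \<longlonglongrightarrow> exp (- ((x - y)\<^sup>2 / (4 * t))) * U0 y"
    proof (rule AE_I2)
      fix y :: real
      have "(\<lambda>n. ?K (r n) y * U0 y) \<longlonglongrightarrow> exp (- ((x - y)\<^sup>2 / (4 * (t - 0)))) * U0 y"
        by (intro tendsto_intros rlim) (use t in auto)
      then show "(\<lambda>n. ?K (r n) y * U0 y) \<longlonglongrightarrow> exp (- ((x - y)\<^sup>2 / (4 * t))) * U0 y" by simp
    qed
  qed measurable
  have L3: "(\<lambda>n. (\<integral>y. ?K (r n) y * U y (r n) \<partial>lborel) - (\<integral>y. ?K (r n) y * U0 y \<partial>lborel)) \<longlonglongrightarrow> 0"
  proof -
    define e where "e = (\<lambda>n. \<integral>\<^sup>+y. ennreal (\<bar>U y (r n) - U0 y\<bar> * exp (- \<kappa> * \<bar>y\<bar>)) \<partial>lborel)"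
    have e0: "e \<longlonglongrightarrow> 0" unfolding e_def by (rule filterlim_compose[OF lim rat])
    have "(\<lambda>n. ennreal C * e n) \<longlonglongrightarrow> ennreal C * 0" by (intro ennreal_tendsto_cmult e0) auto
    then have Ce: "(\<lambda>n. ennreal C * e n) \<longlonglongrightarrow> 0" by simp
    have "ennreal \<bar>(\<integral>y. ?K (r n) y * U y (r n) \<partial>lborel) - (\<integral>y. ?K (r n) y * U0 y \<partial>lborel)\<bar> \<le> ennreal C * e n" for n
    \<comment> \<open>The weighted distance may be infinite for some \<open>n\<close>; since
      \<open>C > 0\<close>, the bound is then trivial.\<close>
    proof (cases "e n = \<infinity>")
      case True
      then show ?thesis by (simp add: C_def ennreal_mult_top)
    next
      case False
      note [measurable] = U_measurable[OF r(1)[of n]]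
      have we: "integrable lborel (\<lambda>y. \<bar>U y (r n) - U0 y\<bar> * exp (- \<kappa> * \<bar>y\<bar>))"
        by (rule integrableI_nonneg) (use False in \<open>auto simp: e_def less_top\<close>)
      have K: "?K (r n) y \<le> C * exp (- \<kappa> * \<bar>y\<bar>)" for y using r[of n] by (intro dom) auto
      have kb: "\<bar>?K (r n) y * (U y (r n) - U0 y)\<bar> \<le> C * (\<bar>U y (r n) - U0 y\<bar> * exp (- \<kappa> * \<bar>y\<bar>))" for y
        using mult_right_mono[OF K, of "\<bar>U y (r n) - U0 y\<bar>"] by (simp add: abs_mult mult_ac)
      have i1: "integrable lborel (\<lambda>y. ?K (r n) y * (U y (r n) - U0 y))"
      proof (rule Bochner_Integration.integrable_bound)
        show "integrable lborel (\<lambda>y. C * (\<bar>U y (r n) - U0 y\<bar> * exp (- \<kappa> * \<bar>y\<bar>)))" using we by (rule integrable_mult_right)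
        show "AE y in lborel. norm (?K (r n) y * (U y (r n) - U0 y)) \<le> norm (C * (\<bar>U y (r n) - U0 y\<bar> * exp (- \<kappa> * \<bar>y\<bar>)))"
          using kb by (intro AE_I2) (simp only: real_norm_def, metis abs_ge_self order_trans)
      qed measurable
      have i0: "integrable lborel (\<lambda>y. ?K (r n) y * U0 y)" using r[of n] by (intro intU0) auto
      have "(\<lambda>y. ?K (r n) y * U y (r n)) = (\<lambda>y. ?K (r n) y * (U y (r n) - U0 y) + ?K (r n) y * U0 y)"
        by (simp add: fun_eq_iff algebra_simps)
      then have "(\<integral>y. ?K (r n) y * U y (r n) \<partial>lborel) - (\<integral>y. ?K (r n) y * U0 y \<partial>lborel) = (\<integral>y. ?K (r n) y * (U y (r n) - U0 y) \<partial>lborel)"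
        using Bochner_Integration.integral_add[OF i1 i0] by simp
      then have "ennreal \<bar>(\<integral>y. ?K (r n) y * U y (r n) \<partial>lborel) - (\<integral>y. ?K (r n) y * U0 y \<partial>lborel)\<bar>
          \<le> (\<integral>\<^sup>+y. norm (?K (r n) y * (U y (r n) - U0 y)) \<partial>lborel)"
        using integral_norm_bound_ennreal[OF i1] by simp
      also have "\<dots> \<le> (\<integral>\<^sup>+y. ennreal C * ennreal (\<bar>U y (r n) - U0 y\<bar> * exp (- \<kappa> * \<bar>y\<bar>)) \<partial>lborel)"
        using kb by (intro nn_integral_mono) (auto simp: ennreal_mult'[symmetric] C_def intro!: ennreal_leI)
      also have "\<dots> = ennreal C * e n" unfolding e_def by (rule nn_integral_cmult) measurable
      finally show ?thesis .
    qed
    then have "(\<lambda>n. ennreal \<bar>(\<integral>y. ?K (r n) y * U y (r n) \<partial>lborel) - (\<integral>y. ?K (r n) y * U0 y \<partial>lborel)\<bar>) \<longlonglongrightarrow> 0"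
      by (intro tendsto_sandwich[OF _ _ tendsto_const Ce]) auto
    then have "(\<lambda>n. \<bar>(\<integral>y. ?K (r n) y * U y (r n) \<partial>lborel) - (\<integral>y. ?K (r n) y * U0 y \<partial>lborel)\<bar>) \<longlonglongrightarrow> 0"
      by (rule tendsto_ennrealD[where x = 0, simplified]) simp
    then show ?thesis by (rule tendsto_rabs_zero_cancel)
  qed
  have "(\<integral>z. exp (- (z\<^sup>2 / 4)) \<partial>lborel) * U x t * sqrt (t - 0) - (\<integral>y. exp (- ((x - y)\<^sup>2 / (4 * t))) * U0 y \<partial>lborel) = 0"
    using LIMSEQ_unique[OF tendsto_diff[OF L1 L2] L3] .
  then show "(\<integral>z. exp (- (z\<^sup>2 / 4)) \<partial>lborel) * sqrt t * U x t = (\<integral>y. exp (- ((x - y)\<^sup>2 / (4 * t))) * U0 y \<partial>lborel)"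
    by (simp add: mult_ac)
qed

end

section \<open>Sign structure of the heat solution\<close>

lemma suminf_split_first:
  fixes f :: "nat \<Rightarrow> real"
  assumes "\<And>n. n \<ge> N \<Longrightarrow> f n = 0"
  shows "(\<Sum>n. f n) = f 0 + (\<Sum>n. f (Suc n))"
proof -
  have "summable f" by (rule summable_finite[of "{..<N}"]) (use assms in auto)
  then show ?thesis using suminf_split_head by fastforce
qed

lemma pos_ext_shift_eventually_0:
  assumes "0 < a" shows "\<exists>N. \<forall>n\<ge>N. pos_ext L g (x + real n * a) = 0" "\<exists>N. \<forall>n\<ge>N. neg_ext L g (x - real n * a) = 0"
proof -
  obtain N where N: "(L + \<bar>x\<bar>) / a < real N" using reals_Archimedean2 by blast
  have "L + \<bar>x\<bar> < real n * a" if "n \<ge> N" for n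
  proof -
    have "L + \<bar>x\<bar> < real N * a" using N assms by (simp add: field_simps)
    also have "\<dots> \<le> real n * a" using that assms by simp
    finally show ?thesis .
  qed
  then have "L < x + real n * a" "x - real n * a < - L" if "n \<ge> N" for n using that by fastforce+
  then show "\<exists>N. \<forall>n\<ge>N. pos_ext L g (x + real n * a) = 0" "\<exists>N. \<forall>n\<ge>N. neg_ext L g (x - real n * a) = 0"
    by (intro exI[of _ N] allI impI; fastforce simp: pos_ext_def neg_ext_def)+
qed

text \<open>Weak inequalities are enough for the algebra of \<open>to_heat\<close>, and they can be
  arranged everywhere for a Borel representative of the datum. For \<open>q\<close> in the interval
  the two clauses together give \<open>g q = 0\<close>.\<close>

definition single_crossing :: "real \<Rightarrow> real \<Rightarrow> (real \<Rightarrow> real) \<Rightarrow> bool" where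
  "single_crossing L q g \<longleftrightarrow> (\<forall>x \<in> {-L<..<L}. (x \<le> q \<longrightarrow> 0 \<le> g x) \<and> (q \<le> x \<longrightarrow> g x \<le> 0))"

lemma pos_sum_rec:
  assumes "0 < a"
  shows "(\<Sum>n. pos_ext L g (x + real n * a)) = pos_ext L g x + (\<Sum>n. pos_ext L g (x + a + real n * a))"
    "(\<Sum>n. neg_ext L g (x - real n * a)) = neg_ext L g x + (\<Sum>n. neg_ext L g (x - a - real n * a))"
proof -
  obtain N N' where "\<And>n. n \<ge> N \<Longrightarrow> pos_ext L g (x + real n * a) = 0" "\<And>n. n \<ge> N' \<Longrightarrow> neg_ext L g (x - real n * a) = 0"
    using pos_ext_shift_eventually_0[OF assms] by metis
  from suminf_split_first[of N "\<lambda>n. pos_ext L g (x + real n * a)", OF this(1)]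
    suminf_split_first[of N' "\<lambda>n. neg_ext L g (x - real n * a)", OF this(2)]
  show "(\<Sum>n. pos_ext L g (x + real n * a)) = pos_ext L g x + (\<Sum>n. pos_ext L g (x + a + real n * a))"
    "(\<Sum>n. neg_ext L g (x - real n * a)) = neg_ext L g x + (\<Sum>n. neg_ext L g (x - a - real n * a))"
    by (simp_all add: algebra_simps)
qed

lemma single_crossing_sums_0:
  assumes "0 < a" "single_crossing L q g"
  shows "q \<le> x \<Longrightarrow> (\<Sum>n. pos_ext L g (x + real n * a)) = 0" "x \<le> q \<Longrightarrow> (\<Sum>n. neg_ext L g (x - real n * a)) = 0"
proof -
  have nn: "0 \<le> real n * a" for n using assms(1) by simp
  have "pos_ext L g (x + real n * a) = 0" if "q \<le> x" for n
    using assms(2) nn[of n] that unfolding single_crossing_def pos_ext_def by (auto simp: max_def)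
  then show "q \<le> x \<Longrightarrow> (\<Sum>n. pos_ext L g (x + real n * a)) = 0" by simp
  have "neg_ext L g (x - real n * a) = 0" if "x \<le> q" for n
    using assms(2) nn[of n] that unfolding single_crossing_def neg_ext_def by (auto simp: max_def)
  then show "x \<le> q \<Longrightarrow> (\<Sum>n. neg_ext L g (x - real n * a)) = 0" by simp
qed

text \<open>Splits off the term \<open>n = 0\<close>. When the shift crosses \<open>q\<close> or
  lands on it, the remaining terms vanish by the sign of \<open>g\<close>; this is the default
  0.\<close>

lemma to_heat_rec:
  assumes "0 < a" "single_crossing L q g"
  shows "x < q \<Longrightarrow> to_heat L a q g x = pos_ext L g x + (if x + a < q then to_heat L a q g (x + a) else 0)"
    "q < x \<Longrightarrow> to_heat L a q g x = - neg_ext L g x + (if q < x - a then to_heat L a q g (x - a) else 0)"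
  using pos_sum_rec(1)[OF assms(1), of L g x] pos_sum_rec(2)[OF assms(1), of L g x]
    single_crossing_sums_0(1)[OF assms, of "x + a"] single_crossing_sums_0(2)[OF assms, of "x - a"]
  by (auto simp: to_heat_def)

lemma to_heat_at: "to_heat L a q g q = 0" by (simp add: to_heat_def)

lemma to_heat_sign:
  assumes "0 < a" shows "x \<le> q \<Longrightarrow> 0 \<le> to_heat L a q g x" "q \<le> x \<Longrightarrow> to_heat L a q g x \<le> 0"
proof -
  obtain N N' where N: "\<And>n. n \<ge> N \<Longrightarrow> pos_ext L g (x + real n * a) = 0" "\<And>n. n \<ge> N' \<Longrightarrow> neg_ext L g (x - real n * a) = 0"
    using pos_ext_shift_eventually_0[OF assms] by metis
  have "0 \<le> (\<Sum>n. pos_ext L g (x + real n * a))"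
    by (rule suminf_nonneg, rule summable_finite[of "{..<N}"]) (use N in \<open>auto simp: pos_ext_def\<close>)
  moreover have "0 \<le> (\<Sum>n. neg_ext L g (x - real n * a))"
    by (rule suminf_nonneg, rule summable_finite[of "{..<N'}"]) (use N in \<open>auto simp: neg_ext_def\<close>)
  ultimately show "x \<le> q \<Longrightarrow> 0 \<le> to_heat L a q g x" "q \<le> x \<Longrightarrow> to_heat L a q g x \<le> 0"
    by (auto simp: to_heat_def)
qed

text \<open>On either side of \<open>q\<close> the two sums differ by one term of known sign; across
  \<open>q\<close> the values have opposite signs. This is the monotonicity that
  \<open>extend_increment_le\<close> carries over to the whole line.\<close>

lemma to_heat_increment:
  assumes a: "0 < a" and sc: "single_crossing L q g"
  shows "to_heat L a q g (x + a) \<le> to_heat L a q g x"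
proof -
  consider "x + a < q" | "x < q" "q \<le> x + a" | "q \<le> x" by linarith
  then show ?thesis
  proof cases
    case 1
    then have "to_heat L a q g x = pos_ext L g x + to_heat L a q g (x + a)"
      using to_heat_rec(1)[OF a sc, of x] a by simp
    moreover have "0 \<le> pos_ext L g x" by (simp add: pos_ext_def)
    ultimately show ?thesis by simp
  next
    case 2
    have "0 \<le> to_heat L a q g x" by (rule to_heat_sign(1)[OF a]) (use 2 in simp)
    moreover have "to_heat L a q g (x + a) \<le> 0" by (rule to_heat_sign(2)[OF a]) (use 2 in simp)
    ultimately show ?thesis by linarith
  next
    case 3
    show ?thesis
    proof (cases "q = x")
      case True
      then show ?thesis using to_heat_sign(2)[OF a, of q "x + a"] a by (simp add: to_heat_at)
    next
      case False
      then have "to_heat L a q g (x + a) = - neg_ext L g (x + a) + to_heat L a q g x"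
        using to_heat_rec(2)[OF a sc, of "x + a"] a 3 by simp
      moreover have "0 \<le> neg_ext L g (x + a)" by (simp add: neg_ext_def)
      ultimately show ?thesis by simp
    qed
  qed
qed

lemma borel_measurable_to_heat [measurable]:
  assumes [measurable]: "g \<in> borel_measurable borel"
  shows "to_heat L a q g \<in> borel_measurable borel"
proof -
  have [measurable]: "pos_ext L g \<in> borel_measurable borel" "neg_ext L g \<in> borel_measurable borel"
    unfolding pos_ext_def[abs_def] neg_ext_def[abs_def] by measurable
  show ?thesis unfolding to_heat_def[abs_def] by measurable
qed

text \<open>The datum is only Lebesgue measurable, while the integral calculus below uses Borel
  functions on \<open>lborel\<close>. The transformed data agree almost everywhere because a point
  can be bad only if one of countably many translates of it lies in the null set
  \<open>N\<close>.\<close>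

lemma borel_datum:
  assumes "L2_on L fI" and p0: "p0 \<in> {-L<..<L}"
    and pos: "\<forall>x \<in> {-L<..<L}. x < p0 \<longrightarrow> fI x > 0" and neg: "\<forall>x \<in> {-L<..<L}. x > p0 \<longrightarrow> fI x < 0"
  obtains fJ where "fJ \<in> borel_measurable borel" "single_crossing L p0 fJ"
    "AE x in lborel. x \<in> {-L<..<L} \<longrightarrow> fJ x = fI x"
    "AE x in lborel. x \<in> {-L<..<L} \<longrightarrow> to_heat L a p0 fJ x = to_heat L a p0 fI x"
proof -
  have "(\<lambda>x. indicator {-L<..<L} x *\<^sub>R fI x) \<in> borel_measurable lebesgue"
    using assms(1) by (simp add: L2_on_def set_borel_measurable_def)
  from completion_ex_borel_measurable_real[OF this] obtain g where g [measurable]: "g \<in> borel_measurable borel"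
    and ae: "AE x in lborel. indicator {-L<..<L} x *\<^sub>R fI x = g x" by auto
  \<comment> \<open>Clamping to the right sign on each side of \<open>p0\<close> makes the sign
    condition hold everywhere and, apart from the point \<open>p0\<close>, changes nothing where
    \<open>g\<close> agrees with \<open>fI\<close>.\<close>
  define fJ where "fJ = (\<lambda>x. if x < p0 then max (g x) 0 else if p0 < x then min (g x) 0 else 0)"
  have m: "fJ \<in> borel_measurable borel" unfolding fJ_def by measurable
  have sc: "single_crossing L p0 fJ" by (auto simp: single_crossing_def fJ_def)
  have aeJ: "AE x in lborel. x \<in> {-L<..<L} \<longrightarrow> fJ x = fI x"
    using ae AE_lborel_singleton[of p0]
  proof eventually_elim
    case (elim x)
    show ?case
    proof
      assume x: "x \<in> {-L<..<L}"
      then have "g x = fI x" using elim by simp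
      then show "fJ x = fI x" using bspec[OF pos x] bspec[OF neg x] elim by (auto simp: fJ_def)
    qed
  qed
  then obtain N where N: "N \<in> null_sets lborel" "{x \<in> space lborel. \<not> (x \<in> {-L<..<L} \<longrightarrow> fJ x = fI x)} \<subseteq> N"
    by (auto elim!: AE_E simp: null_sets_def)
  have [measurable]: "N \<in> sets borel" using N(1) by (auto simp: null_sets_def)
  have aeN: "AE x in lborel. x \<notin> N" by (rule AE_not_in[OF N(1)])
  have "AE x in lborel. \<forall>n. real n * a + 1 * x \<notin> N"
    unfolding AE_all_countable by (intro allI AE_borel_affine aeN) (simp, measurable)
  moreover have "AE x in lborel. \<forall>n. - real n * a + 1 * x \<notin> N"
    unfolding AE_all_countable by (intro allI AE_borel_affine aeN) (simp, measurable)
  ultimately have "AE x in lborel. x \<in> {-L<..<L} \<longrightarrow> to_heat L a p0 fJ x = to_heat L a p0 fI x"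
  proof eventually_elim
    case (elim x)
    have e: "fJ y = fI y" if "y \<in> {-L<..<L}" "y \<notin> N" for y using N(2) that by auto
    have "pos_ext L fJ (x + real n * a) = pos_ext L fI (x + real n * a)" for n
      using elim(1)[rule_format, of n] e[of "x + real n * a"] by (simp add: pos_ext_def add.commute)
    moreover have "neg_ext L fJ (x - real n * a) = neg_ext L fI (x - real n * a)" for n
      using elim(2)[rule_format, of n] e[of "x - real n * a"] by (simp add: neg_ext_def)
    ultimately show ?case by (simp add: to_heat_def)
  qed
  with m sc aeJ show ?thesis by (rule that)
qed

section \<open>Convergence to the datum in L2 and in L1\<close>

lemma ennreal_tendsto_0I:
  assumes "\<And>e::real. 0 < e \<Longrightarrow> \<forall>\<^sub>F x in F. f x \<le> ennreal e"
  shows "(f \<longlongrightarrow> 0) F"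
proof (rule order_tendstoI)
  fix b :: ennreal assume "0 < b"
  then obtain e :: real where e: "0 < e" "ennreal e < b"
  proof (cases b)
    case (real r)
    then show ?thesis using that[of "r / 2"] \<open>0 < b\<close> by (auto simp: ennreal_less_iff)
  next
    case top
    then show ?thesis using that[of 1] by simp
  qed
  show "\<forall>\<^sub>F x in F. f x < b" using assms[OF e(1)] by eventually_elim (use e(2) in auto)
qed simp

text \<open>The interval has finite length; Young's inequality in the form
  \<open>\<bar>h\<bar> \<le> \<eta> + h\<^sup>2 / \<eta>\<close> takes the place of
  Cauchy-Schwarz.\<close>

lemma L2_tendsto_imp_L1_tendsto:
  fixes h :: "'b \<Rightarrow> real \<Rightarrow> real"
  assumes lim: "((\<lambda>s. \<integral>\<^sup>+x\<in>{-L<..<L}. ennreal ((h s x)\<^sup>2) \<partial>lborel) \<longlongrightarrow> 0) F"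
    and meas: "\<forall>\<^sub>F s in F. (\<lambda>x. indicator {-L<..<L} x * h s x) \<in> borel_measurable borel"
  shows "((\<lambda>s. \<integral>\<^sup>+x\<in>{-L<..<L}. ennreal \<bar>h s x\<bar> \<partial>lborel) \<longlongrightarrow> 0) F"
proof (rule ennreal_tendsto_0I)
  fix e :: real assume e: "0 < e"
  \<comment> \<open>Chosen so that \<open>\<eta>\<close> times the length
    \<open>2 * \<bar>L\<bar>\<close> stays below \<open>e / 2\<close>.\<close>
  define \<eta> where "\<eta> = e / (4 * (\<bar>L\<bar> + 1))"
  have \<eta>: "0 < \<eta>" using e by (simp add: \<eta>_def)
  have "\<forall>\<^sub>F s in F. (\<integral>\<^sup>+x\<in>{-L<..<L}. ennreal ((h s x)\<^sup>2) \<partial>lborel) < ennreal (\<eta> * e / 2)"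
    using lim \<eta> e by (intro order_tendstoD(2)) (auto simp: ennreal_less_zero_iff)
  then show "\<forall>\<^sub>F s in F. (\<integral>\<^sup>+x\<in>{-L<..<L}. ennreal \<bar>h s x\<bar> \<partial>lborel) \<le> ennreal e"
    using meas
  proof eventually_elim
    case (elim s)
    let ?h = "\<lambda>x. indicator {-L<..<L} x * h s x"
    note [measurable] = elim(2)
    have "(\<integral>\<^sup>+x\<in>{-L<..<L}. ennreal \<bar>h s x\<bar> \<partial>lborel) \<le> (\<integral>\<^sup>+x. ennreal \<eta> * indicator {-L<..<L} x + ennreal (1 / \<eta>) * ennreal ((?h x)\<^sup>2) \<partial>lborel)"
    proof (rule nn_integral_mono)
      fix x
      have "\<bar>h s x\<bar> \<le> \<eta> + 1 / \<eta> * (h s x)\<^sup>2"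
      proof -
        have "0 \<le> (\<bar>h s x\<bar> - \<eta>)\<^sup>2" "0 \<le> \<bar>h s x\<bar> * \<eta>" using \<eta> by auto
        then have "\<eta> * \<bar>h s x\<bar> \<le> \<eta>\<^sup>2 + (h s x)\<^sup>2" by (simp add: power2_diff mult.commute)
        then show ?thesis using \<eta> by (simp add: field_simps power2_eq_square)
      qed
      then have "ennreal \<bar>h s x\<bar> \<le> ennreal \<eta> + ennreal (1 / \<eta>) * ennreal ((h s x)\<^sup>2)"
        using \<eta> by (simp add: ennreal_mult[symmetric] ennreal_plus[symmetric] del: ennreal_plus)
      then show "ennreal \<bar>h s x\<bar> * indicator {-L<..<L} x \<le> ennreal \<eta> * indicator {-L<..<L} x + ennreal (1 / \<eta>) * ennreal ((?h x)\<^sup>2)"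
        by (auto simp: indicator_def)
    qed
    also have "\<dots> = ennreal \<eta> * emeasure lborel {-L<..<L} + ennreal (1 / \<eta>) * (\<integral>\<^sup>+x. ennreal ((?h x)\<^sup>2) \<partial>lborel)"
      by (subst nn_integral_add) (auto simp: nn_integral_cmult nn_integral_cmult_indicator)
    also have "(\<integral>\<^sup>+x. ennreal ((?h x)\<^sup>2) \<partial>lborel) = (\<integral>\<^sup>+x\<in>{-L<..<L}. ennreal ((h s x)\<^sup>2) \<partial>lborel)"
      by (rule nn_integral_cong) (auto simp: indicator_def)
    also have "ennreal \<eta> * emeasure lborel {-L<..<L} + ennreal (1 / \<eta>) * (\<integral>\<^sup>+x\<in>{-L<..<L}. ennreal ((h s x)\<^sup>2) \<partial>lborel)
      \<le> ennreal (e / 2) + ennreal (e / 2)"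
    proof (rule add_mono)
      have "emeasure lborel {-L<..<L} \<le> ennreal (2 * \<bar>L\<bar>)" by (cases "-L \<le> L") auto
      then have "ennreal \<eta> * emeasure lborel {-L<..<L} \<le> ennreal \<eta> * ennreal (2 * \<bar>L\<bar>)" by (rule mult_left_mono) simp
      also have "\<dots> = ennreal (\<eta> * (2 * \<bar>L\<bar>))" using \<eta> by (simp add: ennreal_mult)
      also have "\<dots> \<le> ennreal (e / 2)" using e by (intro ennreal_leI) (simp add: \<eta>_def field_simps)
      finally show "ennreal \<eta> * emeasure lborel {-L<..<L} \<le> ennreal (e / 2)" .
      have "ennreal (1 / \<eta>) * (\<integral>\<^sup>+x\<in>{-L<..<L}. ennreal ((h s x)\<^sup>2) \<partial>lborel) \<le> ennreal (1 / \<eta>) * ennreal (\<eta> * e / 2)"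
        using elim(1) by (intro mult_left_mono) auto
      also have "\<dots> = ennreal (e / 2)" using \<eta> e by (simp add: ennreal_mult[symmetric])
      finally show "ennreal (1 / \<eta>) * (\<integral>\<^sup>+x\<in>{-L<..<L}. ennreal ((h s x)\<^sup>2) \<partial>lborel) \<le> ennreal (e / 2)" .
    qed
    also have "\<dots> = ennreal e" using e by (simp add: ennreal_plus[symmetric] del: ennreal_plus)
    finally show ?case .
  qed
qed

lemma attains_datum_borel:
  assumes "attains_datum L u u0" "AE x in lborel. x \<in> {-L<..<L} \<longrightarrow> v0 x = u0 x"
  shows "((\<lambda>s. \<integral>\<^sup>+x\<in>{-L<..<L}. ennreal ((u x s - v0 x)\<^sup>2) \<partial>lborel) \<longlongrightarrow> 0) (at_right 0)"
proof -
  have "(\<integral>\<^sup>+x\<in>{-L<..<L}. ennreal ((u x s - u0 x)\<^sup>2) \<partial>lebesgue) = (\<integral>\<^sup>+x\<in>{-L<..<L}. ennreal ((u x s - v0 x)\<^sup>2) \<partial>lborel)" for s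
    unfolding nn_integral_completion
    by (rule nn_integral_cong_AE) (use assms(2) in \<open>eventually_elim, auto simp: indicator_def\<close>)
  then show ?thesis using assms(1) by (simp add: attains_datum_def)
qed

lemma extend_cong:
  assumes "0 < a" "a < L" "\<And>y. \<bar>y\<bar> \<le> L \<Longrightarrow> g y = h y"
  shows "extend L a g x = extend L a h x"
  by (induction x rule: extend_induct[OF assms(1,2)]) (simp_all add: extend_base[OF assms(1,2)] extend_rec[OF assms(1,2)] assms(3))

lemma integral_pos_if_AE_pos_on_interval:
  fixes f :: "real \<Rightarrow> real"
  assumes i: "integrable lborel f" and nn: "AE x in lborel. 0 \<le> f x"
    and pos: "AE x in lborel. c < x \<and> x < d \<longrightarrow> 0 < f x" and cd: "c < d"
  shows "0 < integral\<^sup>L lborel f"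
proof -
  have "integral\<^sup>L lborel f \<noteq> 0"
  proof
    assume "integral\<^sup>L lborel f = 0"
    then have "AE x in lborel. f x = 0" using integral_nonneg_eq_0_iff_AE[OF i nn] by simp
    then have "AE x in lborel. x \<notin> {c<..<d}" using pos by eventually_elim auto
    then have "{c<..<d} \<in> null_sets lborel" by (subst AE_iff_null_sets) auto
    then show False using cd by (auto simp: null_sets_def)
  qed
  moreover have "0 \<le> integral\<^sup>L lborel f" using nn by (rule integral_nonneg_AE)
  ultimately show ?thesis by linarith
qed

lemma gaussian_mass_pos: "0 < (\<integral>z. exp (- ((z::real)\<^sup>2 / 4)) \<partial>lborel)"
proof -
  have i: "integrable lborel (\<lambda>z::real. exp (- (z\<^sup>2 / 4)))"
  proof (rule Bochner_Integration.integrable_bound)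
    show "integrable lborel (\<lambda>z::real. exp 2 * exp (- \<bar>z\<bar>))" using integrable_exp_minus_abs by simp
    have "exp (- (z\<^sup>2 / 4)) \<le> exp 2 * exp (- \<bar>z\<bar>)" for z :: real
      using gaussian_domination[of 1 1 0 z 0] by simp
    then show "AE z::real in lborel. norm (exp (- (z\<^sup>2 / 4))) \<le> norm (exp 2 * exp (- \<bar>z\<bar>))" by (intro AE_I2) simp
  qed measurable
  show ?thesis by (rule integral_pos_if_AE_pos_on_interval[OF i, of 0 1]) auto
qed


lemma heat_solution_caloric:
  assumes "heat_solution L a FI F"
  shows "caloric_on (cylinder L) F"
  using assms unfolding heat_solution_def caloric_on_iff[OF open_cylinder] by blast

lemma Dx_eq_on_open:
  assumes "open U" "(x, t) \<in> U" "\<And>x t. (x, t) \<in> U \<Longrightarrow> u x t = u' x t"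
  shows "Dx u x t = Dx u' x t"
  unfolding Dx_def
  by (rule deriv_cong_ev[OF eventually_mono[OF eventually_slice(1)[OF assms(1,2)]] refl]) (rule assms(3))

text \<open>The rate of change of the mass is the difference of the slopes at the two ends. For the
  extended solution the nonlocal conditions are just this equality of slopes, on
  \<open>[-L, -L + a]\<close> and on \<open>[L - a, L]\<close>.\<close>

lemma caloric_mass_conserved:
  assumes cal: "caloric_on (UNIV \<times> {0<..}) U" and "\<alpha> \<le> \<beta>"
    and eq: "\<And>t. 0 < t \<Longrightarrow> Dx U \<alpha> t = Dx U \<beta> t" and "0 < s" "0 < t"
  shows "integral {\<alpha>..\<beta>} (\<lambda>y. U y s) = integral {\<alpha>..\<beta>} (\<lambda>y. U y t)"
proof -
  have oU: "open (UNIV \<times> {0<..} :: (real \<times> real) set)" by (intro open_Times) auto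
  note D = caloric_onD[OF oU cal]
  have d: "((\<lambda>s. integral (cbox \<alpha> \<beta>) (\<lambda>y. U y s)) has_field_derivative integral (cbox \<alpha> \<beta>) (\<lambda>y. Dx (Dx U) y r)) (at r within {0<..})"
    if r: "r \<in> {0<..}" for r
  proof (rule leibniz_rule_field_derivative[where fx = "\<lambda>s y. Dx (Dx U) y s"])
    show "((\<lambda>s. U y s) has_field_derivative Dx (Dx U) y s) (at s within {0<..})" if "s \<in> {0<..}" for s y
      using D(6)[of y s] that by (auto intro: has_field_derivative_at_within)
    show "(\<lambda>y. U y s) integrable_on cbox \<alpha> \<beta>" if "s \<in> {0<..}" for s
      using D(4)[of _ s] that by (intro integrable_continuous continuous_at_imp_continuous_on ballI DERIV_isCont) auto
    have "continuous_on ({0<..} \<times> cbox \<alpha> \<beta>) (\<lambda>z. (\<lambda>(x, t). Dx (Dx U) x t) (snd z, fst z))"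
      by (rule continuous_on_compose2[OF D(3)]) (auto intro!: continuous_intros)
    then show "continuous_on ({0<..} \<times> cbox \<alpha> \<beta>) (\<lambda>(s, y). Dx (Dx U) y s)" by (simp add: case_prod_unfold)
  qed (use r in auto)
  have z: "integral (cbox \<alpha> \<beta>) (\<lambda>y. Dx (Dx U) y r) = 0" if r: "0 < r" for r
  proof -
    have "((\<lambda>y. Dx (Dx U) y r) has_integral Dx U \<beta> r - Dx U \<alpha> r) {\<alpha>..\<beta>}"
    proof (rule fundamental_theorem_of_calculus)
      fix y
      show "((\<lambda>y. Dx U y r) has_vector_derivative Dx (Dx U) y r) (at y within {\<alpha>..\<beta>})"
        using D(5)[of y r] r by (simp add: has_real_derivative_iff_has_vector_derivative has_vector_derivative_at_within)
    qed fact
    then show ?thesis using eq[OF r] by (simp add: integral_unique)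
  qed
  have "\<exists>c. \<forall>r\<in>{0<..}. integral (cbox \<alpha> \<beta>) (\<lambda>y. U y r) = c"
  proof (rule has_field_derivative_zero_constant)
    show "((\<lambda>s. integral (cbox \<alpha> \<beta>) (\<lambda>y. U y s)) has_field_derivative 0) (at r within {0<..})" if "r \<in> {0<..}" for r
      using d[OF that] z[of r] that by simp
  qed simp
  then show ?thesis using assms(4,5) by (metis cbox_interval greaterThan_iff)
qed

text \<open>Collects what both directions need to know about a heat solution. The uniqueness of the
  zero and the monotonicity under shifts are inherited from the extended datum through the kernel;
  the conserved masses place the zero.\<close>

lemma heat_solution_extension:
  assumes a: "0 < a" and aL: "a < L" and L2: "L2_on L fI" and p0: "p0 \<in> {-L + a<..<L - a}"
    and pos: "\<forall>x \<in> {-L<..<L}. x < p0 \<longrightarrow> fI x > 0" and neg: "\<forall>x \<in> {-L<..<L}. x > p0 \<longrightarrow> fI x < 0"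
    and F: "heat_solution L a (to_heat L a p0 fI) F"
  obtains U where "caloric_on (UNIV \<times> {0<..}) U"
    "\<And>x t. \<bar>x\<bar> < L \<Longrightarrow> 0 < t \<Longrightarrow> U x t = F x t"
    "\<And>t. 0 < t \<Longrightarrow> \<exists>p\<in>{-L<..<L}. U p t = 0 \<and> (\<forall>x<p. 0 < U x t) \<and> (\<forall>x>p. U x t < 0)"
    "\<And>x t. 0 < t \<Longrightarrow> U (x + a) t \<le> U x t"
proof -
  have cal: "caloric_on (cylinder L) F" by (rule heat_solution_caloric[OF F])
  have bs: "bounded_slope (cylinder L) F"
    and left: "\<And>t. 0 < t \<Longrightarrow> left_slope L F t (Dx F (- L + a) t)"
    and right: "\<And>t. 0 < t \<Longrightarrow> right_slope L F t (Dx F (L - a) t)"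
    and att: "attains_datum L F (to_heat L a p0 fI)"
    using F unfolding heat_solution_def by auto
  have p0L: "p0 \<in> {-L<..<L}" using p0 a by auto
  obtain fJ where fJ [measurable]: "fJ \<in> borel_measurable borel" and sc: "single_crossing L p0 fJ"
    and aeJ: "AE x in lborel. x \<in> {-L<..<L} \<longrightarrow> fJ x = fI x"
    and aeH: "AE x in lborel. x \<in> {-L<..<L} \<longrightarrow> to_heat L a p0 fJ x = to_heat L a p0 fI x"
    by (rule borel_datum[OF L2 p0L pos neg, where a = a])
  define H where "H = to_heat L a p0 fJ"
  have Hm [measurable]: "H \<in> borel_measurable borel" unfolding H_def by measurable
  define U where "U = (\<lambda>x t. extend L a (closed_ext L F t) x)"
  define U0 where "U0 = extend L a H"
  have U0m [measurable]: "U0 \<in> borel_measurable borel" unfolding U0_def by (intro borel_measurable_extend a aL Hm)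
  have Ucal: "caloric_on (UNIV \<times> {0<..}) U"
    unfolding U_def by (rule caloric_extend[OF a aL cal bs left right])
  have oU: "open (UNIV \<times> {0<..} :: (real \<times> real) set)" by (intro open_Times) auto
  note UD = caloric_onD[OF oU Ucal]
  have Ucont: "continuous_on S (\<lambda>x. U x t)" if "0 < t" for S t
    using UD(4)[of _ t] that by (intro continuous_at_imp_continuous_on ballI DERIV_isCont) auto
  have Um: "(\<lambda>x. U x t) \<in> borel_measurable borel" if "0 < t" for t
    by (intro borel_measurable_continuous_onI Ucont that)
  have UF: "U x t = F x t" if "\<bar>x\<bar> < L" for x t
    using that unfolding U_def by (subst extend_base[OF a aL]) (auto simp: closed_ext_def)
  define l1 where "l1 = (\<lambda>s. \<integral>\<^sup>+x\<in>{-L<..<L}. ennreal \<bar>F x s - H x\<bar> \<partial>lborel)"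
  have pos_ev: "\<forall>\<^sub>F s in at_right (0::real). 0 < s" by (rule eventually_at_right_less)
  have l1: "(l1 \<longlongrightarrow> 0) (at_right 0)"
    unfolding l1_def
  proof (rule L2_tendsto_imp_L1_tendsto)
    show "((\<lambda>s. \<integral>\<^sup>+x\<in>{-L<..<L}. ennreal ((F x s - H x)\<^sup>2) \<partial>lborel) \<longlongrightarrow> 0) (at_right 0)"
      unfolding H_def by (rule attains_datum_borel[OF att aeH])
    show "\<forall>\<^sub>F s in at_right 0. (\<lambda>x. indicator {-L<..<L} x * (F x s - H x)) \<in> borel_measurable borel"
      using pos_ev
    proof eventually_elim
      case (elim s)
      note [measurable] = Um[OF elim]
      have "(\<lambda>x. indicator {-L<..<L} x * (F x s - H x)) = (\<lambda>x. indicator {-L<..<L} x * (U x s - H x))"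
        using UF by (auto simp: indicator_def fun_eq_iff abs_less_iff)
      then show ?case by simp
    qed
  qed
  have closed_l1: "(\<integral>\<^sup>+x\<in>{-L..L}. ennreal \<bar>U x s - H x\<bar> \<partial>lborel) = l1 s" for s
    unfolding l1_def
  proof (rule nn_integral_cong_AE)
    show "AE x in lborel. ennreal \<bar>U x s - H x\<bar> * indicator {-L..L} x = ennreal \<bar>F x s - H x\<bar> * indicator {-L<..<L} x"
      using AE_lborel_singleton[of L] AE_lborel_singleton[of "-L"]
    proof eventually_elim
      case (elim x)
      then show ?case using UF[of x s] by (auto simp: indicator_def abs_less_iff)
    qed
  qed
  let ?\<kappa> = "ln 14 / a"
  \<comment> \<open>The extension is linear, so \<open>U - U0\<close> is the extension of the error
    on \<open>[-L, L]\<close>, and the weighted bound reduces convergence on the line to the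
    \<open>L\<^sup>1\<close> error \<open>l1\<close>.\<close>
  have lim: "((\<lambda>s. \<integral>\<^sup>+y. ennreal (\<bar>U y s - U0 y\<bar> * exp (- ?\<kappa> * \<bar>y\<bar>)) \<partial>lborel) \<longlongrightarrow> 0) (at_right 0)"
  proof (rule tendsto_sandwich[OF _ _ tendsto_const])
    have "((\<lambda>s. 28 * l1 s) \<longlongrightarrow> 28 * 0) (at_right 0)"
      using l1 by (intro ennreal_tendsto_cmult) auto
    then show "((\<lambda>s. 28 * l1 s) \<longlongrightarrow> 0) (at_right 0)" by simp
    show "\<forall>\<^sub>F s in at_right 0. (\<integral>\<^sup>+y. ennreal (\<bar>U y s - U0 y\<bar> * exp (- ?\<kappa> * \<bar>y\<bar>)) \<partial>lborel) \<le> 28 * l1 s"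
      using pos_ev
    proof eventually_elim
      case (elim s)
      note [measurable] = Um[OF elim]
      define G where "G = (\<lambda>y. if \<bar>y\<bar> \<le> L then U y s - H y else 0)"
      have [measurable]: "G \<in> borel_measurable borel" unfolding G_def by measurable
      have "U y s - U0 y = extend L a G y" for y
        unfolding U_def U0_def extend_diff[OF a aL, symmetric]
        by (rule extend_cong[OF a aL]) (simp add: G_def U_def extend_base[OF a aL])
      then have "(\<integral>\<^sup>+y. ennreal (\<bar>U y s - U0 y\<bar> * exp (- ?\<kappa> * \<bar>y\<bar>)) \<partial>lborel) \<le> 28 * (\<integral>\<^sup>+y\<in>{-L..L}. ennreal \<bar>G y\<bar> \<partial>lborel)"
        using extend_L1_weighted[OF a aL, of G] by simp
      also have "(\<integral>\<^sup>+y\<in>{-L..L}. ennreal \<bar>G y\<bar> \<partial>lborel) = (\<integral>\<^sup>+y\<in>{-L..L}. ennreal \<bar>U y s - H y\<bar> \<partial>lborel)"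
        by (rule nn_integral_cong) (auto simp: G_def indicator_def)
      finally show ?case unfolding closed_l1 .
    qed
  qed simp
  \<comment> \<open>The transformed datum is integrable because it has finite
    \<open>L\<^sup>1\<close> distance from the solution at some positive time, which is bounded on
    the closed interval.\<close>
  have Hfin: "(\<integral>\<^sup>+x\<in>{-L..L}. ennreal \<bar>H x\<bar> \<partial>lborel) < \<infinity>"
  proof -
    have "\<forall>\<^sub>F s in at_right 0. l1 s < 1" using l1 by (intro order_tendstoD(2)) auto
    then have "\<forall>\<^sub>F s in at_right (0::real). l1 s < 1 \<and> 0 < s" using pos_ev by eventually_elim simp
    from eventually_happens'[OF trivial_limit_at_right_real this] obtain s where s: "l1 s < 1" "0 < s" by blast
    obtain M where M: "\<And>x. x \<in> {-L..L} \<Longrightarrow> \<bar>U x s\<bar> \<le> M"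
      using continuous_on_compact_bound[OF compact_Icc Ucont[OF s(2), of "{-L..L}"]] by blast
    note [measurable] = Um[OF s(2)]
    have "(\<integral>\<^sup>+x\<in>{-L..L}. ennreal \<bar>H x\<bar> \<partial>lborel) \<le> (\<integral>\<^sup>+x. ennreal \<bar>U x s - H x\<bar> * indicator {-L..L} x + ennreal M * indicator {-L..L} x \<partial>lborel)"
    proof (rule nn_integral_mono)
      fix x
      show "ennreal \<bar>H x\<bar> * indicator {-L..L} x \<le> ennreal \<bar>U x s - H x\<bar> * indicator {-L..L} x + ennreal M * indicator {-L..L} x"
      proof (cases "x \<in> {-L..L}")
        case True
        have "\<bar>H x\<bar> \<le> \<bar>U x s - H x\<bar> + M" using M[OF True] by linarith
        moreover have "0 \<le> M" using M[OF True] by linarith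
        ultimately show ?thesis using True by (simp add: ennreal_plus[symmetric] del: ennreal_plus)
      qed simp
    qed
    also have "\<dots> = l1 s + ennreal M * emeasure lborel {-L..L}"
      by (subst nn_integral_add) (auto simp: closed_l1 nn_integral_cmult_indicator)
    also have "\<dots> < \<infinity>"
    proof -
      have "ennreal M * emeasure lborel {-L..L} < top" using a aL by (simp add: ennreal_mult_less_top)
      moreover have "l1 s < top" using s(1) by (rule less_trans) simp
      ultimately show ?thesis by simp
    qed
    finally show ?thesis .
  qed
  have fin: "(\<integral>\<^sup>+y. ennreal (\<bar>U0 y\<bar> * exp (- ?\<kappa> * \<bar>y\<bar>)) \<partial>lborel) < \<infinity>"
  proof -
    have "(\<integral>\<^sup>+y. ennreal (\<bar>U0 y\<bar> * exp (- ?\<kappa> * \<bar>y\<bar>)) \<partial>lborel) \<le> 28 * (\<integral>\<^sup>+x\<in>{-L..L}. ennreal \<bar>H x\<bar> \<partial>lborel)"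
      unfolding U0_def by (rule extend_L1_weighted[OF a aL Hm])
    also have "\<dots> < \<infinity>" using Hfin by (simp add: ennreal_mult_less_top)
    finally show ?thesis .
  qed
  have growth: "\<exists>M. \<forall>x t. s \<le> t \<longrightarrow> t \<le> T \<longrightarrow> \<bar>U x t\<bar> \<le> M * exp (ln 3 / a * \<bar>x\<bar>)" if "0 < s" for s T
    using extend_growth[OF a aL cal bs left right that, of T] unfolding U_def by metis
  have k0: "0 \<le> ?\<kappa>" "0 \<le> ln 3 / a" using a by auto
  note rep = gaussian_representation[OF Ucal k0(2) growth _ k0(1) U0m fin lim]
  define c0 where "c0 = (\<integral>z. exp (- ((z::real)\<^sup>2 / 4)) \<partial>lborel)"
  have c0: "0 < c0" unfolding c0_def by (rule gaussian_mass_pos)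
  have Hinc: "H y \<le> H (y - a)" for y
    unfolding H_def using to_heat_increment[OF a sc, of "y - a"] by simp
  have U0inc: "U0 y \<le> U0 (y - a)" for y
    unfolding U0_def by (rule extend_increment_le[OF a aL]) (rule Hinc)
  have U0sign: "(p0 < y \<longrightarrow> U0 y \<le> 0) \<and> (y < p0 \<longrightarrow> 0 \<le> U0 y)" for y
    unfolding U0_def
  proof (rule extend_sign[OF a aL])
    show "H y \<le> H (y - a)" for y by (rule Hinc)
    show "H y \<le> 0" if "p0 < y" for y unfolding H_def by (rule to_heat_sign(2)[OF a]) (use that in simp)
    show "0 \<le> H y" if "y < p0" for y unfolding H_def by (rule to_heat_sign(1)[OF a]) (use that in simp)
  qed (use p0 in auto)
  have strict: "AE x in lborel. x \<in> {-L<..<L} \<longrightarrow> (x < p0 \<longrightarrow> 0 < H x) \<and> (p0 < x \<longrightarrow> H x < 0)"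
    using aeJ
  proof eventually_elim
    case (elim x)
    show ?case
    proof (intro impI conjI)
      assume x: "x \<in> {-L<..<L}" "x < p0"
      have "0 \<le> (if x + a < p0 then to_heat L a p0 fJ (x + a) else 0)"
        using to_heat_sign(1)[OF a, of "x + a" p0] by auto
      moreover have "0 < pos_ext L fJ x" using elim x pos by (auto simp: pos_ext_def)
      ultimately show "0 < H x" unfolding H_def to_heat_rec(1)[OF a sc x(2)] by linarith
    next
      assume x: "x \<in> {-L<..<L}" "p0 < x"
      have "(if p0 < x - a then to_heat L a p0 fJ (x - a) else 0) \<le> 0"
        using to_heat_sign(2)[OF a, of p0 "x - a"] by auto
      moreover have "0 < neg_ext L fJ x" using elim x neg by (auto simp: neg_ext_def)
      ultimately show "H x < 0" unfolding H_def to_heat_rec(2)[OF a sc x(2)] by linarith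
    qed
  qed
  \<comment> \<open>If \<open>U\<close> is nonnegative at a point, it is strictly positive
    everywhere to the left. In this form the statement yields both the uniqueness of the zero and
    the signs on its two sides.\<close>
  have cross: "0 < U x1 t" if t: "0 < t" and x: "x1 < x2" and nn: "0 \<le> U x2 t" for x1 x2 t
  proof -
    \<comment> \<open>Up to the positive factor \<open>exp ((2 x p0 - x\<^sup>2) / (4 t))\<close>,
      the kernel is \<open>exp (x (y - p0) / (2 t))\<close> times a weight independent of
      \<open>x\<close>. This exponential decreases in \<open>x\<close> for \<open>y < p0\<close>,
      where \<open>U0 \<ge> 0\<close>, and increases for \<open>y > p0\<close>, where
      \<open>U0 \<le> 0\<close>; so its integral against \<open>U0\<close> decreases.\<close>
    let ?e = "\<lambda>x y. exp (x * (y - p0) / (2 * t)) * exp (- (y\<^sup>2 / (4 * t)))"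
    have split: "exp (- ((x - y)\<^sup>2 / (4 * t))) = exp ((2 * x * p0 - x\<^sup>2) / (4 * t)) * ?e x y" for x y
    proof -
      have "- ((x - y)\<^sup>2 / (4 * t)) = (2 * x * p0 - x\<^sup>2) / (4 * t) + (x * (y - p0) / (2 * t) + - (y\<^sup>2 / (4 * t)))"
        using t by (simp add: field_simps power2_eq_square)
      then show ?thesis by (simp only: exp_add)
    qed
    have int: "integrable lborel (\<lambda>y. ?e x y * U0 y)" for x
    proof -
      have "(\<lambda>y. ?e x y * U0 y) = (\<lambda>y. exp (- ((2 * x * p0 - x\<^sup>2) / (4 * t))) * (exp (- ((x - y)\<^sup>2 / (4 * t))) * U0 y))"
        unfolding split by (simp add: exp_minus fun_eq_iff)
      then show ?thesis using rep(1)[OF _ t, of x] by simp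
    qed
    have val: "c0 * sqrt t * U x t = exp ((2 * x * p0 - x\<^sup>2) / (4 * t)) * (\<integral>y. ?e x y * U0 y \<partial>lborel)" for x
    proof -
      have "c0 * sqrt t * U x t = (\<integral>y. exp ((2 * x * p0 - x\<^sup>2) / (4 * t)) * (?e x y * U0 y) \<partial>lborel)"
        using rep(2)[OF _ t, of x] unfolding c0_def split by (simp add: mult.assoc)
      then show ?thesis by simp
    qed
    have "0 < (\<integral>y. ?e x1 y * U0 y - ?e x2 y * U0 y \<partial>lborel)"
    \<comment> \<open>Strictness is needed on one interval only; on \<open>(p0, L)\<close> the
      strict sign of the datum is at hand.\<close>
    proof (rule integral_pos_if_AE_pos_on_interval[where c = p0 and d = L])
      show "integrable lborel (\<lambda>y. ?e x1 y * U0 y - ?e x2 y * U0 y)" by (intro Bochner_Integration.integrable_diff int)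
      have eq: "?e x1 y * U0 y - ?e x2 y * U0 y = exp (- (y\<^sup>2 / (4 * t))) * ((exp (x1 * (y - p0) / (2 * t)) - exp (x2 * (y - p0) / (2 * t))) * U0 y)" for y
        by (simp add: algebra_simps)
      have inc: "exp (x1 * (y - p0) / (2 * t)) < exp (x2 * (y - p0) / (2 * t))" if "p0 < y" for y
        using that t x by (simp add: divide_strict_right_mono mult_strict_right_mono)
      have dec: "exp (x2 * (y - p0) / (2 * t)) < exp (x1 * (y - p0) / (2 * t))" if "y < p0" for y
        using that t x by (simp add: divide_strict_right_mono mult_strict_right_mono_neg)
      show "AE y in lborel. 0 \<le> ?e x1 y * U0 y - ?e x2 y * U0 y"
      proof (rule AE_I2)
        fix y
        have "0 \<le> (exp (x1 * (y - p0) / (2 * t)) - exp (x2 * (y - p0) / (2 * t))) * U0 y"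
          using U0sign[of y] inc[of y] dec[of y] by (cases y p0 rule: linorder_cases) (auto intro: mult_nonneg_nonneg mult_nonpos_nonpos)
        then show "0 \<le> ?e x1 y * U0 y - ?e x2 y * U0 y" unfolding eq by simp
      qed
      show "AE y in lborel. p0 < y \<and> y < L \<longrightarrow> 0 < ?e x1 y * U0 y - ?e x2 y * U0 y"
        using strict
      proof eventually_elim
        case (elim y)
        show ?case
        proof
          assume y: "p0 < y \<and> y < L"
          then have "H y < 0" "\<bar>y\<bar> \<le> L" using elim p0L by auto
          then have "U0 y < 0" by (simp add: U0_def extend_base[OF a aL])
          then have "0 < (exp (x1 * (y - p0) / (2 * t)) - exp (x2 * (y - p0) / (2 * t))) * U0 y"
            using inc[of y] y by (intro mult_neg_neg) auto
          then show "0 < ?e x1 y * U0 y - ?e x2 y * U0 y" unfolding eq by simp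
        qed
      qed
    qed (use p0L in auto)
    then have "(\<integral>y. ?e x2 y * U0 y \<partial>lborel) < (\<integral>y. ?e x1 y * U0 y \<partial>lborel)"
      by (simp add: Bochner_Integration.integral_diff[OF int int])
    moreover have "0 \<le> (\<integral>y. ?e x2 y * U0 y \<partial>lborel)"
    proof -
      have "0 \<le> c0 * sqrt t * U x2 t" using c0 t nn by simp
      then show ?thesis unfolding val by (simp add: zero_le_mult_iff)
    qed
    ultimately have "0 < c0 * sqrt t * U x1 t" unfolding val by simp
    moreover have "0 < c0 * sqrt t" using c0 t by simp
    ultimately show ?thesis by (rule zero_less_mult_pos)
  qed
  \<comment> \<open>Translating the integration variable moves the shift from \<open>U\<close> to
    \<open>U0\<close>, where monotonicity is known.\<close>
  have incr: "U (x + a) t \<le> U x t" if t: "0 < t" for x t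
  proof -
    let ?K = "\<lambda>y. exp (- ((x - y)\<^sup>2 / (4 * t)))"
    have g: "(\<lambda>y. exp (- ((x + a - y)\<^sup>2 / (4 * t))) * U0 y) \<in> borel_measurable borel" by measurable
    have "(\<integral>y. exp (- ((x + a - y)\<^sup>2 / (4 * t))) * U0 y \<partial>lborel) = (\<integral>y. exp (- ((x + a - (a + y))\<^sup>2 / (4 * t))) * U0 (a + y) \<partial>lborel)"
      using integral_lborel_translate[OF g, of a] by simp
    then have e1: "c0 * sqrt t * U (x + a) t = (\<integral>y. ?K y * U0 (a + y) \<partial>lborel)"
      using rep(2)[OF _ t, of "x + a"] by (simp add: c0_def)
    have i1: "integrable lborel (\<lambda>y. ?K y * U0 (a + y))"
    proof -
      have "integrable lborel (\<lambda>y. exp (- ((x + a - (a + 1 * y))\<^sup>2 / (4 * t))) * U0 (a + 1 * y))"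
        by (rule lborel_integrable_real_affine[OF rep(1)[OF _ t, of "x + a"]]) auto
      then show ?thesis by simp
    qed
    have "(\<integral>y. ?K y * U0 (a + y) \<partial>lborel) \<le> (\<integral>y. ?K y * U0 y \<partial>lborel)"
      by (rule integral_mono[OF i1 rep(1)[OF _ t]]) (use U0inc[of "a + y" for y] in auto)
    then have "c0 * sqrt t * U (x + a) t \<le> c0 * sqrt t * U x t"
      using rep(2)[OF _ t, of x] e1 by (simp add: c0_def)
    then show ?thesis using c0 t by simp
  qed
  have DxUF: "Dx U x t = Dx F x t" if "\<bar>x\<bar> < L" "0 < t" for x t
    by (rule Dx_eq_on_open[OF open_cylinder]) (use that UF in \<open>auto simp: cylinder_def abs_less_iff\<close>)
  have DxU_lim: "((\<lambda>x. Dx U x t) \<longlongrightarrow> Dx U y t) (at y within S)" if "0 < t" for y t S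
    using UD(5)[of y t] that DERIV_isCont continuous_within_subset[of y UNIV "\<lambda>x. Dx U x t" S]
    by (auto simp: continuous_within)
  have endl: "Dx U (- L) t = Dx U (- L + a) t" if t: "0 < t" for t
  proof -
    have "\<forall>\<^sub>F x in at_right (- L). Dx F x t = Dx U x t"
    proof (rule eventually_at_rightI[of "- L" L])
      fix x assume "x \<in> {- L<..<L}"
      then show "Dx F x t = Dx U x t" using DxUF[of x t] t by (auto simp: abs_less_iff)
    qed (use a aL in auto)
    with left[OF t, unfolded left_slope_def] have "((\<lambda>x. Dx U x t) \<longlongrightarrow> Dx F (- L + a) t) (at_right (- L))"
      by (rule Lim_transform_eventually)
    with DxU_lim[OF t] have "Dx U (- L) t = Dx F (- L + a) t"
      using tendsto_unique trivial_limit_at_right_real by blast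
    then show ?thesis using DxUF[of "- L + a" t] t a aL by simp
  qed
  have endr: "Dx U (L - a) t = Dx U L t" if t: "0 < t" for t
  proof -
    have "\<forall>\<^sub>F x in at_left L. Dx F x t = Dx U x t"
    proof (rule eventually_at_leftI[of "- L" L])
      fix x assume "x \<in> {- L<..<L}"
      then show "Dx F x t = Dx U x t" using DxUF[of x t] t by (auto simp: abs_less_iff)
    qed (use a aL in auto)
    with right[OF t, unfolded right_slope_def] have "((\<lambda>x. Dx U x t) \<longlongrightarrow> Dx F (L - a) t) (at_left L)"
      by (rule Lim_transform_eventually)
    with DxU_lim[OF t] have "Dx U L t = Dx F (L - a) t"
      using tendsto_unique trivial_limit_at_left_real by blast
    then show ?thesis using DxUF[of "L - a" t] t a aL by simp
  qed
  have Hint: "set_integrable lborel {\<alpha>..\<beta>} H" if "- L \<le> \<alpha>" "\<beta> \<le> L" for \<alpha> \<beta>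
  proof -
    have "integrable lborel (\<lambda>x. indicator {-L..L} x * H x)"
    proof (rule integrableI_bounded)
      have "(\<integral>\<^sup>+x. ennreal (norm (indicator {-L..L} x * H x)) \<partial>lborel) = (\<integral>\<^sup>+x\<in>{-L..L}. ennreal \<bar>H x\<bar> \<partial>lborel)"
        by (rule nn_integral_cong) (auto simp: indicator_def)
      then show "(\<integral>\<^sup>+x. ennreal (norm (indicator {-L..L} x * H x)) \<partial>lborel) < \<infinity>" using Hfin by simp
    qed measurable
    then have "set_integrable lborel {-L..L} H" by (simp add: set_integrable_def)
    then show ?thesis by (rule set_integrable_subset) (use that in auto)
  qed
  \<comment> \<open>Conservation is known between positive times only. The discrepancy
    \<open>d\<close> from the mass of the datum is bounded by the \<open>L\<^sup>1\<close> error at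
    every positive time, and this error tends to 0.\<close>
  have mass: "integral {\<alpha>..\<beta>} (\<lambda>y. U y t) = (LINT y:{\<alpha>..\<beta>}|lborel. H y)"
    if \<alpha>: "- L \<le> \<alpha>" "\<alpha> \<le> \<beta>" "\<beta> \<le> L" and eq: "\<And>t. 0 < t \<Longrightarrow> Dx U \<alpha> t = Dx U \<beta> t" and t: "0 < t" for \<alpha> \<beta> t
  proof -
    define d where "d = integral {\<alpha>..\<beta>} (\<lambda>y. U y t) - (LINT y:{\<alpha>..\<beta>}|lborel. H y)"
    have "ennreal \<bar>d\<bar> \<le> l1 s" if s: "0 < s" for s
    proof -
      note [measurable] = Um[OF s]
      have i1: "set_integrable lborel {\<alpha>..\<beta>} (\<lambda>y. U y s)"
        unfolding set_integrable_def by (intro borel_integrable_compact Ucont s) auto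
      note i2 = Hint[OF \<alpha>(1,3)]
      have "d = (LINT y:{\<alpha>..\<beta>}|lborel. U y s) - (LINT y:{\<alpha>..\<beta>}|lborel. H y)"
        unfolding d_def using caloric_mass_conserved[OF Ucal \<alpha>(2) eq s t] set_borel_integral_eq_integral(2)[OF i1] by simp
      also have "\<dots> = (LINT y:{\<alpha>..\<beta>}|lborel. U y s - H y)" by (rule set_integral_diff(2)[OF i1 i2, symmetric])
      finally have d: "d = (\<integral>y. indicator {\<alpha>..\<beta>} y *\<^sub>R (U y s - H y) \<partial>lborel)" by (simp add: set_lebesgue_integral_def)
      have "ennreal (norm d) \<le> (\<integral>\<^sup>+y. ennreal (norm (indicator {\<alpha>..\<beta>} y *\<^sub>R (U y s - H y))) \<partial>lborel)"
        unfolding d by (rule integral_norm_bound_ennreal) (use set_integral_diff(1)[OF i1 i2] in \<open>simp add: set_integrable_def\<close>)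
      also have "\<dots> \<le> (\<integral>\<^sup>+x\<in>{-L..L}. ennreal \<bar>U x s - H x\<bar> \<partial>lborel)"
        by (rule nn_integral_mono) (use \<alpha> in \<open>auto simp: indicator_def\<close>)
      finally show ?thesis unfolding closed_l1 by simp
    qed
    then have "\<forall>\<^sub>F s in at_right 0. ennreal \<bar>d\<bar> \<le> l1 s" using pos_ev by (auto elim: eventually_mono)
    from tendsto_lowerbound[OF l1 this] have "ennreal \<bar>d\<bar> \<le> 0" by (simp add: trivial_limit_at_right_real)
    then show ?thesis by (simp add: d_def)
  qed
  have zero: "\<exists>p\<in>{-L<..<L}. U p t = 0 \<and> (\<forall>x<p. 0 < U x t) \<and> (\<forall>x>p. U x t < 0)" if t: "0 < t" for t
  proof -
    \<comment> \<open>Here \<open>p0 > -L + a\<close> enters: the datum is positive almost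
      everywhere on this interval, so the conserved mass is positive and \<open>U\<close> must be
      positive somewhere in it. At the right end the signs are reversed.\<close>
    have "0 < (LINT y:{-L..-L + a}|lborel. H y)"
      unfolding set_lebesgue_integral_def
    proof (rule integral_pos_if_AE_pos_on_interval[where c = "-L" and d = "-L + a"])
      show "integrable lborel (\<lambda>y. indicator {-L..-L + a} y *\<^sub>R H y)"
        using Hint[of "-L" "-L + a"] a aL by (simp add: set_integrable_def)
      show "AE y in lborel. 0 \<le> indicator {-L..-L + a} y *\<^sub>R H y"
        using p0 to_heat_sign(1)[OF a, of _ p0 L fJ] by (intro AE_I2) (auto simp: indicator_def H_def)
      show "AE y in lborel. -L < y \<and> y < -L + a \<longrightarrow> 0 < indicator {-L..-L + a} y *\<^sub>R H y"
        using strict by eventually_elim (use p0 a aL in auto)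
    qed (use a in simp)
    then have I1: "0 < integral {-L..-L + a} (\<lambda>y. U y t)"
      using mass[of "-L" "-L + a" t] endl t a aL by simp
    have "\<exists>y1\<in>{-L..-L + a}. 0 < U y1 t"
    proof (rule ccontr)
      assume "\<not> ?thesis"
      then have "integral {-L..-L + a} (\<lambda>y. U y t) \<le> integral {-L..-L + a} (\<lambda>y. 0)"
        by (intro integral_le integrable_continuous_real Ucont t) (auto simp: not_less)
      with I1 show False by simp
    qed
    then obtain y1 where y1: "-L \<le> y1" "y1 \<le> -L + a" "0 < U y1 t" by auto
    have "0 < (LINT y:{L - a..L}|lborel. - H y)"
      unfolding set_lebesgue_integral_def
    proof (rule integral_pos_if_AE_pos_on_interval[where c = "L - a" and d = L])
      show "integrable lborel (\<lambda>y. indicator {L - a..L} y *\<^sub>R - H y)"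
        using Hint[of "L - a" L] a aL by (simp add: set_integrable_def)
      show "AE y in lborel. 0 \<le> indicator {L - a..L} y *\<^sub>R - H y"
        using p0 to_heat_sign(2)[OF a, of p0 _ L fJ] by (intro AE_I2) (auto simp: indicator_def H_def)
      show "AE y in lborel. L - a < y \<and> y < L \<longrightarrow> 0 < indicator {L - a..L} y *\<^sub>R - H y"
        using strict by eventually_elim (use p0 a aL in auto)
    qed (use a in simp)
    moreover have "(LINT y:{L - a..L}|lborel. - H y) = - (LINT y:{L - a..L}|lborel. H y)"
      by (simp add: set_lebesgue_integral_def)
    ultimately have I2: "integral {L - a..L} (\<lambda>y. U y t) < 0"
      using mass[of "L - a" L t] endr t a aL by simp
    have "\<exists>y2\<in>{L - a..L}. U y2 t < 0"
    proof (rule ccontr)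
      assume "\<not> ?thesis"
      then have "integral {L - a..L} (\<lambda>y. 0) \<le> integral {L - a..L} (\<lambda>y. U y t)"
        by (intro integral_le integrable_continuous_real Ucont t) (auto simp: not_less)
      with I2 show False by simp
    qed
    then obtain y2 where y2: "L - a \<le> y2" "y2 \<le> L" "U y2 t < 0" by auto
    have "y1 \<le> y2" using cross[OF t, of y2 y1] y1 y2 by (meson less_imp_le linorder_not_less)
    from IVT2'[of "\<lambda>x. U x t" y2 0 y1, OF _ _ this Ucont[OF t]] y1 y2
    obtain p where p: "y1 \<le> p" "p \<le> y2" "U p t = 0" by auto
    have "p \<noteq> y1" "p \<noteq> y2" using p y1 y2 by auto
    then have "p \<in> {-L<..<L}" using p y1 y2 by auto
    moreover have "\<forall>x<p. 0 < U x t" using cross[OF t] p(3) by force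
    moreover have "\<forall>x>p. U x t < 0" using cross[OF t, of p] p(3) by (metis less_irrefl not_less)
    ultimately show ?thesis using p(3) by blast
  qed
  show ?thesis by (rule that[OF Ucal UF zero incr])
qed

section \<open>From the price formation problem to the heat equation\<close>

lemma heat_solutionI:
  assumes "caloric_on (cylinder L) F" "bounded_slope (cylinder L) F"
    "\<And>t. 0 < t \<Longrightarrow> left_slope L F t (Dx F (- L + a) t)" "\<And>t. 0 < t \<Longrightarrow> right_slope L F t (Dx F (L - a) t)"
    "attains_datum L F FI"
  shows "heat_solution L a FI F"
  using assms unfolding heat_solution_def caloric_on_iff[OF open_cylinder] by blast

lemma slope_cong:
  assumes "\<And>x. \<bar>x\<bar> < L \<Longrightarrow> Dx u x t = Dx u' x t" "0 < L"
  shows "left_slope L u t c \<longleftrightarrow> left_slope L u' t c" "right_slope L u t c \<longleftrightarrow> right_slope L u' t c"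
proof -
  have "\<forall>\<^sub>F x in at_right (- L). Dx u x t = Dx u' x t"
    by (rule eventually_at_rightI[of "- L" L]) (use assms in \<open>auto simp: abs_less_iff\<close>)
  then show "left_slope L u t c \<longleftrightarrow> left_slope L u' t c" unfolding left_slope_def by (rule tendsto_cong)
  have "\<forall>\<^sub>F x in at_left L. Dx u x t = Dx u' x t"
    by (rule eventually_at_leftI[of "- L" L]) (use assms in \<open>auto simp: abs_less_iff\<close>)
  then show "right_slope L u t c \<longleftrightarrow> right_slope L u' t c" unfolding right_slope_def by (rule tendsto_cong)
qed

lemma heat_solution_cong:
  assumes F: "heat_solution L a FI F" and a: "0 < a" "a < L"
    and eq: "\<And>x t. \<bar>x\<bar> < L \<Longrightarrow> 0 \<le> t \<Longrightarrow> F' x t = F x t"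
  shows "heat_solution L a FI F'"
proof (rule heat_solutionI)
  have eqc: "F' x t = F x t" if "(x, t) \<in> cylinder L" for x t
    using that by (intro eq) (auto simp: cylinder_def abs_less_iff)
  have D: "Dx F' x t = Dx F x t" if "(x, t) \<in> cylinder L" for x t
    by (rule Dx_eq_on_open[OF open_cylinder that eqc])
  show "caloric_on (cylinder L) F'"
    by (rule caloric_on_cong[OF open_cylinder heat_solution_caloric[OF F] eqc])
  have "(\<lambda>(x, t). Dx F' x t) ` (cylinder L \<inter> UNIV \<times> {s..T}) = (\<lambda>(x, t). Dx F x t) ` (cylinder L \<inter> UNIV \<times> {s..T})" for s T
    by (rule image_cong[OF refl]) (auto simp: D)
  then show "bounded_slope (cylinder L) F'"
    using F by (simp add: heat_solution_def bounded_slope_def)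
  have D': "Dx F' x t = Dx F x t" if "\<bar>x\<bar> < L" "0 < t" for x t
    using that by (intro D) (auto simp: cylinder_def abs_less_iff)
  show "left_slope L F' t (Dx F' (- L + a) t)" "right_slope L F' t (Dx F' (L - a) t)" if "0 < t" for t
    using F that a D' by (auto simp: heat_solution_def slope_cong[where u = F' and u' = F])
  have "\<forall>\<^sub>F t in at_right 0. (\<integral>\<^sup>+ x \<in> {-L<..<L}. ennreal ((F x t - FI x)\<^sup>2) \<partial>lebesgue) = (\<integral>\<^sup>+ x \<in> {-L<..<L}. ennreal ((F' x t - FI x)\<^sup>2) \<partial>lebesgue)"
    using eventually_at_right_less[of "0::real"]
  proof eventually_elim
    case (elim t)
    show ?case by (rule nn_integral_cong) (use eq elim in \<open>auto simp: indicator_def abs_less_iff\<close>)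
  qed
  with F show "attains_datum L F' FI"
    unfolding heat_solution_def attains_datum_def using eq
    by (auto simp: abs_less_iff elim: Lim_transform_eventually)
qed

section \<open>Calculus of L2 limits on the line\<close>

lemma L2_lim_add:
  fixes h k :: "'b \<Rightarrow> real \<Rightarrow> real"
  assumes h: "((\<lambda>s. \<integral>\<^sup>+x. ennreal ((h s x)\<^sup>2) \<partial>lborel) \<longlongrightarrow> 0) F" and k: "((\<lambda>s. \<integral>\<^sup>+x. ennreal ((k s x)\<^sup>2) \<partial>lborel) \<longlongrightarrow> 0) F"
    and m: "\<forall>\<^sub>F s in F. h s \<in> borel_measurable borel" "\<forall>\<^sub>F s in F. k s \<in> borel_measurable borel"
  shows "((\<lambda>s. \<integral>\<^sup>+x. ennreal ((h s x + k s x)\<^sup>2) \<partial>lborel) \<longlongrightarrow> 0) F"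
proof (rule tendsto_sandwich[OF _ _ tendsto_const])
  have "((\<lambda>s. 2 * (\<integral>\<^sup>+x. ennreal ((h s x)\<^sup>2) \<partial>lborel) + 2 * (\<integral>\<^sup>+x. ennreal ((k s x)\<^sup>2) \<partial>lborel)) \<longlongrightarrow> 2 * 0 + 2 * 0) F"
    by (intro tendsto_add ennreal_tendsto_cmult h k) auto
  then show "((\<lambda>s. 2 * (\<integral>\<^sup>+x. ennreal ((h s x)\<^sup>2) \<partial>lborel) + 2 * (\<integral>\<^sup>+x. ennreal ((k s x)\<^sup>2) \<partial>lborel)) \<longlongrightarrow> 0) F" by simp
  show "\<forall>\<^sub>F s in F. (\<integral>\<^sup>+x. ennreal ((h s x + k s x)\<^sup>2) \<partial>lborel) \<le> 2 * (\<integral>\<^sup>+x. ennreal ((h s x)\<^sup>2) \<partial>lborel) + 2 * (\<integral>\<^sup>+x. ennreal ((k s x)\<^sup>2) \<partial>lborel)"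
    using m
  proof eventually_elim
    case (elim s)
    note [measurable] = elim
    have "(\<integral>\<^sup>+x. ennreal ((h s x + k s x)\<^sup>2) \<partial>lborel) \<le> (\<integral>\<^sup>+x. 2 * ennreal ((h s x)\<^sup>2) + 2 * ennreal ((k s x)\<^sup>2) \<partial>lborel)"
    proof (rule nn_integral_mono)
      fix x
      have "0 \<le> (h s x - k s x)\<^sup>2" by simp
      then have "(h s x + k s x)\<^sup>2 \<le> 2 * (h s x)\<^sup>2 + 2 * (k s x)\<^sup>2" by (simp add: power2_sum power2_diff)
      then have "ennreal ((h s x + k s x)\<^sup>2) \<le> ennreal (2 * (h s x)\<^sup>2 + 2 * (k s x)\<^sup>2)" by (rule ennreal_leI)
      also have "\<dots> = 2 * ennreal ((h s x)\<^sup>2) + 2 * ennreal ((k s x)\<^sup>2)" by (simp add: ennreal_mult')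
      finally show "ennreal ((h s x + k s x)\<^sup>2) \<le> 2 * ennreal ((h s x)\<^sup>2) + 2 * ennreal ((k s x)\<^sup>2)" .
    qed
    also have "\<dots> = 2 * (\<integral>\<^sup>+x. ennreal ((h s x)\<^sup>2) \<partial>lborel) + 2 * (\<integral>\<^sup>+x. ennreal ((k s x)\<^sup>2) \<partial>lborel)"
      by (subst nn_integral_add) (auto simp: nn_integral_cmult)
    finally show ?case .
  qed
qed simp

lemma L2_lim_sum:
  fixes h :: "nat \<Rightarrow> 'b \<Rightarrow> real \<Rightarrow> real"
  assumes "\<And>n. ((\<lambda>s. \<integral>\<^sup>+x. ennreal ((h n s x)\<^sup>2) \<partial>lborel) \<longlongrightarrow> 0) F"
    and "\<And>n. \<forall>\<^sub>F s in F. h n s \<in> borel_measurable borel"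
  shows "((\<lambda>s. \<integral>\<^sup>+x. ennreal ((\<Sum>n<N. h n s x)\<^sup>2) \<partial>lborel) \<longlongrightarrow> 0) F"
    and "\<forall>\<^sub>F s in F. (\<lambda>x. \<Sum>n<N. h n s x) \<in> borel_measurable borel"
proof -
  show m: "\<forall>\<^sub>F s in F. (\<lambda>x. \<Sum>n<N. h n s x) \<in> borel_measurable borel" for N
  proof (induction N)
    case (Suc N)
    with assms(2)[of N] show ?case by eventually_elim simp
  qed simp
  show "((\<lambda>s. \<integral>\<^sup>+x. ennreal ((\<Sum>n<N. h n s x)\<^sup>2) \<partial>lborel) \<longlongrightarrow> 0) F"
  proof (induction N)
    case (Suc N)
    from L2_lim_add[OF this assms(1)[of N] m assms(2)] show ?case by simp
  qed simp
qed

lemma L2_lim_affine: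
  fixes h :: "'b \<Rightarrow> real \<Rightarrow> real"
  assumes h: "((\<lambda>s. \<integral>\<^sup>+x. ennreal ((h s x)\<^sup>2) \<partial>lborel) \<longlongrightarrow> 0) F" and m: "\<forall>\<^sub>F s in F. h s \<in> borel_measurable borel"
  shows "((\<lambda>s. \<integral>\<^sup>+x. ennreal ((h s (x + c))\<^sup>2) \<partial>lborel) \<longlongrightarrow> 0) F"
proof -
  have "\<forall>\<^sub>F s in F. (\<integral>\<^sup>+x. ennreal ((h s x)\<^sup>2) \<partial>lborel) = (\<integral>\<^sup>+x. ennreal ((h s (x + c))\<^sup>2) \<partial>lborel)"
    using m
  proof eventually_elim
    case (elim s)
    note [measurable] = elim
    show ?case using nn_integral_real_affine[of "\<lambda>x. ennreal ((h s x)\<^sup>2)" 1 c] by (simp add: add.commute)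
  qed
  with h show ?thesis by (rule Lim_transform_eventually)
qed

lemma L2_lim_bound:
  fixes h k :: "'b \<Rightarrow> real \<Rightarrow> real"
  assumes h: "((\<lambda>s. \<integral>\<^sup>+x. ennreal ((h s x)\<^sup>2) \<partial>lborel) \<longlongrightarrow> 0) F" and k: "\<forall>\<^sub>F s in F. \<forall>x. \<bar>k s x\<bar> \<le> \<bar>h s x\<bar>"
  shows "((\<lambda>s. \<integral>\<^sup>+x. ennreal ((k s x)\<^sup>2) \<partial>lborel) \<longlongrightarrow> 0) F"
proof (rule tendsto_sandwich[OF _ _ tendsto_const h])
  show "\<forall>\<^sub>F s in F. (\<integral>\<^sup>+x. ennreal ((k s x)\<^sup>2) \<partial>lborel) \<le> (\<integral>\<^sup>+x. ennreal ((h s x)\<^sup>2) \<partial>lborel)"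
    using k
  proof eventually_elim
    case (elim s)
    then show ?case by (intro nn_integral_mono ennreal_leI) (simp add: abs_le_square_iff)
  qed
qed simp

text \<open>Dominated convergence: a fixed square-integrable function has vanishing norm on
  intervals shrinking to a point. It controls the error made by cutting the datum at
  \<open>p s\<close> instead of \<open>p0\<close>.\<close>

lemma L2_concentration:
  fixes g :: "real \<Rightarrow> real"
  assumes [measurable]: "g \<in> borel_measurable borel" and fin: "(\<integral>\<^sup>+x. ennreal ((g x)\<^sup>2) \<partial>lborel) < \<infinity>"
    and q: "(q \<longlongrightarrow> c) F"
  shows "((\<lambda>s. \<integral>\<^sup>+x. ennreal ((indicator {x. \<bar>x - c\<bar> \<le> \<bar>q s - c\<bar>} x * g x)\<^sup>2) \<partial>lborel) \<longlongrightarrow> 0) F"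
proof (rule ennreal_tendsto_0I)
  fix e :: real assume e: "0 < e"
  let ?\<delta> = "\<lambda>n. inverse (real (Suc n))"
  let ?h = "\<lambda>n x. ennreal ((indicator {x. \<bar>x - c\<bar> \<le> ?\<delta> n} x * g x)\<^sup>2)"
  have "(\<lambda>n. \<integral>\<^sup>+x. ?h n x \<partial>lborel) \<longlonglongrightarrow> (\<integral>\<^sup>+x. 0 \<partial>(lborel :: real measure))"
  proof (rule nn_integral_dominated_convergence[where w = "\<lambda>x. ennreal ((g x)\<^sup>2)"])
    show "AE x in lborel. ?h n x \<le> ennreal ((g x)\<^sup>2)" for n by (intro AE_I2) (auto simp: indicator_def)
    show "AE x in lborel. (\<lambda>n. ?h n x) \<longlonglongrightarrow> 0"
      using AE_lborel_singleton[of c]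
    proof eventually_elim
      case (elim x)
      have "\<forall>\<^sub>F n in sequentially. ?\<delta> n < \<bar>x - c\<bar>"
        using LIMSEQ_inverse_real_of_nat elim by (intro order_tendstoD(2)) auto
      then have "\<forall>\<^sub>F n in sequentially. ?h n x = 0" by eventually_elim (simp add: indicator_def)
      then show ?case by (rule tendsto_eventually)
    qed
  qed (use fin in measurable)
  then have "\<forall>\<^sub>F n in sequentially. (\<integral>\<^sup>+x. ?h n x \<partial>lborel) < ennreal e"
    using e by (intro order_tendstoD(2)) auto
  then obtain n where n: "(\<integral>\<^sup>+x. ?h n x \<partial>lborel) < ennreal e" using eventually_happens' sequentially_bot by blast
  have "\<forall>\<^sub>F s in F. \<bar>q s - c\<bar> < ?\<delta> n"
    by (rule order_tendstoD(2)[OF tendsto_rabs_zero[OF LIM_zero[OF q]]]) simp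
  then show "\<forall>\<^sub>F s in F. (\<integral>\<^sup>+x. ennreal ((indicator {x. \<bar>x - c\<bar> \<le> \<bar>q s - c\<bar>} x * g x)\<^sup>2) \<partial>lborel) \<le> ennreal e"
  proof eventually_elim
    case (elim s)
    have "(\<integral>\<^sup>+x. ennreal ((indicator {x. \<bar>x - c\<bar> \<le> \<bar>q s - c\<bar>} x * g x)\<^sup>2) \<partial>lborel) \<le> (\<integral>\<^sup>+x. ?h n x \<partial>lborel)"
      by (rule nn_integral_mono) (use elim in \<open>auto simp: indicator_def\<close>)
    then show ?case using n by (meson le_less_trans less_imp_le)
  qed
qed

section \<open>Regions bounded by the free boundary\<close>

lemma mem_cyl: "(x, t) \<in> cylinder L \<longleftrightarrow> \<bar>x\<bar> < L \<and> 0 < t"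
  by (auto simp: cylinder_def)

lemma open_curve_cond:
  assumes p: "continuous_on {0..} (p :: real \<Rightarrow> real)" and Q: "open {w :: real \<times> real. Q (fst w) (snd w)}"
  shows "open {(x, t). 0 < t \<and> Q x (p t)}"
proof -
  have "continuous_on (UNIV \<times> {0<..}) (\<lambda>z :: real \<times> real. (fst z, p (snd z)))"
    by (intro continuous_intros continuous_on_compose2[OF p]) auto
  then have "open ((UNIV \<times> {0<..}) \<inter> (\<lambda>z. (fst z, p (snd z))) -` {w. Q (fst w) (snd w)})"
    by (rule continuous_open_preimage) (auto intro: open_Times Q)
  moreover have "(UNIV \<times> {0<..}) \<inter> (\<lambda>z. (fst z, p (snd z))) -` {w. Q (fst w) (snd w)} = {(x, t). 0 < t \<and> Q x (p t)}" by auto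
  ultimately show ?thesis by simp
qed

lemma mem_off_sources: "0 < a \<Longrightarrow> (x, t) \<in> off_sources L a p \<longleftrightarrow> \<bar>x\<bar> < L \<and> 0 < t \<and> \<bar>x - p t\<bar> \<noteq> a"
  by (auto simp: off_sources_def mem_cyl abs_if)

lemma open_off_sources:
  assumes a: "0 < a" and p: "continuous_on {0..} p"
  shows "open (off_sources L a p)"
proof -
  have "open {(x, t). 0 < t \<and> \<bar>x\<bar> < L \<and> \<bar>x - p t\<bar> \<noteq> a}"
    by (rule open_curve_cond[OF p]) (intro open_Collect_conj open_Collect_less open_Collect_neq continuous_intros)
  moreover have "off_sources L a p = {(x, t). 0 < t \<and> \<bar>x\<bar> < L \<and> \<bar>x - p t\<bar> \<noteq> a}"
    unfolding set_eq_iff split_paired_All mem_off_sources[OF a] mem_Collect_eq prod.case by blast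
  ultimately show ?thesis by simp
qed

locale price_problem =
  fixes L a p0 :: real and fI :: "real \<Rightarrow> real"
  assumes a: "0 < a" and aL: "a < L"
    and L2: "L2_on L fI" and p0: "p0 \<in> {-L + a<..<L - a}" and fI0: "fI p0 = 0"
    and pos: "\<forall>x \<in> {-L<..<L}. x < p0 \<longrightarrow> fI x > 0"
    and neg: "\<forall>x \<in> {-L<..<L}. x > p0 \<longrightarrow> fI x < 0"

lemma (in price_problem) sc_fI: "single_crossing L p0 fI"
  using pos neg fI0 unfolding single_crossing_def by (metis less_eq_real_def order_refl)

locale price_forward = price_problem +
  fixes f :: "real \<Rightarrow> real \<Rightarrow> real" and p :: "real \<Rightarrow> real"
  assumes sol: "price_solution L a fI p0 f p"
begin

lemma p_cont: "continuous_on {0..} p" and p_in: "0 \<le> t \<Longrightarrow> \<bar>p t\<bar> < L" and p_0: "p 0 = p0"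
  and f_cont: "continuous_on (cylinder L) (\<lambda>(x, t). f x t)"
  and f_slope: "bounded_slope (off_sources L a p) f"
  and dirac: "heat_with_dirac_sources L f (\<lambda>t. - Dx f (p t) t) (\<lambda>t. p t - a) (\<lambda>t. p t + a)"
  and f_p: "0 < t \<Longrightarrow> f (p t) t = 0"
  and f_left: "0 < t \<Longrightarrow> left_slope L f t (if p t > -L + a then 0 else Dx f (-L + a) t)"
  and f_right: "0 < t \<Longrightarrow> right_slope L f t (if p t < L - a then 0 else Dx f (L - a) t)"
  and f_att: "attains_datum L f fI"
  using sol unfolding price_solution_def by (auto simp: abs_less_iff)

lemma p_cont_on: "S \<subseteq> {0<..} \<Longrightarrow> continuous_on S p"
  by (rule continuous_on_subset[OF p_cont]) auto

lemmas mem_off = mem_off_sources[OF a, where p = p and L = L]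

lemmas open_off = open_off_sources[OF a p_cont, where L = L]

text \<open>The distributional equation tested with one mollifier; since the mollifier vanishes off
  the square, the integral over the cylinder shrinks to it.\<close>

lemma dirac_mol:
  assumes r: "0 < r" and sub: "sqbox x t r \<subseteq> cylinder L"
  shows "integral (sqbox x t r) (\<lambda>(y, s). f y s * (mol 0 1 r x t y s - mol 2 0 r x t y s)) =
    (LINT s:{0<..}|lborel. - Dx f (p s) s * (mol 0 0 r x t (p s - a) s - mol 0 0 r x t (p s + a) s))"
proof -
  let ?g = "\<lambda>z. f (fst z) (snd z) * (mol 0 1 r x t (fst z) (snd z) - mol 2 0 r x t (fst z) (snd z))"
  have "continuous_on (sqbox x t r) (\<lambda>z. f (fst z) (snd z))"
    using continuous_on_subset[OF f_cont sub] by (simp add: case_prod_unfold)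
  then have "continuous_on (sqbox x t r) ?g" by (intro continuous_intros)
  then have "set_integrable lborel (sqbox x t r) ?g"
    unfolding set_integrable_def by (intro borel_integrable_compact compact_cbox)
  then have "integral (sqbox x t r) ?g = (LINT z:sqbox x t r|lborel. ?g z)"
    by (rule set_borel_integral_eq_integral(2)[symmetric])
  also have "\<dots> = (LINT z:cylinder L|lborel. ?g z)"
    unfolding set_lebesgue_integral_def
  proof (rule Bochner_Integration.integral_cong[OF refl])
    fix z :: "real \<times> real"
    show "indicator (sqbox x t r) z *\<^sub>R ?g z = indicator (cylinder L) z *\<^sub>R ?g z"
    proof (cases "z \<in> sqbox x t r")
      case True
      then show ?thesis using sub by auto
    next
      case False
      then have "?g z = 0" using mol_eq_0[OF r, of "fst z" "snd z" x t] by simp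
      then show ?thesis by simp
    qed
  qed
  also have "\<dots> = (LINT s:{0<..}|lborel. - Dx f (p s) s * (mol 0 0 r x t (p s - a) s - mol 0 0 r x t (p s + a) s))"
    using dirac[unfolded heat_with_dirac_sources_def, rule_format, OF test_function_mol(1)[OF r sub]]
    by (simp add: test_function_mol(2,3)[OF r sub])
  finally show ?thesis by (simp add: case_prod_unfold)
qed

text \<open>A price solution is classically differentiable off the sources, but its equation is
  postulated only in distributions. Squares that avoid the sources see no Dirac mass, and Weyl's
  lemma gives the equation pointwise.\<close>

lemma f_caloric: "caloric_on (off_sources L a p) f"
proof (rule weakly_caloric_imp_caloric[OF open_off])
  have cyl: "off_sources L a p \<subseteq> cylinder L" by (auto simp: off_sources_def)
  show "continuous_on (off_sources L a p) (\<lambda>(x, t). f x t)" by (rule continuous_on_subset[OF f_cont cyl])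
  show "weakly_caloric_on (off_sources L a p) f" unfolding weakly_caloric_on_def
  proof (intro allI impI)
    fix x t r :: real assume r: "0 < r" and sub: "sqbox x t r \<subseteq> off_sources L a p"
    have "mol 0 0 r x t (p s - a) s = 0" "mol 0 0 r x t (p s + a) s = 0" for s
      using sub by (auto intro!: mol_eq_0[OF r] simp: off_sources_def)
    then show "integral (sqbox x t r) (\<lambda>(y, s). f y s * (mol 0 1 r x t y s - mol 2 0 r x t y s)) = 0"
      using dirac_mol[OF r order_trans[OF sub cyl]] by simp
  qed
qed

lemmas fD = caloric_onD[OF open_off f_caloric]

text \<open>Within distance \<open>a\<close> of the curve \<open>f\<close> itself has no source, and
  \<open>f (x - \<sigma> * a)\<close> has only the one at \<open>x = p t\<close>; the other sits at
  \<open>p t + 2 * \<sigma> * a\<close>. The bounds on \<open>x\<close> keep both arguments in the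
  interval.\<close>

definition near :: "real \<Rightarrow> (real \<times> real) set" where
  "near \<sigma> = {(x, t). 0 < t \<and> \<bar>x\<bar> < L \<and> \<bar>x - \<sigma> * a\<bar> < L \<and> \<bar>x - p t\<bar> < a}"

definition cut_sum :: "real \<Rightarrow> real \<Rightarrow> real \<Rightarrow> real" where
  "cut_sum \<sigma> x t = f (x - \<sigma> * a) t + (if 0 < \<sigma> * (p t - x) then f x t else 0)"

lemma open_near: "open (near \<sigma>)"
  unfolding near_def by (rule open_curve_cond[OF p_cont]) (intro open_Collect_conj open_Collect_less continuous_intros)

text \<open>
  The source of \<open>f\<close> at \<open>p - a\<close>, shifted to \<open>p\<close>, compensates the kink that \<open>f\<close> acquires at
  \<open>p\<close> when it is cut off there.
\<close>

lemma cut_sum_caloric: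
  assumes \<sigma>: "\<sigma> = 1 \<or> \<sigma> = -1"
  shows "caloric_on (near \<sigma>) (cut_sum \<sigma>)"
proof (rule weakly_caloric_imp_caloric[OF open_near])
  define g where "g = (\<lambda>x t. if \<sigma> * (p t - x) \<le> 0 then 0 else f x t)"
  have g: "(if 0 < \<sigma> * (p t - x) then f x t else 0) = g x t" for x t by (simp add: g_def not_le)
  have V: "cut_sum \<sigma> x t = f (x - \<sigma> * a) t + g x t" for x t by (simp add: cut_sum_def g)
  have nearD: "0 < t" "\<bar>x\<bar> < L" "\<bar>x - \<sigma> * a\<bar> < L" "\<bar>x - p t\<bar> < a" if "(x, t) \<in> near \<sigma>" for x t
    using that by (auto simp: near_def)
  have fc: "continuous_on (near \<sigma>) (\<lambda>z. f (fst z) (snd z))"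
  proof -
    have "near \<sigma> \<subseteq> cylinder L" by (auto simp: near_def mem_cyl)
    from continuous_on_subset[OF f_cont this] show ?thesis by (simp add: case_prod_unfold)
  qed
  have fsc: "continuous_on (near \<sigma>) (\<lambda>z. f (fst z - \<sigma> * a) (snd z))"
  proof -
    have "continuous_on (near \<sigma>) (\<lambda>z. (\<lambda>(x, t). f x t) (fst z - \<sigma> * a, snd z))"
      by (rule continuous_on_compose2[OF f_cont]) (auto intro!: continuous_intros simp: mem_cyl dest: nearD)
    then show ?thesis by simp
  qed
  have pc: "continuous_on (near \<sigma>) (\<lambda>z. p (snd z))"
    by (rule continuous_on_compose2[OF p_cont_on[OF order_refl]]) (auto intro!: continuous_intros dest: nearD)
  have gc: "continuous_on (near \<sigma>) (\<lambda>z. g (fst z) (snd z))"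
    unfolding g_def
  proof (rule continuous_on_cases_le)
    show "continuous_on {z \<in> near \<sigma>. 0 \<le> \<sigma> * (p (snd z) - fst z)} (\<lambda>z. f (fst z) (snd z))"
      by (rule continuous_on_subset[OF fc]) auto
    show "continuous_on (near \<sigma>) (\<lambda>z. \<sigma> * (p (snd z) - fst z))" by (intro continuous_intros pc)
    show "0 = f (fst z) (snd z)" if "z \<in> near \<sigma>" "\<sigma> * (p (snd z) - fst z) = 0" for z
    proof -
      have "fst z = p (snd z)" using that(2) \<sigma> by auto
      moreover have "0 < snd z" using that(1) nearD(1)[of "fst z" "snd z"] by simp
      ultimately show ?thesis using f_p by simp
    qed
  qed simp
  show "continuous_on (near \<sigma>) (\<lambda>(x, t). cut_sum \<sigma> x t)"
    unfolding V case_prod_unfold by (intro continuous_on_add fsc gc)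
  show "weakly_caloric_on (near \<sigma>) (cut_sum \<sigma>)" unfolding weakly_caloric_on_def
  proof (intro allI impI)
    fix x t r :: real assume r: "0 < r" and sub: "sqbox x t r \<subseteq> near \<sigma>"
    let ?Q = "sqbox x t r"
    let ?\<phi> = "\<lambda>i j y s. mol i j r x t y s"
    let ?\<psi> = "\<lambda>z. ?\<phi> 0 1 (fst z) (snd z) - ?\<phi> 2 0 (fst z) (snd z)"
    \<comment> \<open>Flux of \<open>f\<close> through the free boundary, weighted by the test
      function. The shifted term contributes \<open>- \<sigma> * I\<close> and the cut term
      \<open>\<sigma> * I\<close>.\<close>
    define I where "I = (LINT s:{0<..}|lborel. Dx f (p s) s * ?\<phi> 0 0 (p s) s)"
    have rn: "r \<noteq> 0" using r by simp
    have Q0: "0 < s" if "s \<in> {t - r..t + r}" for s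
    proof -
      have "(x, s) \<in> ?Q" using that r by (auto simp: cbox_Pair_eq)
      then show ?thesis using sub nearD(1) by blast
    qed
    \<comment> \<open>The square lies within distance \<open>a\<close> of the curve, so the
      mollifier does not see any other source.\<close>
    have far: "?\<phi> 0 0 (p s + k) s = 0" if "\<bar>k\<bar> \<ge> a" for s k
    proof (rule mol_eq_0[OF r])
      have "(p s + k, s) \<notin> near \<sigma>" using that by (auto simp: near_def)
      then show "(p s + k, s) \<notin> ?Q \<or> \<bar>p s + k - x\<bar> = r \<or> \<bar>s - t\<bar> = r" using sub by blast
    qed
    have c\<psi>: "continuous_on ?Q ?\<psi>" by (intro continuous_intros)
    have fQ: "continuous_on ?Q (\<lambda>z. f (fst z) (snd z))" and fsQ: "continuous_on ?Q (\<lambda>z. f (fst z - \<sigma> * a) (snd z))"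
      and gQ: "continuous_on ?Q (\<lambda>z. g (fst z) (snd z))"
      using fc fsc gc sub by (auto elim: continuous_on_subset)
    have QQ: "cbox (x - r, t - r) (x + r, t + r) = ?Q" ..
    have "integral ?Q (\<lambda>z. f (fst z - \<sigma> * a) (snd z) * ?\<psi> z) = - \<sigma> * I"
    proof -
      let ?Q' = "sqbox (x - \<sigma> * a) t r"
      have subc: "?Q' \<subseteq> cylinder L"
      proof
        fix z assume z: "z \<in> ?Q'"
        then have "(fst z + \<sigma> * a, snd z) \<in> ?Q"
          using fst_snd_mem_sqbox[of z "x - \<sigma> * a" r t] unfolding mem_sqbox by linarith
        then have "(fst z + \<sigma> * a, snd z) \<in> near \<sigma>" using sub by blast
        from nearD(1,3)[OF this] show "z \<in> cylinder L" by (cases z) (simp add: mem_cyl)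
      qed
      have m: "mol i j r (x - \<sigma> * a) t y s = ?\<phi> i j (y + \<sigma> * a) s" for i j y s
        by (simp add: mol_def algebra_simps)
      have "integral (cbox ((x - r, t - r) - (\<sigma> * a, 0)) ((x + r, t + r) - (\<sigma> * a, 0)))
          (\<lambda>z. (\<lambda>z. f (fst z - \<sigma> * a) (snd z) * ?\<psi> z) (z + (\<sigma> * a, 0))) = integral ?Q (\<lambda>z. f (fst z - \<sigma> * a) (snd z) * ?\<psi> z)"
        by (rule integral_shift_cbox)
      moreover have "cbox ((x - r, t - r) - (\<sigma> * a, 0)) ((x + r, t + r) - (\<sigma> * a, 0)) = ?Q'"
        by (simp add: algebra_simps)
      ultimately have "integral ?Q (\<lambda>z. f (fst z - \<sigma> * a) (snd z) * ?\<psi> z)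
         = integral ?Q' (\<lambda>(y, s). f y s * (mol 0 1 r (x - \<sigma> * a) t y s - mol 2 0 r (x - \<sigma> * a) t y s))"
        by (simp add: m case_prod_unfold)
      also have "\<dots> = (LINT s:{0<..}|lborel. - Dx f (p s) s * (?\<phi> 0 0 (p s - a + \<sigma> * a) s - ?\<phi> 0 0 (p s + a + \<sigma> * a) s))"
        using dirac_mol[OF r subc] by (simp only: m)
      also have "\<dots> = (LINT s:{0<..}|lborel. - \<sigma> * (Dx f (p s) s * ?\<phi> 0 0 (p s) s))"
        using \<sigma> a far[of "2 * a"] far[of "- 2 * a"] by (auto simp: algebra_simps)
      also have "\<dots> = - \<sigma> * I" unfolding I_def by (rule set_integral_mult_right)
      finally show ?thesis .
    qed
    moreover have "integral ?Q (\<lambda>z. g (fst z) (snd z) * ?\<psi> z) = \<sigma> * I"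
    proof -
      have Qoff: "?Q \<subseteq> off_sources L a p" using sub nearD by (fastforce simp: mem_off)
      have green: "(LINT z:{z \<in> ?Q. fst z < p (snd z)}|lborel. f (fst z) (snd z) * ?\<psi> z) = I"
      proof -
        have "(LINT z:{z \<in> ?Q. fst z < p (snd z)}|lborel. f (fst z) (snd z) *
            (- (- ?\<phi> 0 1 (fst z) (snd z)) - ?\<phi> 2 0 (fst z) (snd z))) =
          (LINT s:{t - r..t + r}|lborel. Dx f (p s) s * ?\<phi> 0 0 (p s) s)"
        proof (rule free_boundary_green[where u = f and v = "Dx f" and w = "Dx (Dx f)" and \<phi> = "?\<phi> 0 0" and \<phi>t = "\<lambda>y s. - ?\<phi> 0 1 y s"
              and \<phi>xx = "?\<phi> 2 0" and \<phi>x = "\<lambda>y s. - ?\<phi> 1 0 y s"])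
          show "continuous_on ?Q (\<lambda>(x, y). f x y)" "continuous_on ?Q (\<lambda>(x, y). Dx f x y)" "continuous_on ?Q (\<lambda>(x, y). Dx (Dx f) x y)"
            using fD(1-3) Qoff by (meson continuous_on_subset)+
          show "((\<lambda>y. f y s) has_real_derivative Dx f y s) (at y)"
            "((\<lambda>y. Dx f y s) has_real_derivative Dx (Dx f) y s) (at y)"
            "((\<lambda>s. f y s) has_real_derivative Dx (Dx f) y s) (at s)" if "(y, s) \<in> ?Q" for y s
            using fD(4-6)[OF subsetD[OF Qoff that]] .
          show "((\<lambda>y. mol 0 0 r x t y s) has_real_derivative - mol 1 0 r x t y s) (at y)"
            "((\<lambda>y. - mol 1 0 r x t y s) has_real_derivative mol 2 0 r x t y s) (at y)"
            "((\<lambda>s. mol 0 0 r x t y s) has_real_derivative - mol 0 1 r x t y s) (at s)" for y s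
            using DERIV_mol(3)[OF rn, of 0 0] DERIV_minus[OF DERIV_mol(3)[OF rn, of 1 0]] DERIV_mol(4)[OF rn, of 0 0]
            by (auto simp: numeral_2_eq_2)
          show "continuous_on UNIV (\<lambda>(y, s). mol 0 0 r x t y s)" "continuous_on UNIV (\<lambda>(y, s). - mol 1 0 r x t y s)"
            "continuous_on UNIV (\<lambda>(y, s). mol 2 0 r x t y s)" "continuous_on UNIV (\<lambda>(y, s). - mol 0 1 r x t y s)"
            unfolding case_prod_unfold by (intro continuous_intros)+
          show "mol 0 0 r x t y s = 0 \<and> - mol 1 0 r x t y s = 0" if "(y, s) \<notin> box (x - r, t - r) (x + r, t + r)" for y s
          proof -
            have "(y, s) \<notin> ?Q \<or> \<bar>y - x\<bar> = r \<or> \<bar>s - t\<bar> = r"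
              using that r by (auto simp: mem_box Basis_prod_def cbox_Pair_eq abs_if)
            then show ?thesis using mol_eq_0[OF r] by simp
          qed
          show "continuous_on {t - r..t + r} p" by (rule p_cont_on) (use Q0 in auto)
          show "f (p s) s = 0" if "s \<in> {t - r..t + r}" for s using f_p Q0[OF that] .
        qed (use r in auto)
        also have "\<dots> = I"
          unfolding I_def set_lebesgue_integral_def
        proof (rule Bochner_Integration.integral_cong[OF refl])
          fix s :: real
          show "indicator {t - r..t + r} s *\<^sub>R (Dx f (p s) s * ?\<phi> 0 0 (p s) s) = indicator {0<..} s *\<^sub>R (Dx f (p s) s * ?\<phi> 0 0 (p s) s)"
          proof (cases "s \<in> {t - r..t + r}")
            case True
            then show ?thesis using Q0[OF True] by simp
          next
            case False
            then have "?\<phi> 0 0 (p s) s = 0" by (intro mol_eq_0[OF r]) (auto simp: cbox_Pair_eq)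
            then show ?thesis by simp
          qed
        qed
        finally show ?thesis by simp
      qed
      have SI: "set_integrable lborel ?Q (\<lambda>z. f (fst z) (snd z) * ?\<psi> z)"
        unfolding set_integrable_def by (intro borel_integrable_compact compact_cbox continuous_on_mult fQ c\<psi>)
      have "set_integrable lborel ?Q (\<lambda>z. g (fst z) (snd z) * ?\<psi> z)"
        unfolding set_integrable_def by (intro borel_integrable_compact compact_cbox continuous_on_mult gQ c\<psi>)
      from set_borel_integral_eq_integral(2)[OF this]
      have gL: "integral ?Q (\<lambda>z. g (fst z) (snd z) * ?\<psi> z) = (LINT z:?Q|lborel. g (fst z) (snd z) * ?\<psi> z)" ..
      show ?thesis
      \<comment> \<open>Green's formula is available for left parts. For \<open>\<sigma> = 1\<close>
        this is the cut function itself; for \<open>\<sigma> = -1\<close> the right part is the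
        whole square minus the left part, up to the null graph, and the whole square contributes 0
        because \<open>f\<close> has no source in it.\<close>
      proof (cases "\<sigma> = 1")
        case True
        have "(LINT z:?Q|lborel. g (fst z) (snd z) * ?\<psi> z) = (LINT z:{z \<in> ?Q. fst z < p (snd z)}|lborel. f (fst z) (snd z) * ?\<psi> z)"
          unfolding set_lebesgue_integral_def
          by (rule Bochner_Integration.integral_cong) (auto simp: g_def True indicator_def)
        then show ?thesis using gL green True by simp
      next
        case False
        then have \<sigma>': "\<sigma> = -1" using \<sigma> by simp
        have nullG: "AE z in lborel. z \<notin> {z. snd z \<in> {t - r..t + r} \<and> fst z = p (snd z)}"
          by (intro AE_not_in null_sets_graph p_cont_on) (use Q0 in auto)
        have mS: "{z \<in> ?Q. fst z < p (snd z)} \<in> sets borel"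
        proof -
          have "closed {z \<in> ?Q. p (snd z) \<le> fst z}"
            using continuous_on_subset[OF pc sub] by (intro continuous_on_closed_Collect_le continuous_intros closed_cbox)
          moreover have "{z \<in> ?Q. fst z < p (snd z)} = ?Q - {z \<in> ?Q. p (snd z) \<le> fst z}" by auto
          ultimately show ?thesis by (auto intro!: sets.Diff borel_closed)
        qed
        have SS: "set_integrable lborel {z \<in> ?Q. fst z < p (snd z)} (\<lambda>z. f (fst z) (snd z) * ?\<psi> z)"
          by (rule set_integrable_subset[OF SI]) (use mS in auto)
        have "(LINT z:?Q|lborel. g (fst z) (snd z) * ?\<psi> z) =
          (\<integral>z. indicator ?Q z *\<^sub>R (f (fst z) (snd z) * ?\<psi> z) - indicator {z \<in> ?Q. fst z < p (snd z)} z *\<^sub>R (f (fst z) (snd z) * ?\<psi> z) \<partial>lborel)"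
          unfolding set_lebesgue_integral_def
        proof (rule integral_cong_AE)
          show "AE z in lborel. indicator ?Q z *\<^sub>R (g (fst z) (snd z) * ?\<psi> z) =
            indicator ?Q z *\<^sub>R (f (fst z) (snd z) * ?\<psi> z) - indicator {z \<in> ?Q. fst z < p (snd z)} z *\<^sub>R (f (fst z) (snd z) * ?\<psi> z)"
            using nullG by eventually_elim (auto simp: g_def \<sigma>' indicator_def fst_snd_mem_sqbox abs_le_iff)
          show "(\<lambda>z. indicator ?Q z *\<^sub>R (g (fst z) (snd z) * ?\<psi> z)) \<in> borel_measurable lborel"
            by (intro borel_measurable_integrable borel_integrable_compact compact_cbox continuous_on_mult gQ c\<psi>)
          show "(\<lambda>z. indicator ?Q z *\<^sub>R (f (fst z) (snd z) * ?\<psi> z) - indicator {z \<in> ?Q. fst z < p (snd z)} z *\<^sub>R (f (fst z) (snd z) * ?\<psi> z)) \<in> borel_measurable lborel"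
            using SI SS unfolding set_integrable_def by (intro borel_measurable_diff borel_measurable_integrable)
        qed
        also have "\<dots> = (LINT z:?Q|lborel. f (fst z) (snd z) * ?\<psi> z) - I"
          using SI SS green unfolding set_integrable_def set_lebesgue_integral_def
          by (subst Bochner_Integration.integral_diff) auto
        also have "(LINT z:?Q|lborel. f (fst z) (snd z) * ?\<psi> z) = 0"
        proof -
          have "?Q \<subseteq> cylinder L" using Qoff by (auto simp: off_sources_def)
          moreover have "?\<phi> 0 0 (p s - a) s = 0" "?\<phi> 0 0 (p s + a) s = 0" for s
            using far[of "- a" s] far[of a s] a by auto
          ultimately have "integral ?Q (\<lambda>z. f (fst z) (snd z) * ?\<psi> z) = 0"
            using dirac_mol[OF r] by (simp add: case_prod_unfold)
          then show ?thesis using set_borel_integral_eq_integral(2)[OF SI] by simp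
        qed
        finally show ?thesis using gL \<sigma>' by simp
      qed
    qed
    moreover have "integral ?Q (\<lambda>(y, s). cut_sum \<sigma> y s * (mol 0 1 r x t y s - mol 2 0 r x t y s)) =
      integral ?Q (\<lambda>z. f (fst z - \<sigma> * a) (snd z) * ?\<psi> z) + integral ?Q (\<lambda>z. g (fst z) (snd z) * ?\<psi> z)"
      unfolding case_prod_unfold V distrib_right
      by (rule Henstock_Kurzweil_Integration.integral_add; intro integrable_continuous continuous_on_mult fsQ gQ c\<psi>)
    ultimately show "integral ?Q (\<lambda>(y, s). cut_sum \<sigma> y s * (mol 0 1 r x t y s - mol 2 0 r x t y s)) = 0" by simp
  qed
qed

end

lemma attains_datumI_borel:
  assumes "\<And>x. x \<in> {-L<..<L} \<Longrightarrow> u x 0 = u0 x" "AE x in lborel. x \<in> {-L<..<L} \<longrightarrow> v0 x = u0 x"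
    and lim: "((\<lambda>s. \<integral>\<^sup>+x. ennreal ((indicator {-L<..<L} x * (u x s - v0 x))\<^sup>2) \<partial>lborel) \<longlongrightarrow> 0) (at_right 0)"
  shows "attains_datum L u u0"
proof -
  have "(\<integral>\<^sup>+x\<in>{-L<..<L}. ennreal ((u x s - u0 x)\<^sup>2) \<partial>lebesgue) = (\<integral>\<^sup>+x. ennreal ((indicator {-L<..<L} x * (u x s - v0 x))\<^sup>2) \<partial>lborel)" for s
    unfolding nn_integral_completion
    by (rule nn_integral_cong_AE) (use assms(2) in \<open>eventually_elim, auto simp: indicator_def\<close>)
  with lim assms(1) show ?thesis by (simp add: attains_datum_def)
qed

text \<open>\<open>\<sigma> = 1\<close> keeps the part to the left of \<open>q\<close>,
  \<open>\<sigma> = -1\<close> the part to the right, and the shifts in \<open>shift_sum\<close> go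
  towards the cut. This treats both sides at once.\<close>

definition cut_off :: "real \<Rightarrow> real \<Rightarrow> real \<Rightarrow> (real \<Rightarrow> real) \<Rightarrow> real \<Rightarrow> real" where
  "cut_off L q \<sigma> g x = (if \<bar>x\<bar> < L \<and> 0 < \<sigma> * (q - x) then g x else 0)"

definition shift_sum :: "real \<Rightarrow> real \<Rightarrow> real \<Rightarrow> real \<Rightarrow> (real \<Rightarrow> real) \<Rightarrow> real \<Rightarrow> real" where
  "shift_sum L a q \<sigma> g x = (\<Sum>n. cut_off L q \<sigma> g (x + \<sigma> * (real n * a)))"

text \<open>The formula for \<open>to_heat\<close> without truncation to the positive and negative parts; the two agree once the sign of \<open>g\<close> is known.\<close>

definition unsigned_to_heat :: "real \<Rightarrow> real \<Rightarrow> real \<Rightarrow> (real \<Rightarrow> real) \<Rightarrow> real \<Rightarrow> real" where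
  "unsigned_to_heat L a q g x = shift_sum L a q 1 g x + shift_sum L a q (- 1) g x"

lemma shift_sum_0:
  assumes "0 < a" "\<sigma> = 1 \<or> \<sigma> = -1" "\<sigma> * (q - x) \<le> 0"
  shows "shift_sum L a q \<sigma> g x = 0"
proof -
  have "\<sigma> * (q - (x + \<sigma> * (real n * a))) \<le> 0" for n
  proof -
    have "0 \<le> real n * a" using assms(1) by simp
    then show ?thesis using assms(2,3) by (auto simp: algebra_simps)
  qed
  then have "cut_off L q \<sigma> g (x + \<sigma> * (real n * a)) = 0" for n unfolding cut_off_def by (meson leD)
  then show ?thesis by (simp add: shift_sum_def)
qed

lemma cut_off_shift_0:
  assumes "0 < a" "\<sigma> = 1 \<or> \<sigma> = -1" "L + \<bar>x\<bar> \<le> real N * a" "N \<le> n"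
  shows "cut_off L q \<sigma> g (x + \<sigma> * (real n * a)) = 0"
proof -
  have "real N * a \<le> real n * a" using assms by simp
  then have "L \<le> \<bar>x + \<sigma> * (real n * a)\<bar>" using assms(2,3) by auto
  then show ?thesis by (simp add: cut_off_def)
qed

lemma shift_sum_finite:
  assumes "0 < a" "\<sigma> = 1 \<or> \<sigma> = -1" "L + \<bar>x\<bar> \<le> real N * a"
  shows "shift_sum L a q \<sigma> g x = (\<Sum>n<N. cut_off L q \<sigma> g (x + \<sigma> * (real n * a)))"
  unfolding shift_sum_def by (rule suminf_finite) (auto simp: cut_off_shift_0[OF assms])

lemma shift_sum_rec:
  assumes a: "0 < a" and \<sigma>: "\<sigma> = 1 \<or> \<sigma> = -1"
  shows "shift_sum L a q \<sigma> g x = cut_off L q \<sigma> g x + shift_sum L a q \<sigma> g (x + \<sigma> * a)"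
proof -
  obtain N where "(L + \<bar>x\<bar>) / a < real N" using reals_Archimedean2 by blast
  then have N: "L + \<bar>x\<bar> \<le> real N * a" using a by (simp add: field_simps)
  have e: "x + \<sigma> * (real (Suc n) * a) = x + \<sigma> * a + \<sigma> * (real n * a)" for n by (simp add: algebra_simps)
  show ?thesis unfolding shift_sum_def
    by (subst suminf_split_first[of N]) (simp_all add: cut_off_shift_0[OF a \<sigma> N] e del: of_nat_Suc)
qed

lemma unsigned_to_heat_at: "0 < a \<Longrightarrow> unsigned_to_heat L a q g q = 0"
  by (simp add: unsigned_to_heat_def shift_sum_0)

lemma unsigned_to_heat_side:
  assumes "0 < a" "\<sigma> = 1 \<or> \<sigma> = -1" "0 \<le> \<sigma> * (q - x)"
  shows "unsigned_to_heat L a q g x = shift_sum L a q \<sigma> g x"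
  using assms shift_sum_0[of a "- \<sigma>" q x L g] by (auto simp: unsigned_to_heat_def)

lemma unsigned_to_heat_rec:
  assumes a: "0 < a" and \<sigma>: "\<sigma> = 1 \<or> \<sigma> = -1" and x: "\<bar>x\<bar> < L" "0 < \<sigma> * (q - x)"
  shows "unsigned_to_heat L a q g x = g x + (if a < \<sigma> * (q - x) then unsigned_to_heat L a q g (x + \<sigma> * a) else 0)"
proof -
  have e: "\<sigma> * (q - (x + \<sigma> * a)) = \<sigma> * (q - x) - a" using \<sigma> by (auto simp: algebra_simps)
  have "shift_sum L a q \<sigma> g (x + \<sigma> * a) = (if a < \<sigma> * (q - x) then unsigned_to_heat L a q g (x + \<sigma> * a) else 0)"
    using unsigned_to_heat_side[OF a \<sigma>, of q "x + \<sigma> * a" L g] shift_sum_0[OF a \<sigma>, of q "x + \<sigma> * a" L g] e by auto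
  moreover have "cut_off L q \<sigma> g x = g x" using x by (simp add: cut_off_def)
  ultimately show ?thesis using unsigned_to_heat_side[OF a \<sigma>, of q x L g] shift_sum_rec[OF a \<sigma>, of L q g x] x by simp
qed

lemma unsigned_to_heat_eq:
  assumes a: "0 < a" and sc: "single_crossing L q g"
  shows "unsigned_to_heat L a q g x = to_heat L a q g x"
proof -
  have "cut_off L q 1 g y = pos_ext L g y" "- cut_off L q (- 1) g y = neg_ext L g y" for y
  proof -
    have "y \<in> {-L<..<L} \<Longrightarrow> (y \<le> q \<longrightarrow> 0 \<le> g y) \<and> (q \<le> y \<longrightarrow> g y \<le> 0)"
      using sc unfolding single_crossing_def by blast
    then show "cut_off L q 1 g y = pos_ext L g y" "- cut_off L q (- 1) g y = neg_ext L g y"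
      by (auto simp: cut_off_def pos_ext_def neg_ext_def abs_less_iff max_def)
  qed
  note c = this
  have 1: "shift_sum L a q 1 g x = (\<Sum>n. pos_ext L g (x + real n * a))"
    by (simp add: shift_sum_def c)
  have c2: "cut_off L q (- 1) g y = - neg_ext L g y" for y using c(2)[of y] by simp
  obtain N where N: "\<And>n. n \<ge> N \<Longrightarrow> neg_ext L g (x - real n * a) = 0"
    using pos_ext_shift_eventually_0(2)[OF a] by metis
  have "summable (\<lambda>n. neg_ext L g (x - real n * a))" by (rule summable_finite[of "{..<N}"]) (use N in auto)
  then have 2: "shift_sum L a q (- 1) g x = - (\<Sum>n. neg_ext L g (x - real n * a))"
    by (simp add: shift_sum_def c2 suminf_minus)
  consider "x < q" | "x = q" | "q < x" by linarith
  then show ?thesis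
  proof cases
    case 1
    then show ?thesis using shift_sum_0[OF a, of "- 1" q x L g] by (simp add: unsigned_to_heat_def to_heat_def \<open>shift_sum L a q 1 g x = _\<close>)
  next
    case 2
    then show ?thesis using unsigned_to_heat_at[OF a] by (simp add: to_heat_def)
  next
    case 3
    then show ?thesis using shift_sum_0[OF a, of 1 q x L g] by (simp add: unsigned_to_heat_def to_heat_def 2)
  qed
qed

lemma unsigned_to_heat_cong:
  assumes "\<And>y. \<bar>y\<bar> < L \<Longrightarrow> g y = h y"
  shows "unsigned_to_heat L a q g x = unsigned_to_heat L a q h x"
proof -
  have "cut_off L q \<sigma> g = cut_off L q \<sigma> h" for \<sigma> by (auto simp: cut_off_def assms fun_eq_iff)
  then show ?thesis by (simp add: unsigned_to_heat_def shift_sum_def)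
qed

text \<open>Where both cuts keep or both remove a point, the difference is at most
  \<open>\<bar>g - h\<bar>\<close>. Where they disagree, \<open>y\<close> lies between
  \<open>q\<close> and \<open>c\<close>, and the surviving value is at most
  \<open>\<bar>g - h\<bar> + \<bar>h\<bar>\<close>.\<close>

lemma cut_off_diff_le:
  assumes "\<sigma> = 1 \<or> \<sigma> = -1"
  shows "\<bar>cut_off L q \<sigma> g y - cut_off L c \<sigma> h y\<bar> \<le> \<bar>indicator {-L<..<L} y * (g y - h y)\<bar>
    + \<bar>indicator {y. \<bar>y - c\<bar> \<le> \<bar>q - c\<bar>} y * (indicator {-L<..<L} y * h y)\<bar>"
  using assms by (auto simp: cut_off_def indicator_def abs_less_iff)

lemma unsigned_to_heat_diff_le:
  fixes L a q c :: real and g h :: "real \<Rightarrow> real"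
  assumes a: "0 < a" and N: "2 * L \<le> real N * a" and x: "\<bar>x\<bar> < L"
  defines "E \<equiv> \<lambda>y. \<bar>indicator {-L<..<L} y * (g y - h y)\<bar> + \<bar>indicator {y. \<bar>y - c\<bar> \<le> \<bar>q - c\<bar>} y * (indicator {-L<..<L} y * h y)\<bar>"
  shows "\<bar>unsigned_to_heat L a q g x - unsigned_to_heat L a c h x\<bar> \<le> (\<Sum>n<N. E (x + real n * a) + E (x + - (real n * a)))"
proof -
  have N': "L + \<bar>x\<bar> \<le> real N * a" using N x by simp
  have "\<bar>shift_sum L a q \<sigma> g x - shift_sum L a c \<sigma> h x\<bar> \<le> (\<Sum>n<N. E (x + \<sigma> * (real n * a)))" if \<sigma>: "\<sigma> = 1 \<or> \<sigma> = -1" for \<sigma>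
    unfolding shift_sum_finite[OF a \<sigma> N'] sum_subtractf[symmetric]
    by (rule order_trans[OF sum_abs sum_mono]) (unfold E_def, rule cut_off_diff_le[OF \<sigma>])
  from this[of 1] this[of "- 1"] show ?thesis
    by (simp add: unsigned_to_heat_def sum.distrib)
qed

section \<open>The untruncated transform solves the heat problem\<close>

context price_forward
begin

text \<open>Candidate for the heat solution, formed before anything is known about the sign of
  \<open>f\<close>. It turns out to be \<open>to_heat\<close> once \<open>f_single_crossing\<close>
  is available.\<close>

definition TF :: "real \<Rightarrow> real \<Rightarrow> real" where
  "TF x t = unsigned_to_heat L a (p t) (\<lambda>y. f y t) x"

lemmas TF_rec = unsigned_to_heat_rec[OF a, of _ _ L "p t" "\<lambda>y. f y t" for t, folded TF_def]

lemma TF_near: "0 < t \<Longrightarrow> \<bar>x\<bar> < L \<Longrightarrow> \<bar>x - p t\<bar> < a \<Longrightarrow> TF x t = f x t"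
proof -
  assume *: "0 < t" "\<bar>x\<bar> < L" "\<bar>x - p t\<bar> < a"
  consider "x < p t" | "x = p t" | "p t < x" by linarith
  then show ?thesis
  proof cases
    case 2
    then show ?thesis using f_p[OF *(1)] unsigned_to_heat_at[OF a] by (simp add: TF_def)
  qed (use * TF_rec[of 1 x t] TF_rec[of "- 1" x t] in auto)
qed

text \<open>\<open>\<sigma>\<close> points from \<open>x\<close> towards the curve; the shifted
  point stays in the interval because \<open>p t\<close> does.\<close>

lemma sides:
  assumes "a \<le> \<bar>x - p t\<bar>" "\<bar>x\<bar> < L" "0 < t"
  obtains \<sigma> where "\<sigma> = 1 \<or> \<sigma> = -1" "\<sigma> * (p t - x) = \<bar>x - p t\<bar>" "\<bar>x + \<sigma> * a\<bar> < L" "\<bar>x + \<sigma> * a - p t\<bar> = \<bar>x - p t\<bar> - a"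
proof (cases "x < p t")
  case True
  then show ?thesis using that[of 1] assms p_in[of t] a by auto
next
  case False
  then show ?thesis using that[of "- 1"] assms p_in[of t] a by auto
qed

text \<open>Induction on the number of strips of width \<open>a\<close> between \<open>x\<close> and
  the curve. In the first strip \<open>TF\<close> is \<open>f\<close>; further out it is
  \<open>f\<close> plus a shift of \<open>TF\<close> from the previous strip. On the dividing line
  at distance exactly \<open>a\<close>, the source of \<open>f\<close> meets the kink of the cut,
  shifted function, and \<open>cut_sum_caloric\<close> says that the sum has neither.\<close>

lemma TF_local:
  assumes "0 < t" "\<bar>x\<bar> < L" "\<bar>x - p t\<bar> < real (Suc k) * a"
  shows "\<exists>V. open V \<and> (x, t) \<in> V \<and> caloric_on V TF"
  using assms
proof (induction k arbitrary: x)
  case 0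
  let ?V = "{(x, t). 0 < t \<and> \<bar>x\<bar> < L \<and> \<bar>x - p t\<bar> < a}"
  have V: "open ?V" by (rule open_curve_cond[OF p_cont]) (intro open_Collect_conj open_Collect_less continuous_intros)
  moreover have "caloric_on ?V TF"
    by (rule caloric_on_cong[OF V caloric_on_subset[OF f_caloric]]) (auto simp: mem_off TF_near)
  ultimately show ?case using 0 by (intro exI[of _ ?V]) auto
next
  case (Suc k)
  show ?case
  proof (cases "\<bar>x - p t\<bar> < a")
    case True
    moreover have "a \<le> real (Suc k) * a" using a by simp
    ultimately show ?thesis using Suc by (intro Suc.IH) linarith+
  next
    case False
    then obtain \<sigma> where \<sigma>: "\<sigma> = 1 \<or> \<sigma> = -1" and dx: "\<sigma> * (p t - x) = \<bar>x - p t\<bar>" and xL: "\<bar>x + \<sigma> * a\<bar> < L"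
      and d: "\<bar>x + \<sigma> * a - p t\<bar> = \<bar>x - p t\<bar> - a"
      using sides[of x t] Suc.prems by auto
    have e: "\<sigma> * (p s - (y + \<sigma> * a)) = \<sigma> * (p s - y) - a" for s y using \<sigma> by (auto simp: algebra_simps)
    have "\<bar>x + \<sigma> * a - p t\<bar> < real (Suc k) * a" using d Suc.prems(3) by (simp add: algebra_simps)
    from Suc.IH[OF Suc.prems(1) xL this] obtain V where V: "open V" "(x + \<sigma> * a, t) \<in> V" "caloric_on V TF" by blast
    have shift: "open {(y, s). (y + \<sigma> * a, s) \<in> W}" if W: "open W" for W :: "(real \<times> real) set"
    proof -
      have "open ((\<lambda>z. (fst z + \<sigma> * a, snd z)) -` W)" by (rule open_vimage[OF W]) (intro continuous_intros)
      then show ?thesis by (simp add: vimage_def case_prod_unfold)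
    qed
    show ?thesis
    proof (cases "\<bar>x - p t\<bar> = a")
      case False
      let ?W = "{(y, s). (y + \<sigma> * a, s) \<in> V} \<inter> {(y, s). 0 < s \<and> \<bar>y\<bar> < L \<and> a < \<sigma> * (p s - y)}"
      have W: "open ?W"
        by (intro open_Int shift V(1) open_curve_cond[OF p_cont] open_Collect_conj open_Collect_less continuous_intros)
      have "caloric_on ?W TF"
      proof (rule caloric_on_cong[OF W])
        have 1: "caloric_on ?W f"
          by (rule caloric_on_subset[OF f_caloric]) (use \<sigma> in \<open>auto simp: mem_off\<close>)
        have 2: "caloric_on ?W (\<lambda>x t. 1 * TF (1 * x + \<sigma> * a) t)"
          by (rule caloric_on_subset[OF caloric_on_affine[OF V(3)]]) auto
        from caloric_on_add[OF 1 2] show "caloric_on ?W (\<lambda>y s. f y s + TF (y + \<sigma> * a) s)" by simp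
        show "TF y s = f y s + TF (y + \<sigma> * a) s" if "(y, s) \<in> ?W" for y s
          using that TF_rec[OF \<sigma>, of y s] a by auto
      qed
      moreover have "(x, t) \<in> ?W" using V(2) Suc.prems False \<open>\<not> \<bar>x - p t\<bar> < a\<close> dx by auto
      ultimately show ?thesis using W by blast
    next
      case True
      let ?W = "{(y, s). (y + \<sigma> * a, s) \<in> near \<sigma>}"
      have W: "open ?W" by (rule shift[OF open_near])
      have "caloric_on ?W TF"
      proof (rule caloric_on_cong[OF W])
        have "caloric_on ?W (\<lambda>x t. 1 * cut_sum \<sigma> (1 * x + \<sigma> * a) t)"
          by (rule caloric_on_subset[OF caloric_on_affine[OF cut_sum_caloric[OF \<sigma>]]]) auto
        then show "caloric_on ?W (\<lambda>y s. cut_sum \<sigma> (y + \<sigma> * a) s)" by simp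
        show "TF y s = cut_sum \<sigma> (y + \<sigma> * a) s" if "(y, s) \<in> ?W" for y s
        proof -
          have *: "0 < s" "\<bar>y + \<sigma> * a\<bar> < L" "\<bar>y\<bar> < L" "\<bar>y + \<sigma> * a - p s\<bar> < a" using that by (auto simp: near_def)
          then have "0 < \<sigma> * (p s - y)" using \<sigma> by auto
          then show ?thesis using TF_rec[OF \<sigma> *(3)] TF_near[OF *(1,2,4)] e by (simp add: cut_sum_def)
        qed
      qed
      moreover have "(x, t) \<in> ?W" using Suc.prems xL True d a by (auto simp: near_def)
      ultimately show ?thesis using W by blast
    qed
  qed
qed

lemma far_bound:
  obtains k where "\<And>x t. 0 < t \<Longrightarrow> \<bar>x\<bar> < L \<Longrightarrow> \<bar>x - p t\<bar> < real (Suc k) * a"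
proof -
  obtain k where "2 * L / a < real k" using reals_Archimedean2 by blast
  then have k: "2 * L < real k * a" using a by (simp add: field_simps)
  have "\<bar>x - p t\<bar> < real (Suc k) * a" if "0 < t" "\<bar>x\<bar> < L" for x t
  proof -
    have "\<bar>x - p t\<bar> < 2 * L" using that p_in[of t] by simp
    then show ?thesis using k a by (simp add: algebra_simps)
  qed
  then show ?thesis by (rule that)
qed

lemma TF_caloric: "caloric_on (cylinder L) TF"
proof -
  obtain k where "\<And>x t. 0 < t \<Longrightarrow> \<bar>x\<bar> < L \<Longrightarrow> \<bar>x - p t\<bar> < real (Suc k) * a" using far_bound by metis
  then show ?thesis using TF_local[of _ _ k] by (intro caloric_on_local) (auto simp: mem_cyl)
qed

lemmas TFD = caloric_onD[OF open_cylinder TF_caloric]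

lemma Dx_TF_near:
  assumes "0 < t" "\<bar>x\<bar> < L" "\<bar>x - p t\<bar> < a"
  shows "Dx TF x t = Dx f x t"
proof (rule Dx_eq_on_open)
  show "open {(x, t). 0 < t \<and> \<bar>x\<bar> < L \<and> \<bar>x - p t\<bar> < a}"
    by (rule open_curve_cond[OF p_cont]) (intro open_Collect_conj open_Collect_less continuous_intros)
qed (use assms TF_near in auto)

lemma Dx_TF_far:
  assumes \<sigma>: "\<sigma> = 1 \<or> \<sigma> = -1" and x: "0 < t" "\<bar>x\<bar> < L" "a < \<sigma> * (p t - x)"
  shows "Dx TF x t = Dx f x t + Dx TF (x + \<sigma> * a) t"
proof -
  have "\<bar>x + \<sigma> * a\<bar> < L" using \<sigma> x p_in[of t] a by auto
  then have "((\<lambda>y. TF y t) has_field_derivative Dx TF (x + \<sigma> * a) t) (at (x + \<sigma> * a))"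
    using TFD(4) x by (simp add: mem_cyl)
  then have "((\<lambda>y. TF (y + \<sigma> * a) t) has_field_derivative Dx TF (x + \<sigma> * a) t) (at x)" by (simp add: DERIV_shift)
  moreover have "((\<lambda>y. f y t) has_field_derivative Dx f x t) (at x)"
    by (rule fD(4)) (use \<sigma> x in \<open>auto simp: mem_off\<close>)
  ultimately have "((\<lambda>y. f y t + TF (y + \<sigma> * a) t) has_field_derivative Dx f x t + Dx TF (x + \<sigma> * a) t) (at x)"
    by (intro DERIV_add)
  then have "Dx (\<lambda>y t. f y t + TF (y + \<sigma> * a) t) x t = Dx f x t + Dx TF (x + \<sigma> * a) t"
    unfolding Dx_def by (rule DERIV_imp_deriv)
  moreover have "Dx TF x t = Dx (\<lambda>y t. f y t + TF (y + \<sigma> * a) t) x t"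
  proof (rule Dx_eq_on_open)
    show "open {(x, t). 0 < t \<and> \<bar>x\<bar> < L \<and> a < \<sigma> * (p t - x)}"
      by (rule open_curve_cond[OF p_cont]) (intro open_Collect_conj open_Collect_less continuous_intros)
  qed (use assms TF_rec[OF \<sigma>] a in auto)
  ultimately show ?thesis by simp
qed

lemma Dx_TF_tendsto:
  assumes "\<bar>x\<bar> < L" "0 < t"
  shows "isCont (\<lambda>y. Dx TF y t) x"
  using TFD(5)[of x t] assms by (simp add: mem_cyl DERIV_isCont)

text \<open>Every strip adds one bound for the slope of \<open>f\<close>, and only a bounded number
  of strips meets the interval.\<close>

lemma TF_bounded_slope: "bounded_slope (cylinder L) TF"
  unfolding bounded_slope_def
proof (intro allI impI)
  fix s T :: real assume s: "0 < s"
  have "bounded ((\<lambda>(x, t). Dx f x t) ` (off_sources L a p \<inter> UNIV \<times> {s..T}))"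
    using f_slope s by (simp add: bounded_slope_def)
  then obtain B where "\<forall>y \<in> (\<lambda>(x, t). Dx f x t) ` (off_sources L a p \<inter> UNIV \<times> {s..T}). norm y \<le> B" unfolding bounded_iff by blast
  then have B: "\<bar>Dx f x t\<bar> \<le> B" if "\<bar>x\<bar> < L" "s \<le> t" "t \<le> T" "\<bar>x - p t\<bar> \<noteq> a" for x t
    using that s by (force simp: mem_off)
  have "\<bar>Dx TF x t\<bar> \<le> real (Suc k) * B" if "\<bar>x\<bar> < L" "s \<le> t" "t \<le> T" "\<bar>x - p t\<bar> < real (Suc k) * a" for x t k
    using that
  proof (induction k arbitrary: x)
    case 0
    then show ?case using B[of x t] Dx_TF_near[of t x] s by simp
  next
    case (Suc k)
    have t: "0 < t" using Suc.prems s by simp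
    have B0: "0 \<le> B" using B[of "p t" t] p_in[of t] Suc.prems t a by simp
    then have kB: "B \<le> real (Suc (Suc k)) * B" using mult_right_mono[of 1 "real (Suc (Suc k))" B] by simp
    have near: "\<bar>Dx TF y t\<bar> \<le> B" if "\<bar>y\<bar> < L" "\<bar>y - p t\<bar> < a" for y
      using Dx_TF_near[of t y] B[of y t] Suc.prems that t by simp
    show ?case
    proof (cases "\<bar>x - p t\<bar> < a")
      case True
      then show ?thesis using near[of x] Suc.prems kB by linarith
    next
      case False
      then obtain \<sigma> where \<sigma>: "\<sigma> = 1 \<or> \<sigma> = -1" and dx: "\<sigma> * (p t - x) = \<bar>x - p t\<bar>" and xL: "\<bar>x + \<sigma> * a\<bar> < L"
        and d: "\<bar>x + \<sigma> * a - p t\<bar> = \<bar>x - p t\<bar> - a"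
        using sides[of x t] Suc.prems t by auto
      show ?thesis
      proof (cases "\<bar>x - p t\<bar> = a")
        case False
        have "\<bar>Dx TF (x + \<sigma> * a) t\<bar> \<le> real (Suc k) * B"
          by (rule Suc.IH) (use Suc.prems xL d in \<open>auto simp: algebra_simps\<close>)
        moreover have "Dx TF x t = Dx f x t + Dx TF (x + \<sigma> * a) t"
          by (rule Dx_TF_far[OF \<sigma> t]) (use Suc.prems dx False \<open>\<not> \<bar>x - p t\<bar> < a\<close> in auto)
        ultimately show ?thesis using B[OF Suc.prems(1-3) False] by (simp add: algebra_simps)
      next
        case True
        \<comment> \<open>At distance exactly \<open>a\<close> the slope of \<open>f\<close> need
          not exist, but that of \<open>TF\<close> does: it is the limit of slopes at points moved
          towards the curve, where \<open>TF = f\<close>.\<close>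
        have "((\<lambda>\<epsilon>. \<bar>Dx TF (x + \<sigma> * \<epsilon>) t\<bar>) \<longlongrightarrow> \<bar>Dx TF (x + \<sigma> * 0) t\<bar>) (at_right 0)"
          by (intro tendsto_rabs isCont_tendsto_compose[OF Dx_TF_tendsto] tendsto_intros) (use Suc.prems t in auto)
        moreover have "\<forall>\<^sub>F \<epsilon> in at_right 0. \<bar>Dx TF (x + \<sigma> * \<epsilon>) t\<bar> \<le> B"
        proof (rule eventually_at_rightI[of 0 a])
          fix \<epsilon> assume "\<epsilon> \<in> {0<..<a}"
          then show "\<bar>Dx TF (x + \<sigma> * \<epsilon>) t\<bar> \<le> B"
            by (intro near) (use \<sigma> dx True xL Suc.prems in auto)
        qed (rule a)
        ultimately have "\<bar>Dx TF (x + \<sigma> * 0) t\<bar> \<le> B" by (rule tendsto_upperbound) simp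
        then show ?thesis using kB unfolding mult_zero_right add_0_right by linarith
      qed
    qed
  qed
  moreover obtain k where "\<And>x t. 0 < t \<Longrightarrow> \<bar>x\<bar> < L \<Longrightarrow> \<bar>x - p t\<bar> < real (Suc k) * a" using far_bound by metis
  ultimately have "\<bar>Dx TF x t\<bar> \<le> real (Suc k) * B" if "\<bar>x\<bar> < L" "s \<le> t" "t \<le> T" for x t
    using that s by simp
  then show "bounded ((\<lambda>(x, t). Dx TF x t) ` (cylinder L \<inter> UNIV \<times> {s..T}))"
    unfolding bounded_iff by (intro exI[of _ "real (Suc k) * B"]) (auto simp: mem_cyl)
qed

text \<open>If \<open>p t > -L + a\<close>, then near \<open>-L\<close> the slope of
  \<open>TF\<close> is that of \<open>f\<close>, which tends to 0, plus the slope at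
  \<open>x + a\<close>. Otherwise \<open>TF = f\<close> both near \<open>-L\<close> and near
  \<open>-L + a\<close>, and the condition carries over unchanged. The two cases of the modified
  condition correspond to these.\<close>

lemma TF_left:
  assumes t: "0 < t" shows "left_slope L TF t (Dx TF (- L + a) t)"
proof (cases "p t > - L + a")
  case True
  have "((\<lambda>x. Dx f x t + Dx TF (x + a) t) \<longlongrightarrow> 0 + Dx TF (- L + a) t) (at_right (- L))"
    using f_left[OF t] True a aL t unfolding left_slope_def
    by (intro tendsto_add isCont_tendsto_compose[OF Dx_TF_tendsto] tendsto_intros) auto
  moreover have "\<forall>\<^sub>F x in at_right (- L). Dx f x t + Dx TF (x + a) t = Dx TF x t"
    by (rule eventually_at_rightI[of "- L" "p t - a"]) (use Dx_TF_far[of 1 t] t True p_in[of t] a in \<open>auto simp: abs_less_iff\<close>)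
  ultimately show ?thesis unfolding left_slope_def by (auto elim: Lim_transform_eventually)
next
  case False
  have "Dx TF (- L + a) t = Dx f (- L + a) t"
    by (rule Dx_TF_near[OF t]) (use False p_in[of t] t a aL in auto)
  moreover have "\<forall>\<^sub>F x in at_right (- L). Dx f x t = Dx TF x t"
    by (rule eventually_at_rightI[of "- L" "min L (p t + a)"])
      (use Dx_TF_near[of t] t False p_in[of t] a aL in \<open>auto simp: abs_less_iff\<close>)
  ultimately show ?thesis using f_left[OF t] False unfolding left_slope_def by (auto elim: Lim_transform_eventually)
qed

lemma TF_right:
  assumes t: "0 < t" shows "right_slope L TF t (Dx TF (L - a) t)"
proof (cases "p t < L - a")
  case True
  have "((\<lambda>x. Dx f x t + Dx TF (x - a) t) \<longlongrightarrow> 0 + Dx TF (L - a) t) (at_left L)"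
    using f_right[OF t] True a aL t unfolding right_slope_def
    by (intro tendsto_add isCont_tendsto_compose[OF Dx_TF_tendsto] tendsto_intros) auto
  moreover have "\<forall>\<^sub>F x in at_left L. Dx f x t + Dx TF (x - a) t = Dx TF x t"
    by (rule eventually_at_leftI[of "p t + a"]) (use Dx_TF_far[of "- 1" t] t True p_in[of t] a in \<open>auto simp: abs_less_iff\<close>)
  ultimately show ?thesis unfolding right_slope_def by (auto elim: Lim_transform_eventually)
next
  case False
  have "Dx TF (L - a) t = Dx f (L - a) t"
    by (rule Dx_TF_near[OF t]) (use False p_in[of t] t a aL in auto)
  moreover have "\<forall>\<^sub>F x in at_left L. Dx f x t = Dx TF x t"
    by (rule eventually_at_leftI[of "max (- L) (p t - a)"])
      (use Dx_TF_near[of t] t False p_in[of t] a aL in \<open>auto simp: abs_less_iff\<close>)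
  ultimately show ?thesis using f_right[OF t] False unfolding right_slope_def by (auto elim: Lim_transform_eventually)
qed

text \<open>Two errors are summed over finitely many shifts: \<open>E1\<close>, the distance of
  \<open>f\<close> from the datum, and \<open>E2\<close>, which dominates the part of the datum
  between \<open>p0\<close> and the current cut \<open>p s\<close>.\<close>

lemma TF_attains: "attains_datum L TF (to_heat L a p0 fI)"
proof -
  have p0L: "p0 \<in> {-L<..<L}" using p0 a by auto
  obtain fJ where [measurable]: "fJ \<in> borel_measurable borel" and sJ: "single_crossing L p0 fJ"
    and J: "AE x in lborel. x \<in> {-L<..<L} \<longrightarrow> fJ x = fI x"
    and TJ: "AE x in lborel. x \<in> {-L<..<L} \<longrightarrow> to_heat L a p0 fJ x = to_heat L a p0 fI x"
    using borel_datum[OF L2 p0L pos neg] .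
  show ?thesis
  proof (rule attains_datumI_borel[OF _ TJ])
    fix x assume "x \<in> {-L<..<L}"
    have "TF x 0 = unsigned_to_heat L a p0 fI x"
      unfolding TF_def p_0 by (rule unsigned_to_heat_cong) (use f_att in \<open>auto simp: attains_datum_def abs_less_iff\<close>)
    then show "TF x 0 = to_heat L a p0 fI x" using unsigned_to_heat_eq[OF a sc_fI] by simp
  next
    define E1 where "E1 = (\<lambda>s y. \<bar>indicator {-L<..<L} y * (f y s - fJ y)\<bar>)"
    define E2 where "E2 = (\<lambda>s y. \<bar>indicator {y. \<bar>y - p0\<bar> \<le> \<bar>p s - p0\<bar>} y * (indicator {-L<..<L} y * fJ y)\<bar>)"
    let ?E = "\<lambda>s y. E1 s y + E2 s y"
    have pos0: "\<forall>\<^sub>F s in at_right (0::real). 0 < s" by (rule eventually_at_right_less)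
    have m1: "\<forall>\<^sub>F s in at_right 0. E1 s \<in> borel_measurable borel"
      using pos0
    proof eventually_elim
      case (elim s)
      have "continuous_on {-L<..<L} (\<lambda>y. (\<lambda>(x, t). f x t) (y, s))"
        by (rule continuous_on_compose2[OF f_cont]) (use elim in \<open>auto intro!: continuous_intros simp: mem_cyl\<close>)
      then have "(\<lambda>y. indicator {-L<..<L} y *\<^sub>R f y s) \<in> borel_measurable borel"
        by (intro borel_measurable_continuous_on_indicator) auto
      then have [measurable]: "(\<lambda>y. indicator {-L<..<L} y * f y s) \<in> borel_measurable borel" by simp
      have "E1 s = (\<lambda>y. \<bar>indicator {-L<..<L} y * f y s - indicator {-L<..<L} y * fJ y\<bar>)"
        by (auto simp: E1_def algebra_simps)
      then show ?case by simp
    qed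
    have m2: "\<forall>\<^sub>F s in at_right 0. E2 s \<in> borel_measurable borel"
      unfolding E2_def by (rule always_eventually, rule allI) measurable
    have l1: "((\<lambda>s. \<integral>\<^sup>+x. ennreal ((E1 s x)\<^sup>2) \<partial>lborel) \<longlongrightarrow> 0) (at_right 0)"
    proof -
      have "(E1 s x)\<^sup>2 = (f x s - fJ x)\<^sup>2 * indicator {-L<..<L} x" for s x by (simp add: E1_def indicator_def)
      then have "ennreal ((E1 s x)\<^sup>2) = ennreal ((f x s - fJ x)\<^sup>2) * indicator {-L<..<L} x" for s x by (simp add: indicator_def)
      then show ?thesis using attains_datum_borel[OF f_att J] by simp
    qed
    have l2: "((\<lambda>s. \<integral>\<^sup>+x. ennreal ((E2 s x)\<^sup>2) \<partial>lborel) \<longlongrightarrow> 0) (at_right 0)"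
    proof -
      have "(\<integral>\<^sup>+x. ennreal ((indicator {-L<..<L} x * fJ x)\<^sup>2) \<partial>lborel) = (\<integral>\<^sup>+x. ennreal (norm (indicator {-L<..<L} x *\<^sub>R (fI x)\<^sup>2)) \<partial>lebesgue)"
        unfolding nn_integral_completion
        by (rule nn_integral_cong_AE) (use J in \<open>eventually_elim, auto simp: indicator_def\<close>)
      also have "\<dots> < \<infinity>"
        using L2 unfolding L2_on_def set_integrable_def integrable_iff_bounded by blast
      finally have fin: "(\<integral>\<^sup>+x. ennreal ((indicator {-L<..<L} x * fJ x)\<^sup>2) \<partial>lborel) < \<infinity>" .
      have "(p \<longlongrightarrow> p 0) (at 0 within {0..})" using p_cont by (auto simp: continuous_on_def)
      then have "(p \<longlongrightarrow> p0) (at_right 0)" unfolding p_0 by (rule tendsto_within_subset) auto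
      from L2_concentration[OF _ fin this] show ?thesis by (simp add: E2_def)
    qed
    have lE: "((\<lambda>s. \<integral>\<^sup>+x. ennreal ((?E s x)\<^sup>2) \<partial>lborel) \<longlongrightarrow> 0) (at_right 0)"
      by (rule L2_lim_add[OF l1 l2 m1 m2])
    have mE: "\<forall>\<^sub>F s in at_right 0. ?E s \<in> borel_measurable borel"
      using m1 m2 by eventually_elim simp
    have mEs: "\<forall>\<^sub>F s in at_right 0. (\<lambda>x. ?E s (x + c)) \<in> borel_measurable borel" for c
      using mE by eventually_elim (rule measurable_compose[of "\<lambda>x. x + c" borel borel], auto)
    obtain N where "2 * L / a < real N" using reals_Archimedean2 by blast
    then have N: "2 * L \<le> real N * a" using a by (simp add: field_simps)
    have "((\<lambda>s. \<integral>\<^sup>+x. ennreal ((\<Sum>n<N. ?E s (x + real n * a) + ?E s (x + - (real n * a)))\<^sup>2) \<partial>lborel) \<longlongrightarrow> 0) (at_right 0)"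
    proof (rule L2_lim_sum(1))
      fix n
      show "((\<lambda>s. \<integral>\<^sup>+x. ennreal ((?E s (x + real n * a) + ?E s (x + - (real n * a)))\<^sup>2) \<partial>lborel) \<longlongrightarrow> 0) (at_right 0)"
        by (rule L2_lim_add[OF L2_lim_affine[OF lE mE] L2_lim_affine[OF lE mE] mEs mEs])
      show "\<forall>\<^sub>F s in at_right 0. (\<lambda>x. ?E s (x + real n * a) + ?E s (x + - (real n * a))) \<in> borel_measurable borel"
        using mEs[of "real n * a"] mEs[of "- (real n * a)"] by eventually_elim (rule borel_measurable_add)
    qed
    then show "((\<lambda>s. \<integral>\<^sup>+x. ennreal ((indicator {-L<..<L} x * (TF x s - to_heat L a p0 fJ x))\<^sup>2) \<partial>lborel) \<longlongrightarrow> 0) (at_right 0)"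
    proof (rule L2_lim_bound, intro always_eventually allI)
      fix s x
      have *: "0 \<le> (\<Sum>n<N. ?E s (x + real n * a) + ?E s (x + - (real n * a)))"
        by (intro sum_nonneg) (auto simp: E1_def E2_def)
      show "\<bar>indicator {-L<..<L} x * (TF x s - to_heat L a p0 fJ x)\<bar> \<le> \<bar>\<Sum>n<N. ?E s (x + real n * a) + ?E s (x + - (real n * a))\<bar>"
      proof (cases "\<bar>x\<bar> < L")
        case True
        from unsigned_to_heat_diff_le[OF a N this, of "p s" "\<lambda>y. f y s" p0 fJ]
        have "\<bar>TF x s - to_heat L a p0 fJ x\<bar> \<le> (\<Sum>n<N. ?E s (x + real n * a) + ?E s (x + - (real n * a)))"
          by (simp only: TF_def unsigned_to_heat_eq[OF a sJ] E1_def E2_def)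
        with * show ?thesis by (simp add: indicator_def)
      next
        case False
        then show ?thesis by (auto simp: indicator_def)
      qed
    qed
  qed
qed

lemma TF_solution: "heat_solution L a (to_heat L a p0 fI) TF"
  by (rule heat_solutionI[OF TF_caloric TF_bounded_slope TF_left TF_right TF_attains])

text \<open>\<open>TF\<close> is a heat solution, so its sign and its monotonicity under shifts are
  known, and its only zero must be \<open>p t\<close>. Close to the curve \<open>f\<close> equals
  \<open>TF\<close>; further out than \<open>a\<close>, \<open>f\<close> is the difference of
  \<open>TF\<close> and its shift towards the curve, whose sign is given by the
  monotonicity.\<close>

lemma f_single_crossing:
  assumes "0 \<le> t" shows "single_crossing L (p t) (\<lambda>y. f y t)"
proof (cases "t = 0")
  case True
  then show ?thesis using sc_fI f_att p_0 by (simp add: single_crossing_def attains_datum_def)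
next
  case False
  with assms have t: "0 < t" by simp
  show ?thesis
  proof (rule heat_solution_extension[OF a aL L2 p0 pos neg TF_solution])
    fix U assume U: "\<And>x t. \<bar>x\<bar> < L \<Longrightarrow> 0 < t \<Longrightarrow> U x t = TF x t"
      "\<And>t. 0 < t \<Longrightarrow> \<exists>p\<in>{-L<..<L}. U p t = 0 \<and> (\<forall>x<p. 0 < U x t) \<and> (\<forall>x>p. U x t < 0)"
      "\<And>x t. 0 < t \<Longrightarrow> U (x + a) t \<le> U x t"
    obtain q where q: "U q t = 0" "\<And>x. x < q \<Longrightarrow> 0 < U x t" "\<And>x. q < x \<Longrightarrow> U x t < 0" using U(2)[OF t] by blast
    have "U (p t) t = 0" using U(1)[OF p_in t] t unsigned_to_heat_at[OF a] by (simp add: TF_def)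
    then have qp: "q = p t" using q by (metis less_irrefl linorder_neqE_linordered_idom)
    have pL: "\<bar>p t\<bar> < L" using p_in t by simp
    have "0 \<le> f x t" if "\<bar>x\<bar> < L" "x < p t" for x
      using TF_rec[of 1 x t] that pL a U(1)[OF that(1) t] U(1)[of "x + a" t] U(3)[OF t, of x] q(2)[of x] qp t
      by (auto split: if_splits)
    moreover have "f x t \<le> 0" if "\<bar>x\<bar> < L" "p t < x" for x
      using TF_rec[of "- 1" x t] that pL a U(1)[OF that(1) t] U(1)[of "x - a" t] U(3)[OF t, of "x - a"] q(3)[of x] qp t
      by (auto split: if_splits)
    ultimately show ?thesis using f_p[OF t] unfolding single_crossing_def abs_less_iff
      by (metis greaterThanLessThan_iff less_eq_real_def minus_less_iff)
  qed
qed

theorem to_heat_solution: "heat_solution L a (to_heat L a p0 fI) (\<lambda>x t. to_heat L a (p t) (\<lambda>y. f y t) x)"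
  by (rule heat_solution_cong[OF TF_solution a aL])
    (simp add: TF_def unsigned_to_heat_eq[OF a f_single_crossing])

end

section \<open>From the heat equation to the price formation problem\<close>

text \<open>Telescoping: \<open>to_heat\<close> satisfies a recursion with one shift, and
  \<open>from_heat\<close> subtracts that shift. Applied to the datum, it turns the initial
  condition for \<open>F\<close> into the one for \<open>f\<close>.\<close>

lemma from_heat_to_heat:
  assumes a: "0 < a" and sc: "single_crossing L q g" and x: "\<bar>x\<bar> < L"
  shows "from_heat L a (to_heat L a q g) x = g x"
proof -
  let ?G = "to_heat L a q g"
  have P: "pos_ext L ?G y = (if \<bar>y\<bar> < L \<and> y < q then ?G y else 0)" for y
    using to_heat_sign(1)[OF a, of y q L g] to_heat_sign(2)[OF a, of q y L g] by (cases y q rule: linorder_cases) (auto simp: pos_ext_def abs_less_iff to_heat_at)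
  have N: "neg_ext L ?G y = (if \<bar>y\<bar> < L \<and> q < y then - ?G y else 0)" for y
    using to_heat_sign(1)[OF a, of y q L g] to_heat_sign(2)[OF a, of q y L g] by (cases y q rule: linorder_cases) (auto simp: neg_ext_def abs_less_iff to_heat_at)
  \<comment> \<open>The truncation at the ends of the interval in \<open>pos_ext\<close> and
    \<open>neg_ext\<close> does no harm: outside, on the side that matters, the sum is zero
    anyway.\<close>
  have out: "?G y = 0" if "L \<le> \<bar>y\<bar>" "L \<le> y \<and> y < q \<or> y \<le> - L \<and> q < y" for y
  proof -
    have nn: "0 \<le> real n * a" for n using a by simp
    have "pos_ext L g (y + real n * a) = 0" if "L \<le> y" for n using that nn[of n] by (simp add: pos_ext_def)
    moreover have "neg_ext L g (y - real n * a) = 0" if "y \<le> - L" for n using that nn[of n] by (simp add: neg_ext_def)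
    ultimately show ?thesis using that by (auto simp: to_heat_def)
  qed
  consider "x < q" | "x = q" | "q < x" by linarith
  then show ?thesis
  proof cases
    case 1
    have "0 \<le> g x" using sc x 1 by (auto simp: single_crossing_def abs_less_iff)
    then have "?G x = g x + (if x + a < q then ?G (x + a) else 0)"
      using to_heat_rec(1)[OF a sc 1] x by (simp add: pos_ext_def abs_less_iff)
    then show ?thesis using 1 a x out[of "x + a"] unfolding from_heat_def P N by (auto simp: abs_if split: if_splits)
  next
    case 2
    have "g x = 0" using sc x 2 by (force simp: single_crossing_def abs_less_iff)
    then show ?thesis using 2 a to_heat_at[of L a q g] unfolding from_heat_def P N by auto
  next
    case 3
    have "g x \<le> 0" using sc x 3 by (auto simp: single_crossing_def abs_less_iff)
    then have "?G x = g x + (if q < x - a then ?G (x - a) else 0)"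
      using to_heat_rec(2)[OF a sc 3] x by (simp add: neg_ext_def abs_less_iff)
    then show ?thesis using 3 a x out[of "x - a"] unfolding from_heat_def P N by (auto simp: abs_if split: if_splits)
  qed
qed

text \<open>Taking positive or negative parts is Lipschitz with constant 1.\<close>

lemma from_heat_diff_le:
  fixes L a :: real
  defines "E \<equiv> \<lambda>G H y. \<bar>indicator {-L<..<L} y * (G y - H y :: real)\<bar>"
  assumes "\<bar>x\<bar> < L"
  shows "\<bar>from_heat L a G x - from_heat L a H x\<bar> \<le> E G H x + E G H (x + a) + E G H (x - a)"
proof -
  have "\<bar>pos_ext L G y - pos_ext L H y\<bar> \<le> E G H y" "\<bar>neg_ext L G y - neg_ext L H y\<bar> \<le> E G H y" for y
    by (auto simp: pos_ext_def neg_ext_def E_def indicator_def max_def)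
  from this(1)[of "x + a"] this(2)[of "x - a"] have "\<bar>from_heat L a G x - from_heat L a H x\<bar> \<le> \<bar>G x - H x\<bar> + E G H (x + a) + E G H (x - a)"
    unfolding from_heat_def by linarith
  then show ?thesis using assms(2) unfolding E_def by (simp add: abs_less_iff)
qed

text \<open>\<open>U\<close> is the extension of \<open>F\<close> to the line, so that shifts by
  \<open>a\<close> need no case distinction on leaving the interval. The value
  \<open>p 0 = p0\<close> is prescribed separately because the signs of \<open>U\<close> are known
  for positive times only.\<close>

locale price_backward = price_problem +
  fixes F U :: "real \<Rightarrow> real \<Rightarrow> real" and p :: "real \<Rightarrow> real"
  assumes F: "heat_solution L a (to_heat L a p0 fI) F"
    and U: "caloric_on (UNIV \<times> {0<..}) U"
    and U_eq: "\<And>x t. \<bar>x\<bar> < L \<Longrightarrow> 0 < t \<Longrightarrow> U x t = F x t"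
    and p_0: "p 0 = p0" and p_in_pos: "\<And>t. 0 < t \<Longrightarrow> \<bar>p t\<bar> < L"
    and U_p: "\<And>t. 0 < t \<Longrightarrow> U (p t) t = 0"
    and U_pos: "\<And>x t. 0 < t \<Longrightarrow> x < p t \<Longrightarrow> 0 < U x t" and U_neg: "\<And>x t. 0 < t \<Longrightarrow> p t < x \<Longrightarrow> U x t < 0"
begin

lemma F_att: "attains_datum L F (to_heat L a p0 fI)" and F_slope: "bounded_slope (cylinder L) F"
  and F_left: "0 < t \<Longrightarrow> left_slope L F t (Dx F (- L + a) t)" and F_right: "0 < t \<Longrightarrow> right_slope L F t (Dx F (L - a) t)"
  using F unfolding heat_solution_def by auto

lemma F_0: "\<bar>x\<bar> < L \<Longrightarrow> F x 0 = to_heat L a p0 fI x"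
  using F_att by (simp add: attains_datum_def abs_less_iff)

text \<open>The first term of the sum has the strict sign of \<open>fI\<close>, and the others have
  the same weak sign.\<close>

lemma FI_sign:
  assumes \<sigma>: "\<sigma> = 1 \<or> \<sigma> = -1" and "\<bar>x\<bar> < L" "0 < \<sigma> * (p0 - x)"
  shows "0 < \<sigma> * to_heat L a p0 fI x"
  using \<sigma>
proof
  assume "\<sigma> = 1"
  then show ?thesis using assms pos to_heat_rec(1)[OF a sc_fI, of x] to_heat_sign(1)[OF a, of "x + a" p0 L fI]
    by (auto simp: pos_ext_def abs_less_iff)
next
  assume "\<sigma> = -1"
  then show ?thesis using assms neg to_heat_rec(2)[OF a sc_fI, of x] to_heat_sign(2)[OF a, of p0 "x - a" L fI]
    by (auto simp: neg_ext_def abs_less_iff)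
qed

lemma open_half: "open (UNIV \<times> {0<..} :: (real \<times> real) set)"
  by (intro open_Times) auto

lemmas UD = caloric_onD[OF open_half U]

lemma zero_set:
  assumes "0 \<le> t" shows "{x \<in> {-L<..<L}. F x t = 0} = {p t}"
proof (cases "t = 0")
  case True
  have "F x 0 = 0 \<longleftrightarrow> x = p0" if "\<bar>x\<bar> < L" for x
    using FI_sign[of 1 x] FI_sign[of "- 1" x] that F_0[OF that] to_heat_at[of L a p0 fI]
    by (cases x p0 rule: linorder_cases) auto
  moreover have "\<bar>p0\<bar> < L" using p0 a by auto
  ultimately show ?thesis using True p_0 by (auto simp: abs_less_iff)
next
  case False
  with assms have t: "0 < t" by simp
  have "F x t = 0 \<longleftrightarrow> x = p t" if "\<bar>x\<bar> < L" for x
    using U_eq[OF that t] U_p[OF t] U_pos[OF t, of x] U_neg[OF t, of x] by (cases x "p t" rule: linorder_cases) auto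
  then show ?thesis using p_in_pos[OF t] by (auto simp: abs_less_iff)
qed

lemma fJ_exists:
  obtains fJ where "fJ \<in> borel_measurable borel" "single_crossing L p0 fJ"
    "AE x in lborel. x \<in> {-L<..<L} \<longrightarrow> fJ x = fI x"
    "AE x in lborel. x \<in> {-L<..<L} \<longrightarrow> to_heat L a p0 fJ x = to_heat L a p0 fI x"
  by (rule borel_datum[OF L2 _ pos neg, of a]) (use p0 a in auto)

text \<open>The datum is attained in \<open>L\<^sup>2\<close> only. If \<open>p s\<close> were at
  least \<open>\<epsilon>\<close> away from \<open>p0\<close> on one side, \<open>F(., s)\<close>
  and the datum would have opposite signs on the fixed set \<open>J\<close> next to
  \<open>p0\<close>, and their squared distance would be at least the positive number
  \<open>c\<close>.\<close>

lemma p_cont_0: "(p \<longlongrightarrow> p0) (at_right 0)"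
proof -
  have side: "\<forall>\<^sub>F s in at_right 0. - \<epsilon> < \<sigma> * (p s - p0)" if \<sigma>: "\<sigma> = 1 \<or> \<sigma> = -1" and \<epsilon>: "0 < \<epsilon>" for \<sigma> \<epsilon>
  proof (rule fJ_exists)
    fix fJ assume [measurable]: "fJ \<in> borel_measurable borel"
      and TJ: "AE x in lborel. x \<in> {-L<..<L} \<longrightarrow> to_heat L a p0 fJ x = to_heat L a p0 fI x"
    let ?G = "to_heat L a p0 fJ"
    define J where "J = {x. \<bar>x\<bar> < L \<and> 0 < \<sigma> * (p0 - x) \<and> \<sigma> * (p0 - x) < \<epsilon>}"
    have J: "open J" unfolding J_def by (intro open_Collect_conj open_Collect_less continuous_intros)
    then have [measurable]: "J \<in> sets borel" by simp
    define c where "c = (\<integral>\<^sup>+x\<in>J. ennreal ((?G x)\<^sup>2) \<partial>lborel)"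
    have "0 < min \<epsilon> (L - \<bar>p0\<bar>)" using p0 a \<epsilon> by auto
    from dense[OF this] obtain \<delta> where "0 < \<delta>" "\<delta> < \<epsilon>" "\<delta> < L - \<bar>p0\<bar>" by auto
    then have "p0 - \<sigma> * \<delta> \<in> J" using \<sigma> by (auto simp: J_def)
    then have J_null: "J \<notin> null_sets lborel" using open_not_negligible[OF J] by (auto simp: negligible_iff_null_sets dest: null_sets_completionI)
    have "0 < c"
    proof (rule ccontr)
      assume "\<not> 0 < c"
      then have "AE x in lborel. ennreal ((?G x)\<^sup>2) * indicator J x = 0"
        unfolding c_def by (subst (asm) not_gr_zero, subst (asm) nn_integral_0_iff_AE) auto
      with TJ have "AE x in lborel. x \<notin> J"
      proof eventually_elim
        case (elim x)
        show ?case
        proof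
          assume x: "x \<in> J"
          then have "?G x = to_heat L a p0 fI x" using elim(1) by (auto simp: J_def abs_less_iff)
          moreover have "?G x = 0" using elim(2) x by simp
          ultimately show False using FI_sign[OF \<sigma>, of x] x by (simp add: J_def)
        qed
      qed
      then have "J \<in> null_sets lborel" by (subst AE_iff_null_sets) auto
      with J_null show False ..
    qed
    with attains_datum_borel[OF F_att TJ]
    have "\<forall>\<^sub>F s in at_right 0. (\<integral>\<^sup>+x\<in>{-L<..<L}. ennreal ((F x s - ?G x)\<^sup>2) \<partial>lborel) < c"
      by (rule order_tendstoD(2))
    with eventually_at_right_less[of "0::real"] show "\<forall>\<^sub>F s in at_right 0. - \<epsilon> < \<sigma> * (p s - p0)"
    proof eventually_elim
      case (elim s)
      show ?case
      proof (rule ccontr)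
        assume "\<not> - \<epsilon> < \<sigma> * (p s - p0)"
        then have n: "\<sigma> * (p s - p0) \<le> - \<epsilon>" by simp
        have "c \<le> (\<integral>\<^sup>+x\<in>{-L<..<L}. ennreal ((F x s - ?G x)\<^sup>2) \<partial>lborel)"
          unfolding c_def
        proof (rule nn_integral_mono_AE)
          show "AE x in lborel. ennreal ((?G x)\<^sup>2) * indicator J x \<le> ennreal ((F x s - ?G x)\<^sup>2) * indicator {-L<..<L} x"
            using TJ
          proof eventually_elim
            case (elim x)
            show ?case
            proof (cases "x \<in> J")
              case True
              then have x: "\<bar>x\<bar> < L" "0 < \<sigma> * (p0 - x)" "\<sigma> * (p0 - x) < \<epsilon>" by (auto simp: J_def)
              have G: "0 < \<sigma> * ?G x" using FI_sign[OF \<sigma> x(1,2)] elim x by (simp add: abs_less_iff)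
              have "\<sigma> * F x s \<le> 0"
                using \<sigma> n x U_pos[OF \<open>0 < s\<close>, of x] U_neg[OF \<open>0 < s\<close>, of x] U_eq[OF x(1) \<open>0 < s\<close>] by auto
              with G have "\<bar>?G x\<bar> \<le> \<bar>F x s - ?G x\<bar>" using \<sigma> by auto
              then have "(?G x)\<^sup>2 \<le> (F x s - ?G x)\<^sup>2" by (simp add: abs_le_square_iff)
              then show ?thesis using x by (simp add: indicator_def abs_less_iff ennreal_leI)
            qed simp
          qed
        qed
        then show False using elim by simp
      qed
    qed
  qed
  show ?thesis
  proof (rule tendstoI)
    fix \<epsilon> :: real assume "0 < \<epsilon>"
    with side[of 1 \<epsilon>] side[of "- 1" \<epsilon>] have "\<forall>\<^sub>F s in at_right 0. - \<epsilon> < 1 * (p s - p0)" "\<forall>\<^sub>F s in at_right 0. - \<epsilon> < - 1 * (p s - p0)" by blast+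
    then show "\<forall>\<^sub>F s in at_right 0. dist (p s) p0 < \<epsilon>" by eventually_elim (auto simp: dist_real_def)
  qed
qed

text \<open>The strict signs of \<open>U\<close> at \<open>p t - \<epsilon> / 2\<close> and
  \<open>p t + \<epsilon> / 2\<close> persist for nearby times and trap the zero.\<close>

lemma p_isCont: assumes t: "0 < t" shows "isCont p t"
  unfolding isCont_def
proof (rule tendstoI)
  fix \<epsilon> :: real assume \<epsilon>: "0 < \<epsilon>"
  have Ut: "((\<lambda>s. U x s) \<longlongrightarrow> U x t) (at t)" for x
    using DERIV_isCont[OF UD(6)[of x t]] t by (simp add: isCont_def)
  have "\<forall>\<^sub>F s in at t. 0 < U (p t - \<epsilon> / 2) s"
    by (rule order_tendstoD(1)[OF Ut]) (use U_pos[OF t] \<epsilon> in auto)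
  moreover have "\<forall>\<^sub>F s in at t. U (p t + \<epsilon> / 2) s < 0"
    by (rule order_tendstoD(2)[OF Ut]) (use U_neg[OF t] \<epsilon> in auto)
  moreover have "\<forall>\<^sub>F s in at t. 0 < s" using t by (intro order_tendstoD(1)[OF tendsto_ident_at])
  ultimately show "\<forall>\<^sub>F s in at t. dist (p s) (p t) < \<epsilon>"
  proof eventually_elim
    case (elim s)
    have "\<not> p s < p t - \<epsilon> / 2" "\<not> p t + \<epsilon> / 2 < p s"
      using U_neg[OF elim(3), of "p t - \<epsilon> / 2"] U_pos[OF elim(3), of "p t + \<epsilon> / 2"] elim by linarith+
    then show ?case using \<epsilon> by (simp add: dist_real_def abs_less_iff)
  qed
qed

lemma p_cont: "continuous_on {0..} p"
  unfolding continuous_on_def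
proof
  fix t :: real assume "t \<in> {0..}"
  show "(p \<longlongrightarrow> p t) (at t within {0..})"
  proof (cases "t = 0")
    case True
    then show ?thesis using p_cont_0 p_0 by (simp add: at_within_Ici_at_right)
  next
    case False
    with p_isCont[of t] \<open>t \<in> {0..}\<close> show ?thesis unfolding isCont_def by (auto intro: tendsto_within_subset)
  qed
qed

lemma p_in: "0 \<le> t \<Longrightarrow> p t \<in> {-L<..<L}"
  using p_in_pos[of t] p_0 p0 a by (cases "t = 0") auto

section \<open>The function recovered from the heat solution\<close>

lemmas mem_off = mem_off_sources[OF a, where p = p and L = L]

lemmas open_off = open_off_sources[OF a p_cont, where L = L]

definition f :: "real \<Rightarrow> real \<Rightarrow> real" where
  "f x t = from_heat L a (\<lambda>y. F y t) x"

text \<open>By the signs of \<open>U\<close>, positive and negative parts become one-sided cuts of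
  \<open>U\<close> at the curve. The truncation to the interval disappears because a point between
  \<open>x\<close> and \<open>p t\<close> lies in the interval with them.\<close>

lemma f_eq:
  assumes x: "\<bar>x\<bar> < L" and t: "0 < t"
  shows "f x t = U x t - (if x + a < p t then U (x + a) t else 0) - (if p t < x - a then U (x - a) t else 0)"
proof -
  have P: "pos_ext L (\<lambda>y. F y t) (x + a) = (if x + a < p t then U (x + a) t else 0)"
    using U_eq[of "x + a" t] U_pos[OF t, of "x + a"] U_neg[OF t, of "x + a"] U_p[OF t] p_in_pos[OF t] x t a
    by (cases "x + a" "p t" rule: linorder_cases) (auto simp: pos_ext_def abs_less_iff)
  have N: "neg_ext L (\<lambda>y. F y t) (x - a) = - (if p t < x - a then U (x - a) t else 0)"
    using U_eq[of "x - a" t] U_pos[OF t, of "x - a"] U_neg[OF t, of "x - a"] U_p[OF t] p_in_pos[OF t] x t a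
    by (cases "x - a" "p t" rule: linorder_cases) (auto simp: neg_ext_def abs_less_iff)
  show ?thesis unfolding f_def from_heat_def P N using U_eq[OF x t] by simp
qed

lemma f_near: "\<bar>x\<bar> < L \<Longrightarrow> 0 < t \<Longrightarrow> \<bar>x - p t\<bar> < a \<Longrightarrow> f x t = U x t"
  using a by (auto simp: f_eq)

lemma f_far:
  assumes "\<sigma> = 1 \<or> \<sigma> = -1" "\<bar>x\<bar> < L" "0 < t" "a < \<sigma> * (p t - x)"
  shows "f x t = U x t - U (x + \<sigma> * a) t"
  using assms a by (auto simp: f_eq)

lemma open_near_curve: "open {(x, t). 0 < t \<and> \<bar>x\<bar> < L \<and> \<bar>x - p t\<bar> < a}"
  by (rule open_curve_cond[OF p_cont]) (intro open_Collect_conj open_Collect_less continuous_intros)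

lemma open_far_curve: "open {(x, t). 0 < t \<and> \<bar>x\<bar> < L \<and> a < \<sigma> * (p t - x)}"
  by (rule open_curve_cond[OF p_cont]) (intro open_Collect_conj open_Collect_less continuous_intros)

lemma far_side:
  assumes "a < \<bar>x - p t\<bar>"
  obtains \<sigma> where "\<sigma> = 1 \<or> \<sigma> = -1" "a < \<sigma> * (p t - x)"
proof (cases "x < p t")
  case True
  then show ?thesis using that[of 1] assms by auto
next
  case False
  then show ?thesis using that[of "- 1"] assms by auto
qed

text \<open>Off the sources \<open>f\<close> is locally either \<open>U\<close> or the difference of
  \<open>U\<close> and a shift of it; kinks can occur only where a shifted cut begins.\<close>

lemma f_caloric: "caloric_on (off_sources L a p) f"
proof (rule caloric_on_local)
  fix x t assume "(x, t) \<in> off_sources L a p"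
  then have x: "\<bar>x\<bar> < L" "0 < t" "\<bar>x - p t\<bar> \<noteq> a" by (auto simp: mem_off)
  show "\<exists>V. open V \<and> (x, t) \<in> V \<and> caloric_on V f"
  proof (cases "\<bar>x - p t\<bar> < a")
    case True
    have "caloric_on {(x, t). 0 < t \<and> \<bar>x\<bar> < L \<and> \<bar>x - p t\<bar> < a} f"
      by (rule caloric_on_cong[OF open_near_curve caloric_on_subset[OF U]]) (auto simp: f_near)
    then show ?thesis using open_near_curve x True by blast
  next
    case False
    then have "a < \<bar>x - p t\<bar>" using x by linarith
    then obtain \<sigma> where \<sigma>: "\<sigma> = 1 \<or> \<sigma> = -1" "a < \<sigma> * (p t - x)" by (rule far_side)
    let ?V = "{(x, t). 0 < t \<and> \<bar>x\<bar> < L \<and> a < \<sigma> * (p t - x)}"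
    have "caloric_on ?V f"
    proof (rule caloric_on_cong[OF open_far_curve])
      have 1: "caloric_on ?V U" by (rule caloric_on_subset[OF U]) auto
      have 2: "caloric_on ?V (\<lambda>x t. - 1 * U (1 * x + \<sigma> * a) t)"
        by (rule caloric_on_subset[OF caloric_on_affine[OF U]]) auto
      from caloric_on_add[OF 1 2] show "caloric_on ?V (\<lambda>x t. U x t - U (x + \<sigma> * a) t)" by simp
      show "f x t = U x t - U (x + \<sigma> * a) t" if "(x, t) \<in> ?V" for x t
        using that f_far[OF \<sigma>(1), of x t] by auto
    qed
    then show ?thesis using open_far_curve \<sigma> x by blast
  qed
qed

lemma Dx_f_near:
  assumes "\<bar>x\<bar> < L" "0 < t" "\<bar>x - p t\<bar> < a" shows "Dx f x t = Dx U x t"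
  by (rule Dx_eq_on_open[OF open_near_curve]) (use assms f_near in auto)

lemma Dx_f_far:
  assumes \<sigma>: "\<sigma> = 1 \<or> \<sigma> = -1" and x: "\<bar>x\<bar> < L" "0 < t" "a < \<sigma> * (p t - x)"
  shows "Dx f x t = Dx U x t - Dx U (x + \<sigma> * a) t"
proof -
  have "((\<lambda>y. U (y + \<sigma> * a) t) has_field_derivative Dx U (x + \<sigma> * a) t) (at x)"
    using UD(4)[of "x + \<sigma> * a" t] x by (simp add: DERIV_shift)
  moreover have "((\<lambda>y. U y t) has_field_derivative Dx U x t) (at x)" using UD(4)[of x t] x by simp
  ultimately have "((\<lambda>y. U y t - U (y + \<sigma> * a) t) has_field_derivative Dx U x t - Dx U (x + \<sigma> * a) t) (at x)"
    by (intro DERIV_diff)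
  then have "Dx (\<lambda>y t. U y t - U (y + \<sigma> * a) t) x t = Dx U x t - Dx U (x + \<sigma> * a) t"
    unfolding Dx_def by (rule DERIV_imp_deriv)
  moreover have "Dx f x t = Dx (\<lambda>y t. U y t - U (y + \<sigma> * a) t) x t"
    by (rule Dx_eq_on_open[OF open_far_curve[of \<sigma>]]) (use assms f_far[OF \<sigma>] in auto)
  ultimately show ?thesis by simp
qed

lemma Dx_U_isCont: "0 < t \<Longrightarrow> isCont (\<lambda>y. Dx U y t) x"
  using UD(5)[of x t] by (simp add: DERIV_isCont)

lemma Dx_U_F: "\<bar>x\<bar> < L \<Longrightarrow> 0 < t \<Longrightarrow> Dx U x t = Dx F x t"
  by (rule Dx_eq_on_open[OF open_cylinder]) (auto simp: mem_cyl U_eq)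

text \<open>As \<open>U\<close> is smooth across the end, the one-sided slope condition becomes an
  identity between two derivatives of \<open>U\<close>.\<close>

lemma Dx_U_left: "0 < t \<Longrightarrow> Dx U (- L) t = Dx U (- L + a) t"
proof -
  assume t: "0 < t"
  have L: "0 < L" using a aL by simp
  have "left_slope L U t (Dx F (- L + a) t)"
    using F_left[OF t] slope_cong(1)[of L U t F] Dx_U_F t L by simp
  moreover have "((\<lambda>x. Dx U x t) \<longlongrightarrow> Dx U (- L) t) (at_right (- L))"
    using Dx_U_isCont[OF t] unfolding isCont_def by (rule tendsto_within_subset) auto
  ultimately have "Dx U (- L) t = Dx F (- L + a) t" unfolding left_slope_def by (intro tendsto_unique[of "at_right (- L)"]) auto
  then show ?thesis using Dx_U_F[of "- L + a" t] t a aL by simp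
qed

lemma Dx_U_right: "0 < t \<Longrightarrow> Dx U L t = Dx U (L - a) t"
proof -
  assume t: "0 < t"
  have L: "0 < L" using a aL by simp
  have "right_slope L U t (Dx F (L - a) t)"
    using F_right[OF t] slope_cong(2)[of L U t F] Dx_U_F t L by simp
  moreover have "((\<lambda>x. Dx U x t) \<longlongrightarrow> Dx U L t) (at_left L)"
    using Dx_U_isCont[OF t] unfolding isCont_def by (rule tendsto_within_subset) auto
  ultimately have "Dx U L t = Dx F (L - a) t" unfolding right_slope_def by (intro tendsto_unique[of "at_left L"]) auto
  then show ?thesis using Dx_U_F[of "L - a" t] t a aL by simp
qed

lemma f_left: assumes t: "0 < t" shows "left_slope L f t (if p t > -L + a then 0 else Dx f (-L + a) t)"
proof (cases "p t > - L + a")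
  case True
  have "((\<lambda>x. Dx U x t - Dx U (x + a) t) \<longlongrightarrow> Dx U (- L) t - Dx U (- L + a) t) (at_right (- L))"
    by (intro tendsto_diff isCont_tendsto_compose[OF Dx_U_isCont[OF t]] tendsto_intros)
  moreover have "\<forall>\<^sub>F x in at_right (- L). Dx U x t - Dx U (x + a) t = Dx f x t"
    by (rule eventually_at_rightI[of "- L" "p t - a"]) (use Dx_f_far[of 1 _ t] t True p_in[of t] a in \<open>auto simp: abs_less_iff\<close>)
  ultimately show ?thesis using True Dx_U_left[OF t] unfolding left_slope_def by (auto elim: Lim_transform_eventually)
next
  case False
  have "Dx f (- L + a) t = Dx U (- L) t"
    unfolding Dx_U_left[OF t] by (rule Dx_f_near) (use False p_in[of t] t a aL in auto)
  moreover have "\<forall>\<^sub>F x in at_right (- L). Dx U x t = Dx f x t"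
    by (rule eventually_at_rightI[of "- L" "min L (p t + a)"])
      (use Dx_f_near[of _ t] t False p_in[of t] a aL in \<open>auto simp: abs_less_iff\<close>)
  moreover have "((\<lambda>x. Dx U x t) \<longlongrightarrow> Dx U (- L) t) (at_right (- L))"
    using Dx_U_isCont[OF t] unfolding isCont_def by (rule tendsto_within_subset) auto
  ultimately show ?thesis using False unfolding left_slope_def by (auto elim: Lim_transform_eventually)
qed

lemma f_right: assumes t: "0 < t" shows "right_slope L f t (if p t < L - a then 0 else Dx f (L - a) t)"
proof (cases "p t < L - a")
  case True
  have "((\<lambda>x. Dx U x t - Dx U (x - a) t) \<longlongrightarrow> Dx U L t - Dx U (L - a) t) (at_left L)"
    by (intro tendsto_diff isCont_tendsto_compose[OF Dx_U_isCont[OF t]] tendsto_intros)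
  moreover have "\<forall>\<^sub>F x in at_left L. Dx U x t - Dx U (x - a) t = Dx f x t"
    by (rule eventually_at_leftI[of "p t + a"]) (use Dx_f_far[of "- 1" _ t] t True p_in[of t] a in \<open>auto simp: abs_less_iff\<close>)
  ultimately show ?thesis using True Dx_U_right[OF t] unfolding right_slope_def by (auto elim: Lim_transform_eventually)
next
  case False
  have "Dx f (L - a) t = Dx U L t"
    unfolding Dx_U_right[OF t] by (rule Dx_f_near) (use False p_in[of t] t a aL in auto)
  moreover have "\<forall>\<^sub>F x in at_left L. Dx U x t = Dx f x t"
    by (rule eventually_at_leftI[of "max (- L) (p t - a)"])
      (use Dx_f_near[of _ t] t False p_in[of t] a aL in \<open>auto simp: abs_less_iff\<close>)
  moreover have "((\<lambda>x. Dx U x t) \<longlongrightarrow> Dx U L t) (at_left L)"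
    using Dx_U_isCont[OF t] unfolding isCont_def by (rule tendsto_within_subset) auto
  ultimately show ?thesis using False unfolding right_slope_def by (auto elim: Lim_transform_eventually)
qed

lemma f_bounded_slope: "bounded_slope (off_sources L a p) f"
  unfolding bounded_slope_def
proof (intro allI impI)
  fix s T :: real assume s: "0 < s"
  have "bounded ((\<lambda>(x, t). Dx F x t) ` (cylinder L \<inter> UNIV \<times> {s..T}))"
    using F_slope s by (simp add: bounded_slope_def)
  then obtain B where "\<forall>y \<in> (\<lambda>(x, t). Dx F x t) ` (cylinder L \<inter> UNIV \<times> {s..T}). norm y \<le> B" unfolding bounded_iff by blast
  then have B: "\<bar>Dx U x t\<bar> \<le> B" if "\<bar>x\<bar> < L" "s \<le> t" "t \<le> T" for x t
    using that s Dx_U_F[of x t] by (force simp: mem_cyl)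
  have "\<bar>Dx f x t\<bar> \<le> 2 * B" if x: "\<bar>x\<bar> < L" "s \<le> t" "t \<le> T" "\<bar>x - p t\<bar> \<noteq> a" for x t
  proof (cases "\<bar>x - p t\<bar> < a")
    case True
    then show ?thesis using B[OF x(1-3)] Dx_f_near[of x t] x s by simp
  next
    case False
    then have "a < \<bar>x - p t\<bar>" using x by linarith
    then obtain \<sigma> where \<sigma>: "\<sigma> = 1 \<or> \<sigma> = -1" "a < \<sigma> * (p t - x)" by (rule far_side)
    have "\<bar>x + \<sigma> * a\<bar> < L" using \<sigma> x p_in[of t] a s by auto
    then show ?thesis using B[OF x(1-3)] B[of "x + \<sigma> * a" t] Dx_f_far[OF \<sigma>(1) x(1) _ \<sigma>(2)] x s by simp
  qed
  then show "bounded ((\<lambda>(x, t). Dx f x t) ` (off_sources L a p \<inter> UNIV \<times> {s..T}))"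
    unfolding bounded_iff by (intro exI[of _ "2 * B"]) (auto simp: mem_off)
qed

text \<open>Written with \<open>max\<close> and \<open>min\<close>, the cuts of \<open>U\<close> are
  visibly continuous, without reference to the curve.\<close>

lemma f_cont: "continuous_on (cylinder L) (\<lambda>(x, t). f x t)"
proof (rule continuous_on_eq)
  have Us: "continuous_on (cylinder L) (\<lambda>z. U (fst z + m) (snd z))" for m
  proof -
    have "continuous_on (cylinder L) (\<lambda>z. (\<lambda>(x, t). U x t) (fst z + m, snd z))"
      by (rule continuous_on_compose2[OF UD(1)]) (auto intro!: continuous_intros simp: cylinder_def)
    then show ?thesis by simp
  qed
  show "continuous_on (cylinder L) (\<lambda>z. U (fst z + 0) (snd z) - max (U (fst z + a) (snd z)) 0 - min (U (fst z + - a) (snd z)) 0)"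
    by (intro continuous_on_diff continuous_on_max continuous_on_min Us continuous_on_const)
  fix z assume "z \<in> cylinder L"
  then have z: "\<bar>fst z\<bar> < L" "0 < snd z" by (auto simp: cylinder_def abs_less_iff)
  have "max (U y (snd z)) 0 = (if y < p (snd z) then U y (snd z) else 0)" "min (U y (snd z)) 0 = (if p (snd z) < y then U y (snd z) else 0)" for y
    using U_pos[OF z(2), of y] U_neg[OF z(2), of y] U_p[OF z(2)] by (cases y "p (snd z)" rule: linorder_cases; simp)+
  then show "U (fst z + 0) (snd z) - max (U (fst z + a) (snd z)) 0 - min (U (fst z + - a) (snd z)) 0 = (case z of (x, t) \<Rightarrow> f x t)"
    using f_eq[OF z] by (simp add: case_prod_unfold)
qed

text \<open>Three copies of the \<open>L\<^sup>2\<close> error of \<open>F\<close>, two of them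
  shifted, dominate the error of \<open>f\<close>; \<open>from_heat_to_heat\<close> identifies the
  limit.\<close>

lemma f_attains: "attains_datum L f fI"
proof (rule fJ_exists)
  fix fJ assume [measurable]: "fJ \<in> borel_measurable borel" and sJ: "single_crossing L p0 fJ"
    and J: "AE x in lborel. x \<in> {-L<..<L} \<longrightarrow> fJ x = fI x"
    and TJ: "AE x in lborel. x \<in> {-L<..<L} \<longrightarrow> to_heat L a p0 fJ x = to_heat L a p0 fI x"
  let ?G = "to_heat L a p0 fJ"
  show "attains_datum L f fI"
  proof (rule attains_datumI_borel[OF _ J])
    fix x assume "x \<in> {-L<..<L}"
    then have x: "\<bar>x\<bar> < L" by auto
    have "pos_ext L (\<lambda>y. F y 0) = pos_ext L (to_heat L a p0 fI)" "neg_ext L (\<lambda>y. F y 0) = neg_ext L (to_heat L a p0 fI)"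
      by (auto simp: pos_ext_def neg_ext_def fun_eq_iff F_0 abs_less_iff)
    then have "f x 0 = from_heat L a (to_heat L a p0 fI) x" using F_0[OF x] by (simp add: f_def from_heat_def)
    then show "f x 0 = fI x" using from_heat_to_heat[OF a sc_fI x] by simp
  next
    define E where "E = (\<lambda>s y. \<bar>indicator {-L<..<L} y * (F y s - ?G y)\<bar>)"
    have m: "\<forall>\<^sub>F s in at_right 0. E s \<in> borel_measurable borel"
      using eventually_at_right_less[of "0::real"]
    proof eventually_elim
      case (elim s)
      have "continuous_on {-L<..<L} (\<lambda>y. (\<lambda>(x, t). F x t) (y, s))"
        by (rule continuous_on_compose2[OF caloric_onD(1)[OF open_cylinder heat_solution_caloric[OF F]]])
          (use elim in \<open>auto intro!: continuous_intros simp: mem_cyl\<close>)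
      then have "(\<lambda>y. indicator {-L<..<L} y *\<^sub>R F y s) \<in> borel_measurable borel"
        by (intro borel_measurable_continuous_on_indicator) auto
      then have [measurable]: "(\<lambda>y. indicator {-L<..<L} y * F y s) \<in> borel_measurable borel" by simp
      have "E s = (\<lambda>y. \<bar>indicator {-L<..<L} y * F y s - indicator {-L<..<L} y * ?G y\<bar>)"
        by (auto simp: E_def algebra_simps)
      then show ?case by simp
    qed
    have l: "((\<lambda>s. \<integral>\<^sup>+x. ennreal ((E s x)\<^sup>2) \<partial>lborel) \<longlongrightarrow> 0) (at_right 0)"
    proof -
      have "ennreal ((E s x)\<^sup>2) = ennreal ((F x s - ?G x)\<^sup>2) * indicator {-L<..<L} x" for s x by (simp add: E_def indicator_def)
      then show ?thesis using attains_datum_borel[OF F_att TJ] by simp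
    qed
    have ms: "\<forall>\<^sub>F s in at_right 0. (\<lambda>x. E s (x + c)) \<in> borel_measurable borel" for c
      using m by eventually_elim (rule measurable_compose[of "\<lambda>x. x + c" borel borel], auto)
    have m2: "\<forall>\<^sub>F s in at_right 0. (\<lambda>x. E s x + E s (x + a)) \<in> borel_measurable borel"
      using m ms[of a] by eventually_elim (rule borel_measurable_add)
    have "((\<lambda>s. \<integral>\<^sup>+x. ennreal ((E s x + E s (x + a) + E s (x + - a))\<^sup>2) \<partial>lborel) \<longlongrightarrow> 0) (at_right 0)"
      by (rule L2_lim_add[OF L2_lim_add[OF l L2_lim_affine[OF l m] m ms] L2_lim_affine[OF l m] m2 ms])
    then show "((\<lambda>s. \<integral>\<^sup>+x. ennreal ((indicator {-L<..<L} x * (f x s - fJ x))\<^sup>2) \<partial>lborel) \<longlongrightarrow> 0) (at_right 0)"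
    proof (rule L2_lim_bound, intro always_eventually allI)
      fix s x
      show "\<bar>indicator {-L<..<L} x * (f x s - fJ x)\<bar> \<le> \<bar>E s x + E s (x + a) + E s (x + - a)\<bar>"
      proof (cases "\<bar>x\<bar> < L")
        case True
        from from_heat_diff_le[OF this, of a "\<lambda>y. F y s" ?G]
        have "\<bar>f x s - fJ x\<bar> \<le> E s x + E s (x + a) + E s (x + - a)"
          by (simp add: f_def from_heat_to_heat[OF a sJ True] E_def)
        then show ?thesis using True by (simp add: indicator_def abs_less_iff)
      next
        case False
        then show ?thesis by (auto simp: indicator_def)
      qed
    qed
  qed
qed

section \<open>The Dirac sources of the recovered function\<close>

lemma f_p: "0 < t \<Longrightarrow> f (p t) t = 0"
  using f_near[of "p t" t] U_p p_in_pos a by simp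

text \<open>Green's formula for \<open>U\<close> shifted by \<open>m\<close>, to the left of any
  curve \<open>q\<close> on which the shifted function vanishes as long as \<open>q\<close> is
  within the rectangle. A curve to the right of the rectangle satisfies this trivially and gives the
  integral over the whole rectangle.\<close>

lemma green_shift:
  fixes \<phi> \<phi>x \<phi>xx \<phi>t :: "real \<Rightarrow> real \<Rightarrow> real"
  assumes ord: "x1 < x2" "0 < t1" "t1 < t2"
    and c\<phi>: "continuous_on UNIV (\<lambda>(x, t). \<phi> x t)" "continuous_on UNIV (\<lambda>(x, t). \<phi>x x t)"
      "continuous_on UNIV (\<lambda>(x, t). \<phi>xx x t)" "continuous_on UNIV (\<lambda>(x, t). \<phi>t x t)"
    and d\<phi>: "\<And>x t. ((\<lambda>y. \<phi> y t) has_field_derivative \<phi>x x t) (at x)"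
      "\<And>x t. ((\<lambda>y. \<phi>x y t) has_field_derivative \<phi>xx x t) (at x)"
      "\<And>x t. ((\<lambda>s. \<phi> x s) has_field_derivative \<phi>t x t) (at t)"
    and van: "\<And>x t. (x, t) \<notin> box (x1, t1) (x2, t2) \<Longrightarrow> \<phi> x t = 0 \<and> \<phi>x x t = 0"
    and q: "continuous_on {t1..t2} q" "\<And>t. t \<in> {t1..t2} \<Longrightarrow> q t \<in> {x1..x2} \<Longrightarrow> U (q t + m) t = 0"
  shows "(LINT z:{z \<in> cbox (x1, t1) (x2, t2). fst z < q (snd z)}|lborel.
      U (fst z + m) (snd z) * (- \<phi>t (fst z) (snd z) - \<phi>xx (fst z) (snd z))) =
    (LINT t:{t1..t2}|lborel. Dx U (q t + m) t * \<phi> (q t) t)"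
proof (rule free_boundary_green[where u = "\<lambda>x t. U (x + m) t" and v = "\<lambda>x t. Dx U (x + m) t" and w = "\<lambda>x t. Dx (Dx U) (x + m) t"
    and \<phi>x = \<phi>x])
  have Q: "0 < s" if "(y, s) \<in> cbox (x1, t1) (x2, t2)" for y s using that ord by (auto simp: cbox_Pair_eq)
  have c: "continuous_on (cbox (x1, t1) (x2, t2)) (\<lambda>(x, t). g (x + m) t)" if g: "continuous_on (UNIV \<times> {0<..}) (\<lambda>(x, t). g x t)" for g :: "real \<Rightarrow> real \<Rightarrow> real"
  proof -
    have "continuous_on (cbox (x1, t1) (x2, t2)) (\<lambda>z. (\<lambda>(x, t). g x t) (fst z + m, snd z))"
      by (rule continuous_on_compose2[OF g]) (use ord in \<open>auto intro!: continuous_intros simp: cbox_Pair_eq\<close>)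
    then show ?thesis by (simp add: case_prod_unfold)
  qed
  show "continuous_on (cbox (x1, t1) (x2, t2)) (\<lambda>(x, t). U (x + m) t)" by (rule c[OF UD(1)])
  show "continuous_on (cbox (x1, t1) (x2, t2)) (\<lambda>(x, t). Dx U (x + m) t)" by (rule c[OF UD(2)])
  show "continuous_on (cbox (x1, t1) (x2, t2)) (\<lambda>(x, t). Dx (Dx U) (x + m) t)" by (rule c[OF UD(3)])
  fix x t assume xt: "(x, t) \<in> cbox (x1, t1) (x2, t2)"
  show "((\<lambda>y. U (y + m) t) has_field_derivative Dx U (x + m) t) (at x)"
    using UD(4)[of "x + m" t] Q[OF xt] by (simp add: DERIV_shift)
  show "((\<lambda>y. Dx U (y + m) t) has_field_derivative Dx (Dx U) (x + m) t) (at x)"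
    using UD(5)[of "x + m" t] Q[OF xt] by (simp add: DERIV_shift)
  show "((\<lambda>s. U (x + m) s) has_field_derivative Dx (Dx U) (x + m) t) (at t)"
    using UD(6)[of "x + m" t] Q[OF xt] by simp
qed (use assms in auto)

text \<open>\<open>f\<close> is \<open>U\<close>, minus \<open>U (x + a)\<close> cut to the left of
  \<open>p - a\<close>, minus \<open>U (x - a)\<close> cut to the right of \<open>p + a\<close>.
  Since Green's formula is stated for left parts, the last cut is written as the whole minus its
  left part. Whole rectangles contribute nothing, and the two cuts produce the two Dirac
  masses.\<close>

lemma f_dirac: "heat_with_dirac_sources L f (\<lambda>t. - Dx f (p t) t) (\<lambda>t. p t - a) (\<lambda>t. p t + a)"
  unfolding heat_with_dirac_sources_def
proof (intro allI impI)
  fix \<phi> assume "test_function (cylinder L) \<phi>"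
  then obtain D :: "nat \<Rightarrow> nat \<Rightarrow> real \<Rightarrow> real \<Rightarrow> real" and K where D0: "D 0 0 = \<phi>"
    and Dc: "\<And>i j. continuous_on UNIV (\<lambda>(x, t). D i j x t)"
    and Dd: "\<And>i j x t. ((\<lambda>y. D i j y t) has_field_derivative D (Suc i) j x t) (at x)"
      "\<And>i j x t. ((\<lambda>s. D i j x s) has_field_derivative D i (Suc j) x t) (at t)"
    and K: "compact K" "K \<subseteq> cylinder L" "\<And>x t. (x, t) \<notin> K \<Longrightarrow> \<phi> x t = 0"
    unfolding test_function_def by metis
  have oK: "open (- K)" using compact_imp_closed[OF K(1)] by (simp add: open_Compl)
  \<comment> \<open>The test function is only known to vanish outside \<open>K\<close>; since the
    complement of \<open>K\<close> is open, all derivatives vanish there too.\<close>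
  have Dz: "D i j x t = 0" if "(x, t) \<notin> K" for i j x t
    using that
  proof (induction i arbitrary: x t)
    case 0
    then show ?case
    proof (induction j arbitrary: x t)
      case 0
      then show ?case using K(3) D0 by simp
    next
      case (Suc j)
      have "((\<lambda>s. 0) has_field_derivative D 0 (Suc j) x t) (at t)"
      proof (rule DERIV_cong_ev[THEN iffD1, OF refl _ refl Dd(2)])
        show "\<forall>\<^sub>F s in nhds t. D 0 j x s = 0"
          by (rule eventually_mono[OF eventually_slice(2)[OF oK]]) (use Suc in auto)
      qed
      then show ?case using DERIV_unique DERIV_const by blast
    qed
  next
    case (Suc i)
    have "((\<lambda>y. 0) has_field_derivative D (Suc i) j x t) (at x)"
    proof (rule DERIV_cong_ev[THEN iffD1, OF refl _ refl Dd(1)])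
      show "\<forall>\<^sub>F y in nhds x. D i j y t = 0"
        by (rule eventually_mono[OF eventually_slice(1)[OF oK]]) (use Suc in auto)
    qed
    then show ?case using DERIV_unique DERIV_const by blast
  qed
  have Dx\<phi>: "Dx \<phi> = D 1 0" "Dx (D 1 0) = D 2 0" "Dt \<phi> = D 0 1"
  proof -
    show "Dx \<phi> = D 1 0" using DERIV_imp_deriv[OF Dd(1)[of 0 0]] by (auto simp: Dx_def D0 fun_eq_iff)
    show "Dx (D 1 0) = D 2 0" using DERIV_imp_deriv[OF Dd(1)[of 1 0]] by (auto simp: Dx_def fun_eq_iff numeral_2_eq_2)
    show "Dt \<phi> = D 0 1" using DERIV_imp_deriv[OF Dd(2)[of 0 0]] by (auto simp: Dt_def D0 fun_eq_iff)
  qed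
  obtain t1 t2 where t12: "0 < t1" "t1 < t2" "\<And>x t. (x, t) \<in> K \<Longrightarrow> t1 < t \<and> t < t2"
  proof (cases "K = {}")
    case True
    then show ?thesis using that[of 1 2] by auto
  next
    case False
    have cK: "compact (snd ` K)" "snd ` K \<noteq> {}" using K(1) False by (auto intro!: compact_continuous_image continuous_intros)
    from compact_attains_inf[OF cK] obtain s where s: "s \<in> snd ` K" "\<And>t. t \<in> snd ` K \<Longrightarrow> s \<le> t" by blast
    from compact_attains_sup[OF cK] obtain s' where s': "s' \<in> snd ` K" "\<And>t. t \<in> snd ` K \<Longrightarrow> t \<le> s'" by blast
    have "0 < s" using s(1) K(2) by (auto simp: cylinder_def)
    moreover have "s \<le> s'" using s s' by blast
    moreover have "s \<le> t \<and> t \<le> s'" if "(x, t) \<in> K" for x t using s(2) s'(2) image_eqI[OF _ that, of t snd] by simp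
    \<comment> \<open>Slack on both sides, so that \<open>K\<close> lies in the open box.\<close>
    ultimately show ?thesis using that[of "s / 2" "s' + 1"] by fastforce
  qed
  let ?Q = "cbox (- L, t1) (L, t2)"
  let ?\<psi> = "\<lambda>z. - D 0 1 (fst z) (snd z) - D 2 0 (fst z) (snd z)"
  have L: "0 < L" using a aL by simp
  have KQ: "K \<subseteq> box (- L, t1) (L, t2)"
    using K(2) t12(3) by (fastforce simp: cylinder_def box_def Basis_prod_def)
  have QP: "0 < t" if "t \<in> {t1..t2}" for t using that t12 by auto
  have cp: "continuous_on {t1..t2} p" by (rule continuous_on_subset[OF p_cont]) (use QP in force)
  have green: "(LINT z:{z \<in> ?Q. fst z < q (snd z)}|lborel. U (fst z + m) (snd z) * ?\<psi> z) =
      (LINT t:{t1..t2}|lborel. Dx U (q t + m) t * \<phi> (q t) t)"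
    if "continuous_on {t1..t2} q" "\<And>t. t \<in> {t1..t2} \<Longrightarrow> q t \<in> {-L..L} \<Longrightarrow> U (q t + m) t = 0" for q m
  proof (rule green_shift[where \<phi>x = "D 1 0"])
    show "((\<lambda>y. \<phi> y t) has_real_derivative D 1 0 x t) (at x)" "((\<lambda>y. D 1 0 y t) has_real_derivative D 2 0 x t) (at x)"
      "((\<lambda>s. \<phi> x s) has_real_derivative D 0 1 x t) (at t)" for x t
      using Dd(1)[of 0 0] Dd(1)[of 1 0] Dd(2)[of 0 0] by (simp_all add: D0 numeral_2_eq_2)
    show "\<phi> x t = 0 \<and> D 1 0 x t = 0" if "(x, t) \<notin> box (- L, t1) (L, t2)" for x t
      using Dz[of x t 0 0] Dz[of x t 1 0] that KQ unfolding D0 by blast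
    show "continuous_on UNIV (\<lambda>(x, t). \<phi> x t)" using Dc[of 0 0] by (simp add: D0)
  qed (use that Dc t12 L in auto)
  let ?u = "\<lambda>m z. U (fst z + m) (snd z) * ?\<psi> z"
  have SI: "set_integrable lborel ?Q (?u m)" for m
  proof -
    have "continuous_on ?Q (\<lambda>z. (\<lambda>(x, t). U x t) (fst z + m, snd z))"
      by (rule continuous_on_compose2[OF UD(1)]) (use t12 in \<open>auto intro!: continuous_intros simp: cbox_Pair_eq\<close>)
    moreover have "continuous_on ?Q (\<lambda>z. D i j (fst z) (snd z))" for i j
      using continuous_on_subset[OF Dc[of i j], of ?Q] by (simp add: case_prod_unfold)
    ultimately show ?thesis unfolding set_integrable_def
      by (intro borel_integrable_compact compact_cbox continuous_intros) simp_all
  qed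
  have mS: "{z \<in> ?Q. fst z < q (snd z)} \<in> sets borel" if "continuous_on {t1..t2} q" for q :: "real \<Rightarrow> real"
  proof -
    have "continuous_on ?Q (\<lambda>z. q (snd z))"
      by (rule continuous_on_compose2[OF that]) (auto intro!: continuous_intros simp: cbox_Pair_eq)
    then have "closed {z \<in> ?Q. q (snd z) \<le> fst z}"
      by (intro continuous_on_closed_Collect_le continuous_intros closed_cbox)
    moreover have "{z \<in> ?Q. fst z < q (snd z)} = ?Q - {z \<in> ?Q. q (snd z) \<le> fst z}" by auto
    ultimately show ?thesis by (auto intro!: sets.Diff borel_closed)
  qed
  let ?S = "\<lambda>m. {z \<in> ?Q. fst z < p (snd z) - m}"
  have cpm: "continuous_on {t1..t2} (\<lambda>t. p t - m)" for m by (intro continuous_intros cp)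
  have SS: "set_integrable lborel (?S k) (?u m)" for k m
    by (rule set_integrable_subset[OF SI]) (use mS[OF cpm] in auto)
  \<comment> \<open>The constant curve \<open>x = L + 1\<close> lies outside the rectangle, so the
    left part is everything and the boundary term vanishes through \<open>\<phi>\<close>.\<close>
  have I0: "(LINT z:?Q|lborel. ?u m z) = 0" for m
  proof -
    have "(LINT z:?Q|lborel. ?u m z) = (LINT z:{z \<in> ?Q. fst z < L + 1}|lborel. ?u m z)"
      by (rule arg_cong[where f = "\<lambda>S. LINT z:S|lborel. ?u m z"]) (auto simp: cbox_Pair_eq)
    also have "\<dots> = (LINT t:{t1..t2}|lborel. Dx U (L + 1 + m) t * \<phi> (L + 1) t)"
      by (rule green) auto
    also have "\<dots> = (LINT t:{t1..t2}|lborel. (0::real))"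
    proof -
      have "(L + 1, t) \<notin> K" for t using K(2) by (auto simp: cylinder_def)
      then show ?thesis using K(3) by simp
    qed
    finally show ?thesis by (simp add: set_lebesgue_integral_def)
  qed
  have Ip: "(LINT z:?S m|lborel. ?u m z) = (LINT t:{t1..t2}|lborel. Dx U (p t) t * \<phi> (p t - m) t)" for m
    using green[OF cpm[of m], of m] U_p QP by simp
  have SIp: "set_integrable lborel {t1..t2} (\<lambda>t. Dx U (p t) t * \<phi> (p t - m) t)" for m
  proof -
    have "continuous_on {t1..t2} (\<lambda>t. (\<lambda>(x, t). Dx U x t) (p t, t))"
      by (rule continuous_on_compose2[OF UD(2)]) (use QP in \<open>auto intro!: continuous_intros cp\<close>)
    moreover have "continuous_on {t1..t2} (\<lambda>t. (\<lambda>(x, t). D 0 0 x t) (p t - m, t))"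
      by (rule continuous_on_compose2[OF Dc]) (auto intro!: continuous_intros cp)
    ultimately show ?thesis unfolding set_integrable_def D0
      by (intro borel_integrable_compact continuous_intros) simp_all
  qed
  have "(LINT z:cylinder L|lborel. f (fst z) (snd z) * (- Dt \<phi> (fst z) (snd z) - Dx (Dx \<phi>) (fst z) (snd z))) =
    (\<integral>z. (indicator ?Q z *\<^sub>R ?u 0 z - indicator (?S a) z *\<^sub>R ?u a z) - (indicator ?Q z *\<^sub>R ?u (- a) z - indicator (?S (- a)) z *\<^sub>R ?u (- a) z) \<partial>lborel)"
    unfolding set_lebesgue_integral_def Dx\<phi>
  proof (rule Bochner_Integration.integral_cong[OF refl])
    fix z :: "real \<times> real"
    show "indicator (cylinder L) z *\<^sub>R (f (fst z) (snd z) * ?\<psi> z) =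
      (indicator ?Q z *\<^sub>R ?u 0 z - indicator (?S a) z *\<^sub>R ?u a z) - (indicator ?Q z *\<^sub>R ?u (- a) z - indicator (?S (- a)) z *\<^sub>R ?u (- a) z)"
    proof (cases "z \<in> K")
      case False
      then have "?\<psi> z = 0" using Dz[of "fst z" "snd z"] by simp
      then show ?thesis by simp
    next
      case True
      then have zc: "z \<in> cylinder L" and zQ: "z \<in> ?Q" using K(2) KQ box_subset_cbox by blast+
      then have z: "\<bar>fst z\<bar> < L" "0 < snd z" by (auto simp: cylinder_def abs_less_iff)
      \<comment> \<open>The right part and the whole minus the left part differ by the value on the
        curve \<open>x = p + a\<close> itself, which is 0.\<close>
      have 3: "U (fst z - a) (snd z) = 0" if "\<not> p (snd z) < fst z - a" "\<not> fst z < p (snd z) + a"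
      proof -
        have "fst z - a = p (snd z)" using that by linarith
        then show ?thesis using U_p[OF z(2)] by simp
      qed
      have "f (fst z) (snd z) = U (fst z + 0) (snd z) - (if fst z < p (snd z) - a then U (fst z + a) (snd z) else 0)
         - (U (fst z + - a) (snd z) - (if fst z < p (snd z) - - a then U (fst z + - a) (snd z) else 0))"
        using f_eq[OF z] 3 a by (auto split: if_splits)
      moreover have "indicator (?S m) z = (if fst z < p (snd z) - m then 1 else 0 :: real)" for m
        using zQ by (simp add: indicator_def)
      ultimately show ?thesis using zc zQ by (simp add: left_diff_distrib)
    qed
  qed
  also have "\<dots> = ((LINT z:?Q|lborel. ?u 0 z) - (LINT z:?S a|lborel. ?u a z)) - ((LINT z:?Q|lborel. ?u (- a) z) - (LINT z:?S (- a)|lborel. ?u (- a) z))"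
    using SI[of 0] SI[of "- a"] SS[of a a] SS[of "- a" "- a"] unfolding set_lebesgue_integral_def set_integrable_def
    by (simp only: Bochner_Integration.integral_diff Bochner_Integration.integrable_diff)
  also have "\<dots> = (LINT t:{t1..t2}|lborel. Dx U (p t) t * \<phi> (p t - - a) t) - (LINT t:{t1..t2}|lborel. Dx U (p t) t * \<phi> (p t - a) t)"
    unfolding I0 Ip by simp
  also have "\<dots> = (LINT t:{t1..t2}|lborel. Dx U (p t) t * \<phi> (p t - - a) t - Dx U (p t) t * \<phi> (p t - a) t)"
    by (rule set_integral_diff(2)[OF SIp SIp, symmetric])
  also have "\<dots> = (LINT t:{0<..}|lborel. - Dx f (p t) t * (\<phi> (p t - a) t - \<phi> (p t + a) t))"
    unfolding set_lebesgue_integral_def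
  proof (rule Bochner_Integration.integral_cong[OF refl])
    fix t :: real
    show "indicator {t1..t2} t *\<^sub>R (Dx U (p t) t * \<phi> (p t - - a) t - Dx U (p t) t * \<phi> (p t - a) t) =
      indicator {0<..} t *\<^sub>R (- Dx f (p t) t * (\<phi> (p t - a) t - \<phi> (p t + a) t))"
    proof (cases "t \<in> {t1..t2}")
      case True
      then have "Dx f (p t) t = Dx U (p t) t" using Dx_f_near[of "p t" t] QP p_in_pos a by simp
      then show ?thesis using True QP[OF True] by (simp add: algebra_simps)
    next
      case False
      then have "(x, t) \<notin> K" for x using t12(3)[of x t] by auto
      then show ?thesis using False K(3) by simp
    qed
  qed
  finally show "(LINT z:cylinder L|lborel. f (fst z) (snd z) * (- Dt \<phi> (fst z) (snd z) - Dx (Dx \<phi>) (fst z) (snd z))) =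
    (LINT t:{0<..}|lborel. - Dx f (p t) t * (\<phi> (p t - a) t - \<phi> (p t + a) t))" .
qed

theorem from_heat_solution: "price_solution L a fI p0 (\<lambda>x t. from_heat L a (\<lambda>y. F y t) x) p"
proof -
  have "C21_on (off_sources L a p) f" using f_caloric unfolding caloric_on_iff[OF open_off] by blast
  then have "price_solution L a fI p0 f p"
    unfolding price_solution_def
    by (intro conjI allI impI p_cont p_in p_0 f_cont f_bounded_slope f_dirac f_p f_left f_right f_attains)
  then show ?thesis unfolding f_def[abs_def] .
qed

end

theorem proposition2p1:
  fixes L a p0 :: real and fI :: "real \<Rightarrow> real"
  assumes "0 < a" and "a < L"
    and "L2_on L fI"
    and "p0 \<in> {-L + a<..<L - a}"
    and "fI p0 = 0"
    and "\<forall>x \<in> {-L<..<L}. x < p0 \<longrightarrow> fI x > 0"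
    and "\<forall>x \<in> {-L<..<L}. x > p0 \<longrightarrow> fI x < 0"
  shows "(\<forall>f p. price_solution L a fI p0 f p \<longrightarrow>
            heat_solution L a (to_heat L a p0 fI) (\<lambda>x t. to_heat L a (p t) (\<lambda>y. f y t) x)) \<and>
         (\<forall>F. heat_solution L a (to_heat L a p0 fI) F \<longrightarrow>
            (\<exists>p. (\<forall>t \<ge> 0. {x \<in> {-L<..<L}. F x t = 0} = {p t}) \<and>
                 price_solution L a fI p0 (\<lambda>x t. from_heat L a (\<lambda>y. F y t) x) p))"
proof -
  interpret price_problem L a p0 fI using assms by unfold_locales
  show ?thesis
  proof (intro conjI allI impI)
    fix f p assume "price_solution L a fI p0 f p"
    then interpret price_forward L a p0 fI f p by unfold_locales
    show "heat_solution L a (to_heat L a p0 fI) (\<lambda>x t. to_heat L a (p t) (\<lambda>y. f y t) x)" by (rule to_heat_solution)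
  next
    fix F assume F: "heat_solution L a (to_heat L a p0 fI) F"
    show "\<exists>p. (\<forall>t \<ge> 0. {x \<in> {-L<..<L}. F x t = 0} = {p t}) \<and>
                 price_solution L a fI p0 (\<lambda>x t. from_heat L a (\<lambda>y. F y t) x) p"
    proof (rule heat_solution_extension[OF a aL L2 p0 pos neg F])
      fix U assume U: "caloric_on (UNIV \<times> {0<..}) U" "\<And>x t. \<bar>x\<bar> < L \<Longrightarrow> 0 < t \<Longrightarrow> U x t = F x t"
        and "\<And>t. 0 < t \<Longrightarrow> \<exists>p\<in>{-L<..<L}. U p t = 0 \<and> (\<forall>x<p. 0 < U x t) \<and> (\<forall>x>p. U x t < 0)"
      then obtain q where q: "\<And>t. 0 < t \<Longrightarrow> q t \<in> {-L<..<L} \<and> U (q t) t = 0 \<and> (\<forall>x<q t. 0 < U x t) \<and> (\<forall>x>q t. U x t < 0)"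
        by metis
      \<comment> \<open>The signs of \<open>U\<close> determine the zero for positive times only; at
        time 0 the free boundary starts at \<open>p0\<close>.\<close>
      define p where "p = q(0 := p0)"
      have "\<bar>q t\<bar> < L" if "0 < t" for t using q[OF that] by auto
      then interpret price_backward L a p0 fI F U p
        by unfold_locales (use F U q in \<open>auto simp: p_def\<close>)
      show ?thesis using zero_set from_heat_solution by blast
    qed
  qed
qed

end
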